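(* Let $(M,\Lambda)$ be a manifold endowed with a linear (non-symmetric) connection $\Lambda$. Then all finite order natural $(0,2)$-tensor fields on $T^*M$ are of order one and they form a 14-parameter family of operators with coordinate expression $$\begin{aligned}\Phi=\big(&A\,\dot x_\lambda\dot x_\mu+C_1\,\dot x_\lambda T_\rho{}^\rho{}_\mu+C_2\,\dot x_\mu T_\rho{}^\rho{}_\lambda+C_3\,\dot x_\rho T_\lambda{}^\rho{}_\mu\\&+F_1\,T_\rho{}^\rho{}_\lambda T_\sigma{}^\sigma{}_\mu+F_2\,T_\sigma{}^\rho{}_\lambda T_\rho{}^\sigma{}_\mu+F_3\,T_\rho{}^\rho{}_\sigma T_\lambda{}^\sigma{}_\mu\\&+G_1\,T_\rho{}^\rho{}_{\lambda;\mu}+G_2\,T_\rho{}^\rho{}_{\mu;\lambda}+G_3\,T_\lambda{}^\rho{}_{\mu;\rho}\\&+H_1\,R_\rho{}^\rho{}_{\lambda\mu}+H_2\,R_\lambda{}^\rho{}_{\rho\mu}\big)\,d^\lambda\otimes d^\mu\\&+B\,d^\lambda\otimes(\dot d_\lambda+\Lambda_\lambda{}^\rho{}_\mu\dot x_\rho\,d^\mu)+C\,(\dot d_\lambda+\Lambda_\lambda{}^\rho{}_\mu\dot x_\rho\,d^\mu)\otimes d^\lambda,\end{aligned}$$ where $A,B,C,C_i,F_i,G_i,H_j$, $i=1,2,3$, $j=1,2$, are real constants.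
   Context: $M$ is an $m$-dimensional smooth manifold, $(x^\lambda)$ a local chart, $(x^\lambda,\dot x_\lambda)$ the induced chart on $T^*M$, and $d^\lambda=dx^\lambda$, $\dot d_\lambda=d\dot x_\lambda$ the induced coframe on $T^*M$. Summation convention is used. A linear (not necessarily symmetric) connection $\Lambda$ on $TM$ has coefficients $\Lambda_\lambda{}^\mu{}_\nu$ given by $\Lambda=d^\lambda\otimes(\partial_\lambda+\Lambda_\lambda{}^\mu{}_\nu\dot x^\nu\dot\partial_\mu)$, i.e. $\nabla_{\partial_\lambda}\partial_\nu=-\Lambda_\lambda{}^\mu{}_\nu\partial_\mu$. It splits as $\Lambda=\widetilde\Lambda+T$, where $\widetilde\Lambda$ is the torsion-free connection obtained by symmetrizing $\Lambda$ and $T$ (the torsion tensor) is the antisymmetric part: $\widetilde\Lambda_\lambda{}^\mu{}_\nu=\tfrac12(\Lambda_\lambda{}^\mu{}_\nu+\Lambda_\nu{}^\mu{}_\lambda)$, $T_\lambda{}^\mu{}_\nu=\tfrac12(\Lambda_\lambda{}^\mu{}_\nu-\Lambda_\nu{}^\mu{}_\lambda)$. The semicolon denotes covariant differentiation with respect to $\widetilde\Lambda$, and $R_\nu{}^\rho{}_{\lambda\mu}$ are the components of the curvature tensor of $\widetilde\Lambda$: $R_\nu{}^\rho{}_{\lambda\mu}=\partial_\mu\widetilde\Lambda_\lambda{}^\rho{}_\nu-\partial_\lambda\widetilde\Lambda_\mu{}^\rho{}_\nu+\widetilde\Lambda_\mu{}^\sigma{}_\nu\widetilde\Lambda_\lambda{}^\rho{}_\sigma-\widetilde\Lambda_\lambda{}^\sigma{}_\nu\widetilde\Lambda_\mu{}^\rho{}_\sigma$.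 A natural $(0,2)$-tensor field on $T^*M$ (given by $\Lambda$) is a natural operator, i.e. a system of local operators, defined on all $m$-manifolds and commuting with all local diffeomorphisms, which transforms each linear connection $\Lambda$ on $M$ into a (smooth) section $\Phi$ of $\bigotimes^2T^*(T^*M)\to T^*M$. It is of order $r$ if, for $u\in T^*_xM$, the value $\Phi(u)$ depends only on $u$ and the $r$-jet $j^r_x\Lambda$, so $\Phi=\Phi(u,j^r\Lambda)$; finite order means of order $r$ for some $r$. Order one here means that $\Phi$ depends only on $j^1\Lambda$. *)

theory Defs
  imports "HOL-Analysis.Analysis"
begin

section \<open>Smooth functions on open subsets of Euclidean spaces\<close>

primrec Ck_on :: "nat \<Rightarrow> ('a::euclidean_space \<Rightarrow> 'b::real_normed_vector) \<Rightarrow> 'a set \<Rightarrow> bool" where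
  "Ck_on 0 f S \<longleftrightarrow> continuous_on S f"
| "Ck_on (Suc k) f S \<longleftrightarrow>
     (\<forall>x\<in>S. f differentiable (at x)) \<and> (\<forall>v. Ck_on k (\<lambda>x. frechet_derivative f (at x) v) S)"

text \<open>Only used for open \<open>S\<close>; the values of \<open>f\<close> outside \<open>S\<close> are then irrelevant.\<close>

definition smooth_on :: "('a::euclidean_space \<Rightarrow> 'b::real_normed_vector) \<Rightarrow> 'a set \<Rightarrow> bool" where
  "smooth_on f S \<longleftrightarrow> (\<forall>k. Ck_on k f S)"

definition pd :: "'m::finite \<Rightarrow> (real^'m \<Rightarrow> real) \<Rightarrow> real^'m \<Rightarrow> real" where
  "pd i f x = frechet_derivative f (at x) (axis i 1)"

definition pds :: "'m::finite list \<Rightarrow> (real^'m \<Rightarrow> real) \<Rightarrow> real^'m \<Rightarrow> real" where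
  "pds is f = foldr pd is f"

section \<open>Smooth manifolds and local diffeomorphisms\<close>

text \<open>
  The dimension is \<open>m = CARD('m)\<close>. Points lie in a type \<open>'p\<close>, and the set of points is
  \<open>topspace (mtop M)\<close>. The atlas need not be maximal: two atlases of the same smooth structure
  are two objects related by the diffeomorphism \<open>id\<close>.
\<close>

type_synonym ('p, 'm) chart = "'p set \<times> ('p \<Rightarrow> real^'m)"

record ('p, 'm) mfd =
  mtop :: "'p topology"
  atlas :: "('p, 'm) chart set"

abbreviation cdom :: "('p, 'm::finite) chart \<Rightarrow> 'p set" where "cdom c \<equiv> fst c"
abbreviation cmap :: "('p, 'm::finite) chart \<Rightarrow> 'p \<Rightarrow> real^'m" where "cmap c \<equiv> snd c"
abbreviation cimg :: "('p, 'm::finite) chart \<Rightarrow> (real^'m) set" where "cimg c \<equiv> cmap c ` cdom c"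

definition crep :: "('p, 'm::finite) chart \<Rightarrow> ('p \<Rightarrow> 'p) \<Rightarrow> ('p, 'm) chart \<Rightarrow> real^'m \<Rightarrow> real^'m" where
  "crep c f d = cmap d \<circ> f \<circ> inv_into (cdom c) (cmap c)"

definition smooth_manifold :: "('p, 'm::finite) mfd \<Rightarrow> bool" where
  "smooth_manifold M \<longleftrightarrow>
     Hausdorff_space (mtop M) \<and> second_countable (mtop M) \<and>
     topspace (mtop M) = (\<Union>c\<in>atlas M. cdom c) \<and>
     (\<forall>c\<in>atlas M. openin (mtop M) (cdom c) \<and> open (cimg c) \<and>
        homeomorphic_map (subtopology (mtop M) (cdom c)) (top_of_set (cimg c)) (cmap c)) \<and>
     (\<forall>c\<in>atlas M. \<forall>d\<in>atlas M. smooth_on (crep c id d) (cmap c ` (cdom c \<inter> cdom d)))"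

text \<open>A diffeomorphism \<open>f\<close> from an open subset \<open>U\<close> of \<open>M\<close> onto an open subset \<open>V\<close> of \<open>N\<close>.\<close>

definition local_diffeo ::
  "('p, 'm::finite) mfd \<Rightarrow> ('p, 'm) mfd \<Rightarrow> 'p set \<Rightarrow> 'p set \<Rightarrow> ('p \<Rightarrow> 'p) \<Rightarrow> bool" where
  "local_diffeo M N U V f \<longleftrightarrow>
     openin (mtop M) U \<and> openin (mtop N) V \<and>
     homeomorphic_map (subtopology (mtop M) U) (subtopology (mtop N) V) f \<and>
     (\<forall>c\<in>atlas M. \<forall>d\<in>atlas N.
        smooth_on (crep c f d) (cmap c ` {p \<in> cdom c \<inter> U. f p \<in> cdom d}) \<and>
        smooth_on (crep d (inv_into U f) c) (cmap d ` {q \<in> cdom d \<inter> V. inv_into U f q \<in> cdom c}))"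

section \<open>Linear connections\<close>

text \<open>
  A connection is given by its coefficients in the charts of the atlas:
  \<open>\<Lambda> c x l r n\<close> is the coefficient with first lower index \<open>l\<close>, upper index \<open>r\<close> and second lower
  index \<open>n\<close>, at the point with coordinates \<open>x\<close> in the chart \<open>c\<close>, with the sign convention
  \<open>\<nabla>\<^sub>l \<partial>\<^sub>n = - (\<Sum>r. \<Lambda> c x l r n *\<^sub>R \<partial>\<^sub>r)\<close>. Values at charts outside the atlas or at
  \<open>x \<notin> cimg c\<close> are meaningless.
\<close>

type_synonym 'm coeffs = "'m \<Rightarrow> 'm \<Rightarrow> 'm \<Rightarrow> real"
type_synonym ('p, 'm) connection = "('p, 'm) chart \<Rightarrow> real^'m \<Rightarrow> 'm coeffs"

text \<open>
  The law by which the coefficients \<open>L\<close> at \<open>x\<close> and \<open>L'\<close> at \<open>g x\<close> correspond under a local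
  diffeomorphism \<open>y = g x\<close> of \<open>real^'m\<close>: apply \<open>\<nabla>\<^sub>l\<close> to \<open>\<partial>\<^sub>n = (\<Sum>b. (\<partial>y\<^sup>b/\<partial>x\<^sup>n) \<partial>'\<^sub>b)\<close> and
  compare the components along \<open>\<partial>'\<^sub>k\<close>.
\<close>

definition conn_law :: "(real^'m \<Rightarrow> real^'m) \<Rightarrow> real^'m \<Rightarrow> 'm::finite coeffs \<Rightarrow> 'm coeffs \<Rightarrow> bool" where
  "conn_law g x L L' \<longleftrightarrow>
     (\<forall>l n k. (\<Sum>r\<in>UNIV. pd r (\<lambda>y. g y $ k) x * L l r n) =
        (\<Sum>a\<in>UNIV. \<Sum>b\<in>UNIV. pd l (\<lambda>y. g y $ a) x * pd n (\<lambda>y. g y $ b) x * L' a k b)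
        - pd l (pd n (\<lambda>y. g y $ k)) x)"

definition conn_related ::
  "'p set \<Rightarrow> ('p \<Rightarrow> 'p) \<Rightarrow> ('p, 'm::finite) mfd \<Rightarrow> ('p, 'm) connection \<Rightarrow>
   ('p, 'm) mfd \<Rightarrow> ('p, 'm) connection \<Rightarrow> bool" where
  "conn_related U f M \<Lambda> N \<Lambda>' \<longleftrightarrow>
     (\<forall>c\<in>atlas M. \<forall>d\<in>atlas N. \<forall>p\<in>cdom c \<inter> U. f p \<in> cdom d \<longrightarrow>
        conn_law (crep c f d) (cmap c p) (\<Lambda> c (cmap c p)) (\<Lambda>' d (cmap d (f p))))"

definition linear_connection :: "('p, 'm::finite) mfd \<Rightarrow> ('p, 'm) connection \<Rightarrow> bool" where
  "linear_connection M \<Lambda> \<longleftrightarrow>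
     (\<forall>c\<in>atlas M. \<forall>l r n. smooth_on (\<lambda>x. \<Lambda> c x l r n) (cimg c)) \<and>
     conn_related (topspace (mtop M)) id M \<Lambda> M \<Lambda>"

section \<open>Tensor fields of type (0,2) on the cotangent bundle\<close>

text \<open>
  A chart \<open>c\<close> of \<open>M\<close> induces a chart of the cotangent bundle with image \<open>cimg c \<times> UNIV\<close> and
  coordinates \<open>(x, u)\<close>, where \<open>u $ l\<close> is the fibre coordinate written \<open>x\<close>-dot with lower index
  \<open>l\<close>. A (0,2)-tensor field on the cotangent bundle is given by its local expressions in the
  induced charts: \<open>t c (x, u)\<close> is a bilinear form on tangent vectors \<open>(a, a')\<close>, where \<open>a $ l\<close> is
  the value of the coframe element \<open>d\<^sup>l\<close> and \<open>a' $ l\<close> that of \<open>d\<close>-dot with lower index \<open>l\<close>.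
\<close>

type_synonym 'm cot = "(real^'m) \<times> (real^'m)"
type_synonym ('p, 'm) cot_tensor = "('p, 'm) chart \<Rightarrow> 'm cot \<Rightarrow> 'm cot \<Rightarrow> 'm cot \<Rightarrow> real"

text \<open>
  The induced map of cotangent bundles: the new fibre coordinates are
  \<open>(\<Sum>l. (\<partial>x\<^sup>l/\<partial>y\<^sup>a) * u $ l)\<close>.
\<close>

definition cot_lift :: "(real^'m \<Rightarrow> real^'m) \<Rightarrow> 'm cot \<Rightarrow> 'm::finite cot" where
  "cot_lift g = (\<lambda>(x, u). (g x, u v* matrix_inv (jacobian g (at x))))"

definition tensor_related ::
  "'p set \<Rightarrow> ('p \<Rightarrow> 'p) \<Rightarrow> ('p, 'm::finite) mfd \<Rightarrow> ('p, 'm) cot_tensor \<Rightarrow>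
   ('p, 'm) mfd \<Rightarrow> ('p, 'm) cot_tensor \<Rightarrow> bool" where
  "tensor_related U f M t N t' \<longleftrightarrow>
     (\<forall>c\<in>atlas M. \<forall>d\<in>atlas N. \<forall>p\<in>cdom c \<inter> U. f p \<in> cdom d \<longrightarrow>
        (\<forall>u v w. let G = cot_lift (crep c f d); z = (cmap c p, u) in
           t c z v w = t' d (G z) (frechet_derivative G (at z) v) (frechet_derivative G (at z) w)))"

definition cot_tensor_field :: "('p, 'm::finite) mfd \<Rightarrow> ('p, 'm) cot_tensor \<Rightarrow> bool" where
  "cot_tensor_field M t \<longleftrightarrow>
     (\<forall>c\<in>atlas M. \<forall>z\<in>cimg c \<times> UNIV. bilinear (t c z)) \<and>
     (\<forall>c\<in>atlas M. \<forall>v w. smooth_on (\<lambda>z. t c z v w) (cimg c \<times> UNIV)) \<and>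
     tensor_related (topspace (mtop M)) id M t M t"

section \<open>Natural tensor fields\<close>

type_synonym ('p, 'm) operator = "('p, 'm) mfd \<Rightarrow> ('p, 'm) connection \<Rightarrow> ('p, 'm) cot_tensor"

text \<open>
  Locality also makes \<open>\<Phi> M \<Lambda>\<close> independent of the meaningless values of \<open>\<Lambda>\<close>. Regularity
  (smooth dependence on smooth families of connections) is not assumed.
\<close>

definition local_operator :: "('p, 'm::finite) operator \<Rightarrow> bool" where
  "local_operator \<Phi> \<longleftrightarrow>
     (\<forall>M \<Lambda> \<Lambda>' W. smooth_manifold M \<and> linear_connection M \<Lambda> \<and> linear_connection M \<Lambda>' \<and>
        openin (mtop M) W \<and>
        (\<forall>c\<in>atlas M. \<forall>p\<in>cdom c \<inter> W. \<Lambda> c (cmap c p) = \<Lambda>' c (cmap c p)) \<longrightarrow>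
        (\<forall>c\<in>atlas M. \<forall>p\<in>cdom c \<inter> W. \<forall>u. \<Phi> M \<Lambda> c (cmap c p, u) = \<Phi> M \<Lambda>' c (cmap c p, u)))"

definition natural_cot_tensor :: "('p, 'm::finite) operator \<Rightarrow> bool" where
  "natural_cot_tensor \<Phi> \<longleftrightarrow>
     (\<forall>M \<Lambda>. smooth_manifold M \<and> linear_connection M \<Lambda> \<longrightarrow> cot_tensor_field M (\<Phi> M \<Lambda>)) \<and>
     local_operator \<Phi> \<and>
     (\<forall>M N U V f \<Lambda> \<Lambda>'. smooth_manifold M \<and> smooth_manifold N \<and> local_diffeo M N U V f \<and>
        linear_connection M \<Lambda> \<and> linear_connection N \<Lambda>' \<and> conn_related U f M \<Lambda> N \<Lambda>' \<longrightarrow>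
        tensor_related U f M (\<Phi> M \<Lambda>) N (\<Phi> N \<Lambda>'))"

definition same_jet ::
  "nat \<Rightarrow> real^'m \<Rightarrow> (real^'m \<Rightarrow> 'm coeffs) \<Rightarrow> (real^'m \<Rightarrow> 'm::finite coeffs) \<Rightarrow> bool" where
  "same_jet r x L L' \<longleftrightarrow>
     (\<forall>is l k n. length is \<le> r \<longrightarrow> pds is (\<lambda>y. L y l k n) x = pds is (\<lambda>y. L' y l k n) x)"

definition of_order :: "nat \<Rightarrow> ('p, 'm::finite) operator \<Rightarrow> bool" where
  "of_order r \<Phi> \<longleftrightarrow>
     (\<forall>M \<Lambda> \<Lambda>'. smooth_manifold M \<and> linear_connection M \<Lambda> \<and> linear_connection M \<Lambda>' \<longrightarrow>
        (\<forall>c\<in>atlas M. \<forall>x\<in>cimg c. same_jet r x (\<Lambda> c) (\<Lambda>' c) \<longrightarrow>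
           (\<forall>u. \<Phi> M \<Lambda> c (x, u) = \<Phi> M \<Lambda>' c (x, u))))"

section \<open>The 14-parameter family\<close>

text \<open>In the following, \<open>L\<close> is the coefficient field of a connection in one chart.\<close>

definition symm :: "(real^'m \<Rightarrow> 'm coeffs) \<Rightarrow> real^'m \<Rightarrow> 'm::finite coeffs" where
  "symm L x l r n = (L x l r n + L x n r l) / 2"

definition tors :: "(real^'m \<Rightarrow> 'm coeffs) \<Rightarrow> real^'m \<Rightarrow> 'm::finite coeffs" where
  "tors L x l r n = (L x l r n - L x n r l) / 2"

text \<open>\<open>tors_cov L x l r n k\<close> is \<open>T\<close> with indices \<open>l\<close>, \<open>r\<close>, \<open>n\<close>, followed by the semicolon and \<open>k\<close>.
  The signs come from the sign convention for the coefficients.\<close>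

definition tors_cov ::
  "(real^'m \<Rightarrow> 'm coeffs) \<Rightarrow> real^'m \<Rightarrow> 'm \<Rightarrow> 'm \<Rightarrow> 'm \<Rightarrow> 'm::finite \<Rightarrow> real" where
  "tors_cov L x l r n k =
     pd k (\<lambda>y. tors L y l r n) x
     - (\<Sum>s\<in>UNIV. symm L x k r s * tors L x l s n)
     + (\<Sum>s\<in>UNIV. symm L x k s l * tors L x s r n)
     + (\<Sum>s\<in>UNIV. symm L x k s n * tors L x l r s)"

text \<open>\<open>curv L x n r l k\<close> is \<open>R\<close> with indices \<open>n\<close> (lower), \<open>r\<close> (upper), \<open>l\<close>, \<open>k\<close> (lower).\<close>

definition curv ::
  "(real^'m \<Rightarrow> 'm coeffs) \<Rightarrow> real^'m \<Rightarrow> 'm \<Rightarrow> 'm \<Rightarrow> 'm \<Rightarrow> 'm::finite \<Rightarrow> real" where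
  "curv L x n r l k =
     pd k (\<lambda>y. symm L y l r n) x - pd l (\<lambda>y. symm L y k r n) x
     + (\<Sum>s\<in>UNIV. symm L x k s n * symm L x l r s)
     - (\<Sum>s\<in>UNIV. symm L x l s n * symm L x k r s)"

record params =
  cA :: real  cB :: real  cC :: real
  cC1 :: real  cC2 :: real  cC3 :: real
  cF1 :: real  cF2 :: real  cF3 :: real
  cG1 :: real  cG2 :: real  cG3 :: real
  cH1 :: real  cH2 :: real

definition base_part :: "params \<Rightarrow> (real^'m \<Rightarrow> 'm coeffs) \<Rightarrow> real^'m \<Rightarrow> real^'m \<Rightarrow> 'm \<Rightarrow> 'm::finite \<Rightarrow> real" where
  "base_part k L x u l n =
     cA k * u $ l * u $ n
     + cC1 k * u $ l * (\<Sum>r\<in>UNIV. tors L x r r n)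
     + cC2 k * u $ n * (\<Sum>r\<in>UNIV. tors L x r r l)
     + cC3 k * (\<Sum>r\<in>UNIV. u $ r * tors L x l r n)
     + cF1 k * (\<Sum>r\<in>UNIV. tors L x r r l) * (\<Sum>s\<in>UNIV. tors L x s s n)
     + cF2 k * (\<Sum>r\<in>UNIV. \<Sum>s\<in>UNIV. tors L x s r l * tors L x r s n)
     + cF3 k * (\<Sum>r\<in>UNIV. \<Sum>s\<in>UNIV. tors L x r r s * tors L x l s n)
     + cG1 k * (\<Sum>r\<in>UNIV. tors_cov L x r r l n)
     + cG2 k * (\<Sum>r\<in>UNIV. tors_cov L x r r n l)
     + cG3 k * (\<Sum>r\<in>UNIV. tors_cov L x l r n r)
     + cH1 k * (\<Sum>r\<in>UNIV. curv L x r r l n)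
     + cH2 k * (\<Sum>r\<in>UNIV. curv L x l r r n)"

text \<open>The value on the vector \<open>(a, a')\<close> of \<open>d\<close>-dot\<open>\<^sub>l + \<Lambda>\<^sub>l\<^sup>r\<^sub>n u\<^sub>r d\<^sup>n\<close>.\<close>

definition vert_form ::
  "(real^'m \<Rightarrow> 'm coeffs) \<Rightarrow> 'm cot \<Rightarrow> 'm \<Rightarrow> 'm::finite cot \<Rightarrow> real" where
  "vert_form L = (\<lambda>(x, u) l (a, a'). a' $ l + (\<Sum>r\<in>UNIV. \<Sum>n\<in>UNIV. L x l r n * u $ r * a $ n))"

definition family ::
  "params \<Rightarrow> (real^'m \<Rightarrow> 'm coeffs) \<Rightarrow> 'm cot \<Rightarrow> 'm cot \<Rightarrow> 'm::finite cot \<Rightarrow> real" where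
  "family k L z v w =
     (\<Sum>l\<in>UNIV. \<Sum>n\<in>UNIV. base_part k L (fst z) (snd z) l n * fst v $ l * fst w $ n)
     + cB k * (\<Sum>l\<in>UNIV. fst v $ l * vert_form L z l w)
     + cC k * (\<Sum>l\<in>UNIV. vert_form L z l v * fst w $ l)"

definition has_coord_expr :: "('p, 'm::finite) operator \<Rightarrow> params \<Rightarrow> bool" where
  "has_coord_expr \<Phi> k \<longleftrightarrow>
     (\<forall>M \<Lambda>. smooth_manifold M \<and> linear_connection M \<Lambda> \<longrightarrow>
        (\<forall>c\<in>atlas M. \<forall>z\<in>cimg c \<times> UNIV. \<Phi> M \<Lambda> c z = family k (\<Lambda> c) z))"

end

theory Submission
  imports Defs
begin

text \<open>
  A natural operator is determined by what it does over the coordinate space: the type of points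
  contains a copy of that space, charts are local diffeomorphisms onto open parts of it, and by
  locality a connection given in a chart may be cut off and extended. So the object of study is
  the value \<open>ph P (0, u)\<close> at the origin, for a smooth coefficient field \<open>P\<close>. It is a bilinear form on
  pairs of a horizontal and a vertical vector. A homothety by \<open>t\<close> turns \<open>P\<close> into \<open>t P(t y)\<close> and
  \<open>u\<close> into \<open>t u\<close>, and it multiplies the horizontal part of the form by \<open>t\<^sup>2\<close>, the mixed parts by
  \<open>1\<close> and the vertical part by \<open>t\<^sup>-\<^sup>2\<close>. Letting \<open>t\<close> tend to \<open>0\<close>, the mixed parts are constants and
  the vertical part vanishes (\<open>ph_mixed_const\<close>). If the dependence on the jet of \<open>P\<close> were smooth, the
  homogeneity would also force the horizontal part to be a quadratic form in \<open>(u, P 0)\<close> plus a linear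
  form in the first derivatives of \<open>P\<close>.

  Such smoothness is not part of the definition of a natural operator: all that is known is that
  the tensor field obtained from one connection is smooth along the manifold. This is
  exploited by gluing. One connection can agree, near points \<open>x\<^sub>i\<close> tending to the origin,
  with rapidly converging members of a family of connections (\<open>glued_connection\<close>). Smoothness of its
  tensor field at the origin then bounds the finite differences of the tensor fields along the
  family (\<open>family_bound\<close>, \<open>difference_bound\<close>) and gives continuity along the family
  (\<open>ph_continuous\<close>). The finite differences that would vanish for the predicted polynomial are,
  after a homothety, approximated by differences along a very short step in a bounded family; the bound
  makes these tend to \<open>0\<close>, and continuity identifies the limit (\<open>vanishing_difference\<close>). This lowers
  the order step by step to one (\<open>order_reduction\<close>) and yields the polynomial form
  (\<open>hor_polynomial\<close>).

  The quadratic and linear forms are invariant under the general linear group. Invariant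
  tensors are spanned by permutations (\<open>invariant_tensors\<close>, a double commutant argument), so the
  horizontal part is a combination of finitely many contractions (\<open>uu_form\<close>, \<open>uX_form\<close>,
  \<open>XX_form\<close>, \<open>L_form\<close>).

  The remaining naturality is under maps with nonzero second and third derivatives at the origin.
  Changes of coordinates with a prescribed second derivative add an arbitrary symmetric array to \<open>P 0\<close>. As the members of the
  parameter family are natural themselves (\<open>family_invariant\<close>), the operator and a member need to
  be compared only when \<open>P 0\<close> is antisymmetric, that is, equal to the torsion. A change
  of coordinates with vanishing second and nonzero third derivative, applied to the flat connection, gives one relation between the six coefficients in \<open>L_form\<close>, and five
  free ones remain: three derivatives of the torsion and two contractions of the curvature
  (\<open>ph_agrees\<close>). In dimension at least three, fields supported on three basis vectors separate the
  fourteen parameters (\<open>params_unique\<close>).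
\<close>

section \<open>Calculus of smooth maps\<close>

lemma Ck_on_cong:
  assumes "open S" "\<And>x. x \<in> S \<Longrightarrow> f x = g x"
  shows "Ck_on k f S \<longleftrightarrow> Ck_on k g S"
  using assms(2)
proof (induction k arbitrary: f g)
  case 0
  then show ?case by (simp cong: continuous_on_cong)
next
  case (Suc k)
  have d: "(f has_derivative D) (at x) \<longleftrightarrow> (g has_derivative D) (at x)" if "x \<in> S" for x D
    using has_derivative_transform_within_open[OF _ assms(1) that] Suc.prems by metis
  have "f differentiable (at x) \<longleftrightarrow> g differentiable (at x)" if "x \<in> S" for x
    using d[OF that] by (simp add: differentiable_def)
  moreover have "frechet_derivative f (at x) = frechet_derivative g (at x)" if "x \<in> S" for x
    using d[OF that] by (simp add: frechet_derivative_def)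
  ultimately show ?case
    using Suc.IH[of "\<lambda>x. frechet_derivative f (at x) v" "\<lambda>x. frechet_derivative g (at x) v" for v]
    by auto
qed

text \<open>The Frechet derivative in the definition is a choice; any derivative that is known explicitly does.\<close>

lemma Ck_on_SucI:
  assumes "open S" "\<And>x. x \<in> S \<Longrightarrow> (f has_derivative f' x) (at x)" "\<And>v. Ck_on k (\<lambda>x. f' x v) S"
  shows "Ck_on (Suc k) f S"
proof -
  have "frechet_derivative f (at x) = f' x" if "x \<in> S" for x
    using assms(2)[OF that] by (rule frechet_derivative_at[symmetric])
  then have "Ck_on k (\<lambda>x. frechet_derivative f (at x) v) S \<longleftrightarrow> Ck_on k (\<lambda>x. f' x v) S" for v
    by (intro Ck_on_cong[OF assms(1)]) simp
  then show ?thesis using assms(2,3) by (auto simp: differentiable_def)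
qed

lemma Ck_on_SucD:
  assumes "Ck_on (Suc k) f S"
  shows "x \<in> S \<Longrightarrow> (f has_derivative frechet_derivative f (at x)) (at x)"
    and "Ck_on k (\<lambda>x. frechet_derivative f (at x) v) S"
  using assms by (auto simp: frechet_derivative_works)

lemma Ck_on_mono: "Ck_on k f S \<Longrightarrow> T \<subseteq> S \<Longrightarrow> Ck_on k f T"
  by (induction k arbitrary: f) (auto intro: continuous_on_subset)

lemma Ck_on_Suc_imp: "Ck_on (Suc k) f S \<Longrightarrow> Ck_on k f S"
proof (induction k arbitrary: f)
  case 0
  then have "\<forall>x\<in>S. f differentiable (at x)" by simp
  then show ?case
    by (simp add: continuous_at_imp_continuous_on differentiable_imp_continuous_within)
next
  case (Suc k)
  then show ?case by (metis Ck_on.simps(2))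
qed

lemma smooth_onD_cont: "smooth_on f S \<Longrightarrow> continuous_on S f"
  unfolding smooth_on_def by (metis Ck_on.simps(1))

lemma smooth_on_cong:
  assumes "open S" "\<And>x. x \<in> S \<Longrightarrow> f x = g x"
  shows "smooth_on f S \<longleftrightarrow> smooth_on g S"
  unfolding smooth_on_def using Ck_on_cong[OF assms] by auto

lemma smooth_on_subset: "smooth_on f S \<Longrightarrow> T \<subseteq> S \<Longrightarrow> smooth_on f T"
  unfolding smooth_on_def using Ck_on_mono by blast

lemma smooth_on_has_derivative:
  "smooth_on f S \<Longrightarrow> x \<in> S \<Longrightarrow> (f has_derivative frechet_derivative f (at x)) (at x)"
  unfolding smooth_on_def using Ck_on_SucD(1) by blast

lemma smooth_on_frechet: "smooth_on f S \<Longrightarrow> smooth_on (\<lambda>x. frechet_derivative f (at x) v) S"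
  unfolding smooth_on_def using Ck_on_SucD(2) by blast

text \<open>For a function given by a formula, all derivatives are handled at once by exhibiting a class of
  formulas that contains it and is closed under differentiation; the induction on the order
  then runs over the whole class.\<close>

lemma smooth_on_coinduct:
  assumes "open S" "P f"
    and step: "\<And>f. P f \<Longrightarrow> \<exists>f'. (\<forall>x\<in>S. (f has_derivative f' x) (at x)) \<and> (\<forall>v. P (\<lambda>x. f' x v))"
  shows "smooth_on f S"
proof -
  have "Ck_on k f S" for k
    using assms(2)
  proof (induction k arbitrary: f)
    case 0
    then obtain f' where "\<forall>x\<in>S. (f has_derivative f' x) (at x)" using step by blast
    then show ?case
      by (auto intro!: continuous_at_imp_continuous_on dest: has_derivative_continuous)
  next
    case (Suc k)
    then obtain f' where f': "\<forall>x\<in>S. (f has_derivative f' x) (at x)" "\<forall>v. P (\<lambda>x. f' x v)"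
      using step by blast
    show ?case by (rule Ck_on_SucI[OF assms(1)]) (use f' Suc.IH in auto)
  qed
  then show ?thesis by (simp add: smooth_on_def)
qed

lemma Ck_on_const: "open S \<Longrightarrow> Ck_on k (\<lambda>x. c) S"
  by (induction k arbitrary: c) simp_all

lemma Ck_on_linear_compose:
  assumes "bounded_linear L" "open S" "Ck_on k f S"
  shows "Ck_on k (\<lambda>x. L (f x)) S"
  using assms(3)
proof (induction k arbitrary: f)
  case 0
  then show ?case using assms(1) by (auto intro: bounded_linear.continuous_on)
next
  case (Suc k)
  show ?case
    by (rule Ck_on_SucI[OF assms(2) bounded_linear.has_derivative[OF assms(1)
            Ck_on_SucD(1)[OF Suc.prems]] Suc.IH[OF Ck_on_SucD(2)[OF Suc.prems]]])
qed

lemma Ck_on_add: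
  assumes "open S" "Ck_on k f S" "Ck_on k g S"
  shows "Ck_on k (\<lambda>x. f x + g x) S"
  using assms(2,3)
proof (induction k arbitrary: f g)
  case 0
  then show ?case by (auto intro: continuous_intros)
next
  case (Suc k)
  note f = Ck_on_SucD[OF Suc.prems(1)] and g = Ck_on_SucD[OF Suc.prems(2)]
  show ?case
    by (rule Ck_on_SucI[OF assms(1) has_derivative_add[OF f(1) g(1)] Suc.IH[OF f(2) g(2)]])
qed

lemma Ck_on_sum:
  assumes "open S" "\<And>i. i \<in> A \<Longrightarrow> Ck_on k (f i) S"
  shows "Ck_on k (\<lambda>x. \<Sum>i\<in>A. f i x) S"
  using assms(2)
  by (induction A rule: infinite_finite_induct) (auto intro!: Ck_on_const Ck_on_add assms(1))

lemma Ck_on_scaleR: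
  fixes f :: "'a::euclidean_space \<Rightarrow> real" and g :: "'a \<Rightarrow> 'b::real_normed_vector"
  assumes "open S" "Ck_on k f S" "Ck_on k g S"
  shows "Ck_on k (\<lambda>x. f x *\<^sub>R g x) S"
  using assms(2,3)
proof (induction k arbitrary: f g)
  case 0
  then show ?case by (auto intro: continuous_intros)
next
  case (Suc k)
  note f = Ck_on_SucD[OF Suc.prems(1)] Ck_on_Suc_imp[OF Suc.prems(1)]
  note g = Ck_on_SucD[OF Suc.prems(2)] Ck_on_Suc_imp[OF Suc.prems(2)]
  show ?case
    by (rule Ck_on_SucI[OF assms(1) has_derivative_scaleR[OF f(1) g(1)]
          Ck_on_add[OF assms(1) Suc.IH[OF f(3) g(2)] Suc.IH[OF f(2) g(3)]]])
qed

text \<open>Induction on the order by the chain rule: a directional derivative of the composition is a sum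
  over a basis of products of a derivative of \<open>f\<close> and a derivative of \<open>g\<close> composed with \<open>f\<close>, and
  the induction hypothesis applies to the latter.\<close>

lemma Ck_on_compose:
  fixes f :: "'a::euclidean_space \<Rightarrow> 'b::euclidean_space" and g :: "'b \<Rightarrow> 'c::real_normed_vector"
  assumes "open S" "open T" "f ` S \<subseteq> T" "Ck_on k f S" "Ck_on k g T"
  shows "Ck_on k (\<lambda>x. g (f x)) S"
  using assms(4,5)
proof (induction k arbitrary: g)
  case 0
  then have "continuous_on S f" "continuous_on T g" by simp_all
  then show ?case using continuous_on_compose2[OF _ _ assms(3)] by simp
next
  case (Suc k)
  note f = Ck_on_SucD[OF Suc.prems(1)] Ck_on_Suc_imp[OF Suc.prems(1)]
  note g = Ck_on_SucD[OF Suc.prems(2)] Ck_on_Suc_imp[OF Suc.prems(2)]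
  have b: "Ck_on k (\<lambda>x. \<Sum>b\<in>Basis. (frechet_derivative f (at x) v \<bullet> b) *\<^sub>R
      frechet_derivative g (at (f x)) b) S" for v
    by (intro Ck_on_sum Ck_on_scaleR assms(1) Suc.IH[OF f(3) g(2)]
        Ck_on_linear_compose[OF bounded_linear_inner_left assms(1) f(2)])
  have e: "frechet_derivative g (at (f x)) (frechet_derivative f (at x) v) =
     (\<Sum>b\<in>Basis. (frechet_derivative f (at x) v \<bullet> b) *\<^sub>R frechet_derivative g (at (f x)) b)"
    if "x \<in> S" for x v
  proof -
    have "linear (frechet_derivative g (at (f x)))"
      by (rule has_derivative_linear[OF g(1)]) (use assms(3) that in auto)
    then show ?thesis
      by (subst euclidean_representation[symmetric, of "frechet_derivative f (at x) v"])
        (simp only: linear_sum linear_scale)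
  qed
  show ?case
  proof (rule Ck_on_SucI[OF assms(1), where
        f' = "\<lambda>x v. frechet_derivative g (at (f x)) (frechet_derivative f (at x) v)"])
    show "((\<lambda>x. g (f x)) has_derivative (\<lambda>v. frechet_derivative g (at (f x))
        (frechet_derivative f (at x) v))) (at x)" if "x \<in> S" for x
      using that assms(3) by (intro has_derivative_compose[OF f(1) g(1)]) auto
    show "Ck_on k (\<lambda>x. frechet_derivative g (at (f x)) (frechet_derivative f (at x) v)) S" for v
      using b[of v] by (subst Ck_on_cong[OF assms(1) e]) auto
  qed
qed

lemma smooth_on_const: "open S \<Longrightarrow> smooth_on (\<lambda>x. c) S"
  by (simp add: smooth_on_def Ck_on_const)

lemma smooth_on_linear: 
  assumes "bounded_linear L" "open S" shows "smooth_on L S"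
proof -
  have "Ck_on (Suc k) L S" for k
    by (rule Ck_on_SucI[OF assms(2) bounded_linear_imp_has_derivative[OF assms(1)]])
      (rule Ck_on_const[OF assms(2)])
  then show ?thesis unfolding smooth_on_def using Ck_on_Suc_imp by blast
qed

lemma smooth_on_id: "open S \<Longrightarrow> smooth_on (\<lambda>x. x) S"
  by (rule smooth_on_linear[OF bounded_linear_ident])

lemma smooth_on_linear_compose:
  "bounded_linear L \<Longrightarrow> open S \<Longrightarrow> smooth_on f S \<Longrightarrow> smooth_on (\<lambda>x. L (f x)) S"
  by (simp add: smooth_on_def Ck_on_linear_compose)

lemma smooth_on_add: "open S \<Longrightarrow> smooth_on f S \<Longrightarrow> smooth_on g S \<Longrightarrow> smooth_on (\<lambda>x. f x + g x) S"
  by (simp add: smooth_on_def Ck_on_add)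

lemma smooth_on_minus: "open S \<Longrightarrow> smooth_on f S \<Longrightarrow> smooth_on (\<lambda>x. - f x) S"
  by (rule smooth_on_linear_compose[OF bounded_linear_minus[OF bounded_linear_ident]])

lemma smooth_on_diff: "open S \<Longrightarrow> smooth_on f S \<Longrightarrow> smooth_on g S \<Longrightarrow> smooth_on (\<lambda>x. f x - g x) S"
  using smooth_on_add[OF _ _ smooth_on_minus] by fastforce

lemma smooth_on_sum: "open S \<Longrightarrow> (\<And>i. i \<in> A \<Longrightarrow> smooth_on (f i) S) \<Longrightarrow> smooth_on (\<lambda>x. \<Sum>i\<in>A. f i x) S"
  by (simp add: smooth_on_def Ck_on_sum)

lemma smooth_on_scaleR:
  "open S \<Longrightarrow> smooth_on f S \<Longrightarrow> smooth_on g S \<Longrightarrow> smooth_on (\<lambda>x. f x *\<^sub>R g x) S"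
  by (simp add: smooth_on_def Ck_on_scaleR)

lemma smooth_on_mult:
  fixes f g :: "'a::euclidean_space \<Rightarrow> real"
  shows "open S \<Longrightarrow> smooth_on f S \<Longrightarrow> smooth_on g S \<Longrightarrow> smooth_on (\<lambda>x. f x * g x) S"
  using smooth_on_scaleR[of S f g] by simp

lemma smooth_on_prod:
  fixes f :: "'i \<Rightarrow> 'a::euclidean_space \<Rightarrow> real"
  shows "open S \<Longrightarrow> (\<And>i. i \<in> A \<Longrightarrow> smooth_on (f i) S) \<Longrightarrow> smooth_on (\<lambda>x. \<Prod>i\<in>A. f i x) S"
  by (induction A rule: infinite_finite_induct) (auto intro!: smooth_on_const smooth_on_mult)

lemma smooth_on_power:
  fixes f :: "'a::euclidean_space \<Rightarrow> real"
  shows "open S \<Longrightarrow> smooth_on f S \<Longrightarrow> smooth_on (\<lambda>x. f x ^ n) S"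
  by (induction n) (auto intro!: smooth_on_const smooth_on_mult)

lemma smooth_on_compose:
  "open S \<Longrightarrow> open T \<Longrightarrow> f ` S \<subseteq> T \<Longrightarrow> smooth_on f S \<Longrightarrow> smooth_on g T \<Longrightarrow> smooth_on (\<lambda>x. g (f x)) S"
  by (simp add: smooth_on_def Ck_on_compose)

lemma smooth_on_compose_UNIV:
  "open S \<Longrightarrow> smooth_on g UNIV \<Longrightarrow> smooth_on f S \<Longrightarrow> smooth_on (\<lambda>x. g (f x)) S"
  by (rule smooth_on_compose[of S UNIV]) auto

lemma smooth_on_vec_nth: "open S \<Longrightarrow> smooth_on f S \<Longrightarrow> smooth_on (\<lambda>x. f x $ i) S"
  by (rule smooth_on_linear_compose[OF bounded_linear_vec_nth])

lemma smooth_on_inner_const: "open S \<Longrightarrow> smooth_on f S \<Longrightarrow> smooth_on (\<lambda>x. f x \<bullet> a) S"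
  by (rule smooth_on_linear_compose[OF bounded_linear_inner_left])

lemma smooth_on_fst: "open S \<Longrightarrow> smooth_on f S \<Longrightarrow> smooth_on (\<lambda>x. fst (f x)) S"
  by (rule smooth_on_linear_compose[OF bounded_linear_fst])

lemma smooth_on_snd: "open S \<Longrightarrow> smooth_on f S \<Longrightarrow> smooth_on (\<lambda>x. snd (f x)) S"
  by (rule smooth_on_linear_compose[OF bounded_linear_snd])

lemma smooth_on_euclidean:
  fixes f :: "'a::euclidean_space \<Rightarrow> 'b::euclidean_space"
  assumes "open S" "\<And>b. b \<in> Basis \<Longrightarrow> smooth_on (\<lambda>x. f x \<bullet> b) S"
  shows "smooth_on f S"
proof -
  have "smooth_on (\<lambda>x. \<Sum>b\<in>Basis. (f x \<bullet> b) *\<^sub>R b) S"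
    by (intro smooth_on_sum smooth_on_scaleR smooth_on_const assms)
  then show ?thesis by (simp add: euclidean_representation)
qed

lemma smooth_on_Pair:
  fixes f :: "'a::euclidean_space \<Rightarrow> 'b::euclidean_space" and g :: "'a \<Rightarrow> 'c::euclidean_space"
  shows "open S \<Longrightarrow> smooth_on f S \<Longrightarrow> smooth_on g S \<Longrightarrow> smooth_on (\<lambda>x. (f x, g x)) S"
  by (rule smooth_on_euclidean)
    (auto simp: Basis_prod_def inner_prod_def intro!: smooth_on_inner_const)

lemma smooth_on_vec:
  fixes f :: "'a::euclidean_space \<Rightarrow> ('b::euclidean_space)^'n"
  assumes "open S" "\<And>i. smooth_on (\<lambda>x. f x $ i) S" 
  shows "smooth_on f S"
proof (rule smooth_on_euclidean[OF assms(1)])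
  fix b :: "'b^'n" assume "b \<in> Basis"
  then obtain i u where "b = axis i u" by (auto simp: Basis_vec_def)
  then show "smooth_on (\<lambda>x. f x \<bullet> b) S"
    using smooth_on_inner_const[OF assms(1) assms(2)[of i], of u] by (simp add: inner_axis)
qed

lemmas smooth_intros = smooth_on_const smooth_on_id smooth_on_add smooth_on_minus smooth_on_diff
  smooth_on_sum smooth_on_scaleR smooth_on_mult smooth_on_prod smooth_on_power smooth_on_vec_nth
  smooth_on_fst smooth_on_snd smooth_on_inner_const smooth_on_Pair

lemma smooth_on_local:
  assumes "\<And>x. x \<in> S \<Longrightarrow> \<exists>T. open T \<and> x \<in> T \<and> smooth_on f T"
  shows "smooth_on f S"
proof -
  have "Ck_on k f S" if "\<And>x. x \<in> S \<Longrightarrow> \<exists>T. open T \<and> x \<in> T \<and> Ck_on k f T" for k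
    using that
  proof (induction k arbitrary: f)
    case 0
    then have "isCont f x" if "x \<in> S" for x
      using that continuous_on_eq_continuous_at by fastforce
    then show ?case by (simp add: continuous_at_imp_continuous_on)
  next
    case (Suc k)
    have "Ck_on k (\<lambda>x. frechet_derivative f (at x) v) S" for v
      by (rule Suc.IH) (use Suc.prems in fastforce)
    then show ?case using Suc.prems by fastforce
  qed
  then show ?thesis using assms unfolding smooth_on_def by metis
qed

text \<open>Every derivative of a solution of \<open>f' = F(f)\<close> is again a smooth function of \<open>f\<close> (bootstrapping).
  This covers the elementary functions, whose differential equations are known.\<close>

lemma smooth_on_ode:
  fixes f F :: "real \<Rightarrow> real"
  assumes "open S" "open T" "f ` S \<subseteq> T" "smooth_on F T"
    and f': "\<And>x. x \<in> S \<Longrightarrow> (f has_real_derivative F (f x)) (at x)"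
  shows "smooth_on f S"
proof -
  have "Ck_on k f S" for k
  proof (induction k)
    case 0
    then show ?case using f' by (auto intro!: continuous_at_imp_continuous_on DERIV_isCont)
  next
    case (Suc k)
    have "Ck_on k (\<lambda>x. F (f x)) S"
      by (rule Ck_on_compose[of S T]) (use Suc assms in \<open>auto simp: smooth_on_def\<close>)
    then have "Ck_on k (\<lambda>x. F (f x) * v) S" for v
      using Ck_on_linear_compose[OF bounded_linear_mult_left assms(1)] by blast
    then show ?case
      by (intro Ck_on_SucI[OF assms(1), where f' = "\<lambda>x v. F (f x) * v"])
        (use f' in \<open>auto simp: has_field_derivative_def\<close>)
  qed
  then show ?thesis by (simp add: smooth_on_def)
qed

lemma smooth_on_exp: "open S \<Longrightarrow> smooth_on (exp :: real \<Rightarrow> real) S"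
  by (rule smooth_on_ode[of S UNIV _ "\<lambda>y. y"]) (auto intro!: smooth_on_id DERIV_exp)

lemma smooth_on_inverse: "open S \<Longrightarrow> 0 \<notin> S \<Longrightarrow> smooth_on (inverse :: real \<Rightarrow> real) S"
  by (rule smooth_on_ode[of S UNIV _ "\<lambda>y. - (y ^ 2)"])
    (auto intro!: smooth_intros derivative_eq_intros simp: power2_eq_square)

lemma smooth_on_sinh: "open S \<Longrightarrow> smooth_on (sinh :: real \<Rightarrow> real) S"
  unfolding sinh_def
  by (intro smooth_intros smooth_on_compose_UNIV[OF _ smooth_on_exp]) auto

lemma smooth_on_arsinh: "smooth_on (arsinh :: real \<Rightarrow> real) UNIV"
proof (rule smooth_on_ode[of UNIV UNIV _ "\<lambda>y. inverse (cosh y)"])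
  have "smooth_on (cosh :: real \<Rightarrow> real) UNIV"
    unfolding cosh_def by (intro smooth_intros smooth_on_compose_UNIV[OF _ smooth_on_exp]) auto
  then show "smooth_on (\<lambda>y::real. inverse (cosh y)) UNIV"
    by (intro smooth_on_compose[OF _ _ _ _ smooth_on_inverse[of "{0<..}"]])
      (auto simp: cosh_real_pos)
  show "(arsinh has_real_derivative inverse (cosh (arsinh x))) (at x)" for x :: real
    by (auto intro!: derivative_eq_intros simp: cosh_arsinh_real field_simps)
qed auto

section \<open>Partial derivatives\<close>

text \<open>The mean value theorem in direction \<open>v\<close> for the increment in direction \<open>w\<close>, and then in
  direction \<open>w\<close> for the derivative.\<close>

lemma mixed_difference_mvt:
  fixes f :: "'a::euclidean_space \<Rightarrow> real"
  assumes f: "smooth_on f S" and s: "s > 0"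
    and S: "\<And>a b. 0 \<le> a \<Longrightarrow> a \<le> s \<Longrightarrow> 0 \<le> b \<Longrightarrow> b \<le> s \<Longrightarrow> x + a *\<^sub>R v + b *\<^sub>R w \<in> S"
  shows "\<exists>a b. 0 \<le> a \<and> a \<le> s \<and> 0 \<le> b \<and> b \<le> s \<and>
    f (x + s *\<^sub>R v + s *\<^sub>R w) - f (x + s *\<^sub>R v) - f (x + s *\<^sub>R w) + f x
      = s * s * frechet_derivative (\<lambda>y. frechet_derivative f (at y) v) (at (x + a *\<^sub>R v + b *\<^sub>R w)) w"
proof -
  let ?D = "\<lambda>y. frechet_derivative f (at y) v"
  have line: "((\<lambda>a. h (p + a *\<^sub>R d)) has_real_derivative frechet_derivative h (at (p + a *\<^sub>R d)) d) (at a)"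
    if "smooth_on h S" "p + a *\<^sub>R d \<in> S" for h :: "'a \<Rightarrow> real" and p d a
  proof -
    have h: "(h has_derivative frechet_derivative h (at (p + a *\<^sub>R d))) (at (p + a *\<^sub>R d))"
      using smooth_on_has_derivative[OF that] .
    have "((\<lambda>a. h (p + a *\<^sub>R d)) has_derivative (\<lambda>t. frechet_derivative h (at (p + a *\<^sub>R d)) (t *\<^sub>R d))) (at a)"
      by (rule has_derivative_compose[where f = "\<lambda>a. p + a *\<^sub>R d" and g = h, OF _ h])
        (auto intro!: derivative_eq_intros)
    moreover have "frechet_derivative h (at (p + a *\<^sub>R d)) (t *\<^sub>R d) = frechet_derivative h (at (p + a *\<^sub>R d)) d * t" for t
      using linear_scale[OF has_derivative_linear[OF h]] by simp
    ultimately show ?thesis by (simp add: has_field_derivative_def)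
  qed
  let ?G = "\<lambda>a. f (x + s *\<^sub>R w + a *\<^sub>R v) - f (x + a *\<^sub>R v)"
  have "\<exists>a>0. a < s \<and> ?G s - ?G 0 = (s - 0) * (?D (x + s *\<^sub>R w + a *\<^sub>R v) - ?D (x + a *\<^sub>R v))"
  proof (rule MVT2[OF s])
    fix a assume "0 \<le> a" "a \<le> s"
    then show "DERIV ?G a :> ?D (x + s *\<^sub>R w + a *\<^sub>R v) - ?D (x + a *\<^sub>R v)"
      using S[of a s] S[of a 0] s by (intro DERIV_diff line[OF f]) (auto simp: algebra_simps)
  qed
  then obtain a where a: "0 < a" "a < s"
    and G: "?G s - ?G 0 = s * (?D (x + s *\<^sub>R w + a *\<^sub>R v) - ?D (x + a *\<^sub>R v))" by auto
  let ?H = "\<lambda>b. ?D (x + a *\<^sub>R v + b *\<^sub>R w)"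
  have "\<exists>b>0. b < s \<and> ?H s - ?H 0 = (s - 0) * frechet_derivative ?D (at (x + a *\<^sub>R v + b *\<^sub>R w)) w"
  proof (rule MVT2[OF s])
    fix b assume "0 \<le> b" "b \<le> s"
    then show "DERIV ?H b :> frechet_derivative ?D (at (x + a *\<^sub>R v + b *\<^sub>R w)) w"
      using a by (intro line smooth_on_frechet f S) auto
  qed
  then obtain b where "0 < b" "b < s"
    and "?H s - ?H 0 = s * frechet_derivative ?D (at (x + a *\<^sub>R v + b *\<^sub>R w)) w" by auto
  with a G show ?thesis
    by (intro exI[of _ a] exI[of _ b]) (simp add: algebra_simps)
qed

text \<open>Both iterated derivatives are limits of the same mixed second difference quotient.\<close>

lemma frechet_derivative_commute:
  fixes f :: "'a::euclidean_space \<Rightarrow> real"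
  assumes "open S" "x \<in> S" and f: "smooth_on f S"
  shows "frechet_derivative (\<lambda>y. frechet_derivative f (at y) v) (at x) w =
         frechet_derivative (\<lambda>y. frechet_derivative f (at y) w) (at x) v"
proof -
  let ?L = "\<lambda>v w y. frechet_derivative (\<lambda>y. frechet_derivative f (at y) v) (at y) w"
  have "\<bar>?L v w x - ?L w v x\<bar> < e" if e: "e > 0" for e
  proof -
    have c: "isCont (?L v w) x" for v w
      using smooth_onD_cont[OF smooth_on_frechet[OF smooth_on_frechet[OF f]]] assms(1,2)
      by (simp add: continuous_on_eq_continuous_at)
    have "e / 2 > 0" using e by simp
    then obtain d1 where d1: "d1 > 0" "\<And>y. dist y x < d1 \<Longrightarrow> dist (?L v w y) (?L v w x) < e / 2"
      using c[of v w] unfolding continuous_at_eps_delta by meson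
    obtain d2 where d2: "d2 > 0" "\<And>y. dist y x < d2 \<Longrightarrow> dist (?L w v y) (?L w v x) < e / 2"
      using c[of w v] \<open>e/2 > 0\<close> unfolding continuous_at_eps_delta by meson
    obtain d3 where d3: "d3 > 0" "ball x d3 \<subseteq> S" using assms(1,2) openE by blast
    define d where "d = min d1 (min d2 d3)"
    define s where "s = d / (2 * (norm v + norm w + 1))"
    have d: "d > 0" using d1 d2 d3 by (simp add: d_def)
    have np: "norm v + norm w + 1 > 0" by (smt (verit) norm_ge_zero)
    have s: "s > 0" using d np by (simp add: s_def)
    have near: "dist (x + a *\<^sub>R v + b *\<^sub>R w) x < d" if "0 \<le> a" "a \<le> s" "0 \<le> b" "b \<le> s" for a b
    proof -
      have "dist (x + a *\<^sub>R v + b *\<^sub>R w) x \<le> a * norm v + b * norm w"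
        using norm_triangle_ineq[of "a *\<^sub>R v" "b *\<^sub>R w"] that by (simp add: dist_norm)
      also have "\<dots> \<le> s * norm v + s * norm w" using that by (intro add_mono mult_right_mono) auto
      also have "\<dots> \<le> s * (norm v + norm w + 1)" using s by (simp add: algebra_simps)
      also have "\<dots> = d / 2" using np unfolding s_def times_divide_eq_left
        by (subst mult_divide_mult_cancel_right) auto
      also have "\<dots> < d" using d by simp
      finally show ?thesis .
    qed
    have inS: "x + a *\<^sub>R v + b *\<^sub>R w \<in> S" if "0 \<le> a" "a \<le> s" "0 \<le> b" "b \<le> s" for a b
      using near[OF that] d3(2) by (auto simp: d_def dist_commute)
    obtain a b where ab: "0 \<le> a" "a \<le> s" "0 \<le> b" "b \<le> s"
      "f (x + s *\<^sub>R v + s *\<^sub>R w) - f (x + s *\<^sub>R v) - f (x + s *\<^sub>R w) + f x = s * s * ?L v w (x + a *\<^sub>R v + b *\<^sub>R w)"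
      using mixed_difference_mvt[OF f s inS] by blast
    have inS': "x + a *\<^sub>R w + b *\<^sub>R v \<in> S" if "0 \<le> a" "a \<le> s" "0 \<le> b" "b \<le> s" for a b
      using inS[of b a] that by (simp add: algebra_simps)
    obtain a' b' where ab': "0 \<le> a'" "a' \<le> s" "0 \<le> b'" "b' \<le> s"
      "f (x + s *\<^sub>R w + s *\<^sub>R v) - f (x + s *\<^sub>R w) - f (x + s *\<^sub>R v) + f x = s * s * ?L w v (x + a' *\<^sub>R w + b' *\<^sub>R v)"
      using mixed_difference_mvt[OF f s inS'] by blast
    have "s * s * ?L v w (x + a *\<^sub>R v + b *\<^sub>R w) = s * s * ?L w v (x + a' *\<^sub>R w + b' *\<^sub>R v)"
      using ab(5) ab'(5) by (simp add: algebra_simps)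
    then have "?L v w (x + a *\<^sub>R v + b *\<^sub>R w) = ?L w v (x + a' *\<^sub>R w + b' *\<^sub>R v)" using s by simp
    moreover have "dist (?L v w (x + a *\<^sub>R v + b *\<^sub>R w)) (?L v w x) < e / 2"
      using near[OF ab(1-4)] by (intro d1(2)) (simp add: d_def)
    moreover have "dist (?L w v (x + a' *\<^sub>R w + b' *\<^sub>R v)) (?L w v x) < e / 2"
      using near[OF ab'(3,4,1,2)] by (intro d2(2)) (simp add: d_def algebra_simps)
    ultimately show ?thesis by (simp add: dist_real_def abs_if split: if_splits)
  qed
  then have "\<bar>?L v w x - ?L w v x\<bar> \<le> 0" by (meson less_irrefl not_le_imp_less)
  then show ?thesis by simp
qed

lemma pd_eqI: "(f has_derivative D) (at x) \<Longrightarrow> pd i f x = D (axis i 1)"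
  unfolding pd_def by (metis frechet_derivative_at)

lemma smooth_on_pd: "smooth_on f S \<Longrightarrow> smooth_on (pd i f) S"
  unfolding pd_def[abs_def] by (rule smooth_on_frechet)

lemma smooth_on_pds: "smooth_on f S \<Longrightarrow> smooth_on (pds is f) S"
  by (induction "is") (auto simp: pds_def intro: smooth_on_pd)

lemma has_derivative_cong_open:
  "open S \<Longrightarrow> x \<in> S \<Longrightarrow> (\<And>y. y \<in> S \<Longrightarrow> f y = g y) \<Longrightarrow>
   frechet_derivative f (at x) = frechet_derivative g (at x)"
  unfolding frechet_derivative_def
  by (rule arg_cong[where f = Eps], rule ext)
    (metis has_derivative_transform_within_open)

lemma pd_cong:
  "open S \<Longrightarrow> x \<in> S \<Longrightarrow> (\<And>y. y \<in> S \<Longrightarrow> f y = g y) \<Longrightarrow> pd i f x = pd i g x"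
  unfolding pd_def using has_derivative_cong_open by metis

lemma pds_Nil [simp]: "pds [] f = f" and pds_Cons [simp]: "pds (i # is) f = pd i (pds is f)"
  by (simp_all add: pds_def)

lemma pds_cong:
  assumes "open S" "x \<in> S" "\<And>y. y \<in> S \<Longrightarrow> f y = g y" 
  shows "pds is f x = pds is g x"
  using assms(2)
  by (induction "is" arbitrary: x) (use assms in \<open>auto intro: pd_cong\<close>)

lemma frechet_derivative_pd:
  fixes f :: "real^'m::finite \<Rightarrow> real"
  assumes "f differentiable (at x)"
  shows "frechet_derivative f (at x) v = (\<Sum>i\<in>UNIV. v $ i * pd i f x)"
proof -
  have l: "linear (frechet_derivative f (at x))" using assms by (rule linear_frechet_derivative)
  have "frechet_derivative f (at x) v = frechet_derivative f (at x) (\<Sum>i\<in>UNIV. v $ i *\<^sub>R axis i 1)"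
    by (simp add: basis_expansion scalar_mult_eq_scaleR[symmetric])
  then show ?thesis by (simp add: linear_sum[OF l] linear_scale[OF l] pd_def)
qed

lemma smooth_on_differentiable: "smooth_on f S \<Longrightarrow> x \<in> S \<Longrightarrow> f differentiable (at x)"
  using smooth_on_has_derivative differentiable_def by blast

lemma pd_commute:
  "open S \<Longrightarrow> x \<in> S \<Longrightarrow> smooth_on f S \<Longrightarrow> pd i (pd j f) x = pd j (pd i f) x"
  unfolding pd_def[abs_def] by (rule frechet_derivative_commute)

lemma pd_add:
  assumes "f differentiable (at x)" "g differentiable (at x)"
  shows "pd i (\<lambda>y. f y + g y) x = pd i f x + pd i g x"
  using assms by (intro pd_eqI[THEN trans]) 
    (auto simp: frechet_derivative_works pd_def intro!: has_derivative_add)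

lemma pd_cmult:
  assumes "f differentiable (at x)"
  shows "pd i (\<lambda>y. c * f y) x = c * pd i f x"
  using assms by (intro pd_eqI[THEN trans])
    (auto simp: frechet_derivative_works pd_def intro!: has_derivative_mult_right)

lemma pd_mult:
  assumes "f differentiable (at x)" "g differentiable (at x)"
  shows "pd i (\<lambda>y. f y * g y) x = f x * pd i g x + pd i f x * g x"
  using assms by (intro pd_eqI[THEN trans])
    (auto simp: frechet_derivative_works pd_def intro!: has_derivative_mult)

lemma pd_const [simp]: "pd i (\<lambda>y. c) x = 0"
  by (simp add: pd_def)

lemma pd_sum:
  assumes "\<And>a. a \<in> A \<Longrightarrow> f a differentiable (at x)"
  shows "pd i (\<lambda>y. \<Sum>a\<in>A. f a y) x = (\<Sum>a\<in>A. pd i (f a) x)"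
  using assms by (intro pd_eqI[THEN trans])
    (auto simp: frechet_derivative_works pd_def intro!: has_derivative_sum)

lemma pd_nth: "pd i (\<lambda>y. y $ j) x = (if i = j then 1 else 0)"
  by (rule pd_eqI[THEN trans, OF bounded_linear_imp_has_derivative[OF bounded_linear_vec_nth]])
    (simp add: axis_def)

lemma pds_add:
  assumes "open S" "x \<in> S" "smooth_on f S" "smooth_on g S"
  shows "pds is (\<lambda>y. f y + g y) x = pds is f x + pds is g x"
  using assms(2)
proof (induction "is" arbitrary: x)
  case (Cons i "is")
  have "pd i (pds is (\<lambda>y. f y + g y)) x = pd i (\<lambda>y. pds is f y + pds is g y) x"
    by (rule pd_cong[OF assms(1)]) (use Cons in auto)
  also have "\<dots> = pd i (pds is f) x + pd i (pds is g) x"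
    by (rule pd_add[OF smooth_on_differentiable[OF smooth_on_pds[OF assms(3)] Cons.prems]
          smooth_on_differentiable[OF smooth_on_pds[OF assms(4)] Cons.prems]])
  finally show ?case by simp
qed simp

lemma pds_cmult:
  assumes "open S" "x \<in> S" "smooth_on f S"
  shows "pds is (\<lambda>y. c * f y) x = c * pds is f x"
  using assms(2)
proof (induction "is" arbitrary: x)
  case (Cons i "is")
  have "pd i (pds is (\<lambda>y. c * f y)) x = pd i (\<lambda>y. c * pds is f y) x"
    by (rule pd_cong[OF assms(1)]) (use Cons in auto)
  also have "\<dots> = c * pd i (pds is f) x"
    by (rule pd_cmult[OF smooth_on_differentiable[OF smooth_on_pds[OF assms(3)] Cons.prems]])
  finally show ?case by simp
qed simp

text \<open>Differentiability at a point is carried over by a translation in both directions, so the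
  default derivative at nondifferentiable points is carried over, too.\<close>

lemma pd_translate: "pd i (\<lambda>y. f (y + a)) x = pd i f (x + a)"
proof -
  have h: "((\<lambda>y. f (y + a)) has_derivative D) (at x) \<longleftrightarrow> (f has_derivative D) (at (x + a))" for D
  proof
    assume "((\<lambda>y. f (y + a)) has_derivative D) (at x)"
    then have "((\<lambda>y. f (y + a)) has_derivative D) (at (x + a + - a))" by simp
    then show "(f has_derivative D) (at (x + a))"
      using has_derivative_compose[where f = "\<lambda>y. y + - a" and f' = "\<lambda>v. v" and s = UNIV
          and g = "\<lambda>y. f (y + a)" and x = "x + a" and g' = D]
      by (simp add: has_derivative_add_const[of _ _ _ "- a", simplified])
  next
    assume "(f has_derivative D) (at (x + a))"
    then show "((\<lambda>y. f (y + a)) has_derivative D) (at x)"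
      using has_derivative_compose[where f = "\<lambda>y. y + a" and f' = "\<lambda>v. v" and s = UNIV
          and g = f and x = x and g' = D]
      by (simp add: has_derivative_add_const)
  qed
  show ?thesis unfolding pd_def frechet_derivative_def h ..
qed

text \<open>A derivative of order less than \<open>k\<close> of a \<open>k\<close>-homogeneous function is homogeneous of positive
  degree, hence zero at the origin.\<close>

lemma pds_homogeneous:
  fixes f :: "real^'m::finite \<Rightarrow> real"
  assumes f: "smooth_on f UNIV" and h: "\<And>t y. f (t *\<^sub>R y) = t ^ k * f y" and l: "length is < k"
  shows "pds is f 0 = 0"
proof -
  have "length is \<le> k \<Longrightarrow> pds is f (t *\<^sub>R y) = t ^ (k - length is) * pds is f y" if t: "t \<noteq> 0" for t y
  proof (induction "is" arbitrary: y)
    case Nil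
    then show ?case using h by simp
  next
    case (Cons i "is")
    let ?f = "pds is f"
    have sm: "smooth_on ?f UNIV" by (rule smooth_on_pds[OF f])
    have d: "(?f has_derivative frechet_derivative ?f (at z)) (at z)" for z
      using smooth_on_has_derivative[OF sm] by simp
    have "((\<lambda>y. ?f (t *\<^sub>R y)) has_derivative (\<lambda>v. frechet_derivative ?f (at (t *\<^sub>R y)) (t *\<^sub>R v))) (at y)"
      by (rule has_derivative_compose[where f = "\<lambda>y. t *\<^sub>R y" and g = ?f, OF _ d])
        (auto intro!: derivative_eq_intros)
    then have "pd i (\<lambda>y. ?f (t *\<^sub>R y)) y = frechet_derivative ?f (at (t *\<^sub>R y)) (t *\<^sub>R axis i 1)"
      by (rule pd_eqI)
    also have "\<dots> = t * pd i ?f (t *\<^sub>R y)"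
      using linear_scale[OF has_derivative_linear[OF d]] by (simp add: pd_def)
    finally have 1: "pd i (\<lambda>y. ?f (t *\<^sub>R y)) y = t * pd i ?f (t *\<^sub>R y)" .
    have "pd i (\<lambda>y. ?f (t *\<^sub>R y)) y = pd i (\<lambda>y. t ^ (k - length is) * ?f y) y"
      using Cons by (intro arg_cong2[where f = "pd i"] ext) auto
    also have "\<dots> = t ^ (k - length is) * pd i ?f y"
      by (intro pd_cmult smooth_on_differentiable[OF sm]) simp
    finally have "t * pd i ?f (t *\<^sub>R y) = t ^ (k - length is) * pd i ?f y" using 1 by simp
    moreover have "k - length is = Suc (k - Suc (length is))" using Cons.prems by simp
    ultimately show ?case using t by simp
  qed
  from this[of 2 0] l have "pds is f 0 = 2 ^ (k - length is) * pds is f 0" by simp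
  moreover have "(2::real) ^ (k - length is) > 1" using l by simp
  ultimately show ?thesis by (metis less_irrefl mult_cancel_right1)
qed

section \<open>Bump functions and flat interpolation\<close>

text \<open>The functions \<open>q(1/x) exp(-1/x)\<close> for \<open>x > 0\<close>, extended by zero, form a class closed
  under differentiation; this gives the standard flat function.\<close>

definition flat_fun :: "real poly \<Rightarrow> real \<Rightarrow> real" where
  "flat_fun q x = (if x > 0 then poly q (inverse x) * exp (- inverse x) else 0)"

lemma poly_exp_tendsto_0: "((\<lambda>y. poly q y * exp (- y)) \<longlongrightarrow> 0) at_top" for q :: "real poly"
proof -
  have "((\<lambda>y::real. y ^ n * exp (- y)) \<longlongrightarrow> 0) at_top" for n
    using tendsto_power_div_exp_0[of n] by (simp add: exp_minus divide_inverse)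
  then have "((\<lambda>y::real. \<Sum>i\<le>degree q. coeff q i * (y ^ i * exp (- y))) \<longlongrightarrow> 0) at_top"
    by (auto intro!: tendsto_null_sum tendsto_mult_right_zero)
  then show ?thesis by (simp add: poly_altdef sum_distrib_right mult.assoc)
qed

lemma flat_fun_tendsto_0: "(flat_fun q \<longlongrightarrow> 0) (at 0)"
proof -
  have "((\<lambda>x. poly q (inverse x) * exp (- inverse x)) \<longlongrightarrow> 0) (at_right 0)"
    by (rule filterlim_compose[OF poly_exp_tendsto_0 filterlim_inverse_at_top_right])
  then have "(flat_fun q \<longlongrightarrow> 0) (at_right 0)"
    by (rule Lim_transform_eventually) (auto simp: flat_fun_def eventually_at_right_less eventually_at_filter)
  moreover have "(flat_fun q \<longlongrightarrow> 0) (at_left 0)"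
    by (rule Lim_transform_eventually[OF tendsto_const]) (auto simp: flat_fun_def eventually_at_filter)
  ultimately show ?thesis by (simp add: filterlim_split_at)
qed

text \<open>At \<open>0\<close> the difference quotient is the flat function with \<open>q(1/x)/x\<close> in place of \<open>q(1/x)\<close>.\<close>

lemma flat_fun_deriv:
  "(flat_fun q has_real_derivative flat_fun ([:0, 0, 1:] * (q - pderiv q)) x) (at x)"
proof (cases x "0 :: real" rule: linorder_cases)
  case less
  show ?thesis
    by (rule has_field_derivative_transform_within_open[of "\<lambda>x. 0" _ _ "{..<0}"])
      (use less in \<open>auto simp: flat_fun_def\<close>)
next
  case greater
  show ?thesis
    by (rule has_field_derivative_transform_within_open[of "\<lambda>x. poly q (inverse x) * exp (- inverse x)" _ _ "{0<..}"])
      (use greater in \<open>auto simp: flat_fun_def power2_eq_square field_simps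
        intro!: derivative_eq_intros DERIV_chain'[OF _ poly_DERIV]\<close>)
next
  case equal
  have "(\<lambda>y. (flat_fun q y - flat_fun q 0) / (y - 0)) = flat_fun (pCons 0 q)"
    by (auto simp: flat_fun_def fun_eq_iff divide_inverse)
  then show ?thesis using flat_fun_tendsto_0[of "pCons 0 q"] equal
    by (simp add: has_field_derivative_iff flat_fun_def)
qed

lemma smooth_on_flat_fun: "smooth_on (flat_fun q) UNIV"
proof (rule smooth_on_coinduct[where P = "\<lambda>f. \<exists>q c. f = (\<lambda>x. flat_fun q x * c)"])
  fix f assume "\<exists>q c. f = (\<lambda>x. flat_fun q x * c)"
  then obtain q c where f: "f = (\<lambda>x. flat_fun q x * c)" by blast
  show "\<exists>f'. (\<forall>x\<in>UNIV. (f has_derivative f' x) (at x)) \<and>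
             (\<forall>v. \<exists>q c. (\<lambda>x. f' x v) = (\<lambda>x. flat_fun q x * c))"
  proof (intro exI[of _ "\<lambda>x v. (flat_fun ([:0, 0, 1:] * (q - pderiv q)) x * c) * v"] conjI ballI allI)
    show "(f has_derivative (\<lambda>v. (flat_fun ([:0, 0, 1:] * (q - pderiv q)) x * c) * v)) (at x)" for x
      unfolding f using DERIV_cmult_right[OF flat_fun_deriv[of q x], of c]
      by (simp only: has_field_derivative_def)
    show "\<exists>q' c'. (\<lambda>x. (flat_fun ([:0, 0, 1:] * (q - pderiv q)) x * c) * v) = (\<lambda>x. flat_fun q' x * c')" for v
      by (rule exI[of _ "[:0, 0, 1:] * (q - pderiv q)"], rule exI[of _ "c * v"]) (simp only: mult.assoc)
  qed
next
  show "\<exists>q' c. flat_fun q = (\<lambda>x. flat_fun q' x * c)" by (rule exI[of _ q], rule exI[of _ 1]) simp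
qed simp

text \<open>The quotient \<open>e(b\<^sup>2 - s\<^sup>2) / (e(b\<^sup>2 - s\<^sup>2) + e(s\<^sup>2 - a\<^sup>2))\<close> of the flat function
  \<open>e\<close>; its denominator never vanishes because \<open>a < b\<close>.\<close>

lemma exists_bump:
  assumes "0 < a" "a < b"
  shows "\<exists>\<beta> :: real \<Rightarrow> real. smooth_on \<beta> UNIV \<and> (\<forall>s. \<bar>s\<bar> \<le> a \<longrightarrow> \<beta> s = 1) \<and> (\<forall>s. b \<le> \<bar>s\<bar> \<longrightarrow> \<beta> s = 0)"
proof -
  define e where "e = flat_fun 1"
  have e: "smooth_on e UNIV" "\<And>x. x > 0 \<Longrightarrow> e x > 0" "\<And>x. x \<le> 0 \<Longrightarrow> e x = 0"
    unfolding e_def by (auto simp: smooth_on_flat_fun flat_fun_def)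
  define \<beta> where "\<beta> s = e (b\<^sup>2 - s\<^sup>2) * inverse (e (b\<^sup>2 - s\<^sup>2) + e (s\<^sup>2 - a\<^sup>2))" for s
  have ab: "a\<^sup>2 < b\<^sup>2" using assms by (simp add: power_strict_mono)
  have pos: "e (b\<^sup>2 - s\<^sup>2) + e (s\<^sup>2 - a\<^sup>2) > 0" for s
    using e(2)[of "b\<^sup>2 - s\<^sup>2"] e(2)[of "s\<^sup>2 - a\<^sup>2"] e(3)[of "b\<^sup>2 - s\<^sup>2"] e(3)[of "s\<^sup>2 - a\<^sup>2"] ab
    by (cases "s\<^sup>2 < b\<^sup>2"; cases "a\<^sup>2 < s\<^sup>2") auto
  have "smooth_on \<beta> UNIV" unfolding \<beta>_def
    by (intro smooth_on_mult smooth_on_compose[OF _ _ _ _ smooth_on_inverse[of "{0<..}"]]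
        smooth_on_add smooth_on_compose_UNIV[OF _ e(1)] smooth_intros)
      (use pos in auto)
  moreover have "\<beta> s = 1" if "\<bar>s\<bar> \<le> a" for s
  proof -
    have "s\<^sup>2 \<le> a\<^sup>2" using that power_mono[of "\<bar>s\<bar>" a 2] by simp
    then have "e (s\<^sup>2 - a\<^sup>2) = 0" using e(3) by simp
    then show ?thesis using pos[of s] by (simp add: \<beta>_def)
  qed
  moreover have "\<beta> s = 0" if "b \<le> \<bar>s\<bar>" for s
  proof -
    have "b\<^sup>2 \<le> s\<^sup>2" using that assms power_mono[of b "\<bar>s\<bar>" 2] by simp
    then show ?thesis using e(3) by (simp add: \<beta>_def)
  qed
  ultimately show ?thesis by blast
qed

text \<open>Compose with the squared distance from \<open>p\<close>, which is smooth, unlike the distance.\<close>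

lemma exists_bump_ball:
  fixes p :: "'a::euclidean_space"
  assumes "0 < a" "a < b"
  shows "\<exists>\<psi> :: 'a \<Rightarrow> real. smooth_on \<psi> UNIV \<and> (\<forall>x\<in>ball p a. \<psi> x = 1) \<and> (\<forall>x. x \<notin> ball p b \<longrightarrow> \<psi> x = 0)"
proof -
  have "a\<^sup>2 < b\<^sup>2" "0 < a\<^sup>2" using assms by (simp_all add: power_strict_mono)
  from exists_bump[OF this(2,1)] obtain \<beta> :: "real \<Rightarrow> real" where "smooth_on \<beta> UNIV \<and>
    (\<forall>s. \<bar>s\<bar> \<le> a\<^sup>2 \<longrightarrow> \<beta> s = 1) \<and> (\<forall>s. b\<^sup>2 \<le> \<bar>s\<bar> \<longrightarrow> \<beta> s = 0)" ..
  then have \<beta>: "smooth_on \<beta> UNIV" "\<And>s. \<bar>s\<bar> \<le> a\<^sup>2 \<Longrightarrow> \<beta> s = 1" "\<And>s. b\<^sup>2 \<le> \<bar>s\<bar> \<Longrightarrow> \<beta> s = 0"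
    by simp_all
  define \<psi> where "\<psi> x = \<beta> (\<Sum>i\<in>Basis. ((x - p) \<bullet> i)\<^sup>2)" for x
  have n: "(\<Sum>i\<in>Basis. ((x - p) \<bullet> i)\<^sup>2) = (dist p x)\<^sup>2" for x
  proof -
    have "(dist p x)\<^sup>2 = (x - p) \<bullet> (x - p)"
      by (subst dist_commute) (simp only: dist_norm power2_norm_eq_inner)
    also have "\<dots> = (\<Sum>i\<in>Basis. ((x - p) \<bullet> i) * ((x - p) \<bullet> i))" by (rule euclidean_inner)
    finally show ?thesis by (simp add: power2_eq_square)
  qed
  have "smooth_on \<psi> UNIV" unfolding \<psi>_def
    by (intro smooth_on_compose_UNIV[OF _ \<beta>(1)] smooth_intros) auto
  moreover have "\<psi> x = 1" if "x \<in> ball p a" for x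
    unfolding \<psi>_def n using that by (intro \<beta>(2)) (simp add: power_mono)
  moreover have "\<psi> x = 0" if "x \<notin> ball p b" for x
    unfolding \<psi>_def n using that assms by (intro \<beta>(3)) (simp add: power_mono)
  ultimately show ?thesis by blast
qed

text \<open>Differentiation multiplies the \<open>i\<close>-th coefficient by \<open>2 ^ i\<close> and replaces \<open>\<gamma>\<close> by its derivative;
  the summability hypothesis is stable under this, so such series form a class closed under
  differentiation.\<close>

lemma smooth_on_rapid_series:
  fixes a :: "nat \<Rightarrow> real" and \<gamma> :: "real \<Rightarrow> real"
  assumes \<gamma>: "smooth_on \<gamma> UNIV" "\<And>s. s \<notin> {-2..2} \<Longrightarrow> \<gamma> s = (0::real)"
    and a: "\<And>n. summable (\<lambda>i. \<bar>a i\<bar> * (2 ^ i) ^ n)"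
  shows "smooth_on (\<lambda>s. \<Sum>i. a i * \<gamma> (2 ^ i * s)) UNIV"
proof -
  define P where "P f \<longleftrightarrow> (\<exists>a \<gamma>. f = (\<lambda>s. \<Sum>i. a i * \<gamma> (2 ^ i * s)) \<and> smooth_on \<gamma> UNIV \<and>
    (\<forall>s. s \<notin> {-2..2} \<longrightarrow> \<gamma> s = 0) \<and> (\<forall>n. summable (\<lambda>i. \<bar>a i\<bar> * (2 ^ i) ^ n)))"
    for f :: "real \<Rightarrow> real"
  show ?thesis
  proof (rule smooth_on_coinduct[where P = P])
    fix f assume "P f"
    then obtain a \<gamma> where f: "f = (\<lambda>s. \<Sum>i. a i * \<gamma> (2 ^ i * s))" and \<gamma>: "smooth_on \<gamma> UNIV"
      "\<And>s. s \<notin> {-2..2} \<Longrightarrow> \<gamma> s = 0" and a: "\<And>n. summable (\<lambda>i. \<bar>a i\<bar> * (2 ^ i) ^ n)"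
      unfolding P_def by blast
    define \<gamma>' where "\<gamma>' s = frechet_derivative \<gamma> (at s) 1" for s
    have sm': "smooth_on \<gamma>' UNIV" unfolding \<gamma>'_def by (rule smooth_on_frechet[OF \<gamma>(1)])
    have d: "(\<gamma> has_real_derivative \<gamma>' s) (at s)" for s
    proof -
      have h: "(\<gamma> has_derivative frechet_derivative \<gamma> (at s)) (at s)"
        using smooth_on_has_derivative[OF \<gamma>(1)] by simp
      have "frechet_derivative \<gamma> (at s) v = \<gamma>' s * v" for v
        using linear_scale[OF has_derivative_linear[OF h], of v 1] by (simp add: \<gamma>'_def)
      then have "frechet_derivative \<gamma> (at s) = (*) (\<gamma>' s)" by (rule ext)
      then show ?thesis using h by (simp add: has_field_derivative_def)
    qed
    have z: "\<gamma>' s = 0" if "s \<notin> {-2..2}" for s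
    proof -
      have "open (- {-2..2::real})" by (intro open_Compl closed_atLeastAtMost)
      then have "(\<gamma> has_real_derivative 0) (at s)"
        by (rule has_field_derivative_transform_within_open[of "\<lambda>x. 0", rotated])
          (use that \<gamma>(2) in auto)
      then show ?thesis using d DERIV_unique by blast
    qed
    have bdd: "\<exists>K. \<forall>s. \<bar>h s\<bar> \<le> K" if "smooth_on h UNIV" "\<And>s. s \<notin> {-2..2} \<Longrightarrow> h s = 0" for h :: "real \<Rightarrow> real"
    proof -
      have "compact (h ` {-2..2})"
        by (intro compact_continuous_image continuous_on_subset[OF smooth_onD_cont[OF that(1)]]) auto
      then obtain K where K: "\<forall>s\<in>{-2..2}. \<bar>h s\<bar> \<le> K"
        by (auto simp: bounded_iff dest!: compact_imp_bounded)
      have "\<bar>h s\<bar> \<le> max K 0" for s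
      proof (cases "s \<in> {-2..2}")
        case True
        then show ?thesis using K by (simp add: le_max_iff_disj)
      next
        case False
        then show ?thesis using that(2) by simp
      qed
      then show ?thesis by blast
    qed
    obtain K where K: "\<And>s. \<bar>\<gamma> s\<bar> \<le> K" using bdd[OF \<gamma>] by blast
    obtain K' where K': "\<And>s. \<bar>\<gamma>' s\<bar> \<le> K'" using bdd[OF sm' z] by blast
    have a': "summable (\<lambda>i. \<bar>a i * 2 ^ i\<bar> * (2 ^ i) ^ n)" for n
      using a[of "Suc n"] by (simp add: abs_mult mult_ac)
    define f' where "f' s = (\<Sum>i. a i * 2 ^ i * \<gamma>' (2 ^ i * s))" for s
    have df: "(f has_real_derivative f' s) (at s)" for s
      unfolding f f'_def
    proof (rule has_field_derivative_series'(2)[where S = UNIV])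
      show "((\<lambda>s. a i * \<gamma> (2 ^ i * s)) has_real_derivative a i * 2 ^ i * \<gamma>' (2 ^ i * s)) (at s within UNIV)" for i s
      proof -
        have "((*) (2 ^ i) has_real_derivative 2 ^ i) (at s)" by (auto intro!: derivative_eq_intros)
        from DERIV_cmult[OF DERIV_chain'[OF this d[of "2 ^ i * s"]], of "a i"]
        show ?thesis by (simp only: mult.assoc mult.commute[of "2 ^ i" "\<gamma>' (2 ^ i * s)"] UNIV_I)
      qed
      show "uniformly_convergent_on UNIV (\<lambda>n s. \<Sum>i<n. a i * 2 ^ i * \<gamma>' (2 ^ i * s))"
      proof (rule Weierstrass_m_test')
        show "norm (a i * 2 ^ i * \<gamma>' (2 ^ i * s)) \<le> \<bar>a i\<bar> * (2 ^ i) ^ 1 * K'" for i s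
          using K'[of "2 ^ i * s"] by (simp add: abs_mult mult_left_mono)
        show "summable (\<lambda>i. \<bar>a i\<bar> * (2 ^ i) ^ 1 * K')" by (rule summable_mult2[OF a])
      qed
      show "summable (\<lambda>i. a i * \<gamma> (2 ^ i * 0))"
      proof (rule summable_comparison_test'[where N = 0])
        show "summable (\<lambda>i. \<bar>a i\<bar> * (2 ^ i) ^ 0 * K)" by (rule summable_mult2[OF a])
        show "norm (a i * \<gamma> (2 ^ i * 0)) \<le> \<bar>a i\<bar> * (2 ^ i) ^ 0 * K" for i
          using K[of 0] by (simp add: abs_mult mult_left_mono)
      qed
    qed auto
    show "\<exists>f'. (\<forall>x\<in>UNIV. (f has_derivative f' x) (at x)) \<and> (\<forall>v. P (\<lambda>x. f' x v))"
    proof (intro exI[of _ "\<lambda>x v. f' x * v"] conjI ballI allI)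
      show "(f has_derivative (*) (f' x)) (at x)" for x
        using df by (simp add: has_field_derivative_def)
      fix v
      have "f' s * v = (\<Sum>i. a i * 2 ^ i * v * \<gamma>' (2 ^ i * s))" for s
      proof -
        have "summable (\<lambda>i. a i * 2 ^ i * \<gamma>' (2 ^ i * s))"
        proof (rule summable_comparison_test'[where N = 0])
          show "summable (\<lambda>i. \<bar>a i\<bar> * (2 ^ i) ^ 1 * K')" by (rule summable_mult2[OF a])
          show "norm (a i * 2 ^ i * \<gamma>' (2 ^ i * s)) \<le> \<bar>a i\<bar> * (2 ^ i) ^ 1 * K'" for i
            using K'[of "2 ^ i * s"] by (simp add: abs_mult mult_left_mono)
        qed
        from suminf_mult2[OF this, of v] show ?thesis by (simp add: f'_def mult_ac)
      qed
      moreover have "summable (\<lambda>i. \<bar>a i * 2 ^ i * v\<bar> * (2 ^ i) ^ n)" for n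
        using summable_mult2[OF a'[of n], of "\<bar>v\<bar>"] by (simp add: abs_mult mult_ac)
      ultimately show "P (\<lambda>s. f' s * v)"
        unfolding P_def using sm' z by (intro exI[of _ "\<lambda>i. a i * 2 ^ i * v"] exI[of _ \<gamma>']) auto
    qed
  next
    show "P (\<lambda>s. \<Sum>i. a i * \<gamma> (2 ^ i * s))" unfolding P_def using assms by blast
  qed simp
qed

text \<open>Bumps at the points \<open>2\<^sup>-\<^sup>i\<close>, rescaled so that their supports are disjoint, are added with weights
  \<open>c i\<close>. The derivatives of order \<open>n\<close> grow like \<open>2 ^ (i * n)\<close>, and the bound on \<open>c i\<close> beats
  this for every \<open>n\<close>.\<close>

lemma flat_interpolation:
  fixes c :: "nat \<Rightarrow> 'c::euclidean_space"
  assumes c: "\<And>i. norm (c i) \<le> (1/2) ^ (i * i)"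
  shows "\<exists>g :: real \<Rightarrow> 'c. smooth_on g UNIV \<and> (\<forall>i s. \<bar>2 ^ i * s - 1\<bar> \<le> 1/8 \<longrightarrow> g s = c i)"
proof -
  obtain \<beta> :: "real \<Rightarrow> real" where \<beta>: "smooth_on \<beta> UNIV"
    "\<And>s. \<bar>s\<bar> \<le> 1/8 \<Longrightarrow> \<beta> s = 1" "\<And>s. 1/4 \<le> \<bar>s\<bar> \<Longrightarrow> \<beta> s = 0"
    using exists_bump[of "1/8" "1/4"] by auto
  define \<gamma> where "\<gamma> s = \<beta> (s - 1)" for s
  have \<gamma>: "smooth_on \<gamma> UNIV" "\<And>s. s \<notin> {-2..2} \<Longrightarrow> \<gamma> s = 0"
    unfolding \<gamma>_def by (auto intro!: smooth_on_compose_UNIV[OF _ \<beta>(1)] smooth_intros \<beta>(3))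
  define g where "g s = (\<Sum>b\<in>Basis. (\<Sum>i. (c i \<bullet> b) * \<gamma> (2 ^ i * s)) *\<^sub>R b)" for s
  have "summable (\<lambda>i. \<bar>c i \<bullet> b\<bar> * (2 ^ i) ^ n)" if "b \<in> Basis" for b n
  proof (rule summable_comparison_test'[where N = "Suc n"])
    show "summable (\<lambda>i. (1/2::real) ^ i)" by (rule summable_geometric) simp
    fix i assume i: "Suc n \<le> i"
    have "\<bar>c i \<bullet> b\<bar> * (2 ^ i) ^ n \<le> (1/2) ^ (i * i) * (2 ^ i) ^ n"
      using order_trans[OF Basis_le_norm[OF that] c] by (intro mult_right_mono) auto
    also have "\<dots> = (1/2) ^ (i * i) * 2 ^ (i * n)" by (simp add: power_mult)
    also have "i * i = i * n + i * (i - n)" using i by (simp flip: distrib_left)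
    also have "(1/2) ^ (i * n + i * (i - n)) * 2 ^ (i * n) = (1/2::real) ^ (i * (i - n))"
      by (simp add: power_add power_one_over)
    also have "\<dots> \<le> (1/2) ^ i" using i by (intro power_decreasing) auto
    finally show "norm (\<bar>c i \<bullet> b\<bar> * (2 ^ i) ^ n) \<le> (1/2) ^ i" by (simp add: abs_mult)
  qed
  then have "smooth_on g UNIV" unfolding g_def
    by (intro smooth_intros smooth_on_rapid_series \<gamma>) auto
  moreover have "g s = c i" if s: "\<bar>2 ^ i * s - 1\<bar> \<le> 1/8" for i s
  proof -
    have "\<gamma> (2 ^ j * s) = (if j = i then 1 else 0)" for j
    proof (cases j i rule: linorder_cases)
      case equal
      then show ?thesis using s by (simp add: \<gamma>_def \<beta>(2))
    next
      case less
      then obtain k where k: "i = j + Suc k" using less_imp_Suc_add by auto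
      have "2 ^ i * s = 2 ^ Suc k * (2 ^ j * s)" by (simp add: k power_add)
      moreover have "2 ^ i * s \<le> 9/8" "2 ^ i * s \<ge> 7/8" using s by linarith+
      moreover have "(2::real) ^ Suc k \<ge> 2" by simp
      ultimately have le: "2 ^ Suc k * (2 ^ j * s) \<le> 9/8" and "2 ^ Suc k * (2 ^ j * s) > 0" by linarith+
      then have "2 ^ j * s > 0" by (simp only: zero_less_mult_iff) auto
      moreover note le
      moreover have "2 * (2 ^ j * s) \<le> 2 ^ Suc k * (2 ^ j * s)"
        using \<open>2 ^ j * s > 0\<close> by (intro mult_right_mono) auto
      ultimately have "2 ^ j * s \<le> 3/4" by linarith
      then show ?thesis using less by (auto simp: \<gamma>_def intro: \<beta>(3))
    next
      case greater
      then obtain k where k: "j = i + Suc k" using less_imp_Suc_add by auto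
      have "2 ^ j * s = 2 ^ Suc k * (2 ^ i * s)" by (simp add: k power_add)
      moreover have i: "2 ^ i * s \<ge> 7/8" using s by linarith
      moreover have "2 * (2 ^ i * s) \<le> 2 ^ Suc k * (2 ^ i * s)"
        using i by (intro mult_right_mono) auto
      ultimately have "2 ^ j * s \<ge> 2 * (7/8)" by linarith
      then show ?thesis using greater by (auto simp: \<gamma>_def intro: \<beta>(3))
    qed
    then have "(\<Sum>j. (c j \<bullet> b) * \<gamma> (2 ^ j * s)) = c i \<bullet> b" for b
      using suminf_finite[of "{i}" "\<lambda>j. (c j \<bullet> b) * \<gamma> (2 ^ j * s)"] by simp
    then show ?thesis by (simp add: g_def euclidean_representation)
  qed
  ultimately show ?thesis by blast
qed

section \<open>Invariant tensors of the general linear group\<close>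

lemma linear_combination_of_span:
  fixes P :: "'a \<Rightarrow> 'b::real_vector"
  assumes "finite G" "x \<in> span (P ` G)"
  shows "\<exists>a. x = (\<Sum>g\<in>G. a g *\<^sub>R P g)"
  using assms(2)
proof (induction rule: span_induct_alt)
  case base
  then show ?case by (intro exI[of _ "\<lambda>_. 0"]) simp
next
  case (step c x y)
  then obtain g a where g: "g \<in> G" "x = P g" "y = (\<Sum>g\<in>G. a g *\<^sub>R P g)" by blast
  have "(\<Sum>h\<in>G. (a h + (if h = g then c else 0)) *\<^sub>R P h) = (\<Sum>h\<in>G. (if h = g then c else 0) *\<^sub>R P h) + y"
    by (simp add: algebra_simps sum.distrib g)
  also have "(\<Sum>h\<in>G. (if h = g then c else 0) *\<^sub>R P h) = (\<Sum>h\<in>G. if h = g then c *\<^sub>R P h else 0)"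
    by (intro sum.cong) auto
  also have "\<dots> = c *\<^sub>R x" using g assms(1) by simp
  finally show ?case by metis
qed

text \<open>A double commutant theorem for a finite group \<open>G\<close> of permutations of a finite set. View a
  matrix as an element of \<open>W \<otimes> W\<close>; the orthogonal projection onto the span \<open>U\<close> of the permutation
  matrices consists of blocks that commute with \<open>G\<close>, so a matrix \<open>f\<close> commuting with such blocks
  satisfies \<open>f = f Id = f (pr Id) = pr (f Id) = pr f\<close>, that is, \<open>f \<in> U\<close>.\<close>

theorem bicommutant_permutation_group:
  fixes G :: "('i::finite \<Rightarrow> 'i) set" and f :: "'i \<Rightarrow> 'i \<Rightarrow> real"
  assumes G: "id \<in> G" "\<And>s. s \<in> G \<Longrightarrow> bij s" "\<And>s. s \<in> G \<Longrightarrow> inv s \<in> G"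
      "\<And>s t. s \<in> G \<Longrightarrow> t \<in> G \<Longrightarrow> s \<circ> t \<in> G"
    and f: "\<And>M i l. (\<And>s a b. s \<in> G \<Longrightarrow> M (s a) (s b) = M a b) \<Longrightarrow>
        (\<Sum>j\<in>UNIV. f i j * M j l) = (\<Sum>j\<in>UNIV. M i j * f j l)"
  shows "\<exists>a. \<forall>i j. f i j = (\<Sum>s\<in>G. a s * (if i = s j then 1 else 0))"
proof -
  have finG: "finite G" by simp
  define P :: "('i \<Rightarrow> 'i) \<Rightarrow> real^('i \<times> 'i)" where "P s = (\<chi> p. if fst p = s (snd p) then 1 else 0)" for s
  define L :: "('i \<Rightarrow> 'i) \<Rightarrow> real^('i \<times> 'i) \<Rightarrow> real^('i \<times> 'i)"
    where "L s X = (\<chi> p. X $ (s (fst p), snd p))" for s X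
  define U where "U = span (P ` G)"
  have sub: "subspace U" by (simp add: U_def)
  obtain B where B: "B \<subseteq> U" "pairwise orthogonal B" "\<And>x. x \<in> B \<Longrightarrow> norm x = 1"
    "independent B" "card B = dim U" "span B = U"
    using orthonormal_basis_subspace[OF sub] by metis
  have finB: "finite B" using B(4) independent_imp_finite by blast
  define pr where "pr X = (\<Sum>b\<in>B. (X \<bullet> b) *\<^sub>R b)" for X
  have prU: "pr X \<in> U" for X
    unfolding pr_def using B(1) by (intro subspace_sum[OF sub] subspace_scale[OF sub]) auto
  have orthB: "b \<bullet> c = (if b = c then 1 else 0)" if "b \<in> B" "c \<in> B" for b c
    using B(2,3) that by (auto simp: pairwise_def orthogonal_def norm_eq_1)
  have prB: "pr X \<bullet> c = X \<bullet> c" if "c \<in> B" for X c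
  proof -
    have "pr X \<bullet> c = (\<Sum>b\<in>B. (X \<bullet> b) * (b \<bullet> c))" by (simp add: pr_def inner_sum_left)
    also have "\<dots> = (\<Sum>b\<in>B. if b = c then X \<bullet> c else 0)" by (intro sum.cong) (auto simp: orthB that)
    finally show ?thesis using finB that by simp
  qed
  have perp: "(X - pr X) \<bullet> u = 0" if "u \<in> U" for X u
    using that unfolding B(6)[symmetric]
  proof (induction rule: span_induct_alt)
    case (step c x y)
    then show ?case using prB by (simp add: inner_add_right inner_diff_left)
  qed simp
  have uniq: "pr X = u" if "u \<in> U" "\<And>w. w \<in> U \<Longrightarrow> (X - u) \<bullet> w = 0" for X u
  proof -
    have "u - pr X \<in> U" by (intro subspace_diff[OF sub] that prU)
    then have "(X - pr X) \<bullet> (u - pr X) = 0" "(X - u) \<bullet> (u - pr X) = 0" using perp that(2) by auto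
    then have "(u - pr X) \<bullet> (u - pr X) = 0" by (simp add: inner_diff_left)
    then show ?thesis by simp
  qed
  have Llin: "linear (L s)" for s by (rule linearI) (simp_all add: L_def vec_eq_iff)
  have LU: "L s u \<in> U" if s: "s \<in> G" and u: "u \<in> U" for s u
    using u unfolding U_def
  proof (induction rule: span_induct_alt)
    case base
    then show ?case using linear_0[OF Llin] by (simp add: span_zero)
  next
    case (step c x y)
    then obtain g where g: "g \<in> G" "x = P g" by blast
    have "L s x = P (inv s \<circ> g)"
      using bij_inv_eq_iff[OF G(2)[OF s]] by (simp add: g L_def P_def vec_eq_iff)
    then have "L s x \<in> P ` G" using G(3)[OF s] G(4) g by blast
    then show ?case using step
      by (simp add: linear_add[OF Llin] linear_scale[OF Llin] span_add span_scale span_base)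
  qed
  have Linner: "L s X \<bullet> Y = X \<bullet> L (inv s) Y" if s: "s \<in> G" for s X Y
  proof -
    have "L s X \<bullet> Y = (\<Sum>i\<in>UNIV. \<Sum>j\<in>UNIV. X $ (s i, j) * Y $ (i, j))"
      by (simp add: inner_vec_def L_def sum.cartesian_product split_beta UNIV_Times_UNIV[symmetric] del: UNIV_Times_UNIV)
    also have "\<dots> = (\<Sum>i\<in>UNIV. \<Sum>j\<in>UNIV. X $ (i, j) * Y $ (inv s i, j))"
      by (rule sum.reindex_bij_witness[of _ "inv s" s])
        (use G(2)[OF s] in \<open>auto simp: bij_is_surj bij_is_inj surj_f_inv_f inv_f_f\<close>)
    also have "\<dots> = X \<bullet> L (inv s) Y"
      by (simp add: inner_vec_def L_def sum.cartesian_product split_beta UNIV_Times_UNIV[symmetric] del: UNIV_Times_UNIV)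
    finally show ?thesis .
  qed
  have prL: "pr (L s X) = L s (pr X)" if s: "s \<in> G" for s X
  proof (rule uniq[OF LU[OF s prU]])
    fix w assume "w \<in> U"
    then have "(X - pr X) \<bullet> L (inv s) w = 0" using LU[OF G(3)[OF s]] perp by blast
    then show "(L s X - L s (pr X)) \<bullet> w = 0"
      using Linner[OF s, of "X - pr X" w] linear_diff[OF Llin, of s X "pr X"] by simp
  qed
  \<comment> \<open>The matrix entries of \<open>pr\<close>. For fixed \<open>j\<close> and \<open>l\<close> they form a matrix in \<open>i\<close> and \<open>k\<close> that commutes
    with \<open>G\<close>, because \<open>pr\<close> commutes with the action \<open>L\<close> of \<open>G\<close> on the first index.\<close>
  define p where "p i j k l = (\<Sum>b\<in>B. b $ (i, j) * b $ (k, l))" for i j k l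
  have pr_p: "pr X $ (i, j) = (\<Sum>k\<in>UNIV. \<Sum>l\<in>UNIV. p i j k l * X $ (k, l))" for X i j
  proof -
    have "pr X $ (i, j) = (\<Sum>b\<in>B. (\<Sum>q\<in>UNIV. X $ q * b $ q) * b $ (i, j))"
      by (simp add: pr_def inner_vec_def)
    also have "\<dots> = (\<Sum>b\<in>B. \<Sum>q\<in>UNIV. b $ (i, j) * b $ q * X $ q)"
      by (simp add: sum_distrib_left sum_distrib_right mult_ac)
    also have "\<dots> = (\<Sum>q\<in>UNIV. (\<Sum>b\<in>B. b $ (i, j) * b $ q) * X $ q)"
      by (subst sum.swap) (simp add: sum_distrib_right)
    also have "\<dots> = (\<Sum>k\<in>UNIV. \<Sum>l\<in>UNIV. p i j k l * X $ (k, l))"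
      by (simp add: p_def sum.cartesian_product split_beta UNIV_Times_UNIV[symmetric] del: UNIV_Times_UNIV)
    finally show ?thesis .
  qed
  have p_inv: "p (s i) j (s k) l = p i j k l" if s: "s \<in> G" for s i j k l
  proof -
    define X where "X = (axis (s k, l) 1 :: real^('i \<times> 'i))"
    have b: "bij s" by (rule G(2)[OF s])
    have LX: "L s X = axis (k, l) 1"
      using bij_is_inj[OF b] by (auto simp: L_def X_def axis_def vec_eq_iff inj_eq)
    have e: "pr (axis (k, l) 1) $ (i, j) = p i j k l" for i j k l
    proof -
      have "pr (axis (k, l) 1) $ (i, j) = (\<Sum>k'\<in>UNIV. \<Sum>l'\<in>UNIV. if k' = k then if l' = l then p i j k l else 0 else 0)"
        unfolding pr_p by (intro sum.cong refl) (auto simp: axis_def)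
      also have "\<dots> = (\<Sum>k'\<in>UNIV. if k' = k then p i j k l else 0)"
        by (intro sum.cong refl) auto
      finally show ?thesis by simp
    qed
    have "p (s i) j (s k) l = pr X $ (s i, j)" unfolding X_def by (rule e[symmetric])
    also have "\<dots> = L s (pr X) $ (i, j)" by (simp add: L_def)
    also have "\<dots> = p i j k l" by (simp only: prL[OF s, of X, symmetric] LX e)
    finally show ?thesis .
  qed
  define F where "F = (\<chi> q. f (fst q) (snd q))"
  have "id \<in> G" by (rule G(1))
  then have IdU: "P id \<in> U" unfolding U_def by (intro span_base) auto
  have "pr (P id) = P id" by (rule uniq[OF IdU]) simp
  then have Id: "(\<Sum>k\<in>UNIV. p a j k k) = (if a = j then 1 else 0)" for a j
  proof -
    have "(\<Sum>k\<in>UNIV. p a j k k) = (\<Sum>k\<in>UNIV. \<Sum>l\<in>UNIV. p a j k l * P id $ (k, l))"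
      by (intro sum.cong refl) (simp add: P_def if_distrib cong: if_cong)
    also have "\<dots> = P id $ (a, j)" using pr_p[of "P id" a j] \<open>pr (P id) = P id\<close> by simp
    finally show ?thesis by (simp add: P_def)
  qed
  have "F = pr F"
  proof (rule vec_eq_iff[THEN iffD2], rule allI)
    fix q :: "'i \<times> 'i" obtain i j where q: "q = (i, j)" by (cases q)
    have "f i j = (\<Sum>a\<in>UNIV. f i a * (\<Sum>k\<in>UNIV. p a j k k))" by (simp add: Id if_distrib cong: if_cong)
    also have "\<dots> = (\<Sum>k\<in>UNIV. \<Sum>a\<in>UNIV. f i a * p a j k k)"
      by (simp add: sum_distrib_left) (rule sum.swap)
    also have "\<dots> = (\<Sum>k\<in>UNIV. \<Sum>a\<in>UNIV. p i j a k * f a k)"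
      by (rule sum.cong[OF refl], rule f) (rule p_inv)
    also have "\<dots> = pr F $ (i, j)" unfolding pr_p by (subst sum.swap) (simp add: F_def)
    finally show "F $ q = pr F $ q" by (simp add: F_def q)
  qed
  then have "F \<in> span (P ` G)" using prU U_def by metis
  then obtain a where "F = (\<Sum>g\<in>G. a g *\<^sub>R P g)" using linear_combination_of_span[OF finG] by blast
  then have "F $ (i, j) = (\<Sum>s\<in>G. a s * (if i = s j then 1 else 0))" for i j
    by (simp add: P_def)
  then show ?thesis by (auto simp: F_def)
qed

text \<open>Expanding the product gives a sum over all maps \<open>s\<close> with range in \<open>S\<close>; in the alternating sum over
  \<open>S\<close> only the surjective ones survive, by inclusion and exclusion. So the symmetrised product of
  different matrices is a combination of tensor powers of single matrices.\<close>

lemma permanent_polarisation: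
  fixes B :: "'k::finite \<Rightarrow> 'k \<Rightarrow> real"
  shows "(\<Sum>S\<in>UNIV. (-1) ^ card (- S) * (\<Prod>q\<in>UNIV. \<Sum>p\<in>S. B p q)) =
         (\<Sum>s | bij s. \<Prod>q\<in>UNIV. B (s q) q)"
proof -
  have alt: "(\<Sum>S\<in>UNIV. if R \<subseteq> S then (-1) ^ card (- S) else 0) = (if R = UNIV then 1 else (0::real))"
    for R :: "'k set"
  proof -
    let ?g = "\<lambda>p. if p \<in> R then 0 else (-1::real)"
    have "(\<Sum>S\<in>Pow UNIV. (\<Prod>p\<in>S. 1) * (\<Prod>p\<in>UNIV - S. ?g p)) = (\<Prod>p\<in>UNIV. 1 + ?g p)"
      by (rule prod_add[symmetric]) simp
    moreover have "(\<Prod>p\<in>UNIV - S. ?g p) = (if R \<subseteq> S then (-1) ^ card (- S) else 0)" for S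
    proof (cases "R \<subseteq> S")
      case True
      then have "(\<Prod>p\<in>UNIV - S. ?g p) = (\<Prod>p\<in>UNIV - S. -1)" by (intro prod.cong) auto
      then show ?thesis using True by (simp add: Compl_eq_Diff_UNIV)
    next
      case False
      then show ?thesis by (auto intro!: prod_zero)
    qed
    moreover have "(\<Prod>p\<in>UNIV. 1 + ?g p) = (if R = UNIV then 1 else 0)"
      by (auto intro!: prod_zero)
    ultimately show ?thesis by simp
  qed
  have expand: "(\<Prod>q\<in>UNIV. \<Sum>p\<in>S. B p q) = (\<Sum>s\<in>UNIV. if range s \<subseteq> S then \<Prod>q\<in>UNIV. B (s q) q else 0)" for S
  proof -
    have "(\<Prod>q\<in>UNIV. \<Sum>p\<in>S. B p q) = (\<Sum>s\<in>PiE UNIV (\<lambda>_. S). \<Prod>q\<in>UNIV. B (s q) q)"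
      by (rule prod_sum_PiE) auto
    also have "PiE UNIV (\<lambda>_. S) = {s \<in> UNIV. range s \<subseteq> S}" by (auto simp: PiE_def)
    also have "(\<Sum>s\<in>{s \<in> UNIV. range s \<subseteq> S}. \<Prod>q\<in>UNIV. B (s q) q) = (\<Sum>s\<in>UNIV. if range s \<subseteq> S then \<Prod>q\<in>UNIV. B (s q) q else 0)"
      by (rule sum.inter_filter) simp
    finally show ?thesis .
  qed
  have "(\<Sum>S\<in>UNIV. (-1) ^ card (- S) * (\<Prod>q\<in>UNIV. \<Sum>p\<in>S. B p q)) =
      (\<Sum>S\<in>UNIV. \<Sum>s\<in>UNIV. (if range s \<subseteq> S then (-1) ^ card (- S) else 0) * (\<Prod>q\<in>UNIV. B (s q) q))"
    unfolding expand sum_distrib_left by (intro sum.cong refl) auto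
  also have "\<dots> = (\<Sum>s\<in>UNIV. (\<Sum>S\<in>UNIV. if range s \<subseteq> S then (-1) ^ card (- S) else 0) * (\<Prod>q\<in>UNIV. B (s q) q))"
    by (subst sum.swap) (simp add: sum_distrib_right)
  also have "\<dots> = (\<Sum>s\<in>UNIV. if bij s then \<Prod>q\<in>UNIV. B (s q) q else 0)"
    unfolding alt by (intro sum.cong refl) (auto simp: bij_def finite_UNIV_surj_inj)
  also have "\<dots> = (\<Sum>s\<in>{s\<in>UNIV. bij s}. \<Prod>q\<in>UNIV. B (s q) q)"
    by (rule sum.inter_filter[symmetric]) simp
  finally show ?thesis by simp
qed

lemma invertible_add_large_scalar:
  fixes A :: "real^'m^'m"
  shows "\<exists>s0. \<forall>s>s0. invertible (A + mat s)"
proof (intro exI allI impI)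
  fix s assume s: "s > onorm ((*v) A)"
  have "x = 0" if "(A + mat s) *v x = 0" for x
  proof (rule ccontr)
    assume "x \<noteq> 0"
    have "mat s *v x = s *\<^sub>R x"
      by (simp add: matrix_vector_mult_def mat_def vec_eq_iff if_distrib[of "\<lambda>c. c * _"] cong: if_cong)
    then have "A *v x = - (s *\<^sub>R x)"
      using that by (simp add: matrix_vector_mult_add_rdistrib eq_neg_iff_add_eq_0)
    then have "\<bar>s\<bar> * norm x \<le> onorm ((*v) A) * norm x"
      using onorm[OF matrix_vector_mul_bounded_linear, of A x] by simp
    then show False using s \<open>x \<noteq> 0\<close> by (simp add: mult_le_cancel_right)
  qed
  then show "invertible (A + mat s)" by (simp add: invertible_left_inverse matrix_left_invertible_ker)
qed

lemma sum_rotate: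
  "(\<Sum>j\<in>A. \<Sum>x\<in>B. \<Sum>y\<in>C. g j x y) = (\<Sum>x\<in>B. \<Sum>y\<in>C. \<Sum>j\<in>A. (g j x y :: 'a::comm_monoid_add))"
proof -
  have "(\<Sum>j\<in>A. \<Sum>x\<in>B. \<Sum>y\<in>C. g j x y) = (\<Sum>x\<in>B. \<Sum>j\<in>A. \<Sum>y\<in>C. g j x y)" by (rule sum.swap)
  also have "\<dots> = (\<Sum>x\<in>B. \<Sum>y\<in>C. \<Sum>j\<in>A. g j x y)" by (intro sum.cong refl sum.swap)
  finally show ?thesis .
qed

text \<open>Schur--Weyl duality. The hypothesis says that \<open>f\<close>, as an operator on the tensor power indexed by
  \<open>'k\<close>, commutes with all tensor powers of invertible matrices. These span the commutant of the
  permutation group, so \<open>f\<close> is a combination of permutations by the double commutant theorem.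
  The dimension is arbitrary; in small dimensions the coefficients are not unique.\<close>

theorem invariant_tensors:
  fixes f :: "('k::finite \<Rightarrow> 'm::finite) \<Rightarrow> ('k \<Rightarrow> 'm) \<Rightarrow> real"
  assumes inv: "\<And>A i l. invertible (A :: real^'m^'m) \<Longrightarrow>
      (\<Sum>j\<in>UNIV. f i j * (\<Prod>q\<in>UNIV. A $ (j q) $ (l q))) = (\<Sum>j\<in>UNIV. (\<Prod>q\<in>UNIV. A $ (i q) $ (j q)) * f j l)"
  shows "\<exists>a. \<forall>i j. f i j = (\<Sum>s | bij s. a s * (if j = i \<circ> s then 1 else 0))"
proof -
  have inv': "(\<Sum>j\<in>UNIV. f i j * (\<Prod>q\<in>UNIV. A $ (j q) $ (l q))) = (\<Sum>j\<in>UNIV. (\<Prod>q\<in>UNIV. A $ (i q) $ (j q)) * f j l)"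
    for A :: "real^'m^'m" and i l
  proof -
    \<comment> \<open>Both sides are polynomials in \<open>s\<close> when \<open>A\<close> is replaced by \<open>A + s\<close>, which is invertible for large \<open>s\<close>;
      hence the identity also holds for singular matrices.\<close>
    define D where "D a b = [: A $ a $ b, if a = b then 1 else 0 :]" for a b
    define p where "p = (\<Sum>j\<in>UNIV. smult (f i j) (\<Prod>q\<in>UNIV. D (j q) (l q))) -
        (\<Sum>j\<in>UNIV. smult (f j l) (\<Prod>q\<in>UNIV. D (i q) (j q)))"
    have D: "poly (D a b) s = (A + mat s) $ a $ b" for a b s
      by (simp add: D_def mat_def)
    have p: "poly p s = (\<Sum>j\<in>UNIV. f i j * (\<Prod>q\<in>UNIV. (A + mat s) $ (j q) $ (l q)))
        - (\<Sum>j\<in>UNIV. (\<Prod>q\<in>UNIV. (A + mat s) $ (i q) $ (j q)) * f j l)" for s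
      by (simp add: p_def poly_sum poly_prod D mult.commute del: vector_add_component)
    obtain s0 where "\<And>s. s > s0 \<Longrightarrow> invertible (A + mat s)" using invertible_add_large_scalar by blast
    then have "poly p s = 0" if "s > s0" for s using p[of s] inv[of "A + mat s" i l] that by simp
    then have "{s0<..} \<subseteq> {s. poly p s = 0}" by auto
    then have "infinite {s. poly p s = 0}" using infinite_Ioi infinite_super by blast
    then have "p = 0" using poly_roots_finite by blast
    then have "poly p 0 = 0" by simp
    moreover have "(mat 0 :: real^'m^'m) = 0" by (simp add: mat_def vec_eq_iff)
    ultimately show ?thesis unfolding p by simp
  qed
  define act :: "('k \<Rightarrow> 'k) \<Rightarrow> ('k \<Rightarrow> 'm) \<Rightarrow> ('k \<Rightarrow> 'm)" where "act s j = j \<circ> s" for s j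
  define G where "G = act ` {s. bij s}"
  have act: "act s \<circ> act t = act (t \<circ> s)" for s t by (auto simp: act_def comp_assoc)
  have actid: "act id = id" by (auto simp: act_def)
  have act_inv: "inv (act s) = act (inv s)" "bij (act s)" if "bij s" for s
  proof -
    have "inv s \<circ> s = id" "s \<circ> inv s = id"
      using surj_iff[THEN iffD1, OF bij_is_surj[OF that]] that by (auto simp: bij_is_inj)
    then have "act (inv s) \<circ> act s = id" "act s \<circ> act (inv s) = id"
      by (simp_all add: act actid)
    then show "inv (act s) = act (inv s)" "bij (act s)"
      by (metis inv_unique_comp, metis o_bij)
  qed
  have "\<exists>a. \<forall>i j. f i j = (\<Sum>s\<in>G. a s * (if i = s j then 1 else 0))"
  proof (rule bicommutant_permutation_group)
    show "id \<in> G" unfolding G_def using actid bij_id by (metis imageI mem_Collect_eq)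
    show "bij s" "inv s \<in> G" if "s \<in> G" for s
      using that act_inv by (auto simp: G_def intro: bij_imp_bij_inv)
    show "s \<circ> t \<in> G" if "s \<in> G" "t \<in> G" for s t
      using that by (auto simp: G_def act intro: bij_comp)
    fix M i l assume M: "\<And>s a b. s \<in> G \<Longrightarrow> M (s a) (s b) = (M a b :: real)"
    \<comment> \<open>The symmetrisation of an elementary matrix on the tensor power; it is a combination of tensor
      powers by polarisation, and such matrices span the commutant.\<close>
    define E where "E x y a b = (\<Sum>s | bij s. \<Prod>q\<in>UNIV. if a q = x (s q) \<and> b q = y (s q) then 1 else 0::real)"
      for x y a b :: "'k \<Rightarrow> 'm"
    have E: "(\<Sum>j\<in>UNIV. f i j * E x y j l) = (\<Sum>j\<in>UNIV. E x y i j * f j l)" for x y i l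
    proof -
      define A :: "'k set \<Rightarrow> real^'m^'m" where "A S = (\<chi> a b. \<Sum>p\<in>S. if a = x p \<and> b = y p then 1 else 0)" for S
      have EA: "E x y a b = (\<Sum>S\<in>UNIV. (-1) ^ card (- S) * (\<Prod>q\<in>UNIV. A S $ (a q) $ (b q)))" for a b
        unfolding E_def A_def
        using permanent_polarisation[of "\<lambda>p q. if a q = x p \<and> b q = y p then 1 else 0"] by simp
      have "(\<Sum>j\<in>UNIV. f i j * E x y j l) =
          (\<Sum>S\<in>UNIV. (-1) ^ card (- S) * (\<Sum>j\<in>UNIV. f i j * (\<Prod>q\<in>UNIV. A S $ (j q) $ (l q))))"
        unfolding EA sum_distrib_left by (subst sum.swap) (simp add: mult_ac)
      also have "\<dots> = (\<Sum>S\<in>UNIV. (-1) ^ card (- S) * (\<Sum>j\<in>UNIV. (\<Prod>q\<in>UNIV. A S $ (i q) $ (j q)) * f j l))"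
        by (simp only: inv')
      also have "\<dots> = (\<Sum>j\<in>UNIV. E x y i j * f j l)"
        unfolding EA sum_distrib_left sum_distrib_right by (subst sum.swap) (simp add: mult_ac)
      finally show ?thesis .
    qed
    define N where "N = real (card {s :: 'k \<Rightarrow> 'k. bij s})"
    have N: "N > 0" using bij_id by (auto simp: N_def card_gt_0_iff)
    have ME: "M a b = (\<Sum>x\<in>UNIV. \<Sum>y\<in>UNIV. M x y * E x y a b) / N" for a b
    proof -
      have "(\<Sum>x\<in>UNIV. \<Sum>y\<in>UNIV. M x y * E x y a b) =
        (\<Sum>s | bij s. \<Sum>x\<in>UNIV. \<Sum>y\<in>UNIV. M x y * (if a = x \<circ> s \<and> b = y \<circ> s then 1 else 0))"
      proof -
        have pe: "(\<Prod>q\<in>UNIV. if a q = x (s q) \<and> b q = y (s q) then 1 else 0::real) = (if a = x \<circ> s \<and> b = y \<circ> s then 1 else 0)"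
          for x y s by (auto simp: fun_eq_iff)
        have "(\<Sum>x\<in>UNIV. \<Sum>y\<in>UNIV. M x y * E x y a b) =
          (\<Sum>x\<in>UNIV. \<Sum>s | bij s. \<Sum>y\<in>UNIV. M x y * (if a = x \<circ> s \<and> b = y \<circ> s then 1 else 0))"
          unfolding E_def pe sum_distrib_left by (intro sum.cong refl sum.swap)
        also have "\<dots> = (\<Sum>s | bij s. \<Sum>x\<in>UNIV. \<Sum>y\<in>UNIV. M x y * (if a = x \<circ> s \<and> b = y \<circ> s then 1 else 0))"
          by (rule sum.swap)
        finally show ?thesis .
      qed
      also have "\<dots> = (\<Sum>s | bij (s :: 'k \<Rightarrow> 'k). M a b)"
      proof (intro sum.cong refl)
        fix s :: "'k \<Rightarrow> 'k" assume "s \<in> {s. bij s}"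
        then have s: "bij s" by simp
        have "inv s \<circ> s = id" "s \<circ> inv s = id"
          using surj_iff[THEN iffD1, OF bij_is_surj[OF s]] s by (auto simp: bij_is_inj)
        then have c: "a = x \<circ> s \<longleftrightarrow> x = act (inv s) a" for x a :: "'k \<Rightarrow> 'm"
          by (auto simp: act_def comp_assoc)
        have "(\<Sum>x\<in>UNIV. \<Sum>y\<in>UNIV. M x y * (if a = x \<circ> s \<and> b = y \<circ> s then 1 else 0)) =
          (\<Sum>x\<in>UNIV. \<Sum>y\<in>UNIV. if y = act (inv s) b then if x = act (inv s) a then M x y else 0 else 0)"
          by (intro sum.cong refl) (auto simp: c)
        also have "\<dots> = M (act (inv s) a) (act (inv s) b)" by simp
        also have "\<dots> = M a b" using s by (intro M) (auto simp: G_def bij_imp_bij_inv)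
        finally show "(\<Sum>x\<in>UNIV. \<Sum>y\<in>UNIV. M x y * (if a = x \<circ> s \<and> b = y \<circ> s then 1 else 0)) = M a b" .
      qed
      finally have "(\<Sum>x\<in>UNIV. \<Sum>y\<in>UNIV. M x y * E x y a b) = N * M a b" by (simp add: N_def)
      then show ?thesis using N by simp
    qed
    have "(\<Sum>j\<in>UNIV. f i j * M j l) = (\<Sum>x\<in>UNIV. \<Sum>y\<in>UNIV. M x y * (\<Sum>j\<in>UNIV. f i j * E x y j l)) / N"
    proof -
      have "(\<Sum>j\<in>UNIV. f i j * M j l) = (\<Sum>j\<in>UNIV. \<Sum>x\<in>UNIV. \<Sum>y\<in>UNIV. M x y * (f i j * E x y j l)) / N"
        unfolding ME[of _ l] by (simp add: sum_divide_distrib sum_distrib_left mult_ac)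
      also have "(\<Sum>j\<in>UNIV. \<Sum>x\<in>UNIV. \<Sum>y\<in>UNIV. M x y * (f i j * E x y j l)) =
        (\<Sum>x\<in>UNIV. \<Sum>y\<in>UNIV. \<Sum>j\<in>UNIV. M x y * (f i j * E x y j l))"
        by (rule sum_rotate)
      finally show ?thesis by (simp add: sum_distrib_left)
    qed
    also have "\<dots> = (\<Sum>x\<in>UNIV. \<Sum>y\<in>UNIV. M x y * (\<Sum>j\<in>UNIV. E x y i j * f j l)) / N"
      by (simp only: E)
    also have "\<dots> = (\<Sum>j\<in>UNIV. M i j * f j l)"
    proof -
      have "(\<Sum>j\<in>UNIV. M i j * f j l) = (\<Sum>j\<in>UNIV. \<Sum>x\<in>UNIV. \<Sum>y\<in>UNIV. M x y * (E x y i j * f j l)) / N"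
        unfolding ME[of i] by (simp only: times_divide_eq_left sum_distrib_right sum_divide_distrib[symmetric] mult.assoc)
      also have "(\<Sum>j\<in>UNIV. \<Sum>x\<in>UNIV. \<Sum>y\<in>UNIV. M x y * (E x y i j * f j l)) =
        (\<Sum>x\<in>UNIV. \<Sum>y\<in>UNIV. \<Sum>j\<in>UNIV. M x y * (E x y i j * f j l))"
        by (rule sum_rotate)
      finally show ?thesis by (simp add: sum_distrib_left)
    qed
    finally show "(\<Sum>j\<in>UNIV. f i j * M j l) = (\<Sum>j\<in>UNIV. M i j * f j l)" .
  qed
  then obtain a where a: "\<And>i j. f i j = (\<Sum>g\<in>G. a g * (if i = g j then 1 else 0))" by blast
  \<comment> \<open>\<open>act\<close> may fail to be injective (when \<open>'m\<close> is a singleton), so choose one preimage.\<close>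
  define b where "b s = (if s = (SOME t. bij t \<and> act t = act s) then a (act s) else 0)" for s
  have "f i j = (\<Sum>s | bij s. b s * (if i = act s j then 1 else 0))" for i j
  proof -
    have "(\<Sum>s | bij s. b s * (if i = act s j then 1 else 0)) =
       (\<Sum>g\<in>G. \<Sum>s | bij s \<and> act s = g. b s * (if i = act s j then 1 else 0))"
      unfolding G_def by (subst sum.image_gen[of _ _ act]) (auto intro!: sum.cong)
    also have "\<dots> = (\<Sum>g\<in>G. a g * (if i = g j then 1 else 0))"
    proof (intro sum.cong refl)
      fix g assume "g \<in> G"
      then obtain t where "bij t \<and> act t = g" by (auto simp: G_def)
      then have some: "bij (SOME t. bij t \<and> act t = g) \<and> act (SOME t. bij t \<and> act t = g) = g"
        by (rule someI[of "\<lambda>t. bij t \<and> act t = g"])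
      have "(\<Sum>s | bij s \<and> act s = g. b s * (if i = act s j then 1 else 0)) =
         (\<Sum>s | bij s \<and> act s = g. if s = (SOME t. bij t \<and> act t = g) then a g * (if i = g j then 1 else 0) else 0)"
        by (intro sum.cong refl) (auto simp: b_def)
      also have "\<dots> = a g * (if i = g j then 1 else 0)" using some by simp
      finally show "(\<Sum>s | bij s \<and> act s = g. b s * (if i = act s j then 1 else 0)) = a g * (if i = g j then 1 else 0)" .
    qed
    finally show ?thesis by (simp add: a)
  qed
  then have "f i j = (\<Sum>s | bij s. b (inv s) * (if j = i \<circ> s then 1 else 0))" for i j
  proof -
    assume f: "\<And>i j. f i j = (\<Sum>s | bij s. b s * (if i = act s j then 1 else 0))"
    have "(\<Sum>s | bij s. b s * (if i = act s j then 1 else 0)) = (\<Sum>s | bij s. b (inv s) * (if j = i \<circ> s then 1 else 0))"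
    proof (rule sum.reindex_bij_witness[of _ inv inv])
      fix s :: "'k \<Rightarrow> 'k" assume "s \<in> {s. bij s}"
      then have s: "bij s" by simp
      show "inv (inv s) = s" using s by (rule inv_inv_eq)
      show "inv s \<in> {s. bij s}" using s by (simp add: bij_imp_bij_inv)
      have "inv s \<circ> s = id" "s \<circ> inv s = id"
        using surj_iff[THEN iffD1, OF bij_is_surj[OF s]] s by (auto simp: bij_is_inj)
      then have "i = act s j \<longleftrightarrow> j = i \<circ> inv s"
        by (auto simp: act_def comp_assoc)
      then show "b (inv (inv s)) * (if j = i \<circ> inv s then 1 else 0) = b s * (if i = act s j then 1 else 0)"
        using s by (simp add: inv_inv_eq)
    qed (auto simp: inv_inv_eq bij_imp_bij_inv)
    then show ?thesis using f by simp
  qed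
  then show ?thesis by (intro exI[of _ "\<lambda>s. b (inv s)"]) simp
qed

section \<open>Invariance of the family under changes of coordinates\<close>

text \<open>The calculations with changes of coordinates are done without indices: \<open>c\<close> is an array such as the
  coefficients of a connection, its torsion or a derivative of these, and \<open>gam\<close> applies it to two
  vectors.\<close>

definition gam :: "'m::finite coeffs \<Rightarrow> real^'m \<Rightarrow> real^'m \<Rightarrow> real^'m" where
  "gam c v w = (\<chi> r. \<Sum>l\<in>UNIV. \<Sum>n\<in>UNIV. c l r n * v $ l * w $ n)"

definition dcf :: "(real^'m \<Rightarrow> 'm coeffs) \<Rightarrow> real^'m \<Rightarrow> real^'m \<Rightarrow> 'm::finite coeffs" where
  "dcf M x d l r n = frechet_derivative (\<lambda>y. M y l r n) (at x) d"

definition trc :: "(real^'m \<Rightarrow> real^'m) \<Rightarrow> real" where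
  "trc f = (\<Sum>i\<in>UNIV. f (axis i 1) $ (i::'m::finite))"

lemma gam_linear:
  "gam c (v + v') w = gam c v w + gam c v' w" "gam c v (w + w') = gam c v w + gam c v w'"
  "gam c (t *\<^sub>R v) w = t *\<^sub>R gam c v w" "gam c v (t *\<^sub>R w) = t *\<^sub>R gam c v w"
  by (simp_all add: gam_def vec_eq_iff algebra_simps sum.distrib sum_distrib_left)

lemma gam_linear_fun:
  "gam c (v + v') = (\<lambda>w. gam c v w + gam c v' w)" "gam c (t *\<^sub>R v) = (\<lambda>w. t *\<^sub>R gam c v w)"
  "gam (\<lambda>l r n. c l r n + c' l r n) v = (\<lambda>w. gam c v w + gam c' v w)"
  "gam (\<lambda>l r n. t * c l r n) v = (\<lambda>w. t *\<^sub>R gam c v w)"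
  by (simp_all add: fun_eq_iff gam_def vec_eq_iff algebra_simps sum.distrib sum_distrib_left)

lemma gam_diff: "gam c (v - v') w = gam c v w - gam c v' w" "gam c v (w - w') = gam c v w - gam c v w'"
  by (simp_all add: gam_def vec_eq_iff algebra_simps sum_subtractf)

lemma gam_coeffs:
  "gam (\<lambda>l r n. c l r n + c' l r n) v w = gam c v w + gam c' v w"
  "gam (\<lambda>l r n. t * c l r n) v w = t *\<^sub>R gam c v w"
  by (simp_all add: gam_def vec_eq_iff algebra_simps sum.distrib sum_distrib_left)

lemma sum_axis: 
  "(\<Sum>l\<in>UNIV. f l * axis a 1 $ l) = (f (a::'m::finite) :: real)"
  by (simp add: axis_def if_distrib cong: if_cong)

lemma gam_axis1: "gam c (axis l 1) w $ r = (\<Sum>n\<in>UNIV. c l r n * w $ n)"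
proof -
  have "gam c (axis l 1) w $ r = (\<Sum>l'\<in>UNIV. (\<Sum>n\<in>UNIV. c l' r n * w $ n) * axis l 1 $ l')"
    by (simp add: gam_def sum_distrib_left sum_distrib_right mult_ac)
  then show ?thesis by (simp only: sum_axis)
qed

lemma gam_axis2: "gam c v (axis n 1) $ r = (\<Sum>l\<in>UNIV. c l r n * v $ l)"
  by (simp add: gam_def sum_axis)

lemma gam_axis: "gam c (axis l 1) (axis n 1) $ r = c l r n"
  by (simp add: gam_axis1 sum_axis)

lemma trc_linear:
  "trc (\<lambda>e. f e + g e) = trc f + trc g" "trc (\<lambda>e. f e - g e) = trc f - trc g" "trc (\<lambda>e. t *\<^sub>R f e) = t * trc f"
  by (simp_all add: trc_def sum.distrib sum_subtractf sum_distrib_left)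

text \<open>A trace does not depend on the basis; \<open>A\<close> and \<open>A'\<close> are conjugate by \<open>J\<close>.\<close>

lemma trc_conj:
  fixes A A' J K :: "real^'m::finite \<Rightarrow> real^'m"
  assumes lin: "linear A" "linear A'" "linear J" "linear K"
    and J: "\<And>v. J (A v) = A' (J v)" and KJ: "\<And>v. K (J v) = v" and JK: "\<And>v. J (K v) = v"
  shows "trc A = trc A'"
proof -
  have tr: "trc f = trace (matrix f)" for f :: "real^'m \<Rightarrow> real^'m"
    by (simp add: trc_def trace_def matrix_def)
  have A: "A = K \<circ> A' \<circ> J" using J KJ by (metis comp_apply ext)
  have "matrix A = matrix K ** matrix A' ** matrix J"
    unfolding A using lin by (simp add: matrix_compose linear_compose matrix_mul_assoc)
  then have "trc A = trace (matrix K ** (matrix A' ** matrix J))" by (simp add: tr matrix_mul_assoc)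
  also have "\<dots> = trace (matrix A' ** (matrix J ** matrix K))"
    by (subst trace_mul_sym) (simp add: matrix_mul_assoc)
  also have "matrix J ** matrix K = mat 1"
  proof -
    have "J \<circ> K = id" using JK by auto
    then show ?thesis using lin(3,4) by (metis matrix_compose matrix_id_mat_1)
  qed
  finally show ?thesis by (simp add: tr)
qed

text \<open>Index-free versions of \<open>tors_cov\<close>, \<open>curv\<close> and \<open>base_part\<close>. Their transformation laws involve only the
  first derivative of the coordinate change, while those of the terms they consist of contain
  the second and third derivatives.\<close>

definition covT :: "(real^'m \<Rightarrow> 'm coeffs) \<Rightarrow> real^'m \<Rightarrow> real^'m \<Rightarrow> real^'m \<Rightarrow> real^'m \<Rightarrow> real^'m::finite" where
  "covT L x v w d = gam (dcf (tors L) x d) v w - gam (symm L x) d (gam (tors L x) v w)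
     + gam (tors L x) (gam (symm L x) d v) w + gam (tors L x) v (gam (symm L x) d w)"

definition Rvec :: "(real^'m \<Rightarrow> 'm coeffs) \<Rightarrow> real^'m \<Rightarrow> real^'m \<Rightarrow> real^'m \<Rightarrow> real^'m \<Rightarrow> real^'m::finite" where
  "Rvec L x n l k = gam (dcf (symm L) x k) l n - gam (dcf (symm L) x l) k n
     + gam (symm L x) l (gam (symm L x) k n) - gam (symm L x) k (gam (symm L x) l n)"

definition base_form :: "params \<Rightarrow> (real^'m \<Rightarrow> 'm coeffs) \<Rightarrow> real^'m \<Rightarrow> real^'m \<Rightarrow> real^'m \<Rightarrow> real^'m::finite \<Rightarrow> real" where
  "base_form k L x u v w = (let T = gam (tors L x) in
     cA k * (u \<bullet> v) * (u \<bullet> w)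
     + cC1 k * (u \<bullet> v) * trc (\<lambda>e. T e w) + cC2 k * (u \<bullet> w) * trc (\<lambda>e. T e v) + cC3 k * (u \<bullet> T v w)
     + cF1 k * trc (\<lambda>e. T e v) * trc (\<lambda>e. T e w) + cF2 k * trc (\<lambda>e. T (T e v) w)
     + cF3 k * trc (\<lambda>e. T e (T v w))
     + cG1 k * trc (\<lambda>e. covT L x e v w) + cG2 k * trc (\<lambda>e. covT L x e w v) + cG3 k * trc (\<lambda>e. covT L x v w e)
     + cH1 k * trc (\<lambda>e. Rvec L x e v w) + cH2 k * trc (\<lambda>e. Rvec L x v e w))"

lemma dcf_linear:
  assumes "\<And>l r n. (\<lambda>y. M y l r n) differentiable (at x)"
  shows "dcf M x (d + d') = (\<lambda>l r n. dcf M x d l r n + dcf M x d' l r n)"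
    and "dcf M x (t *\<^sub>R d) = (\<lambda>l r n. t * dcf M x d l r n)"
  using linear_add[OF linear_frechet_derivative[OF assms]] linear_scale[OF linear_frechet_derivative[OF assms]]
  by (simp_all add: dcf_def fun_eq_iff)

lemma dcf_axis: "dcf M x (axis k 1) l r n = pd k (\<lambda>y. M y l r n) x"
  by (simp add: dcf_def pd_def)

lemma differentiable_symm_tors:
  assumes "\<And>l r n. (\<lambda>y. L y l r n) differentiable (at x)"
  shows "(\<lambda>y. symm L y l r n) differentiable (at x)" "(\<lambda>y. tors L y l r n) differentiable (at x)"
  unfolding symm_def tors_def divide_inverse
  using assms by (intro differentiable_mult differentiable_add differentiable_diff differentiable_const; simp)+

lemma bilinear_expand:
  assumes "bilinear (f :: real^'m::finite \<Rightarrow> real^'m \<Rightarrow> real)"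
  shows "f v w = (\<Sum>l\<in>UNIV. \<Sum>n\<in>UNIV. f (axis l 1) (axis n 1) * v $ l * w $ n)"
proof -
  have "f v w = f (\<Sum>l\<in>UNIV. v $ l *\<^sub>R axis l 1) (\<Sum>n\<in>UNIV. w $ n *\<^sub>R axis n 1)"
    by (simp add: basis_expansion scalar_mult_eq_scaleR[symmetric])
  also have "\<dots> = (\<Sum>(l, n)\<in>UNIV \<times> UNIV. f (v $ l *\<^sub>R axis l 1) (w $ n *\<^sub>R axis n 1))"
    by (rule bilinear_sum[OF assms])
  also have "\<dots> = (\<Sum>l\<in>UNIV. \<Sum>n\<in>UNIV. f (axis l 1) (axis n 1) * v $ l * w $ n)"
    by (subst sum.cartesian_product[symmetric])
      (simp add: bilinear_lmul[OF assms] bilinear_rmul[OF assms] mult_ac)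
  finally show ?thesis .
qed

lemma inner_axis1: "u \<bullet> axis l (1::real) = u $ l"
  by (simp add: inner_axis)

lemma base_form_bilinear:
  assumes "\<And>l r n. (\<lambda>y. L y l r n) differentiable (at x)"
  shows "bilinear (base_form k L x u)"
  unfolding bilinear_def
  by (auto intro!: linearI simp: base_form_def Let_def covT_def Rvec_def gam_linear inner_add_right trc_linear
      dcf_linear[OF differentiable_symm_tors(1)[OF assms]] dcf_linear[OF differentiable_symm_tors(2)[OF assms]]
      gam_coeffs gam_linear_fun algebra_simps)

lemma base_form_axis:
  "base_form k L x u (axis l 1) (axis n 1) = base_part k L x u l n"
proof -
  have t: "trc (\<lambda>e. gam c e (axis n 1)) = (\<Sum>r\<in>UNIV. c r r n)" for c :: "'a coeffs" and n
    by (simp add: trc_def gam_axis)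
  have cov: "covT L x (axis l 1) (axis n 1) (axis k 1) $ r = tors_cov L x l r n k" for l n k r
    by (simp add: covT_def tors_cov_def gam_axis gam_axis1 gam_axis2 dcf_axis sum_axis) (simp add: mult.commute)
  have R: "Rvec L x (axis n 1) (axis l 1) (axis k 1) $ r = curv L x n r l k" for l n k r
    by (simp add: Rvec_def curv_def gam_axis gam_axis1 gam_axis2 dcf_axis sum_axis) (simp add: mult.commute)
  have "trc (\<lambda>e. gam (tors L x) (gam (tors L x) e (axis l 1)) (axis n 1)) =
      (\<Sum>r\<in>UNIV. \<Sum>s\<in>UNIV. tors L x s r l * tors L x r s n)"
    unfolding trc_def gam_axis2[of _ "gam _ _ _"] gam_axis by (subst sum.swap) (simp only: mult.commute)
  moreover have "trc (\<lambda>e. gam (tors L x) e (gam (tors L x) (axis l 1) (axis n 1))) =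
      (\<Sum>r\<in>UNIV. \<Sum>s\<in>UNIV. tors L x r r s * tors L x l s n)"
    unfolding trc_def gam_axis1[of _ _ "gam _ _ _"] gam_axis ..
  moreover have "u \<bullet> gam (tors L x) (axis l 1) (axis n 1) = (\<Sum>r\<in>UNIV. u $ r * tors L x l r n)"
    by (simp add: inner_vec_def gam_axis)
  ultimately show ?thesis
    by (simp add: base_form_def base_part_def Let_def inner_axis1 t) (simp add: trc_def cov R)
qed

lemma family_eq:
  assumes "\<And>l r n. (\<lambda>y. L y l r n) differentiable (at x)"
  shows "family k L (x, u) v w = base_form k L x u (fst v) (fst w)
    + cB k * (snd w \<bullet> fst v + u \<bullet> gam (L x) (fst v) (fst w))
    + cC k * (snd v \<bullet> fst w + u \<bullet> gam (L x) (fst w) (fst v))"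
proof -
  have vf: "(\<Sum>l\<in>UNIV. a $ l * vert_form L (x, u) l w) = snd w \<bullet> a + u \<bullet> gam (L x) a (fst w)" for a w
  proof -
    have "u \<bullet> gam (L x) a (fst w) = (\<Sum>r\<in>UNIV. \<Sum>l\<in>UNIV. \<Sum>n\<in>UNIV. a $ l * (L x l r n * u $ r * fst w $ n))"
      by (simp add: inner_vec_def gam_def sum_distrib_left mult_ac)
    also have "\<dots> = (\<Sum>l\<in>UNIV. a $ l * (\<Sum>r\<in>UNIV. \<Sum>n\<in>UNIV. L x l r n * u $ r * fst w $ n))"
      by (subst sum.swap) (simp add: sum_distrib_left)
    finally show ?thesis
      by (simp add: vert_form_def split_beta algebra_simps sum.distrib inner_vec_def)
  qed
  have "(\<Sum>l\<in>UNIV. vert_form L (x, u) l v * fst w $ l) = snd v \<bullet> fst w + u \<bullet> gam (L x) (fst w) (fst v)"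
    using vf[of "fst w" v] by (simp add: mult.commute)
  then show ?thesis
    unfolding family_def vf
    using bilinear_expand[OF base_form_bilinear[OF assms], where v = "fst v" and w = "fst w"]
    by (simp add: base_form_axis)
qed

lemma gam_has_derivative:
  fixes M :: "real^'m::finite \<Rightarrow> 'm coeffs"
  assumes g: "(g has_derivative g') (at x)"
    and M: "\<And>l r n. (\<lambda>y. M y l r n) differentiable (at (g x))"
    and a: "(a has_derivative a') (at x)" and b: "(b has_derivative b') (at x)"
  shows "((\<lambda>y. gam (M (g y)) (a y) (b y)) has_derivative
    (\<lambda>d. gam (dcf M (g x) (g' d)) (a x) (b x) + gam (M (g x)) (a' d) (b x) + gam (M (g x)) (a x) (b' d))) (at x)"
proof -
  have M': "((\<lambda>y. M (g y) l r n) has_derivative (\<lambda>d. dcf M (g x) (g' d) l r n)) (at x)" for l r n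
    using has_derivative_compose[OF g M[unfolded frechet_derivative_works]] by (simp add: dcf_def)
  have a': "((\<lambda>y. a y $ l) has_derivative (\<lambda>d. a' d $ l)) (at x)" for l
    by (rule bounded_linear.has_derivative[OF bounded_linear_vec_nth a])
  have b': "((\<lambda>y. b y $ l) has_derivative (\<lambda>d. b' d $ l)) (at x)" for l
    by (rule bounded_linear.has_derivative[OF bounded_linear_vec_nth b])
  have "((\<lambda>y. \<Sum>l\<in>UNIV. \<Sum>n\<in>UNIV. M (g y) l r n * a y $ l * b y $ n) has_derivative
      (\<lambda>d. \<Sum>l\<in>UNIV. \<Sum>n\<in>UNIV. M (g x) l r n * a x $ l * b' d $ n
          + (M (g x) l r n * a' d $ l + dcf M (g x) (g' d) l r n * a x $ l) * b x $ n)) (at x)" for r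
    by (intro has_derivative_sum has_derivative_mult M' a' b')
  then have "((\<lambda>y. gam (M (g y)) (a y) (b y) $ r) has_derivative
    (\<lambda>d. (gam (dcf M (g x) (g' d)) (a x) (b x) + gam (M (g x)) (a' d) (b x) + gam (M (g x)) (a x) (b' d)) $ r)) (at x)" for r
    by (simp add: gam_def algebra_simps sum.distrib)
  then show ?thesis
    by (subst has_derivative_componentwise_within) (auto simp: Basis_vec_def inner_axis)
qed

text \<open>Changes of coordinates. \<open>J\<close> and \<open>H\<close> below are the first and the second derivative of \<open>g\<close>, and
  \<open>K\<close> is the derivative of the inverse, all as functions of the source point.\<close>

locale coord_change =
  fixes g h :: "real^'m::finite \<Rightarrow> real^'m" and X Y :: "(real^'m) set"
  assumes X: "open X" and Y: "open Y" and sg: "smooth_on g X" and sh: "smooth_on h Y"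
    and gX: "\<And>x. x \<in> X \<Longrightarrow> g x \<in> Y" and hY: "\<And>y. y \<in> Y \<Longrightarrow> h y \<in> X"
    and hg: "\<And>x. x \<in> X \<Longrightarrow> h (g x) = x" and gh: "\<And>y. y \<in> Y \<Longrightarrow> g (h y) = y"
begin

definition J where "J x v = frechet_derivative g (at x) v"
definition K where "K x v = frechet_derivative h (at (g x)) v"
definition H where "H x d v = frechet_derivative (\<lambda>y. J y v) (at x) d"

lemma g_deriv: "x \<in> X \<Longrightarrow> (g has_derivative J x) (at x)"
  unfolding J_def[abs_def] by (rule smooth_on_has_derivative[OF sg])

lemma h_deriv: "x \<in> X \<Longrightarrow> (h has_derivative K x) (at (g x))"
  unfolding K_def[abs_def] by (rule smooth_on_has_derivative[OF sh gX])

lemma linJ: "x \<in> X \<Longrightarrow> linear (J x)" and linK: "x \<in> X \<Longrightarrow> linear (K x)"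
  using g_deriv h_deriv has_derivative_linear by blast+

lemma KJ: assumes "x \<in> X" shows "K x (J x v) = v"
proof -
  have "((\<lambda>y. h (g y)) has_derivative (\<lambda>v. K x (J x v))) (at x)"
    by (rule has_derivative_compose[OF g_deriv[OF assms] h_deriv[OF assms]])
  moreover have "((\<lambda>y. h (g y)) has_derivative (\<lambda>v. v)) (at x)"
    by (rule has_derivative_transform_within_open[OF has_derivative_ident X assms]) (simp add: hg)
  ultimately show ?thesis using has_derivative_unique by metis
qed

lemma JK: assumes "x \<in> X" shows "J x (K x v) = v"
proof -
  have "inj (J x)" using KJ[OF assms] by (metis injI)
  then have "surj (J x)" using linear_injective_imp_surjective linJ[OF assms] by blast
  then obtain w where "v = J x w" by blast
  then show ?thesis using KJ[OF assms] by simp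
qed

lemma smJ: "smooth_on (\<lambda>x. J x v) X"
  unfolding J_def by (rule smooth_on_frechet[OF sg])

lemma J_deriv: "x \<in> X \<Longrightarrow> ((\<lambda>y. J y v) has_derivative (\<lambda>d. H x d v)) (at x)"
  unfolding H_def by (rule smooth_on_has_derivative[OF smJ])

lemma smH: "smooth_on (\<lambda>x. H x d v) X"
  unfolding H_def by (rule smooth_on_frechet[OF smJ])

lemma linH1: "x \<in> X \<Longrightarrow> linear (\<lambda>d. H x d v)"
  using J_deriv has_derivative_linear by blast

lemma J_comp: "x \<in> X \<Longrightarrow> J x v $ i = frechet_derivative (\<lambda>y. g y $ i) (at x) v"
  using frechet_derivative_at[OF bounded_linear.has_derivative[OF bounded_linear_vec_nth[of i] g_deriv[of x]]]
  by (metis (full_types))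

lemma sgi: "smooth_on (\<lambda>y. g y $ i) X" by (rule smooth_on_vec_nth[OF X sg])

lemma H_comp: assumes x: "x \<in> X"
  shows "H x d v $ i = frechet_derivative (\<lambda>y. frechet_derivative (\<lambda>y. g y $ i) (at y) v) (at x) d"
proof -
  have "((\<lambda>y. J y v $ i) has_derivative (\<lambda>d. H x d v $ i)) (at x)"
    by (rule bounded_linear.has_derivative[OF bounded_linear_vec_nth J_deriv[OF x]])
  then have "((\<lambda>y. frechet_derivative (\<lambda>y. g y $ i) (at y) v) has_derivative (\<lambda>d. H x d v $ i)) (at x)"
    by (rule has_derivative_transform_within_open[OF _ X x]) (simp add: J_comp)
  from fun_cong[OF frechet_derivative_at[OF this], of d] show ?thesis .
qed

lemma H_sym: assumes "x \<in> X" shows "H x d v = H x v d"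
  using frechet_derivative_commute[OF X assms sgi] by (simp add: vec_eq_iff H_comp[OF assms])

lemma linH2: "x \<in> X \<Longrightarrow> linear (H x d)"
  using linH1[of x d] by (subst ext[of "H x d" "\<lambda>v. H x v d"]) (auto simp: H_sym)

lemmas lin_simps = linear_add[OF linJ] linear_scale[OF linJ] linear_add[OF linH1] linear_scale[OF linH1]
  linear_add[OF linH2] linear_scale[OF linH2]

lemma J_pd: "x \<in> X \<Longrightarrow> J x v $ k = (\<Sum>r\<in>UNIV. pd r (\<lambda>y. g y $ k) x * v $ r)"
  using frechet_derivative_pd[OF smooth_on_differentiable[OF sgi]] by (simp add: J_comp mult.commute)

lemma H_pd: assumes x: "x \<in> X"
  shows "H x (axis l 1) (axis n 1) $ k = pd l (pd n (\<lambda>y. g y $ k)) x"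
  by (simp add: H_comp[OF x] pd_def[abs_def])

lemma H_expand: assumes "x \<in> X"
  shows "H x v w $ k = (\<Sum>l\<in>UNIV. \<Sum>n\<in>UNIV. pd l (pd n (\<lambda>y. g y $ k)) x * v $ l * w $ n)"
proof -
  have "bilinear (\<lambda>v w. H x v w $ k)"
    unfolding bilinear_def by (auto intro!: linearI simp: lin_simps assms)
  from bilinear_expand[OF this, of v w] show ?thesis by (simp add: H_pd[OF assms])
qed

text \<open>Both sides are bilinear in \<open>v\<close> and \<open>w\<close>, and \<open>conn_law\<close> is their equality on basis vectors.\<close>

lemma conn_law_iff:
  assumes x: "x \<in> X"
  shows "conn_law g x c c' \<longleftrightarrow> (\<forall>v w. J x (gam c v w) = gam c' (J x v) (J x w) - H x v w)"
proof -
  define E where "E l n k = (\<Sum>r\<in>UNIV. pd r (\<lambda>y. g y $ k) x * c l r n) -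
        ((\<Sum>a\<in>UNIV. \<Sum>b\<in>UNIV. pd l (\<lambda>y. g y $ a) x * pd n (\<lambda>y. g y $ b) x * c' a k b)
        - pd l (pd n (\<lambda>y. g y $ k)) x)" for l n k
  define D where "D v w = J x (gam c v w) - (gam c' (J x v) (J x w) - H x v w)" for v w
  have DE: "D (axis l 1) (axis n 1) $ k = E l n k" for l n k
  proof -
    have Jx: "J x (axis l 1) $ a = pd l (\<lambda>y. g y $ a) x" for l a
      using J_pd[OF x, of "axis l 1" a] by (simp add: sum_axis)
    show ?thesis
      unfolding D_def E_def using H_pd[OF x]
      by (simp add: J_pd[OF x, of "gam _ _ _"] gam_axis) (simp add: gam_def Jx mult_ac)
  qed
  have "bilinear (\<lambda>v w. D v w $ k)" for k
    unfolding bilinear_def D_def by (auto intro!: linearI simp: lin_simps x gam_linear algebra_simps)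
  from bilinear_expand[OF this] have "D v w $ k = (\<Sum>l\<in>UNIV. \<Sum>n\<in>UNIV. E l n k * v $ l * w $ n)" for v w k
    by (simp add: DE)
  then have "(\<forall>l n k. E l n k = 0) \<longleftrightarrow> (\<forall>v w. D v w = 0)"
    using DE by (auto simp: vec_eq_iff)
  then show ?thesis unfolding conn_law_def E_def D_def by simp
qed

lemma J_apply_deriv:
  assumes x: "x \<in> X" and a: "(a has_derivative a') (at x)"
  shows "((\<lambda>y. J y (a y)) has_derivative (\<lambda>d. H x d (a x) + J x (a' d))) (at x)"
proof -
  have ex: "f v = (\<Sum>i\<in>UNIV. v $ i *\<^sub>R f (axis i 1))" if "linear f" for f :: "real^'m \<Rightarrow> real^'m" and v
  proof -
    have "f v = f (\<Sum>i\<in>UNIV. v $ i *\<^sub>R axis i 1)"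
      by (simp add: basis_expansion scalar_mult_eq_scaleR[symmetric])
    then show ?thesis using that by (simp add: linear_sum linear_scale)
  qed
  have ai: "((\<lambda>y. a y $ i) has_derivative (\<lambda>d. a' d $ i)) (at x)" for i
    by (rule bounded_linear.has_derivative[OF bounded_linear_vec_nth a])
  have "((\<lambda>y. \<Sum>i\<in>UNIV. a y $ i *\<^sub>R J y (axis i 1)) has_derivative
      (\<lambda>d. \<Sum>i\<in>UNIV. a x $ i *\<^sub>R H x d (axis i 1) + a' d $ i *\<^sub>R J x (axis i 1))) (at x)"
    by (intro has_derivative_sum has_derivative_scaleR ai J_deriv x)
  moreover have "(\<Sum>i\<in>UNIV. a x $ i *\<^sub>R H x d (axis i 1) + a' d $ i *\<^sub>R J x (axis i 1)) = H x d (a x) + J x (a' d)" for d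
    using ex[OF linH2[OF x, of d], of "a x"] ex[OF linJ[OF x], of "a' d"] by (simp add: sum.distrib)
  ultimately have "((\<lambda>y. \<Sum>i\<in>UNIV. a y $ i *\<^sub>R J y (axis i 1)) has_derivative (\<lambda>d. H x d (a x) + J x (a' d))) (at x)"
    by simp
  then show ?thesis
    by (rule has_derivative_transform_within_open[OF _ X x]) (simp add: ex[OF linJ, symmetric])
qed

text \<open>Differentiate a transformation law with an inhomogeneous term \<open>t\<close> in direction \<open>d\<close>. It is used with
  \<open>t = H\<close> for a connection or its symmetric part, and with \<open>t = 0\<close> for the torsion.\<close>

lemma law_deriv:
  assumes x: "x \<in> X"
    and M: "\<And>l r n. (\<lambda>y. M y l r n) differentiable (at x)" and M': "\<And>l r n. (\<lambda>y. M' y l r n) differentiable (at (g x))"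
    and law: "\<And>y v w. y \<in> X \<Longrightarrow> J y (gam (M y) v w) = gam (M' (g y)) (J y v) (J y w) - t y v w"
    and t: "\<And>v w. ((\<lambda>y. t y v w) has_derivative (\<lambda>d. t' d v w)) (at x)"
  shows "J x (gam (dcf M x d) v w) = gam (dcf M' (g x) (J x d)) (J x v) (J x w)
      + gam (M' (g x)) (H x d v) (J x w) + gam (M' (g x)) (J x v) (H x d w) - t' d v w - H x d (gam (M x) v w)"
proof -
  have "((\<lambda>y. gam (M y) v w) has_derivative (\<lambda>d. gam (dcf M x d) v w + gam (M x) 0 w + gam (M x) v 0)) (at x)"
    by (rule gam_has_derivative[OF has_derivative_ident M has_derivative_const has_derivative_const])
  then have "((\<lambda>y. gam (M y) v w) has_derivative (\<lambda>d. gam (dcf M x d) v w)) (at x)"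
    by (simp add: gam_def zero_vec_def[symmetric])
  from J_apply_deriv[OF x this]
  have "((\<lambda>y. J y (gam (M y) v w)) has_derivative (\<lambda>d. H x d (gam (M x) v w) + J x (gam (dcf M x d) v w))) (at x)" .
  moreover have "((\<lambda>y. gam (M' (g y)) (J y v) (J y w) - t y v w) has_derivative
     (\<lambda>d. gam (dcf M' (g x) (J x d)) (J x v) (J x w)
      + gam (M' (g x)) (H x d v) (J x w) + gam (M' (g x)) (J x v) (H x d w) - t' d v w)) (at x)"
    by (intro has_derivative_diff t gam_has_derivative[OF g_deriv[OF x] M'] J_deriv x)
  then have "((\<lambda>y. J y (gam (M y) v w)) has_derivative
     (\<lambda>d. gam (dcf M' (g x) (J x d)) (J x v) (J x w)
      + gam (M' (g x)) (H x d v) (J x w) + gam (M' (g x)) (J x v) (H x d w) - t' d v w)) (at x)"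
    by (rule has_derivative_transform_within_open[OF _ X x]) (simp add: law)
  ultimately have "(\<lambda>d. H x d (gam (M x) v w) + J x (gam (dcf M x d) v w)) = (\<lambda>d. gam (dcf M' (g x) (J x d)) (J x v) (J x w)
      + gam (M' (g x)) (H x d v) (J x w) + gam (M' (g x)) (J x v) (H x d w) - t' d v w)"
    by (rule has_derivative_unique)
  from fun_cong[OF this, of d] show ?thesis by (simp add: algebra_simps)
qed

text \<open>The lift of a covector is best described by its pairing with vectors, which is preserved.\<close>

lemma cot_lift_inner:
  assumes x: "x \<in> X"
  shows "fst (cot_lift g (x, u)) = g x" "snd (cot_lift g (x, u)) = (\<chi> a. u \<bullet> K x (axis a 1))"
    and "snd (cot_lift g (x, u)) \<bullet> J x v = u \<bullet> v"
proof -
  have jac: "jacobian g (at x) = matrix (J x)" by (simp add: jacobian_def J_def[abs_def])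
  have "matrix (J x) ** matrix (K x) = mat 1" "matrix (K x) ** matrix (J x) = mat 1"
  proof -
    have "J x \<circ> K x = id" "K x \<circ> J x = id" using JK[OF x] KJ[OF x] by auto
    then show "matrix (J x) ** matrix (K x) = mat 1" "matrix (K x) ** matrix (J x) = mat 1"
      using linJ[OF x] linK[OF x] by (metis matrix_compose matrix_id_mat_1)+
  qed
  then have inv: "matrix_inv (jacobian g (at x)) = matrix (K x)"
    unfolding jac matrix_inv_def
    by (intro some_equality) (auto, metis matrix_mul_assoc matrix_mul_lid matrix_mul_rid)
  show "fst (cot_lift g (x, u)) = g x" by (simp add: cot_lift_def)
  show s: "snd (cot_lift g (x, u)) = (\<chi> a. u \<bullet> K x (axis a 1))"
    by (simp add: cot_lift_def inv vector_matrix_mult_def matrix_def inner_vec_def vec_eq_iff mult.commute)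
  have "snd (cot_lift g (x, u)) \<bullet> w = u \<bullet> K x w" for w
  proof -
    have "u \<bullet> K x w = u \<bullet> K x (\<Sum>i\<in>UNIV. w $ i *\<^sub>R axis i 1)"
      by (simp add: basis_expansion scalar_mult_eq_scaleR[symmetric])
    also have "\<dots> = (\<Sum>i\<in>UNIV. w $ i * (u \<bullet> K x (axis i 1)))"
      by (simp add: linear_sum[OF linK[OF x]] linear_scale[OF linK[OF x]] inner_sum_right)
    finally show ?thesis unfolding s by (simp add: inner_vec_def mult.commute)
  qed
  then show "snd (cot_lift g (x, u)) \<bullet> J x v = u \<bullet> v" by (simp add: KJ[OF x])
qed

text \<open>The vertical component \<open>b\<close> of the derivative is characterised by differentiating the invariance of
  the pairing; the term with \<open>H\<close> is the one that \<open>vert_form\<close> compensates.\<close>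

lemma cot_lift_deriv:
  assumes x: "x \<in> X"
  shows "\<exists>b. frechet_derivative (cot_lift g) (at (x, u)) (a, a') = (J x a, b) \<and>
    (\<forall>v. b \<bullet> J x v + snd (cot_lift g (x, u)) \<bullet> H x a v = a' \<bullet> v)"
proof -
  let ?Z = "X \<times> (UNIV :: (real^'m) set)"
  have oZ: "open ?Z" using X by (simp add: open_Times)
  define W where "W z = (\<chi> i. snd z \<bullet> K (fst z) (axis i 1))" for z :: "'m cot"
  have smK: "smooth_on (\<lambda>y. K y v) X" for v
    unfolding K_def using gX by (intro smooth_on_compose[OF X Y _ sg smooth_on_frechet[OF sh]]) auto
  have smKz: "smooth_on (\<lambda>z. K (fst z) v) ?Z" for v
    by (rule smooth_on_compose[OF oZ X _ _ smK]) (auto intro!: smooth_intros oZ)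
  have smW: "smooth_on W ?Z"
  proof (rule smooth_on_vec[OF oZ])
    fix i
    have "smooth_on (\<lambda>z::'m cot. \<Sum>j\<in>UNIV. snd z $ j * K (fst z) (axis i 1) $ j) ?Z"
      by (intro smooth_intros oZ smooth_on_vec_nth[OF oZ smKz])
    then show "smooth_on (\<lambda>z. W z $ i) ?Z" by (simp add: W_def inner_vec_def)
  qed
  have smgz: "smooth_on (\<lambda>z. g (fst z)) ?Z"
    by (rule smooth_on_compose[OF oZ X _ _ sg]) (auto intro!: smooth_intros oZ)
  let ?W' = "frechet_derivative W (at (x, u))"
  have zin: "(x, u) \<in> ?Z" using x by simp
  have W': "(W has_derivative ?W') (at (x, u))" by (rule smooth_on_has_derivative[OF smW zin])
  have fst': "((\<lambda>z. g (fst z)) has_derivative (\<lambda>d. J x (fst d))) (at (x, u))"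
    using has_derivative_compose[OF has_derivative_fst[OF has_derivative_ident], where g = g and g' = "J x" and x = "(x, u)" and s = UNIV]
      g_deriv[OF x] by simp
  have "((\<lambda>z. (g (fst z), W z)) has_derivative (\<lambda>d. (J x (fst d), ?W' d))) (at (x, u))"
    by (rule has_derivative_Pair[OF fst' W'])
  then have "(cot_lift g has_derivative (\<lambda>d. (J x (fst d), ?W' d))) (at (x, u))"
    by (rule has_derivative_transform_within_open[OF _ oZ zin])
      (auto simp: W_def cot_lift_inner prod_eq_iff)
  from frechet_derivative_at[OF this, symmetric]
  have 1: "frechet_derivative (cot_lift g) (at (x, u)) (a, a') = (J x a, ?W' (a, a'))" by simp
  have Jz: "((\<lambda>z. J (fst z) v) has_derivative (\<lambda>d. H x (fst d) v)) (at (x, u))" for v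
    using has_derivative_compose[OF has_derivative_fst[OF has_derivative_ident], where g = "\<lambda>y. J y v" and g' = "\<lambda>d. H x d v" and x = "(x, u)" and s = UNIV]
      J_deriv[OF x] by simp
  have "?W' (a, a') \<bullet> J x v + W (x, u) \<bullet> H x a v = a' \<bullet> v" for v
  proof -
    have "((\<lambda>z. W z \<bullet> J (fst z) v) has_derivative (\<lambda>d. W (x, u) \<bullet> H x (fst d) v + ?W' d \<bullet> J x v)) (at (x, u))"
      using has_derivative_inner[OF W' Jz[of v]] by simp
    moreover have "((\<lambda>z. snd z \<bullet> v) has_derivative (\<lambda>d. snd d \<bullet> v)) (at (x, u))"
      by (intro derivative_intros)
    then have "((\<lambda>z. W z \<bullet> J (fst z) v) has_derivative (\<lambda>d. snd d \<bullet> v)) (at (x, u))"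
      by (rule has_derivative_transform_within_open[OF _ oZ zin])
        (auto simp: W_def cot_lift_inner(3)[unfolded cot_lift_inner(2)] simp flip: cot_lift_inner(2))
    ultimately have "(\<lambda>d. W (x, u) \<bullet> H x (fst d) v + ?W' d \<bullet> J x v) = (\<lambda>d. snd d \<bullet> v)"
      by (rule has_derivative_unique)
    from fun_cong[OF this, of "(a, a')"] show ?thesis by simp
  qed
  moreover have "W (x, u) = snd (cot_lift g (x, u))" by (simp add: W_def cot_lift_inner[OF x])
  ultimately show ?thesis using 1 by metis
qed

text \<open>The parameter family is built from tensors and from the form \<open>vert_form\<close>, so it does not
  depend on coordinates. The curvature law is the usual computation: third derivatives of \<open>g\<close> are
  symmetric and cancel.\<close>

theorem family_invariant:
  assumes L: "\<And>l r n. smooth_on (\<lambda>y. L y l r n) X" and L': "\<And>l r n. smooth_on (\<lambda>y. L' y l r n) Y"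
    and law: "\<And>y. y \<in> X \<Longrightarrow> conn_law g y (L y) (L' (g y))" and x: "x \<in> X"
  shows "family k L (x, u) v w = family k L' (cot_lift g (x, u))
    (frechet_derivative (cot_lift g) (at (x, u)) v) (frechet_derivative (cot_lift g) (at (x, u)) w)"
proof -
  have dL: "(\<lambda>y. L y l r n) differentiable (at x)" for l r n
    by (rule smooth_on_differentiable[OF L x])
  have dL': "(\<lambda>y. L' y l r n) differentiable (at (g x))" for l r n
    by (rule smooth_on_differentiable[OF L' gX[OF x]])
  note dS = differentiable_symm_tors(1)[OF dL] differentiable_symm_tors(1)[OF dL']
  note dT = differentiable_symm_tors(2)[OF dL] differentiable_symm_tors(2)[OF dL']
  have claw: "J y (gam (L y) v w) = gam (L' (g y)) (J y v) (J y w) - H y v w" if "y \<in> X" for y v w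
    using law[OF that] conn_law_iff[OF that] by blast
  have gS: "gam (symm M y) v w = (1/2) *\<^sub>R (gam (M y) v w + gam (M y) w v)"
    and gT: "gam (tors M y) v w = (1/2) *\<^sub>R (gam (M y) v w - gam (M y) w v)" for M :: "real^'m \<Rightarrow> 'm coeffs" and y v w
  proof -
    have sw: "gam (\<lambda>l r n. M y n r l) v w = gam (M y) w v"
      unfolding gam_def vec_eq_iff by (simp, subst sum.swap) (simp add: mult_ac)
    have "symm M y = (\<lambda>l r n. (1/2) * (M y l r n + M y n r l))"
      and "tors M y = (\<lambda>l r n. (1/2) * (M y l r n + (- 1) * M y n r l))"
      by (auto simp: symm_def tors_def fun_eq_iff)
    then show "gam (symm M y) v w = (1/2) *\<^sub>R (gam (M y) v w + gam (M y) w v)"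
      "gam (tors M y) v w = (1/2) *\<^sub>R (gam (M y) v w - gam (M y) w v)"
      by (simp_all only: gam_coeffs sw) simp
  qed
  have Slaw: "J y (gam (symm L y) v w) = gam (symm L' (g y)) (J y v) (J y w) - H y v w" if "y \<in> X" for y v w
    using linJ[OF that] by (simp add: gS linear_scale linear_add claw[OF that] H_sym[OF that, of w v] algebra_simps
        flip: scaleR_add_left)
  have Tlaw: "J y (gam (tors L y) v w) = gam (tors L' (g y)) (J y v) (J y w) - 0" if "y \<in> X" for y v w
    using linJ[OF that] by (simp add: gT linear_scale linear_diff claw[OF that] H_sym[OF that, of w v])
  define D3 where "D3 d v w = frechet_derivative (\<lambda>y. H y v w) (at x) d" for d v w
  have D3: "((\<lambda>y. H y v w) has_derivative (\<lambda>d. D3 d v w)) (at x)" for v w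
    unfolding D3_def by (rule smooth_on_has_derivative[OF smH x])
  have D3_sym: "D3 d v w = D3 v d w" for d v w
  proof (rule vec_eq_iff[THEN iffD2], rule allI)
    fix i
    let ?f = "\<lambda>y. frechet_derivative (\<lambda>y. g y $ i) (at y) w"
    have "D3 d v w $ i = frechet_derivative (\<lambda>y. frechet_derivative ?f (at y) v) (at x) d" for d v
    proof -
      have "((\<lambda>y. H y v w $ i) has_derivative (\<lambda>d. D3 d v w $ i)) (at x)"
        by (rule bounded_linear.has_derivative[OF bounded_linear_vec_nth D3])
      then have "((\<lambda>y. frechet_derivative ?f (at y) v) has_derivative (\<lambda>d. D3 d v w $ i)) (at x)"
        by (rule has_derivative_transform_within_open[OF _ X x]) (simp add: H_comp)
      from fun_cong[OF frechet_derivative_at[OF this], of d] show ?thesis .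
    qed
    moreover have "smooth_on ?f X" by (rule smooth_on_frechet[OF sgi])
    ultimately show "D3 d v w $ i = D3 v d w $ i" by (simp add: frechet_derivative_commute[OF X x])
  qed
  have S1: "J x (gam (dcf (symm L) x d) v w) = gam (dcf (symm L') (g x) (J x d)) (J x v) (J x w)
      + gam (symm L' (g x)) (H x d v) (J x w) + gam (symm L' (g x)) (J x v) (H x d w) - D3 d v w
      - H x d (gam (symm L x) v w)" for d v w
    by (rule law_deriv[OF x dS Slaw D3])
  have T1: "J x (gam (dcf (tors L) x d) v w) = gam (dcf (tors L') (g x) (J x d)) (J x v) (J x w)
      + gam (tors L' (g x)) (H x d v) (J x w) + gam (tors L' (g x)) (J x v) (H x d w) - 0
      - H x d (gam (tors L x) v w)" for d v w
    by (rule law_deriv[OF x dT Tlaw has_derivative_const])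
  note Jlin = linear_add[OF linJ[OF x]] linear_diff[OF linJ[OF x]]
  have covT': "J x (covT L x v w d) = covT L' (g x) (J x v) (J x w) (J x d)" for v w d
    unfolding covT_def Jlin T1 by (simp add: Slaw[OF x] Tlaw[OF x] gam_diff gam_linear algebra_simps)
  have R': "J x (Rvec L x n l k) = Rvec L' (g x) (J x n) (J x l) (J x k)" for n l k
    unfolding Rvec_def Jlin S1
    by (simp add: Slaw[OF x] gam_diff gam_linear algebra_simps H_sym[OF x, of l k] D3_sym[of k l])
  define u' where "u' = snd (cot_lift g (x, u))"
  have u': "u' \<bullet> J x v = u \<bullet> v" for v unfolding u'_def by (rule cot_lift_inner(3)[OF x])
  have cl: "cot_lift g (x, u) = (g x, u')" by (simp add: u'_def prod_eq_iff cot_lift_inner(1)[OF x])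
  have tr: "trc A = trc A'" if "\<And>v. J x (A v) = A' (J x v)" "linear A" "linear A'" for A A'
    by (rule trc_conj[OF that(2,3) linJ[OF x] linK[OF x] that(1) KJ[OF x] JK[OF x]])
  note Tx = Tlaw[OF x, simplified]
  have linc: "linear (\<lambda>e. covT L0 y e v w)" "linear (\<lambda>e. covT L0 y v w e)"
     "linear (\<lambda>e. Rvec L0 y e v w)" "linear (\<lambda>e. Rvec L0 y v e w)"
    if "\<And>l r n. (\<lambda>y. L0 y l r n) differentiable (at y)" for L0 :: "real^'m \<Rightarrow> 'm coeffs" and y v w
    by (auto intro!: linearI simp: covT_def Rvec_def gam_linear 
      dcf_linear[OF differentiable_symm_tors(1)[OF that]] dcf_linear[OF differentiable_symm_tors(2)[OF that]]
      gam_coeffs gam_linear_fun algebra_simps)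
  have lint: "linear (\<lambda>e. gam c e v)" "linear (\<lambda>e. gam c' (gam c e v) w)" for c c' :: "'m coeffs" and v w
    by (auto intro!: linearI simp: gam_linear)
  have base: "base_form k L x u a b = base_form k L' (g x) u' (J x a) (J x b)" for a b
  proof -
    have "trc (\<lambda>e. gam (tors L x) e a) = trc (\<lambda>e. gam (tors L' (g x)) e (J x a))" for a
      by (rule tr) (auto simp: Tx lint)
    moreover have "trc (\<lambda>e. gam (tors L x) (gam (tors L x) e a) b) = trc (\<lambda>e. gam (tors L' (g x)) (gam (tors L' (g x)) e (J x a)) (J x b))"
      by (rule tr) (auto simp: Tx lint)
    moreover have "trc (\<lambda>e. covT L x e a b) = trc (\<lambda>e. covT L' (g x) e (J x a) (J x b))" for a b
      by (rule tr[OF covT' linc(1)[OF dL] linc(1)[OF dL']])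
    moreover have "trc (\<lambda>e. covT L x a b e) = trc (\<lambda>e. covT L' (g x) (J x a) (J x b) e)"
      by (rule tr[OF covT' linc(2)[OF dL] linc(2)[OF dL']])
    moreover have "trc (\<lambda>e. Rvec L x e a b) = trc (\<lambda>e. Rvec L' (g x) e (J x a) (J x b))"
      by (rule tr[OF R' linc(3)[OF dL] linc(3)[OF dL']])
    moreover have "trc (\<lambda>e. Rvec L x a e b) = trc (\<lambda>e. Rvec L' (g x) (J x a) e (J x b))"
      by (rule tr[OF R' linc(4)[OF dL] linc(4)[OF dL']])
    ultimately show ?thesis
      by (simp add: base_form_def Let_def u' flip: Tx)
  qed
  obtain a a' b b' where vw: "v = (a, a')" "w = (b, b')" by (cases v, cases w)
  obtain c where c: "frechet_derivative (cot_lift g) (at (x, u)) (a, a') = (J x a, c)"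
    "\<And>v. c \<bullet> J x v + u' \<bullet> H x a v = a' \<bullet> v" using cot_lift_deriv[OF x] unfolding u'_def by blast
  obtain d where d: "frechet_derivative (cot_lift g) (at (x, u)) (b, b') = (J x b, d)"
    "\<And>v. d \<bullet> J x v + u' \<bullet> H x b v = b' \<bullet> v" using cot_lift_deriv[OF x] unfolding u'_def by blast
  have vert: "b' \<bullet> a + u \<bullet> gam (L x) a b = d \<bullet> J x a + u' \<bullet> gam (L' (g x)) (J x a) (J x b)"
    if "\<And>v. d \<bullet> J x v + u' \<bullet> H x b v = b' \<bullet> v" for a b b' d
  proof -
    have "u \<bullet> gam (L x) a b = u' \<bullet> J x (gam (L x) a b)" by (simp add: u')
    also have "\<dots> = u' \<bullet> gam (L' (g x)) (J x a) (J x b) - u' \<bullet> H x b a"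
      by (simp add: claw[OF x] inner_diff_right H_sym[OF x, of a b])
    finally show ?thesis using that[of a] by linarith
  qed
  show ?thesis
    unfolding vw c(1) d(1) cl family_eq[OF dL] family_eq[OF dL'] fst_conv snd_conv
    by (simp only: base vert[OF c(2)] vert[OF d(2)])
qed

end

section \<open>The family consists of natural tensor fields of order one\<close>

lemma chart_facts:
  assumes M: "smooth_manifold M" and c: "c \<in> atlas M"
  shows "openin (mtop M) (cdom c)" "cdom c \<subseteq> topspace (mtop M)" "open (cimg c)" "inj_on (cmap c) (cdom c)"
    and "\<And>p. p \<in> cdom c \<Longrightarrow> inv_into (cdom c) (cmap c) (cmap c p) = p"
    and "\<And>W. openin (mtop M) W \<Longrightarrow> W \<subseteq> cdom c \<Longrightarrow> open (cmap c ` W)"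
proof -
  have o: "openin (mtop M) (cdom c)" and i: "open (cimg c)"
    and h: "homeomorphic_map (subtopology (mtop M) (cdom c)) (top_of_set (cimg c)) (cmap c)"
    using M c unfolding smooth_manifold_def by blast+
  have s: "cdom c \<subseteq> topspace (mtop M)" using o by (rule openin_subset)
  then have t: "topspace (subtopology (mtop M) (cdom c)) = cdom c" by auto
  show "openin (mtop M) (cdom c)" "cdom c \<subseteq> topspace (mtop M)" "open (cimg c)" by fact+
  show inj: "inj_on (cmap c) (cdom c)" using homeomorphic_imp_injective_map[OF h] t by simp
  show "inv_into (cdom c) (cmap c) (cmap c p) = p" if "p \<in> cdom c" for p
    using inj that by (rule inv_into_f_f)
  show "open (cmap c ` W)" if W: "openin (mtop M) W" "W \<subseteq> cdom c" for W
  proof -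
    have "openin (subtopology (mtop M) (cdom c)) W" using W by (simp add: openin_open_subtopology[OF o])
    then have "openin (top_of_set (cimg c)) (cmap c ` W)"
      using homeomorphic_imp_open_map[OF h] unfolding open_map_def by blast
    then show ?thesis using i by (simp add: openin_open_eq)
  qed
qed

lemma local_diffeo_bij:
  assumes "local_diffeo M N U V f"
  shows "inj_on f U" "f ` U = V"
    and "\<And>W. openin (mtop M) W \<Longrightarrow> openin (mtop N) (f ` (U \<inter> W))"
    and "\<And>W. openin (mtop N) W \<Longrightarrow> openin (mtop M) {p \<in> U. f p \<in> W}"
proof -
  have U: "openin (mtop M) U" and V: "openin (mtop N) V"
    and h: "homeomorphic_map (subtopology (mtop M) U) (subtopology (mtop N) V) f"
    using assms unfolding local_diffeo_def by blast+
  have t: "topspace (subtopology (mtop M) U) = U" "topspace (subtopology (mtop N) V) = V"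
    using openin_subset[OF U] openin_subset[OF V] by auto
  show "inj_on f U" "f ` U = V"
    using homeomorphic_imp_injective_map[OF h] homeomorphic_imp_surjective_map[OF h] t by simp_all
  show "openin (mtop N) (f ` (U \<inter> W))" if "openin (mtop M) W" for W
  proof -
    have "openin (subtopology (mtop M) U) (U \<inter> W)" using that U by (simp add: openin_open_subtopology openin_Int)
    then have "openin (subtopology (mtop N) V) (f ` (U \<inter> W))"
      using homeomorphic_imp_open_map[OF h] unfolding open_map_def by blast
    then show ?thesis using V by (simp add: openin_open_subtopology)
  qed
  show "openin (mtop M) {p \<in> U. f p \<in> W}" if "openin (mtop N) W" for W
  proof -
    have "openin (subtopology (mtop N) V) (V \<inter> W)" using that V by (simp add: openin_open_subtopology openin_Int)
    then have "openin (subtopology (mtop M) U) {p \<in> topspace (subtopology (mtop M) U). f p \<in> V \<inter> W}"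
      using homeomorphic_imp_continuous_map[OF h] openin_continuous_map_preimage by blast
    moreover have "{p \<in> topspace (subtopology (mtop M) U). f p \<in> V \<inter> W} = {p \<in> U. f p \<in> W}"
      using t \<open>f ` U = V\<close> by auto
    ultimately show ?thesis using U by (simp add: openin_open_subtopology)
  qed
qed

text \<open>In charts, a local diffeomorphism of manifolds is a change of coordinates between open sets, so
  everything proved for changes of coordinates applies to it.\<close>

lemma coord_change_crep:
  assumes M: "smooth_manifold M" and N: "smooth_manifold N" and f: "local_diffeo M N U V f"
    and c: "c \<in> atlas M" and d: "d \<in> atlas N"
  shows "coord_change (crep c f d) (crep d (inv_into U f) c)
    (cmap c ` {p \<in> cdom c \<inter> U. f p \<in> cdom d}) (cmap d ` {q \<in> cdom d \<inter> V. inv_into U f q \<in> cdom c})"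
proof -
  note C = chart_facts[OF M c] and D = chart_facts[OF N d] and F = local_diffeo_bij[OF f]
  have crep1: "crep c f d (cmap c p) = cmap d (f p)" if "p \<in> cdom c" for p
    using C(5)[OF that] by (simp add: crep_def)
  have crep2: "crep d (inv_into U f) c (cmap d q) = cmap c (inv_into U f q)" if "q \<in> cdom d" for q
    using D(5)[OF that] by (simp add: crep_def)
  have ff: "inv_into U f (f p) = p" if "p \<in> U" for p using F(1) that by (rule inv_into_f_f)
  have V: "q \<in> V \<Longrightarrow> inv_into U f q \<in> U \<and> f (inv_into U f q) = q" for q
    using F(2) by (metis inv_into_into f_inv_into_f)
  show ?thesis
  proof
    have "{p \<in> cdom c \<inter> U. f p \<in> cdom d} = cdom c \<inter> {p \<in> U. f p \<in> cdom d}" by auto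
    then show "open (cmap c ` {p \<in> cdom c \<inter> U. f p \<in> cdom d})"
      using C(1) F(4)[OF D(1)] by (intro C(6)) auto
    have "{q \<in> cdom d \<inter> V. inv_into U f q \<in> cdom c} = cdom d \<inter> f ` (U \<inter> cdom c)"
      using V F(2) ff by (auto intro!: image_eqI)
    then show "open (cmap d ` {q \<in> cdom d \<inter> V. inv_into U f q \<in> cdom c})"
      using D(1) F(3)[OF C(1)] by (intro D(6)) auto
    show "smooth_on (crep c f d) (cmap c ` {p \<in> cdom c \<inter> U. f p \<in> cdom d})"
      "smooth_on (crep d (inv_into U f) c) (cmap d ` {q \<in> cdom d \<inter> V. inv_into U f q \<in> cdom c})"
      using f c d unfolding local_diffeo_def by blast+
  qed (use F(2) V in \<open>auto simp: crep1 crep2 ff intro!: imageI\<close>)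
qed

text \<open>The transition between two charts is the chart representation of the identity; so the invariance of
  the family under local diffeomorphisms also makes it a well-defined tensor field.\<close>

lemma local_diffeo_id:
  assumes M: "smooth_manifold M"
  shows "local_diffeo M M (topspace (mtop M)) (topspace (mtop M)) id"
  unfolding local_diffeo_def
proof (intro conjI ballI)
  let ?T = "topspace (mtop M)"
  show "openin (mtop M) ?T" "openin (mtop M) ?T" by simp_all
  show "homeomorphic_map (subtopology (mtop M) ?T) (subtopology (mtop M) ?T) id"
    by (simp add: homeomorphic_map_id)
  fix c d assume c: "c \<in> atlas M" and d: "d \<in> atlas M"
  note C = chart_facts[OF M c] and D = chart_facts[OF M d]
  have sm: "smooth_on (crep c id d) (cmap c ` (cdom c \<inter> cdom d))" "smooth_on (crep d id c) (cmap d ` (cdom d \<inter> cdom c))"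
    using M c d unfolding smooth_manifold_def by blast+
  have "{p \<in> cdom c \<inter> ?T. id p \<in> cdom d} = cdom c \<inter> cdom d" using C(2) by auto
  then show "smooth_on (crep c id d) (cmap c ` {p \<in> cdom c \<inter> ?T. id p \<in> cdom d})" using sm by simp
  have iv: "inv_into ?T id q = q" if "q \<in> ?T" for q
    using inv_into_f_f[of id ?T q] that by simp
  have S: "{q \<in> cdom d \<inter> ?T. inv_into ?T id q \<in> cdom c} = cdom d \<inter> cdom c" using D(2) iv by auto
  have op: "open (cmap d ` (cdom d \<inter> cdom c))" using D(1) C(1) by (intro D(6)) auto
  show "smooth_on (crep d (inv_into ?T id) c) (cmap d ` {q \<in> cdom d \<inter> ?T. inv_into ?T id q \<in> cdom c})"
    unfolding S
  proof (rule smooth_on_cong[OF op, THEN iffD2, OF _ sm(2)])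
    fix y assume "y \<in> cmap d ` (cdom d \<inter> cdom c)"
    then show "crep d (inv_into ?T id) c y = crep d id c y"
      using D(2,5) iv by (auto simp: crep_def)
  qed
qed

lemma family_tensor_related:
  assumes M: "smooth_manifold M" and N: "smooth_manifold N" and f: "local_diffeo M N U V f"
    and L: "linear_connection M \<Lambda>" and L': "linear_connection N \<Lambda>'" and rel: "conn_related U f M \<Lambda> N \<Lambda>'"
  shows "tensor_related U f M (\<lambda>c. family k (\<Lambda> c)) N (\<lambda>d. family k (\<Lambda>' d))"
  unfolding tensor_related_def Let_def
proof (intro ballI impI allI)
  fix c d p u v w assume c: "c \<in> atlas M" and d: "d \<in> atlas N" and p: "p \<in> cdom c \<inter> U" "f p \<in> cdom d"
  interpret coord_change "crep c f d" "crep d (inv_into U f) c" "cmap c ` {p \<in> cdom c \<inter> U. f p \<in> cdom d}"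
      "cmap d ` {q \<in> cdom d \<inter> V. inv_into U f q \<in> cdom c}"
    by (rule coord_change_crep[OF M N f c d])
  have sm: "smooth_on (\<lambda>x. \<Lambda> c x l r n) (cimg c)" "smooth_on (\<lambda>x. \<Lambda>' d x l r n) (cimg d)" for l r n
    using L L' c d unfolding linear_connection_def by blast+
  show "family k (\<Lambda> c) (cmap c p, u) v w = family k (\<Lambda>' d) (cot_lift (crep c f d) (cmap c p, u))
       (frechet_derivative (cot_lift (crep c f d)) (at (cmap c p, u)) v)
       (frechet_derivative (cot_lift (crep c f d)) (at (cmap c p, u)) w)"
  proof (rule family_invariant)
    show "smooth_on (\<lambda>y. \<Lambda> c y l r n) (cmap c ` {p \<in> cdom c \<inter> U. f p \<in> cdom d})" for l r n
      by (rule smooth_on_subset[OF sm(1)]) auto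
    show "smooth_on (\<lambda>y. \<Lambda>' d y l r n) (cmap d ` {q \<in> cdom d \<inter> V. inv_into U f q \<in> cdom c})" for l r n
      by (rule smooth_on_subset[OF sm(2)]) auto
    show "cmap c p \<in> cmap c ` {p \<in> cdom c \<inter> U. f p \<in> cdom d}" using p by auto
    fix y assume "y \<in> cmap c ` {p \<in> cdom c \<inter> U. f p \<in> cdom d}"
    then obtain q where q: "q \<in> cdom c \<inter> U" "f q \<in> cdom d" "y = cmap c q" by auto
    moreover have "crep c f d y = cmap d (f q)" using q chart_facts(5)[OF M c] by (simp add: crep_def)
    ultimately show "conn_law (crep c f d) y (\<Lambda> c y) (\<Lambda>' d (crep c f d y))"
      using rel c d unfolding conn_related_def by auto
  qed
qed

lemma smooth_on_family:
  assumes X: "open X" and L: "\<And>l r n. smooth_on (\<lambda>x. L x l r n) X"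
  shows "smooth_on (\<lambda>z. family k L z v w) (X \<times> UNIV)"
proof -
  have oZ: "open (X \<times> (UNIV :: (real^'a) set))" using X by (simp add: open_Times)
  have S: "smooth_on (\<lambda>x. symm L x l r n) X" and T: "smooth_on (\<lambda>x. tors L x l r n) X" for l r n
    unfolding symm_def tors_def divide_inverse by (intro smooth_intros L X)+
  have cov: "smooth_on (\<lambda>x. tors_cov L x l r n d) X" for l r n d
    unfolding tors_cov_def by (intro smooth_intros S T X smooth_on_pd)
  have R: "smooth_on (\<lambda>x. curv L x l r n d) X" for l r n d
    unfolding curv_def by (intro smooth_intros S T X smooth_on_pd)
  have up: "smooth_on (\<lambda>z. q (fst z)) (X \<times> (UNIV :: (real^'a) set))" if "smooth_on q X" for q :: "real^'a \<Rightarrow> real"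
    by (rule smooth_on_compose[OF oZ X _ _ that]) (auto intro!: smooth_intros oZ)
  show ?thesis
    unfolding family_def base_part_def vert_form_def split_beta
    by (intro smooth_intros oZ up[OF L] up[OF T] up[OF cov] up[OF R])
qed

lemma family_bilinear:
  assumes "\<And>l r n. (\<lambda>y. L y l r n) differentiable (at x)"
  shows "bilinear (family k L (x, u))"
proof -
  note b = base_form_bilinear[where k = k and u = u, OF assms]
  show ?thesis
    unfolding bilinear_def
    by (auto intro!: linearI simp: family_eq[OF assms] gam_linear inner_add_right inner_add_left
      bilinear_ladd[OF b] bilinear_radd[OF b] bilinear_lmul[OF b] bilinear_rmul[OF b] algebra_simps)
qed

text \<open>The formula contains the coefficients and their first derivatives.\<close>

lemma family_jet:
  assumes L: "\<And>l r n. (\<lambda>y. L y l r n) differentiable (at x)" and L': "\<And>l r n. (\<lambda>y. L' y l r n) differentiable (at x)"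
    and jet: "same_jet 1 x L L'"
  shows "family k L (x, u) = family k L' (x, u)"
proof -
  have 0: "L x l r n = L' x l r n" for l r n
    using jet[unfolded same_jet_def, rule_format, of "[]"] by simp
  have 1: "pd i (\<lambda>y. L y l r n) x = pd i (\<lambda>y. L' y l r n) x" for i l r n
    using jet[unfolded same_jet_def, rule_format, of "[i]"] by simp
  have S: "symm L x = symm L' x" and T: "tors L x = tors L' x"
    by (simp_all add: symm_def tors_def fun_eq_iff 0)
  have dS: "pd i (\<lambda>y. symm M y l r n) x = (pd i (\<lambda>y. M y l r n) x + pd i (\<lambda>y. M y n r l) x) / 2"
    and dT: "pd i (\<lambda>y. tors M y l r n) x = (pd i (\<lambda>y. M y l r n) x - pd i (\<lambda>y. M y n r l) x) / 2"
    if M: "\<And>l r n. (\<lambda>y. M y l r n) differentiable (at x)" for M :: "real^'a \<Rightarrow> 'a coeffs" and i l r n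
  proof -
    have "symm M y l r n = (1/2) * (M y l r n + M y n r l)" "tors M y l r n = (1/2) * (M y l r n + (- 1) * M y n r l)" for y
      by (auto simp: symm_def tors_def)
    moreover have "(\<lambda>y. (-1) * M y n r l) differentiable (at x)" by (intro differentiable_mult M differentiable_const)
    ultimately show "pd i (\<lambda>y. symm M y l r n) x = (pd i (\<lambda>y. M y l r n) x + pd i (\<lambda>y. M y n r l) x) / 2"
      "pd i (\<lambda>y. tors M y l r n) x = (pd i (\<lambda>y. M y l r n) x - pd i (\<lambda>y. M y n r l) x) / 2"
      using M by (simp_all only: pd_cmult pd_add differentiable_add) simp_all
  qed
  have "tors_cov L x = tors_cov L' x" "curv L x = curv L' x"
    unfolding fun_eq_iff tors_cov_def curv_def dS[OF L] dS[OF L'] dT[OF L] dT[OF L'] 1 S T by simp_all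
  then have "base_part k L x = base_part k L' x" unfolding fun_eq_iff base_part_def T by simp
  moreover have "vert_form L (x, u) = vert_form L' (x, u)" by (simp add: vert_form_def 0 fun_eq_iff)
  ultimately show ?thesis by (simp add: family_def fun_eq_iff)
qed

theorem family_natural:
  assumes "has_coord_expr (\<Phi> :: ('p, 'm::finite) operator) k"
  shows "natural_cot_tensor \<Phi>" "of_order 1 \<Phi>"
proof -
  have \<Phi>: "\<Phi> M \<Lambda> c z = family k (\<Lambda> c) z"
    if "smooth_manifold M" "linear_connection M \<Lambda>" "c \<in> atlas M" "fst z \<in> cimg c" for M \<Lambda> c z
    using assms that unfolding has_coord_expr_def by (cases z) auto
  have sm: "smooth_on (\<lambda>x. \<Lambda> c x l r n) (cimg c)" if "linear_connection M \<Lambda>" "c \<in> atlas M" for M :: "('p, 'm) mfd" and \<Lambda> c l r n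
    using that unfolding linear_connection_def by blast
  have df: "(\<lambda>x. \<Lambda> c x l r n) differentiable (at x)" if "linear_connection M \<Lambda>" "c \<in> atlas M" "x \<in> cimg c" for M :: "('p, 'm) mfd" and \<Lambda> c l r n x
    by (rule smooth_on_differentiable[OF sm[OF that(1,2)] that(3)])
  show order: "of_order 1 \<Phi>"
    unfolding of_order_def
  proof (intro allI impI ballI)
    fix M :: "('p, 'm) mfd" and \<Lambda> \<Lambda>' c x u
    assume a: "smooth_manifold M \<and> linear_connection M \<Lambda> \<and> linear_connection M \<Lambda>'" "c \<in> atlas M" "x \<in> cimg c" "same_jet 1 x (\<Lambda> c) (\<Lambda>' c)"
    show "\<Phi> M \<Lambda> c (x, u) = \<Phi> M \<Lambda>' c (x, u)"
      using a family_jet[where k = k and u = u, OF df[of M \<Lambda> c x] df[of M "\<Lambda>'" c x]] by (simp add: \<Phi>)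
  qed
  have rel: "tensor_related U f M (\<Phi> M \<Lambda>) N (\<Phi> N \<Lambda>')"
    if h: "smooth_manifold M" "smooth_manifold N" "local_diffeo M N U V f" "linear_connection M \<Lambda>" "linear_connection N \<Lambda>'"
      "conn_related U f M \<Lambda> N \<Lambda>'" for M N :: "('p, 'm) mfd" and U V f \<Lambda> \<Lambda>'
    unfolding tensor_related_def Let_def
  proof (intro ballI impI allI)
    fix c d p u v w assume c: "c \<in> atlas M" and d: "d \<in> atlas N" and p: "p \<in> cdom c \<inter> U" "f p \<in> cdom d"
    have "fst (cot_lift (crep c f d) (cmap c p, u)) = cmap d (f p)"
      using chart_facts(5)[OF h(1) c] p by (simp add: cot_lift_def crep_def)
    then have 2: "fst (cot_lift (crep c f d) (cmap c p, u)) \<in> cimg d" using p by auto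
    have 1: "fst (cmap c p, u) \<in> cimg c" using p by auto
    show "\<Phi> M \<Lambda> c (cmap c p, u) v w = \<Phi> N \<Lambda>' d (cot_lift (crep c f d) (cmap c p, u))
       (frechet_derivative (cot_lift (crep c f d)) (at (cmap c p, u)) v)
       (frechet_derivative (cot_lift (crep c f d)) (at (cmap c p, u)) w)"
      unfolding \<Phi>[OF h(1,4) c 1] \<Phi>[OF h(2,5) d 2]
      using family_tensor_related[where k = k, OF h] c d p unfolding tensor_related_def Let_def by blast
  qed
  show "natural_cot_tensor \<Phi>"
    unfolding natural_cot_tensor_def
  proof (intro conjI allI impI)
    fix M :: "('p, 'm) mfd" and \<Lambda> assume a: "smooth_manifold M \<and> linear_connection M \<Lambda>"
    show "cot_tensor_field M (\<Phi> M \<Lambda>)"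
      unfolding cot_tensor_field_def
    proof (intro conjI ballI allI)
      fix c assume c: "c \<in> atlas M"
      show "bilinear (\<Phi> M \<Lambda> c z)" if "z \<in> cimg c \<times> UNIV" for z
        using that a c family_bilinear[where k = k and u = "snd z", OF df[of M \<Lambda> c "fst z"]] by (simp add: \<Phi> mem_Times_iff)
      have o: "open (cimg c)" using chart_facts(3) a c by blast
      then have oZ: "open (cimg c \<times> (UNIV :: (real^'m) set))" by (simp add: open_Times)
      show "smooth_on (\<lambda>z. \<Phi> M \<Lambda> c z v w) (cimg c \<times> UNIV)" for v w
      proof (rule smooth_on_cong[OF oZ, THEN iffD2])
        show "smooth_on (\<lambda>z. family k (\<Lambda> c) z v w) (cimg c \<times> UNIV)"
          using a c by (intro smooth_on_family o sm) auto
        show "\<Phi> M \<Lambda> c z v w = family k (\<Lambda> c) z v w" if "z \<in> cimg c \<times> UNIV" for z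
          using \<Phi>[of M \<Lambda> c z] a c that by (simp add: mem_Times_iff)
      qed
    next
      show "tensor_related (topspace (mtop M)) id M (\<Phi> M \<Lambda>) M (\<Phi> M \<Lambda>)"
        using a by (intro rel[OF _ _ local_diffeo_id]) (auto simp: linear_connection_def)
    qed
  next
    show "local_operator \<Phi>"
      unfolding local_operator_def
    proof (intro allI impI ballI)
      fix M :: "('p, 'm) mfd" and \<Lambda> \<Lambda>' W c p u
      assume a: "smooth_manifold M \<and> linear_connection M \<Lambda> \<and> linear_connection M \<Lambda>' \<and> openin (mtop M) W \<and>
        (\<forall>c\<in>atlas M. \<forall>p\<in>cdom c \<inter> W. \<Lambda> c (cmap c p) = \<Lambda>' c (cmap c p))" and c: "c \<in> atlas M" and p: "p \<in> cdom c \<inter> W"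
      have o: "open (cmap c ` (cdom c \<inter> W))"
        using a c chart_facts(1,6) openin_Int by (metis inf_le1)
      have "same_jet 1 (cmap c p) (\<Lambda> c) (\<Lambda>' c)"
        unfolding same_jet_def using a c p by (auto intro!: pds_cong[OF o])
      then show "\<Phi> M \<Lambda> c (cmap c p, u) = \<Phi> M \<Lambda>' c (cmap c p, u)"
        using order a c p unfolding of_order_def by blast
    qed
  next
    fix M N :: "('p, 'm) mfd" and U V f \<Lambda> \<Lambda>'
    assume "smooth_manifold M \<and> smooth_manifold N \<and> local_diffeo M N U V f \<and>
        linear_connection M \<Lambda> \<and> linear_connection N \<Lambda>' \<and> conn_related U f M \<Lambda> N \<Lambda>'"
    then show "tensor_related U f M (\<Phi> M \<Lambda>) N (\<Phi> N \<Lambda>')" using rel by blast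
  qed
qed

section \<open>The coordinate space as a manifold\<close>

text \<open>The coordinate space is transported along an injection \<open>h\<close> into the type of points, so that an
  operator, whose manifolds all have points of one type, can be applied to it. The single chart
  is \<open>inv h\<close>.\<close>

definition stdM :: "(real^'m::finite \<Rightarrow> 'p) \<Rightarrow> ('p, 'm) mfd" where
  "stdM h = \<lparr>mtop = pullback_topology (range h) (inv h) euclidean, atlas = {(range h, inv h)}\<rparr>"

abbreviation stdc :: "(real^'m::finite \<Rightarrow> 'p) \<Rightarrow> ('p, 'm) chart" where "stdc h \<equiv> (range h, inv h)"

lemma std_homeo:
  fixes h :: "real^'m::finite \<Rightarrow> 'p"
  assumes inj: "inj h"
  shows "homeomorphic_map (mtop (stdM h)) euclidean (inv h)" "homeomorphic_map euclidean (mtop (stdM h)) h"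
    "topspace (mtop (stdM h)) = range h"
proof -
  have hh: "inv h (h x) = x" for x using inj by simp
  have "continuous_map (mtop (stdM h)) euclidean (id \<circ> inv h)"
    unfolding stdM_def by (simp only: mfd.select_convs) (rule continuous_map_pullback, simp add: id_def)
  moreover have "continuous_map euclidean (mtop (stdM h)) h"
    unfolding stdM_def using hh
    by (simp, intro continuous_map_pullback') (auto simp: comp_def)
  ultimately have m: "homeomorphic_maps (mtop (stdM h)) euclidean (inv h) h"
    unfolding homeomorphic_maps_def using hh by (auto simp: stdM_def topspace_pullback_topology)
  then show "homeomorphic_map (mtop (stdM h)) euclidean (inv h)" "homeomorphic_map euclidean (mtop (stdM h)) h"
    using homeomorphic_maps_imp_map homeomorphic_maps_sym by blast+
  show "topspace (mtop (stdM h)) = range h" by (simp add: stdM_def topspace_pullback_topology)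
qed

lemma second_countable_euclidean: "second_countable (euclidean :: 'a::euclidean_space topology)"
proof -
  obtain B :: "'a set set" where B: "countable B" "\<And>C. C \<in> B \<Longrightarrow> open C"
    "\<And>S. open S \<Longrightarrow> \<exists>U. U \<subseteq> B \<and> S = \<Union>U" using univ_second_countable by metis
  show ?thesis
    unfolding second_countable_def
  proof (intro exI[of _ B] conjI allI impI ballI)
    fix U and x :: 'a assume "openin euclidean U \<and> x \<in> U"
    then show "\<exists>V\<in>B. x \<in> V \<and> V \<subseteq> U" using B(3)[of U] by auto
  qed (use B in auto)
qed

lemma crep_std:
  assumes "inj h"
  shows "crep (stdc h) (h \<circ> g \<circ> inv h) (stdc h) = g" "crep (stdc h) id (stdc h) = id"
    "crep c (h \<circ> cmap c) (stdc h) = cmap c \<circ> inv_into (cdom c) (cmap c)"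
    "cmap (stdc h) ` cdom (stdc h) = UNIV"
proof -
  have hh: "inv h (h x) = x" for x using assms by simp
  have "inj_on (inv h) (range h)" using hh by (auto intro!: inj_onI)
  then have i: "inv_into (range h) (inv h) x = h x" for x
    using inv_into_f_f[of "inv h" "range h" "h x"] by (simp add: hh)
  show "crep (stdc h) (h \<circ> g \<circ> inv h) (stdc h) = g" "crep (stdc h) id (stdc h) = id"
    "crep c (h \<circ> cmap c) (stdc h) = cmap c \<circ> inv_into (cdom c) (cmap c)"
    by (auto simp: crep_def fun_eq_iff i hh)
  show "cmap (stdc h) ` cdom (stdc h) = UNIV" using hh by (auto intro!: image_eqI[of _ _ "h _"])
qed

lemma std_smooth_manifold:
  fixes h :: "real^'m::finite \<Rightarrow> 'p"
  assumes inj: "inj h"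
  shows "smooth_manifold (stdM h)"
proof -
  note H = std_homeo[OF inj]
  have sp: "mtop (stdM h) homeomorphic_space (euclidean :: (real^'m) topology)"
    using H(1) homeomorphic_map_imp_homeomorphic_space by blast
  have sub: "subtopology (mtop (stdM h)) (range h) = mtop (stdM h)" using H(3) by (metis subtopology_topspace)
  show ?thesis
    unfolding smooth_manifold_def
  proof (intro conjI)
    show "Hausdorff_space (mtop (stdM h))" using homeomorphic_Hausdorff_space[OF sp] by simp
    show "second_countable (mtop (stdM h))"
      using homeomorphic_space_second_countability[OF sp] second_countable_euclidean by blast
    show "topspace (mtop (stdM h)) = (\<Union>c\<in>atlas (stdM h). cdom c)" using H(3) by (simp add: stdM_def)
    show "\<forall>c\<in>atlas (stdM h). openin (mtop (stdM h)) (cdom c) \<and> open (cimg c) \<and>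
        homeomorphic_map (subtopology (mtop (stdM h)) (cdom c)) (top_of_set (cimg c)) (cmap c)"
    proof
      fix c assume "c \<in> atlas (stdM h)"
      then have c: "c = stdc h" by (simp add: stdM_def)
      show "openin (mtop (stdM h)) (cdom c) \<and> open (cimg c) \<and>
        homeomorphic_map (subtopology (mtop (stdM h)) (cdom c)) (top_of_set (cimg c)) (cmap c)"
        using H(1,3) crep_std(4)[OF inj] openin_topspace[of "mtop (stdM h)"] unfolding c by (simp add: sub)
    qed
    show "\<forall>c\<in>atlas (stdM h). \<forall>d\<in>atlas (stdM h). smooth_on (crep c id d) (cmap c ` (cdom c \<inter> cdom d))"
    proof (intro ballI)
      fix c d assume "c \<in> atlas (stdM h)" "d \<in> atlas (stdM h)"
      then have c: "c = stdc h" "d = stdc h" by (simp_all add: stdM_def)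
      show "smooth_on (crep c id d) (cmap c ` (cdom c \<inter> cdom d))"
        unfolding c crep_std[OF inj] using crep_std(4)[OF inj] by (simp add: id_def smooth_on_id)
    qed
  qed
qed

lemma coord_change_id: "coord_change id id UNIV UNIV"
  by unfold_locales (auto simp: id_def smooth_on_id)

text \<open>The second derivatives of the identity vanish.\<close>

lemma conn_law_id: "conn_law id x c c"
proof -
  interpret coord_change "id :: real^'a \<Rightarrow> real^'a" id UNIV UNIV by (rule coord_change_id)
  have "J x v = v" "H x d v = 0" for x d v by (simp_all add: J_def[abs_def] H_def)
  then show ?thesis by (simp add: conn_law_iff)
qed

lemma std_linear_connection:
  assumes inj: "inj h" and P: "\<And>l r n. smooth_on (\<lambda>x. P x l r n) UNIV"
  shows "linear_connection (stdM h) (\<lambda>c. P)"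
  unfolding linear_connection_def conn_related_def
proof (intro conjI ballI allI impI)
  fix c l r n assume "c \<in> atlas (stdM h)"
  then show "smooth_on (\<lambda>x. P x l r n) (cimg c)" using P smooth_on_subset by blast
next
  fix c d p assume a: "c \<in> atlas (stdM h)" "d \<in> atlas (stdM h)"
  then have c: "c = stdc h" "d = stdc h" by (simp_all add: stdM_def)
  show "conn_law (crep c id d) (cmap c p) (P (cmap c p)) (P (cmap d (id p)))"
    unfolding c crep_std(2)[OF inj] using conn_law_id by simp
qed

lemma std_local_diffeo:
  fixes h :: "real^'m::finite \<Rightarrow> 'p"
  assumes inj: "inj h" and g: "coord_change g k X Y"
  shows "local_diffeo (stdM h) (stdM h) (h ` X) (h ` Y) (h \<circ> g \<circ> inv h)"
proof -
  interpret coord_change g k X Y by (rule g)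
  note H = std_homeo[OF inj]
  have hh: "inv h (h x) = x" for x using inj by simp
  have o: "openin (mtop (stdM h)) (h ` S)" if "open S" for S
    using homeomorphic_imp_open_map[OF H(2)] that unfolding open_map_def by simp
  have gY: "g ` X = Y" using gX hY gh by force
  have h1: "homeomorphic_map (subtopology (mtop (stdM h)) (h ` X)) (top_of_set X) (inv h)"
  proof (rule homeomorphic_map_subtopologies[OF H(1)])
    have "inv h ` (h ` X) = X" using hh by (simp add: image_image)
    moreover have "range h \<inter> h ` X = h ` X" by auto
    ultimately show "inv h ` (topspace (mtop (stdM h)) \<inter> h ` X) = topspace euclidean \<inter> X" using H(3) by simp
  qed
  have h3: "homeomorphic_map (top_of_set Y) (subtopology (mtop (stdM h)) (h ` Y)) h"
    by (rule homeomorphic_map_subtopologies[OF H(2)]) (use H(3) in auto)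
  have "homeomorphic_maps (top_of_set X) (top_of_set Y) g k"
    unfolding homeomorphic_maps_def using smooth_onD_cont[OF sg] smooth_onD_cont[OF sh] gX hY gh hg
    by (auto simp: continuous_map_in_subtopology)
  then have h2: "homeomorphic_map (top_of_set X) (top_of_set Y) g" by (rule homeomorphic_maps_imp_map)
  have hom: "homeomorphic_map (subtopology (mtop (stdM h)) (h ` X)) (subtopology (mtop (stdM h)) (h ` Y)) (h \<circ> g \<circ> inv h)"
    using homeomorphic_map_compose[OF h1 homeomorphic_map_compose[OF h2 h3]] by (simp add: comp_assoc)
  have inv: "inv_into (h ` X) (h \<circ> g \<circ> inv h) (h y) = h (k y)" if "y \<in> Y" for y
  proof -
    have "inj_on (h \<circ> g \<circ> inv h) (h ` X)"
      using inj hg by (auto intro!: inj_onI simp: hh inj_eq) (metis hg)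
    from inv_into_f_f[OF this, of "h (k y)"] show ?thesis using that hY gh by (simp add: hh)
  qed
  show ?thesis
    unfolding local_diffeo_def
  proof (intro conjI ballI hom o X Y)
    fix c d assume a: "c \<in> atlas (stdM h)" "d \<in> atlas (stdM h)"
    then have c: "c = stdc h" "d = stdc h" by (simp_all add: stdM_def)
    have "cmap c ` {p \<in> cdom c \<inter> h ` X. (h \<circ> g \<circ> inv h) p \<in> cdom d} \<subseteq> X" unfolding c using hh by auto
    then show "smooth_on (crep c (h \<circ> g \<circ> inv h) d) (cmap c ` {p \<in> cdom c \<inter> h ` X. (h \<circ> g \<circ> inv h) p \<in> cdom d})"
      unfolding c crep_std(1)[OF inj] using smooth_on_subset[OF sg] by blast
    have s: "cmap d ` {q \<in> cdom d \<inter> h ` Y. inv_into (h ` X) (h \<circ> g \<circ> inv h) q \<in> cdom c} \<subseteq> Y" unfolding c using hh by auto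
    have i: "inj_on (inv h) (range h)" using hh by (auto intro!: inj_onI)
    have "crep d (inv_into (h ` X) (h \<circ> g \<circ> inv h)) c y = k y" if "y \<in> Y" for y
    proof -
      have "inv_into (range h) (inv h) y = h y" using inv_into_f_f[OF i, of "h y"] by (simp add: hh)
      then show ?thesis unfolding c using inv[OF that] by (simp add: crep_def hh)
    qed
    then have "smooth_on (crep d (inv_into (h ` X) (h \<circ> g \<circ> inv h)) c) Y"
      using smooth_on_cong[OF Y] sh by blast
    then show "smooth_on (crep d (inv_into (h ` X) (h \<circ> g \<circ> inv h)) c)
        (cmap d ` {q \<in> cdom d \<inter> h ` Y. inv_into (h ` X) (h \<circ> g \<circ> inv h) q \<in> cdom c})"
      using s by (rule smooth_on_subset)
  qed
qed

text \<open>Charts are the local diffeomorphisms that carry a connection on an arbitrary manifold to the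
  standard one.\<close>

lemma chart_local_diffeo:
  fixes h :: "real^'m::finite \<Rightarrow> 'p"
  assumes inj: "inj h" and M: "smooth_manifold M" and c: "c \<in> atlas M"
    and W: "openin (mtop M) W" "W \<subseteq> cdom c"
  shows "local_diffeo M (stdM h) W (h ` cmap c ` W) (h \<circ> cmap c)"
proof -
  note H = std_homeo[OF inj] and C = chart_facts[OF M c]
  have hh: "inv h (h x) = x" for x using inj by simp
  have o: "openin (mtop (stdM h)) (h ` S)" if "open S" for S
    using homeomorphic_imp_open_map[OF H(2)] that unfolding open_map_def by simp
  have oW: "open (cmap c ` W)" using C(6)[OF W] .
  have "homeomorphic_map (subtopology (mtop M) (cdom c)) (top_of_set (cimg c)) (cmap c)"
    using M c unfolding smooth_manifold_def by blast
  then have "homeomorphic_map (subtopology (subtopology (mtop M) (cdom c)) W) (subtopology (top_of_set (cimg c)) (cmap c ` W)) (cmap c)"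
    by (rule homeomorphic_map_subtopologies) (use W C(2) in auto)
  moreover have "cdom c \<inter> W = W" "cimg c \<inter> cmap c ` W = cmap c ` W" using W by auto
  ultimately have h1: "homeomorphic_map (subtopology (mtop M) W) (top_of_set (cmap c ` W)) (cmap c)"
    by (simp add: subtopology_subtopology)
  have h3: "homeomorphic_map (top_of_set (cmap c ` W)) (subtopology (mtop (stdM h)) (h ` cmap c ` W)) h"
    by (rule homeomorphic_map_subtopologies[OF H(2)]) (use H(3) in auto)
  have hom: "homeomorphic_map (subtopology (mtop M) W) (subtopology (mtop (stdM h)) (h ` cmap c ` W)) (h \<circ> cmap c)"
    by (rule homeomorphic_map_compose[OF h1 h3])
  have inv: "inv_into W (h \<circ> cmap c) (h (cmap c p)) = p" if "p \<in> W" for p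
  proof -
    have "inj_on (h \<circ> cmap c) W" using C(4) W(2) inj by (metis comp_inj_on inj_on_subset subset_UNIV)
    from inv_into_f_f[OF this that] show ?thesis by simp
  qed
  show ?thesis
    unfolding local_diffeo_def
  proof (intro conjI ballI hom o oW W(1))
    fix d e assume d: "d \<in> atlas M" and "e \<in> atlas (stdM h)"
    then have e: "e = stdc h" by (simp add: stdM_def)
    note D = chart_facts[OF M d]
    have sm: "smooth_on (crep d id c) (cmap d ` (cdom d \<inter> cdom c))" "smooth_on (crep c id d) (cmap c ` (cdom c \<inter> cdom d))"
      using M c d unfolding smooth_manifold_def by blast+
    have "crep d (h \<circ> cmap c) e = crep d id c" unfolding e by (auto simp: crep_def hh fun_eq_iff)
    then show "smooth_on (crep d (h \<circ> cmap c) e) (cmap d ` {p \<in> cdom d \<inter> W. (h \<circ> cmap c) p \<in> cdom e})"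
    proof (simp only:, intro smooth_on_subset[OF sm(1)] image_mono)
      show "{p \<in> cdom d \<inter> W. (h \<circ> cmap c) p \<in> cdom e} \<subseteq> cdom d \<inter> cdom c" using W(2) by blast
    qed
    have i: "inj_on (inv h) (range h)" using hh by (auto intro!: inj_onI)
    have S: "cmap e ` {q \<in> cdom e \<inter> h ` cmap c ` W. inv_into W (h \<circ> cmap c) q \<in> cdom d} = cmap c ` (W \<inter> cdom d)"
      unfolding e using inv by (force simp: hh image_iff)
    have oS: "open (cmap c ` (W \<inter> cdom d))" using W D(1) by (intro C(6)) auto
    have "smooth_on (crep e (inv_into W (h \<circ> cmap c)) d) (cmap c ` (W \<inter> cdom d))"
    proof (rule smooth_on_cong[OF oS, THEN iffD2])
      show "smooth_on (crep c id d) (cmap c ` (W \<inter> cdom d))" using W(2) by (intro smooth_on_subset[OF sm(2)]) auto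
      fix y assume "y \<in> cmap c ` (W \<inter> cdom d)"
      then obtain p where p: "p \<in> W" "y = cmap c p" by auto
      have "inv_into (range h) (inv h) y = h y" using inv_into_f_f[OF i, of "h y"] by (simp add: hh)
      then show "crep e (inv_into W (h \<circ> cmap c)) d y = crep c id d y"
        using p inv C(5)[of p] W(2) by (auto simp: crep_def e)
    qed
    then show "smooth_on (crep e (inv_into W (h \<circ> cmap c)) d)
        (cmap e ` {q \<in> cdom e \<inter> h ` cmap c ` W. inv_into W (h \<circ> cmap c) q \<in> cdom d})" by (simp only: S)
  qed
qed

text \<open>Coefficient fields are taken with values in a vector space, so that they can be added, scaled and
  differentiated as a whole; \<open>co\<close> returns to the format of \<open>conn_law\<close>.\<close>

type_synonym 'm cf = "real^'m^'m^'m"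

definition co :: "'m::finite cf \<Rightarrow> 'm coeffs" where "co X l r n = X $ l $ r $ n"

lemma gam_co:
  "gam (co (X + Y)) v w = gam (co X) v w + gam (co Y) v w" "gam (co (t *\<^sub>R X)) v w = t *\<^sub>R gam (co X) v w"
  by (simp_all add: gam_def co_def vec_eq_iff algebra_simps sum.distrib sum_distrib_left)

lemma smooth_on_co: "open S \<Longrightarrow> smooth_on P S \<Longrightarrow> smooth_on (\<lambda>x. co (P x) l r n) S"
  unfolding co_def by (intro smooth_on_vec_nth)

locale nat_op =
  fixes \<Phi> :: "('p, 'm::finite) operator" and h :: "real^'m \<Rightarrow> 'p" and ord :: nat
  assumes nat: "natural_cot_tensor \<Phi>" and order: "of_order ord \<Phi>" and inj: "inj h"
begin

text \<open>The tensor field that the operator assigns to a connection with global coordinates.\<close>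

definition ph :: "(real^'m \<Rightarrow> 'm cf) \<Rightarrow> 'm cot \<Rightarrow> 'm cot \<Rightarrow> 'm cot \<Rightarrow> real" where
  "ph P z v w = \<Phi> (stdM h) (\<lambda>c y. co (P y)) (stdc h) z v w"

lemma std_conn: "smooth_on P UNIV \<Longrightarrow> linear_connection (stdM h) (\<lambda>c y. co (P y))"
  by (rule std_linear_connection[OF inj]) (rule smooth_on_co[OF open_UNIV])

lemma ph_tensor:
  assumes "smooth_on P UNIV"
  shows "bilinear (ph P z)" "smooth_on (\<lambda>z. ph P z v w) UNIV"
proof -
  have t: "cot_tensor_field (stdM h) (\<Phi> (stdM h) (\<lambda>c y. co (P y)))"
    using nat std_smooth_manifold[OF inj] std_conn[OF assms] unfolding natural_cot_tensor_def by blast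
  have c: "stdc h \<in> atlas (stdM h)" by (simp add: stdM_def)
  have i: "cimg (stdc h) \<times> (UNIV :: (real^'m) set) = UNIV" using crep_std(4)[OF inj] by simp
  have b: "\<forall>c\<in>atlas (stdM h). \<forall>z\<in>cimg c \<times> UNIV. bilinear (\<Phi> (stdM h) (\<lambda>c y. co (P y)) c z)"
    and s: "\<forall>c\<in>atlas (stdM h). \<forall>v w. smooth_on (\<lambda>z. \<Phi> (stdM h) (\<lambda>c y. co (P y)) c z v w) (cimg c \<times> UNIV)"
    using t unfolding cot_tensor_field_def by simp_all
  have "z \<in> cimg (stdc h) \<times> UNIV" unfolding i by simp
  from b[THEN bspec, OF c, THEN bspec, OF this] show "bilinear (ph P z)" by (simp add: ph_def[abs_def])
  show "smooth_on (\<lambda>z. ph P z v w) UNIV" using s[THEN bspec, OF c, rule_format, of v w] i by (simp add: ph_def[abs_def])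
qed

text \<open>The finite order of the operator enters only here.\<close>

lemma ph_jet:
  assumes "smooth_on P UNIV" "smooth_on P' UNIV" "same_jet ord x (\<lambda>y. co (P y)) (\<lambda>y. co (P' y))"
  shows "ph P (x, u) = ph P' (x, u)"
proof -
  have "x \<in> cimg (stdc h)" using crep_std(4)[OF inj] by simp
  moreover have "stdc h \<in> atlas (stdM h)" by (simp add: stdM_def)
  ultimately have "\<Phi> (stdM h) (\<lambda>c y. co (P y)) (stdc h) (x, u) = \<Phi> (stdM h) (\<lambda>c y. co (P' y)) (stdc h) (x, u)"
    using order[unfolded of_order_def, THEN spec[of _ "stdM h"], THEN spec[of _ "\<lambda>c y. co (P y)"],
        THEN spec[of _ "\<lambda>c y. co (P' y)"]]
      std_smooth_manifold[OF inj] std_conn[OF assms(1)] std_conn[OF assms(2)] assms(3) by blast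
  then show ?thesis by (simp add: ph_def[abs_def])
qed

lemma ph_local:
  assumes "smooth_on P UNIV" "smooth_on P' UNIV" "open S" "x \<in> S" "\<And>y. y \<in> S \<Longrightarrow> P y = P' y"
  shows "ph P (x, u) = ph P' (x, u)"
  by (rule ph_jet[OF assms(1,2)]) (auto simp: same_jet_def assms intro!: pds_cong[OF assms(3,4)])

text \<open>The connections are defined on the whole space, but they need to correspond only over the domain of the
  change of coordinates.\<close>

lemma ph_natural:
  assumes g: "coord_change g k X Y" and P: "smooth_on P UNIV" "smooth_on P' UNIV"
    and law: "\<And>x. x \<in> X \<Longrightarrow> conn_law g x (co (P x)) (co (P' (g x)))" and x: "x \<in> X"
  shows "ph P (x, u) v w = ph P' (cot_lift g (x, u))
    (frechet_derivative (cot_lift g) (at (x, u)) v) (frechet_derivative (cot_lift g) (at (x, u)) w)"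
proof -
  let ?f = "h \<circ> g \<circ> inv h"
  have hh: "inv h (h x) = x" for x using inj by simp
  have d: "local_diffeo (stdM h) (stdM h) (h ` X) (h ` Y) ?f" by (rule std_local_diffeo[OF inj g])
  have "conn_related (h ` X) ?f (stdM h) (\<lambda>c y. co (P y)) (stdM h) (\<lambda>c y. co (P' y))"
    unfolding conn_related_def
  proof (intro ballI impI)
    fix c d p assume "c \<in> atlas (stdM h)" "d \<in> atlas (stdM h)" and p: "p \<in> cdom c \<inter> h ` X"
    then have c: "c = stdc h" "d = stdc h" by (simp_all add: stdM_def)
    obtain x where "x \<in> X" "p = h x" using p by auto
    then show "conn_law (crep c ?f d) (cmap c p) (co (P (cmap c p))) (co (P' (cmap d (?f p))))"
      unfolding c crep_std(1)[OF inj] using law by (simp add: hh)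
  qed
  then have "tensor_related (h ` X) ?f (stdM h) (\<Phi> (stdM h) (\<lambda>c y. co (P y))) (stdM h) (\<Phi> (stdM h) (\<lambda>c y. co (P' y)))"
    using nat std_smooth_manifold[OF inj] std_conn P d unfolding natural_cot_tensor_def by blast
  moreover have "stdc h \<in> atlas (stdM h)" "h x \<in> cdom (stdc h) \<inter> h ` X" "?f (h x) \<in> cdom (stdc h)" using x by (auto simp: stdM_def)
  ultimately have "\<Phi> (stdM h) (\<lambda>c y. co (P y)) (stdc h) (cmap (stdc h) (h x), u) v w =
     \<Phi> (stdM h) (\<lambda>c y. co (P' y)) (stdc h) (cot_lift (crep (stdc h) ?f (stdc h)) (cmap (stdc h) (h x), u))
        (frechet_derivative (cot_lift (crep (stdc h) ?f (stdc h))) (at (cmap (stdc h) (h x), u)) v)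
        (frechet_derivative (cot_lift (crep (stdc h) ?f (stdc h))) (at (cmap (stdc h) (h x), u)) w)"
    unfolding tensor_related_def Let_def by blast
  then show ?thesis unfolding ph_def crep_std(1)[OF inj] by (simp add: hh)
qed

text \<open>For an affine map the second derivative vanishes, so connection coefficients transform as a tensor. The
  action on covectors is described by pairings, which avoids inverse transposed matrices.\<close>

lemma ph_affine:
  assumes A: "linear A" "linear B" "\<And>v. B (A v) = v" "\<And>v. A (B v) = v"
    and P: "smooth_on P UNIV" "smooth_on P' UNIV"
    and law: "\<And>x v w. A (gam (co (P x)) v w) = gam (co (P' (A x + c))) (A v) (A w)"
    and u: "\<And>v. u' \<bullet> A v = u \<bullet> v" and a: "\<And>v. a'' \<bullet> A v = a' \<bullet> v" and b: "\<And>v. b'' \<bullet> A v = b' \<bullet> v"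
  shows "ph P (x, u) (a, a') (b, b') = ph P' (A x + c, u') (A a, a'') (A b, b'')"
proof -
  let ?g = "\<lambda>x. A x + c" and ?k = "\<lambda>y. B (y - c)"
  have bl: "bounded_linear A" "bounded_linear B" using A by (simp_all add: linear_conv_bounded_linear)
  interpret coord_change ?g ?k UNIV UNIV
    by unfold_locales (use A in \<open>auto intro!: smooth_intros smooth_on_linear_compose[OF bl(1)] smooth_on_linear_compose[OF bl(2)]\<close>)
  have gd: "(?g has_derivative A) (at x)" for x
    using has_derivative_add_const[OF bounded_linear_imp_has_derivative[OF bl(1)]] by simp
  then have J: "J x v = A v" for x v using frechet_derivative_at[OF gd] by (simp add: J_def)
  have H: "H x d v = 0" for x d v unfolding H_def J by simp
  have cl: "conn_law ?g x (co (P x)) (co (P' (?g x)))" for x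
    by (subst conn_law_iff) (auto simp: J H law)
  have e: "p = q" if "\<And>v. p \<bullet> A v = q \<bullet> A v" for p q
    by (metis A(4) that vector_eq_rdot)
  obtain p where p: "frechet_derivative (cot_lift ?g) (at (x, u)) (a, a') = (J x a, p)"
    "\<And>v. p \<bullet> J x v + snd (cot_lift ?g (x, u)) \<bullet> H x a v = a' \<bullet> v" using cot_lift_deriv[of x u a a'] by blast
  obtain q where q: "frechet_derivative (cot_lift ?g) (at (x, u)) (b, b') = (J x b, q)"
    "\<And>v. q \<bullet> J x v + snd (cot_lift ?g (x, u)) \<bullet> H x b v = b' \<bullet> v" using cot_lift_deriv[of x u b b'] by blast
  have "p = a''" "q = b''" by (rule e, use p q a b J H in simp)+
  moreover have "snd (cot_lift ?g (x, u)) = u'"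
    by (rule e) (use cot_lift_inner(3)[of x u] u in \<open>simp add: J\<close>)
  then have "cot_lift ?g (x, u) = (?g x, u')" by (simp add: prod_eq_iff cot_lift_inner(1))
  ultimately show ?thesis
    using ph_natural[OF coord_change_axioms P cl, of x u "(a, a')" "(b, b')"] p(1) q(1) by (simp add: J)
qed

lemma smooth_affine: "smooth_on (P :: real^'m \<Rightarrow> 'm cf) UNIV \<Longrightarrow> smooth_on (\<lambda>y. P (t *\<^sub>R y + a)) UNIV"
  by (rule smooth_on_compose_UNIV[OF open_UNIV, where g = P]) (assumption, intro smooth_intros open_UNIV)

lemma ph_translate:
  assumes "smooth_on P UNIV"
  shows "ph (\<lambda>y. P (y + c)) (x, u) v w = ph P (x + c, u) v w"
  using ph_affine[of "\<lambda>v. v" "\<lambda>v. v" "\<lambda>y. P (y + c)" P c u u "snd v" "snd v" "snd w" "snd w" x "fst v" "fst w"]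
    assms smooth_affine[OF assms, of 1 c] by (simp add: linear_ident)

text \<open>Homogeneity of the operator: the source of all bounds on degrees.\<close>

lemma ph_homothety:
  assumes P: "smooth_on P UNIV" and t: "t \<noteq> 0"
  shows "ph (\<lambda>y. t *\<^sub>R P (t *\<^sub>R y)) (x, u) (a, a') (b, b') =
    ph P (t *\<^sub>R x, u /\<^sub>R t) (t *\<^sub>R a, a' /\<^sub>R t) (t *\<^sub>R b, b' /\<^sub>R t)"
proof -
  have "smooth_on (\<lambda>y. t *\<^sub>R P (t *\<^sub>R y)) UNIV" using smooth_affine[OF P, of t 0] by (intro smooth_intros) auto
  then show ?thesis
    using ph_affine[of "(*\<^sub>R) t" "(*\<^sub>R) (inverse t)" "\<lambda>y. t *\<^sub>R P (t *\<^sub>R y)" P 0 "u /\<^sub>R t" u "a' /\<^sub>R t" a' "b' /\<^sub>R t" b' x a b] t P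
    by (simp add: linear_scale_self gam_co gam_linear)
qed

end

section \<open>Finite differences and uniform bounds\<close>

text \<open>
  The operator is not assumed to depend smoothly on parameters of the connection, so finite differences
  take the place of derivatives.
\<close>

primrec findiff :: "nat \<Rightarrow> (nat \<Rightarrow> real) \<Rightarrow> real" where
  "findiff 0 a = a 0"
| "findiff (Suc k) a = findiff k (\<lambda>j. a (Suc j)) - findiff k a"

definition line_diff :: "nat \<Rightarrow> ('a::real_vector \<Rightarrow> real) \<Rightarrow> 'a \<Rightarrow> 'a \<Rightarrow> real" where
  "line_diff k f z d = findiff k (\<lambda>j. f (z + real j *\<^sub>R d))"

lemma findiff_cong: "(\<And>j. j \<le> k \<Longrightarrow> a j = b j) \<Longrightarrow> findiff k a = findiff k b"
proof (induction k arbitrary: a b)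
  case (Suc k)
  have "findiff k (\<lambda>j. a (Suc j)) = findiff k (\<lambda>j. b (Suc j))" "findiff k a = findiff k b" by (rule Suc.IH, use Suc.prems in simp)+
  then show ?case by simp
qed simp

lemma findiff_cmult: "findiff k (\<lambda>j. c * a j) = c * findiff k a"
  by (induction k arbitrary: a) (simp_all add: algebra_simps)

lemma findiff_add_const: "k > 0 \<Longrightarrow> findiff k (\<lambda>j. a j + c) = findiff k a"
proof (induction k arbitrary: a)
  case (Suc k)
  then show ?case by (cases "k = 0") simp_all
qed simp

lemma tendsto_findiff: "(\<And>j. ((\<lambda>s. a s j) \<longlongrightarrow> b j) F) \<Longrightarrow> ((\<lambda>s. findiff k (a s)) \<longlongrightarrow> findiff k b) F"
  by (induction k arbitrary: a b) (auto intro!: tendsto_diff)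

lemma line_diff_Suc: "line_diff (Suc k) f z d = line_diff k f (z + d) d - line_diff k f z d"
  by (simp add: line_diff_def algebra_simps)

lemma line_diff_1: "line_diff 1 f z d = f (z + d) - f z"
  by (simp add: line_diff_def)

text \<open>Such a difference is a combination of \<open>k\<close>-th derivatives at intermediate points: apply the mean value
  theorem to the \<open>k\<close>-th difference along the last step and use the induction hypothesis for
  the directional derivatives. The radius grows by one in each step.\<close>

lemma line_diff_bound:
  fixes f :: "'a::euclidean_space \<Rightarrow> real"
  assumes "smooth_on f UNIV"
  shows "\<exists>K\<ge>0. \<forall>z d. norm z \<le> R \<and> norm d \<le> 1 \<longrightarrow> \<bar>line_diff k f z d\<bar> \<le> K * norm d ^ k"
  using assms
proof (induction k arbitrary: f R)
  case 0
  have "compact (f ` cball 0 R)"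
    by (intro compact_continuous_image continuous_on_subset[OF smooth_onD_cont[OF 0]]) auto
  then obtain K where K: "\<forall>z\<in>cball 0 R. \<bar>f z\<bar> \<le> K" by (auto simp: bounded_iff dest!: compact_imp_bounded)
  show ?case by (rule exI[of _ "max K 0"]) (use K in \<open>force simp: line_diff_def\<close>)
next
  case (Suc k)
  let ?D = "\<lambda>b z. frechet_derivative f (at z) b"
  have "\<forall>b. \<exists>K\<ge>0. \<forall>z d. norm z \<le> R + 1 \<and> norm d \<le> 1 \<longrightarrow> \<bar>line_diff k (?D b) z d\<bar> \<le> K * norm d ^ k"
    using Suc.IH[OF smooth_on_frechet[OF Suc.prems]] by blast
  then obtain K where K: "\<And>b. K b \<ge> 0"
    "\<And>b z d. norm z \<le> R + 1 \<Longrightarrow> norm d \<le> 1 \<Longrightarrow> \<bar>line_diff k (?D b) z d\<bar> \<le> K b * norm d ^ k" by metis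
  show ?case
  proof (intro exI[of _ "\<Sum>b\<in>Basis. K b"] conjI allI impI)
    show "0 \<le> (\<Sum>b\<in>Basis. K b)" by (intro sum_nonneg K)
    fix z d :: 'a assume zd: "norm z \<le> R \<and> norm d \<le> 1"
    have der: "((\<lambda>\<tau>. f (p + \<tau> *\<^sub>R d)) has_real_derivative (\<Sum>b\<in>Basis. (d \<bullet> b) * ?D b (p + \<tau> *\<^sub>R d))) (at \<tau>)" for p \<tau>
    proof -
      have f': "(f has_derivative frechet_derivative f (at (p + \<tau> *\<^sub>R d))) (at (p + \<tau> *\<^sub>R d))"
        using smooth_on_has_derivative[OF Suc.prems] by simp
      have "((\<lambda>\<tau>. f (p + \<tau> *\<^sub>R d)) has_derivative (\<lambda>t. frechet_derivative f (at (p + \<tau> *\<^sub>R d)) (t *\<^sub>R d))) (at \<tau>)"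
        by (rule has_derivative_compose[where f = "\<lambda>\<tau>. p + \<tau> *\<^sub>R d" and g = f, OF _ f'])
          (auto intro!: derivative_eq_intros)
      moreover have "frechet_derivative f (at (p + \<tau> *\<^sub>R d)) (t *\<^sub>R d) = (\<Sum>b\<in>Basis. (d \<bullet> b) * ?D b (p + \<tau> *\<^sub>R d)) * t" for t
      proof -
        note l = has_derivative_linear[OF f']
        have "frechet_derivative f (at (p + \<tau> *\<^sub>R d)) d = frechet_derivative f (at (p + \<tau> *\<^sub>R d)) (\<Sum>b\<in>Basis. (d \<bullet> b) *\<^sub>R b)"
          by (simp add: euclidean_representation)
        then show ?thesis by (simp add: linear_scale[OF l] linear_sum[OF l])
      qed
      ultimately show ?thesis by (simp add: has_field_derivative_def)
    qed
    have findiff_der: "((\<lambda>\<tau>. findiff k (a \<tau>)) has_real_derivative findiff k a') (at \<tau>)"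
      if "\<And>j. ((\<lambda>\<tau>. a \<tau> j) has_real_derivative a' j) (at \<tau>)" for a a' k and \<tau> :: real
      using that by (induction k arbitrary: a a') (auto intro!: DERIV_diff)
    have findiff_lin: "findiff k (\<lambda>j. \<Sum>b\<in>B. c b * a b j) = (\<Sum>b\<in>B. c b * findiff k (a b))" for k and B :: "'a set" and c a
      by (induction k arbitrary: a) (simp_all add: sum_subtractf algebra_simps)
    let ?q = "\<lambda>\<tau>. line_diff k f (z + \<tau> *\<^sub>R d) d" and ?q' = "\<lambda>\<tau>. \<Sum>b\<in>Basis. (d \<bullet> b) * line_diff k (?D b) (z + \<tau> *\<^sub>R d) d"
    have q: "(?q has_real_derivative ?q' \<tau>) (at \<tau>)" for \<tau>
    proof -
      have "((\<lambda>\<tau>. f (z + \<tau> *\<^sub>R d + real j *\<^sub>R d)) has_real_derivative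
          (\<Sum>b\<in>Basis. (d \<bullet> b) * ?D b (z + \<tau> *\<^sub>R d + real j *\<^sub>R d))) (at \<tau>)" for j
        using der[of "z + real j *\<^sub>R d" \<tau>] by (simp add: algebra_simps)
      then show ?thesis unfolding line_diff_def findiff_lin[symmetric] by (rule findiff_der)
    qed
    obtain \<tau> where \<tau>: "0 < \<tau>" "\<tau> < 1" "?q 1 - ?q 0 = (1 - 0) * ?q' \<tau>" using MVT2[of 0 1 ?q ?q'] q by auto
    have "norm (z + \<tau> *\<^sub>R d) \<le> norm z + \<tau> * norm d" using norm_triangle_ineq[of z "\<tau> *\<^sub>R d"] \<tau> by simp
    also have "\<dots> \<le> R + 1" using zd \<tau> mult_le_one[of \<tau> "norm d"] by (intro add_mono) auto
    finally have n: "norm (z + \<tau> *\<^sub>R d) \<le> R + 1" .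
    have "line_diff (Suc k) f z d = ?q' \<tau>" using \<tau>(3) by (simp add: line_diff_Suc)
    also have "\<bar>?q' \<tau>\<bar> \<le> (\<Sum>b\<in>Basis. \<bar>(d \<bullet> b) * line_diff k (?D b) (z + \<tau> *\<^sub>R d) d\<bar>)" by (rule sum_abs)
    also have "\<dots> \<le> (\<Sum>b\<in>Basis. norm d * (K b * norm d ^ k))"
      unfolding abs_mult using K(2)[OF n] zd Basis_le_norm by (intro sum_mono mult_mono) auto
    finally show "\<bar>line_diff (Suc k) f z d\<bar> \<le> (\<Sum>b\<in>Basis. K b) * norm d ^ Suc k"
      by (simp add: sum_distrib_left sum_distrib_right mult_ac)
  qed
qed

context nat_op
begin

text \<open>A sequence of points tending to the origin, at which connections are prescribed.\<close>

abbreviation e0 :: "real^'m" where "e0 \<equiv> axis (SOME i. True) 1"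
abbreviation xp :: "nat \<Rightarrow> real^'m" where "xp i \<equiv> (1/2) ^ i *\<^sub>R e0"

text \<open>The parameter of the family is made a function \<open>g\<close> of one coordinate. A flat interpolation is
  constant near \<open>2\<^sup>-\<^sup>i\<close>, hence near \<open>xp i\<close> the glued connection coincides with a member of the family and
  locality identifies the tensor fields there.\<close>

lemma glued_connection:
  fixes H :: "'c::euclidean_space \<times> (real^'m) \<Rightarrow> 'm cf" and c :: "nat \<Rightarrow> 'c"
  assumes H: "smooth_on H UNIV" and c: "\<And>i. norm (c i) \<le> (1/2) ^ (i * i)"
  shows "\<exists>P. smooth_on P UNIV \<and> (\<forall>i x u. norm (x - xp i) < (1/2) ^ i / 8 \<longrightarrow> ph P (x, u) = ph (\<lambda>y. H (c i, y)) (x, u))"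
proof -
  obtain g :: "real \<Rightarrow> 'c" where g: "smooth_on g UNIV" "\<And>i s. \<bar>2 ^ i * s - 1\<bar> \<le> 1/8 \<Longrightarrow> g s = c i"
    using flat_interpolation[OF c] by blast
  define i0 :: 'm where "i0 = (SOME i. True)"
  define P where "P x = H (g (x $ i0), x)" for x :: "real^'m"
  have sP: "smooth_on P UNIV" unfolding P_def
    by (rule smooth_on_compose_UNIV[OF open_UNIV H])
      (rule smooth_on_Pair[OF open_UNIV smooth_on_compose_UNIV[OF open_UNIV g(1)]], intro smooth_intros open_UNIV, intro smooth_intros open_UNIV)
  have sH: "smooth_on (\<lambda>y. H (a, y)) UNIV" for a
    by (rule smooth_on_compose_UNIV[OF open_UNIV H]) (intro smooth_intros open_UNIV)
  have "ph P (x, u) = ph (\<lambda>y. H (c i, y)) (x, u)" if x: "norm (x - xp i) < (1/2) ^ i / 8" for i x u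
  proof (rule ph_local[OF sP sH open_ball])
    show "x \<in> ball (xp i) ((1/2) ^ i / 8)" using x by (simp add: dist_norm norm_minus_commute)
    fix y assume "y \<in> ball (xp i) ((1/2) ^ i / 8)"
    then have "norm (y - xp i) < (1/2) ^ i / 8" by (simp add: dist_norm norm_minus_commute)
    then have "\<bar>(y - xp i) $ i0\<bar> < (1/2) ^ i / 8" using component_le_norm_cart le_less_trans by blast
    then have "\<bar>y $ i0 - (1/2) ^ i\<bar> < (1/2) ^ i / 8" by (simp add: i0_def)
    then have "2 ^ i * \<bar>y $ i0 - (1/2) ^ i\<bar> < 2 ^ i * ((1/2) ^ i / 8)" by (intro mult_strict_left_mono) auto
    moreover have "2 ^ i * \<bar>y $ i0 - (1/2) ^ i\<bar> = \<bar>2 ^ i * y $ i0 - 1\<bar>"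
    proof -
      have "2 ^ i * \<bar>y $ i0 - (1/2) ^ i\<bar> = \<bar>2 ^ i * (y $ i0 - (1/2) ^ i)\<bar>" by (simp add: abs_mult)
      then show ?thesis by (simp add: right_diff_distrib power_one_over)
    qed
    moreover have "(2::real) ^ i * ((1/2) ^ i / 8) = 1/8" by (simp add: power_one_over)
    ultimately have "\<bar>2 ^ i * y $ i0 - 1\<bar> \<le> 1/8" by linarith
    then show "P y = H (c i, y)" unfolding P_def by (simp add: g(2))
  qed
  then show ?thesis using sP by blast
qed

text \<open>A uniform bound for all members of a family with small parameters, at one of the points \<open>xp i\<close>. If
  there were none, counterexamples with parameters \<open>c i\<close> and constants \<open>i\<close> at the points \<open>xp i\<close> could be
  glued to one connection, whose smooth tensor field violates \<open>line_diff_bound\<close> near the origin.\<close>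

lemma family_bound:
  fixes H :: "'c::euclidean_space \<times> (real^'m) \<Rightarrow> 'm cf"
  assumes H: "smooth_on H UNIV"
  shows "\<exists>i K \<rho>. \<rho> > 0 \<and> K \<ge> 0 \<and> (\<forall>c u d. norm c \<le> \<rho> \<and> norm u \<le> 1 \<and> norm d \<le> \<rho> \<longrightarrow>
     \<bar>line_diff k (\<lambda>z. ph (\<lambda>y. H (c, y)) z v w) (xp i, u) d\<bar> \<le> K * norm d ^ k)"
proof (rule ccontr)
  assume neg: "\<not> ?thesis"
  \<comment> \<open>The first bound makes the gluing possible, the second one keeps all points of the \<open>k\<close>-th difference in the
    neighbourhood of \<open>xp i\<close> where the glued connection is prescribed.\<close>
  define r where "r i = min ((1/2) ^ (i * i)) ((1/2) ^ i / (16 * (real k + 1)))" for i :: nat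
  have r: "r i > 0" for i by (simp add: r_def add_pos_nonneg)
  have "\<forall>i. \<exists>c u d. norm c \<le> r i \<and> norm u \<le> 1 \<and> norm d \<le> r i \<and>
     real i * norm d ^ k < \<bar>line_diff k (\<lambda>z. ph (\<lambda>y. H (c, y)) z v w) (xp i, u) d\<bar>"
    using neg r by (meson not_le of_nat_0_le_iff)
  then obtain c u d where c: "\<And>i. norm (c i) \<le> r i" and u: "\<And>i. norm (u i) \<le> 1" and d: "\<And>i. norm (d i) \<le> r i"
    and big: "\<And>i. real i * norm (d i) ^ k < \<bar>line_diff k (\<lambda>z. ph (\<lambda>y. H (c i, y)) z v w) (xp i, u i) (d i)\<bar>" by metis
  have "norm (c i) \<le> (1/2) ^ (i * i)" for i using c[of i] by (simp add: r_def)
  from glued_connection[OF H this] obtain P where P: "smooth_on P UNIV"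
    "\<And>i x u. norm (x - xp i) < (1/2) ^ i / 8 \<Longrightarrow> ph P (x, u) = ph (\<lambda>y. H (c i, y)) (x, u)" by blast
  have eq: "line_diff k (\<lambda>z. ph (\<lambda>y. H (c i, y)) z v w) (xp i, u i) (d i) = line_diff k (\<lambda>z. ph P z v w) (xp i, u i) (d i)" for i
    unfolding line_diff_def
  proof (rule findiff_cong)
    fix j assume j: "j \<le> k"
    have "norm (real j *\<^sub>R fst (d i)) \<le> real k * norm (d i)"
      using j norm_fst_le[of "fst (d i)" "snd (d i)"] by (simp add: mult_mono)
    also have "\<dots> \<le> real k * ((1/2) ^ i / (16 * (real k + 1)))" using d[of i] by (intro mult_left_mono) (auto simp: r_def)
    also have "\<dots> = (real k / (real k + 1)) * ((1/2) ^ i / 16)" by simp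
    also have "\<dots> \<le> 1 * ((1/2) ^ i / 16)" by (intro mult_right_mono) auto
    also have "\<dots> < (1/2) ^ i / 8" by simp
    finally have "norm (xp i + real j *\<^sub>R fst (d i) - xp i) < (1/2) ^ i / 8" by simp
    from P(2)[OF this, of "u i + real j *\<^sub>R snd (d i)"]
    have "ph P ((xp i, u i) + real j *\<^sub>R d i) = ph (\<lambda>y. H (c i, y)) ((xp i, u i) + real j *\<^sub>R d i)"
      by (cases "d i") (simp add: scaleR_Pair)
    then show "ph (\<lambda>y. H (c i, y)) ((xp i, u i) + real j *\<^sub>R d i) v w = ph P ((xp i, u i) + real j *\<^sub>R d i) v w"
      by simp
  qed
  from line_diff_bound[OF ph_tensor(2)[OF P(1)], of 2 k v w] obtain K where K: "K \<ge> 0"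
    "\<And>z d. norm z \<le> 2 \<and> norm d \<le> 1 \<Longrightarrow> \<bar>line_diff k (\<lambda>z. ph P z v w) z d\<bar> \<le> K * norm d ^ k" by blast
  obtain i where i: "K < real i" using reals_Archimedean2 by blast
  have "norm (xp i, u i) \<le> norm (xp i) + norm (u i)" by (rule norm_Pair_le)
  also have "\<dots> \<le> 1 + 1" using u[of i] by (intro add_mono) (auto simp: power_le_one norm_axis_1)
  finally have "norm (xp i, u i) \<le> 2" by simp
  moreover have "norm (d i) \<le> 1" using d[of i] power_le_one[of "1/2::real" "i * i"] by (simp add: r_def)
  ultimately have "real i * norm (d i) ^ k < K * norm (d i) ^ k" using K(2)[of "(xp i, u i)" "d i"] big[of i] eq[of i] by fastforce
  moreover have "K * norm (d i) ^ k \<le> real i * norm (d i) ^ k" using i by (intro mult_right_mono) auto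
  ultimately show False by simp
qed

text \<open>The bound moves from \<open>xp i\<close>, with \<open>i\<close> unknown, to the origin: include a translation of each of the two
  terms of the field among the parameters of the family. The translations needed, by \<open>t\<close> and
  \<open>c\<close> times a fixed vector, are small when \<open>t\<close> and \<open>c\<close> are.\<close>

lemma difference_bound:
  fixes G :: "real \<times> (real^'m) \<Rightarrow> 'm cf" and q :: "real^'m \<Rightarrow> 'm cf"
  assumes G: "smooth_on G UNIV" and q: "smooth_on q UNIV"
  shows "\<exists>K \<rho>. \<rho> > 0 \<and> K \<ge> 0 \<and> (\<forall>s t c u d. \<bar>s\<bar> \<le> \<rho> \<and> \<bar>t\<bar> \<le> \<rho> \<and> \<bar>c\<bar> \<le> \<rho> \<and> norm u \<le> 1 \<and> norm d \<le> \<rho> \<longrightarrow>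
     \<bar>line_diff k (\<lambda>z. ph (\<lambda>y. t *\<^sub>R G (s, t *\<^sub>R y) + q (c *\<^sub>R y)) z v w) (0, u) d\<bar> \<le> K * norm d ^ k)"
proof -
  define H :: "(real \<times> real \<times> real \<times> real \<times> real) \<times> (real^'m) \<Rightarrow> 'm cf" where
    "H p = (let s = fst (fst p); t = fst (snd (fst p)); b = fst (snd (snd (fst p)));
       c = fst (snd (snd (snd (fst p)))); e = snd (snd (snd (snd (fst p)))); x = snd p in
     t *\<^sub>R G (s, t *\<^sub>R x + b *\<^sub>R e0) + q (c *\<^sub>R x + e *\<^sub>R e0))" for p
  have H: "smooth_on H UNIV"
    unfolding H_def Let_def
    by (intro smooth_on_add smooth_on_scaleR smooth_on_compose_UNIV[OF _ G] smooth_on_compose_UNIV[OF _ q]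
        smooth_on_Pair smooth_on_fst smooth_on_snd smooth_on_id smooth_on_const open_UNIV)
  obtain i K \<rho> where \<rho>: "\<rho> > 0" "K \<ge> 0" and b: "\<And>c u d. norm c \<le> \<rho> \<Longrightarrow> norm u \<le> 1 \<Longrightarrow> norm d \<le> \<rho> \<Longrightarrow>
     \<bar>line_diff k (\<lambda>z. ph (\<lambda>y. H (c, y)) z v w) (xp i, u) d\<bar> \<le> K * norm d ^ k"
    using family_bound[OF H, of k v w] by blast
  show ?thesis
  proof (rule exI[of _ K], rule exI[of _ "\<rho> / 5"], intro conjI allI impI)
    fix s t c :: real and u :: "real^'m" and d :: "'m cot"
    assume a: "\<bar>s\<bar> \<le> \<rho> / 5 \<and> \<bar>t\<bar> \<le> \<rho> / 5 \<and> \<bar>c\<bar> \<le> \<rho> / 5 \<and> norm u \<le> 1 \<and> norm d \<le> \<rho> / 5"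
    define a where "a = (s, t, - (t * (1/2) ^ i), c, - (c * (1/2) ^ i))"
    let ?F = "\<lambda>y. t *\<^sub>R G (s, t *\<^sub>R y) + q (c *\<^sub>R y)"
    have F: "smooth_on ?F UNIV"
      by (intro smooth_on_add smooth_on_scaleR smooth_on_compose_UNIV[OF _ G] smooth_on_compose_UNIV[OF _ q]
        smooth_on_Pair smooth_on_id smooth_on_const open_UNIV)
    have "H (a, y) = ?F (y + - xp i)" for y
      by (simp add: H_def a_def Let_def scaleR_diff_right)
    then have ph: "ph (\<lambda>y. H (a, y)) (xp i + x, u) v w = ph ?F (x, u) v w" for x u
      using ph_translate[OF F, of "- xp i" "xp i + x" u v w] by simp
    have "line_diff k (\<lambda>z. ph (\<lambda>y. H (a, y)) z v w) (xp i, u) d = line_diff k (\<lambda>z. ph ?F z v w) (0, u) d"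
      unfolding line_diff_def using ph by (cases d) (simp add: scaleR_Pair)
    moreover have "norm a \<le> \<rho>"
    proof -
      have p: "\<bar>x * (1/2) ^ i\<bar> \<le> \<bar>x\<bar>" for x :: real
        by (simp add: abs_mult mult_left_le power_le_one)
      have "norm a \<le> \<bar>s\<bar> + (\<bar>t\<bar> + (\<bar>t * (1/2) ^ i\<bar> + (\<bar>c\<bar> + \<bar>c * (1/2) ^ i\<bar>)))"
        unfolding a_def by (intro order_trans[OF norm_Pair_le] add_mono) (auto simp: abs_mult)
      also have "\<dots> \<le> \<rho>" using p[of t] p[of c] a by linarith
      finally show ?thesis .
    qed
    ultimately show "\<bar>line_diff k (\<lambda>z. ph ?F z v w) (0, u) d\<bar> \<le> K * norm d ^ k" using b[of a u d] a \<rho> by auto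
  qed (use \<rho> in auto)
qed

lemma ph_scaled:
  assumes P: "smooth_on P UNIV" and t: "t \<noteq> 0"
  shows "ph P (x, u) (a, a') (b, b') =
    ph (\<lambda>y. t *\<^sub>R P (t *\<^sub>R y)) (x /\<^sub>R t, t *\<^sub>R u) (a /\<^sub>R t, t *\<^sub>R a') (b /\<^sub>R t, t *\<^sub>R b')"
  using ph_homothety[OF P t, of "x /\<^sub>R t" "t *\<^sub>R u" "a /\<^sub>R t" "t *\<^sub>R a'" "b /\<^sub>R t" "t *\<^sub>R b'"] t by simp

text \<open>If continuity failed along a sequence of parameters \<open>s i\<close>, glue the members with parameters \<open>s i\<close> for even
  \<open>i\<close> with copies of the limit for odd \<open>i\<close>. The tensor field of the glued connection is continuous at
  the origin, so the values at \<open>xp i\<close> along both subsequences have the same limit. A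
  Lipschitz bound that is uniform in the family passes from \<open>xp i\<close> to the origin.\<close>

lemma ph_continuous:
  fixes G :: "real \<times> (real^'m) \<Rightarrow> 'm cf"
  assumes G: "smooth_on G UNIV" and uu: "(uu \<longlongrightarrow> u0) (at 0)"
  shows "((\<lambda>s. ph (\<lambda>y. G (s, y)) (0, uu s) v w) \<longlongrightarrow> ph (\<lambda>y. G (0, y)) (0, u0) v w) (at 0)"
proof (rule ccontr)
  assume "\<not> ?thesis"
  then obtain e where e: "e > 0" and "\<not> (\<forall>\<^sub>F s in at 0. dist (ph (\<lambda>y. G (s, y)) (0, uu s) v w) (ph (\<lambda>y. G (0, y)) (0, u0) v w) < e)"
    unfolding tendsto_iff by blast
  then have far: "\<exists>s. s \<noteq> 0 \<and> \<bar>s\<bar> < \<delta> \<and> \<not> dist (ph (\<lambda>y. G (s, y)) (0, uu s) v w) (ph (\<lambda>y. G (0, y)) (0, u0) v w) < e" if "\<delta> > 0" for \<delta>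
    using that unfolding eventually_at by (auto simp: dist_real_def)
  have "\<forall>i::nat. \<exists>s. s \<noteq> 0 \<and> \<bar>s\<bar> < (1/2) ^ (i * i + i) \<and> \<not> dist (ph (\<lambda>y. G (s, y)) (0, uu s) v w) (ph (\<lambda>y. G (0, y)) (0, u0) v w) < e"
    using far by (simp add: zero_less_power)
  then obtain s where s: "\<And>i. s i \<noteq> 0" "\<And>i. \<bar>s i\<bar> < (1/2) ^ (i * i + i)"
    and sfar: "\<And>i. \<not> dist (ph (\<lambda>y. G (s i, y)) (0, uu (s i)) v w) (ph (\<lambda>y. G (0, y)) (0, u0) v w) < e" by metis
  define c where "c i = (if even i then s i else 0)" for i :: nat
  have "norm (c i) \<le> (1/2) ^ (i * i)" for i
  proof -
    have "(1/2::real) ^ (i * i + i) \<le> (1/2) ^ (i * i)" by (intro power_decreasing) auto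
    then have "\<bar>s i\<bar> \<le> (1/2) ^ (i * i)" using s(2)[of i] by linarith
    then show ?thesis unfolding c_def by (cases "even i") simp_all
  qed
  from glued_connection[OF G this] obtain P where P: "smooth_on P UNIV"
    "\<And>i x u. norm (x - xp i) < (1/2) ^ i / 8 \<Longrightarrow> ph P (x, u) = ph (\<lambda>y. G (c i, y)) (x, u)" by blast
  have Pi: "ph P (xp i, u) = ph (\<lambda>y. G (c i, y)) (xp i, u)" for i u by (rule P(2)) simp
  have Gs: "smooth_on (\<lambda>y. G (a, y)) UNIV" for a
    by (rule smooth_on_compose_UNIV[OF open_UNIV G]) (intro smooth_intros open_UNIV)
  have cont: "isCont (\<lambda>z. ph Q z v w) z" if "smooth_on Q UNIV" for Q z
    using smooth_onD_cont[OF ph_tensor(2)[OF that], of v w]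
      continuous_on_eq_continuous_at[OF open_UNIV, of "\<lambda>z. ph Q z v w"] by blast
  have xp0: "xp \<longlonglongrightarrow> 0" using tendsto_scaleR[OF LIMSEQ_power_zero[of "1/2::real"] tendsto_const[of e0]] by simp
  have s0: "s \<longlonglongrightarrow> 0"
  proof (rule tendsto_rabs_zero_cancel, rule tendsto_sandwich[OF _ _ tendsto_const])
    show "(\<lambda>i. (1/2::real) ^ i) \<longlonglongrightarrow> 0" by (rule LIMSEQ_power_zero) simp
    show "\<forall>\<^sub>F i in sequentially. \<bar>s i\<bar> \<le> (1/2) ^ i"
    proof (rule always_eventually, rule allI)
      fix i
      have "(1/2::real) ^ (i * i + i) \<le> (1/2) ^ i" by (intro power_decreasing) auto
      then show "\<bar>s i\<bar> \<le> (1/2) ^ i" using s(2)[of i] by linarith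
    qed
  qed simp
  have us: "(\<lambda>i. uu (s i)) \<longlonglongrightarrow> u0"
    by (rule filterlim_compose[OF uu]) (use s0 s(1) in \<open>simp add: filterlim_at\<close>)
  let ?ev = "\<lambda>i::nat. 2 * i" and ?od = "\<lambda>i::nat. 2 * i + 1"
  have sub: "strict_mono ?ev" "strict_mono ?od" by (auto simp: strict_mono_def)
  have evs: "(\<lambda>i. X (?ev i)) \<longlonglongrightarrow> L" "(\<lambda>i. X (?od i)) \<longlonglongrightarrow> L" if "X \<longlonglongrightarrow> L" for X :: "nat \<Rightarrow> 'z::topological_space" and L
    using LIMSEQ_subseq_LIMSEQ[OF that sub(1)] LIMSEQ_subseq_LIMSEQ[OF that sub(2)] by (simp_all add: comp_def)
  \<comment> \<open>Along the odd points the glued connection equals the limit of the family.\<close>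
  have "(\<lambda>i. ph P (xp (?od i), u0) v w) \<longlonglongrightarrow> ph P (0, u0) v w"
    by (rule isCont_tendsto_compose[OF cont[OF P(1)]]) (intro tendsto_Pair evs(2)[OF xp0] tendsto_const)
  moreover have "(\<lambda>i. ph P (xp (?od i), u0) v w) = (\<lambda>i. ph (\<lambda>y. G (0, y)) (xp (?od i), u0) v w)"
    unfolding Pi c_def by simp
  moreover have "(\<lambda>i. ph (\<lambda>y. G (0, y)) (xp (?od i), u0) v w) \<longlonglongrightarrow> ph (\<lambda>y. G (0, y)) (0, u0) v w"
    by (rule isCont_tendsto_compose[OF cont[OF Gs]]) (intro tendsto_Pair evs(2)[OF xp0] tendsto_const)
  ultimately have L: "ph P (0, u0) v w = ph (\<lambda>y. G (0, y)) (0, u0) v w" using LIMSEQ_unique by metis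
  have "(\<lambda>i. ph P (xp (?ev i), uu (s (?ev i))) v w) \<longlonglongrightarrow> ph P (0, u0) v w"
    by (rule isCont_tendsto_compose[OF cont[OF P(1)]]) (intro tendsto_Pair evs(1)[OF xp0] evs(1)[OF us])
  then have 1: "(\<lambda>i. ph (\<lambda>y. G (s (?ev i), y)) (xp (?ev i), uu (s (?ev i))) v w) \<longlonglongrightarrow> ph (\<lambda>y. G (0, y)) (0, u0) v w"
    unfolding Pi c_def L by simp
  \<comment> \<open>A uniform Lipschitz bound compares the values at \<open>xp i\<close> and at the origin.\<close>
  obtain a a' b b' where vw: "v = (a, a')" "w = (b, b')" by (cases v, cases w)
  define B where "B = norm u0 + 1"
  have B: "B > 0" by (simp add: B_def add_nonneg_pos)
  have "\<exists>K. \<forall>\<^sub>F i in sequentially. \<bar>ph (\<lambda>y. G (s i, y)) (xp i, uu (s i)) v w - ph (\<lambda>y. G (s i, y)) (0, uu (s i)) v w\<bar> \<le> K * (1/2) ^ i"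
  proof -
    \<comment> \<open>The bound holds for rescaled fields; the factor \<open>t\<close> must not depend on the bound, so the
      argument vectors are rescaled afterwards by bilinearity.\<close>
    have bil: "bilinear (ph Q z)" if "smooth_on Q UNIV" for Q z by (rule ph_tensor(1)[OF that])
    have split: "ph Q z v w = ph Q z (a, 0) (b, 0) + ph Q z (a, 0) (0, b') + ph Q z (0, a') (b, 0) + ph Q z (0, a') (0, b')"
      if "smooth_on Q UNIV" for Q z
      using bilinear_ladd[OF bil[OF that, of z], of "(a, 0)" "(0, a')" w]
        bilinear_radd[OF bil[OF that, of z], of _ "(b, 0)" "(0, b')"]
      unfolding vw by simp
    have one: "\<exists>K. \<forall>\<^sub>F i in sequentially. \<bar>ph (\<lambda>y. G (s i, y)) (xp i, uu (s i)) p q - ph (\<lambda>y. G (s i, y)) (0, uu (s i)) p q\<bar> \<le> K * (1/2) ^ i"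
      if pq: "p = (a, 0) \<or> p = (0, a')" "q = (b, 0) \<or> q = (0, b')" for p q
    proof -
      obtain K \<rho> where \<rho>: "\<rho> > 0" "K \<ge> 0" and bd: "\<And>s t c u d. \<bar>s\<bar> \<le> \<rho> \<Longrightarrow> \<bar>t\<bar> \<le> \<rho> \<Longrightarrow> \<bar>c\<bar> \<le> \<rho> \<Longrightarrow> norm u \<le> 1 \<Longrightarrow> norm d \<le> \<rho> \<Longrightarrow>
         \<bar>line_diff 1 (\<lambda>z. ph (\<lambda>y. t *\<^sub>R G (s, t *\<^sub>R y) + 0) z p q) (0, u) d\<bar> \<le> K * norm d ^ 1"
        using difference_bound[OF G smooth_on_const[OF open_UNIV, of 0], of 1 p q] by blast
      define t where "t = min \<rho> (1 / B)"
      have t: "t > 0" "\<bar>t\<bar> \<le> \<rho>" "t * B \<le> 1" using \<rho> B by (auto simp: t_def min_def field_simps)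

      \<comment> \<open>Under the homothety a horizontal argument is divided by \<open>t\<close> and a vertical one multiplied.\<close>
      have sc: "\<exists>m. \<forall>Q z. smooth_on Q UNIV \<longrightarrow> ph Q z p q = m * ph (\<lambda>y. t *\<^sub>R Q (t *\<^sub>R y)) (fst z /\<^sub>R t, t *\<^sub>R snd z) p q"
      proof -
        have "\<exists>m. (fst p /\<^sub>R t, t *\<^sub>R snd p) = m *\<^sub>R p" using pq(1)
          by (elim disjE) (rule exI[of _ "inverse t"], simp, rule exI[of _ t], simp)
        then obtain m1 where m1: "(fst p /\<^sub>R t, t *\<^sub>R snd p) = m1 *\<^sub>R p" ..
        have "\<exists>m. (fst q /\<^sub>R t, t *\<^sub>R snd q) = m *\<^sub>R q" using pq(2)
          by (elim disjE) (rule exI[of _ "inverse t"], simp, rule exI[of _ t], simp)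
        then obtain m2 where m2: "(fst q /\<^sub>R t, t *\<^sub>R snd q) = m2 *\<^sub>R q" ..
        show ?thesis
        proof (intro exI[of _ "m1 * m2"] allI impI)
          fix Q :: "real^'m \<Rightarrow> 'm cf" and z :: "'m cot" assume Q: "smooth_on Q UNIV"
          have sQ: "smooth_on (\<lambda>y. t *\<^sub>R Q (t *\<^sub>R y)) UNIV"
            using smooth_affine[OF Q, of t 0] by (intro smooth_on_scaleR smooth_on_const open_UNIV) auto
          note bl = ph_tensor(1)[OF sQ]
          show "ph Q z p q = m1 * m2 * ph (\<lambda>y. t *\<^sub>R Q (t *\<^sub>R y)) (fst z /\<^sub>R t, t *\<^sub>R snd z) p q"
            using ph_scaled[OF Q, of t "fst z" "snd z" "fst p" "snd p" "fst q" "snd q"] t(1)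
            by (simp add: m1 m2 bilinear_lmul[OF bl] bilinear_rmul[OF bl])
        qed
      qed
      then obtain m where m: "\<And>Q z. smooth_on Q UNIV \<Longrightarrow> ph Q z p q = m * ph (\<lambda>y. t *\<^sub>R Q (t *\<^sub>R y)) (fst z /\<^sub>R t, t *\<^sub>R snd z) p q" by blast
      show ?thesis
      proof (intro exI[of _ "\<bar>m\<bar> * (K / t)"])
        have "\<forall>\<^sub>F i in sequentially. dist (uu (s i)) u0 < 1" using us by (rule tendstoD) simp
        moreover have "\<forall>\<^sub>F i in sequentially. dist (s i) 0 < \<rho>" using s0 \<rho>(1) by (rule tendstoD)
        moreover have "(\<lambda>i. (1/2::real) ^ i) \<longlonglongrightarrow> 0" by (rule LIMSEQ_power_zero) simp
        then have "\<forall>\<^sub>F i in sequentially. (1/2::real) ^ i < \<rho> * t" by (rule order_tendstoD(2)) (use \<rho> t in simp)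
        ultimately show "\<forall>\<^sub>F i in sequentially. \<bar>ph (\<lambda>y. G (s i, y)) (xp i, uu (s i)) p q - ph (\<lambda>y. G (s i, y)) (0, uu (s i)) p q\<bar> \<le> \<bar>m\<bar> * (K / t) * (1/2) ^ i"
        proof eventually_elim
          fix i assume i: "dist (uu (s i)) u0 < 1" "dist (s i) 0 < \<rho>" "(1/2::real) ^ i < \<rho> * t"
          have "norm (uu (s i)) \<le> norm u0 + norm (uu (s i) - u0)" by (rule norm_triangle_sub)
          then have "norm (uu (s i)) \<le> B" using i(1) by (simp add: B_def dist_norm)
          then have "t * norm (uu (s i)) \<le> t * B" using t by (intro mult_left_mono) auto
          moreover have "norm (t *\<^sub>R uu (s i)) = t * norm (uu (s i))" using t by simp
          ultimately have n: "norm (t *\<^sub>R uu (s i)) \<le> 1" using t(3) by linarith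
          let ?d = "(xp i /\<^sub>R t, 0 :: real^'m)"
          have "norm ?d = norm (xp i /\<^sub>R t)" by (rule norm_Pair2)
          also have "\<dots> = inverse t * ((1/2) ^ i * 1)" using t(1)
            by (simp only: norm_scaleR norm_axis_1 abs_inverse abs_of_pos) simp
          finally have findiff: "norm ?d = (1/2) ^ i / t" by (simp only: divide_inverse mult.commute mult_1_right)
          have le: "(1/2) ^ i / t \<le> \<rho>"
            by (rule pos_divide_le_eq[OF t(1), THEN iffD2]) (rule less_imp_le[OF i(3)])
          have si: "\<bar>s i\<bar> \<le> \<rho>" using i(2) by (simp add: dist_real_def)
          have "\<bar>line_diff 1 (\<lambda>z. ph (\<lambda>y. t *\<^sub>R G (s i, t *\<^sub>R y) + 0) z p q) (0, t *\<^sub>R uu (s i)) ?d\<bar> \<le> K * norm ?d ^ 1"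
            by (rule bd[of "s i" t 0 "t *\<^sub>R uu (s i)" ?d, OF si t(2) _ n])
              (simp_all only: findiff le abs_zero less_imp_le[OF \<rho>(1)])
          moreover define X where "X = ph (\<lambda>y. t *\<^sub>R G (s i, t *\<^sub>R y)) (xp i /\<^sub>R t, t *\<^sub>R uu (s i)) p q"
          moreover define Y where "Y = ph (\<lambda>y. t *\<^sub>R G (s i, t *\<^sub>R y)) (0, t *\<^sub>R uu (s i)) p q"
          moreover have "(0, t *\<^sub>R uu (s i)) + ?d = (xp i /\<^sub>R t, t *\<^sub>R uu (s i))" by simp
          ultimately have XY: "\<bar>X - Y\<bar> \<le> K * ((1/2) ^ i / t)"
            unfolding findiff power_one_right line_diff_1 by (simp only: add_0_right)
          have "ph (\<lambda>y. G (s i, y)) (xp i, uu (s i)) p q - ph (\<lambda>y. G (s i, y)) (0, uu (s i)) p q = m * (X - Y)"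
            unfolding m[OF Gs[of "s i"], of "(xp i, uu (s i))"] m[OF Gs[of "s i"], of "(0, uu (s i))"]
              X_def Y_def right_diff_distrib fst_conv snd_conv scaleR_zero_right ..
          then have "\<bar>ph (\<lambda>y. G (s i, y)) (xp i, uu (s i)) p q - ph (\<lambda>y. G (s i, y)) (0, uu (s i)) p q\<bar> = \<bar>m\<bar> * \<bar>X - Y\<bar>"
            by (simp only: abs_mult)
          also have "\<dots> \<le> \<bar>m\<bar> * (K * ((1/2) ^ i / t))" by (rule mult_left_mono[OF XY abs_ge_zero])
          also have "\<dots> = \<bar>m\<bar> * (K / t) * (1/2) ^ i" by (simp only: times_divide_eq_left times_divide_eq_right mult_ac)
          finally show "\<bar>ph (\<lambda>y. G (s i, y)) (xp i, uu (s i)) p q - ph (\<lambda>y. G (s i, y)) (0, uu (s i)) p q\<bar> \<le> \<bar>m\<bar> * (K / t) * (1/2) ^ i" .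

        qed
      qed
    qed
    obtain K1 where K1:
      "\<forall>\<^sub>F i in sequentially. \<bar>ph (\<lambda>y. G (s i, y)) (xp i, uu (s i)) (a, 0) (b, 0) - ph (\<lambda>y. G (s i, y)) (0, uu (s i)) (a, 0) (b, 0)\<bar> \<le> K1 * (1/2) ^ i"
      using one[of "(a, 0)" "(b, 0)"] by auto
    obtain K2 where K2:
      "\<forall>\<^sub>F i in sequentially. \<bar>ph (\<lambda>y. G (s i, y)) (xp i, uu (s i)) (a, 0) (0, b') - ph (\<lambda>y. G (s i, y)) (0, uu (s i)) (a, 0) (0, b')\<bar> \<le> K2 * (1/2) ^ i"
      using one[of "(a, 0)" "(0, b')"] by auto
    obtain K3 where K3:
      "\<forall>\<^sub>F i in sequentially. \<bar>ph (\<lambda>y. G (s i, y)) (xp i, uu (s i)) (0, a') (b, 0) - ph (\<lambda>y. G (s i, y)) (0, uu (s i)) (0, a') (b, 0)\<bar> \<le> K3 * (1/2) ^ i"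
      using one[of "(0, a')" "(b, 0)"] by auto
    obtain K4 where K4:
      "\<forall>\<^sub>F i in sequentially. \<bar>ph (\<lambda>y. G (s i, y)) (xp i, uu (s i)) (0, a') (0, b') - ph (\<lambda>y. G (s i, y)) (0, uu (s i)) (0, a') (0, b')\<bar> \<le> K4 * (1/2) ^ i"
      using one[of "(0, a')" "(0, b')"] by auto
    from K1 K2 K3 K4 have "\<forall>\<^sub>F i in sequentially. \<bar>ph (\<lambda>y. G (s i, y)) (xp i, uu (s i)) v w - ph (\<lambda>y. G (s i, y)) (0, uu (s i)) v w\<bar> \<le> (K1 + K2 + K3 + K4) * (1/2) ^ i"
      by eventually_elim (simp add: split[OF Gs] algebra_simps)
    then show ?thesis by blast
  qed
  then obtain K where K: "\<forall>\<^sub>F i in sequentially. \<bar>ph (\<lambda>y. G (s i, y)) (xp i, uu (s i)) v w - ph (\<lambda>y. G (s i, y)) (0, uu (s i)) v w\<bar> \<le> K * (1/2) ^ i" by blast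
  have "(\<lambda>i. K * (1/2) ^ i) \<longlonglongrightarrow> 0" using tendsto_mult_right_zero[OF LIMSEQ_power_zero[of "1/2::real"]] by simp
  then have "(\<lambda>i. \<bar>ph (\<lambda>y. G (s i, y)) (xp i, uu (s i)) v w - ph (\<lambda>y. G (s i, y)) (0, uu (s i)) v w\<bar>) \<longlonglongrightarrow> 0"
    by (rule tendsto_sandwich[OF _ K tendsto_const, rotated]) simp
  then have "(\<lambda>i. ph (\<lambda>y. G (s i, y)) (xp i, uu (s i)) v w - ph (\<lambda>y. G (s i, y)) (0, uu (s i)) v w) \<longlonglongrightarrow> 0"
    by (rule tendsto_rabs_zero_cancel)
  from tendsto_diff[OF 1 evs(1)[OF this]]
  have "(\<lambda>i. ph (\<lambda>y. G (s (?ev i), y)) (0, uu (s (?ev i))) v w) \<longlonglongrightarrow> ph (\<lambda>y. G (0, y)) (0, u0) v w" by simp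
  from tendstoD[OF this e] have "\<forall>\<^sub>F i in sequentially. False" by eventually_elim (use sfar in blast)
  then show False by simp
qed

end

section \<open>Reduction of the order and polynomial form\<close>

text \<open>Additivity gives the claim at rational multiples; these are approximated by
  \<open>\<lfloor>n t\<rfloor> / n\<close>.\<close>

lemma real_additive_linear:
  fixes g :: "real \<Rightarrow> real"
  assumes add: "\<And>x y. g (x + y) = g x + g y" and c: "(g \<longlongrightarrow> 0) (at 0)"
  shows "g t = t * g 1"
proof -
  have nat: "g (real n * x) = real n * g x" for n x
  proof (induction n)
    case 0
    then show ?case using add[of 0 0] by simp
  next
    case (Suc n)
    then show ?case using add[of "real n * x" x] by (simp add: algebra_simps)
  qed
  have neg: "g (- x) = - g x" for x using add[of x "- x"] nat[of 0 x] by simp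
  have int: "g (of_int k * x) = of_int k * g x" for k x
    using nat[of "nat k" x] nat[of "nat (- k)" x] neg[of "of_int (- k) * x"] by (cases "k \<ge> 0") auto
  define d where "d n = t - of_int \<lfloor>real (Suc n) * t\<rfloor> / real (Suc n)" for n
  have gd: "g (d n) = g t - (of_int \<lfloor>real (Suc n) * t\<rfloor> / real (Suc n)) * g 1" for n
  proof -
    have "real (Suc n) * g (1 / real (Suc n)) = g 1" using nat[of "Suc n" "1 / real (Suc n)"] by simp
    then have "g (1 / real (Suc n)) = g 1 / real (Suc n)" by (simp add: field_simps)
    then have "g (of_int \<lfloor>real (Suc n) * t\<rfloor> / real (Suc n)) = of_int \<lfloor>real (Suc n) * t\<rfloor> * (g 1 / real (Suc n))"
      using int[of "\<lfloor>real (Suc n) * t\<rfloor>" "1 / real (Suc n)"] by simp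
    moreover have "g t = g (d n) + g (of_int \<lfloor>real (Suc n) * t\<rfloor> / real (Suc n))"
      using add[of "d n" "of_int \<lfloor>real (Suc n) * t\<rfloor> / real (Suc n)"] by (simp add: d_def)
    ultimately show ?thesis by simp
  qed
  have bd: "0 \<le> d n" "d n \<le> 1 / real (Suc n)" for n
  proof -
    have "of_int \<lfloor>real (Suc n) * t\<rfloor> \<le> real (Suc n) * t" "real (Suc n) * t \<le> of_int \<lfloor>real (Suc n) * t\<rfloor> + 1"
      by linarith+
    moreover have "real (Suc n) * d n = real (Suc n) * t - of_int \<lfloor>real (Suc n) * t\<rfloor>"
      unfolding d_def right_diff_distrib by simp
    ultimately have "0 \<le> real (Suc n) * d n" "real (Suc n) * d n \<le> 1" by linarith+
    then show "0 \<le> d n" "d n \<le> 1 / real (Suc n)" 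
      by (simp add: zero_le_mult_iff, subst pos_le_divide_eq) (simp_all add: mult.commute)
  qed
  have d0: "d \<longlonglongrightarrow> 0"
  proof (rule tendsto_sandwich[OF _ _ tendsto_const])
    show "(\<lambda>n. 1 / real (Suc n)) \<longlonglongrightarrow> 0" using LIMSEQ_inverse_real_of_nat by (simp add: inverse_eq_divide)
  qed (use bd in auto)
  have "g 0 = 0" using add[of 0 0] by simp
  then have "isCont g 0" using c by (simp add: isCont_def)
  from isCont_tendsto_compose[OF this d0] have 1: "(\<lambda>n. g (d n)) \<longlonglongrightarrow> 0" using \<open>g 0 = 0\<close> by simp
  have "(\<lambda>n. g t - (t - d n) * g 1) \<longlonglongrightarrow> g t - (t - 0) * g 1"
    by (intro tendsto_diff tendsto_mult tendsto_const d0)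
  moreover have "g (d n) = g t - (t - d n) * g 1" for n unfolding gd by (simp add: d_def)
  ultimately have "(\<lambda>n. g (d n)) \<longlonglongrightarrow> g t - t * g 1" by simp
  with 1 have "0 = g t - t * g 1" using LIMSEQ_unique by blast
  then show ?thesis by simp
qed

lemma findiff_3: "findiff 3 a = a 3 - 3 * a 2 + 3 * a 1 - a 0"
  by (simp add: eval_nat_numeral)

text \<open>A function that is homogeneous of degree two, continuous along lines and has vanishing third
  differences is a quadratic form: along a line it is quadratic on the integers, homogeneity
  identifies the leading coefficient, and this gives the parallelogram law.\<close>

lemma quadratic_form:
  fixes a :: "'z::real_vector \<Rightarrow> real"
  assumes hom: "\<And>t z. t \<noteq> 0 \<Longrightarrow> a (t *\<^sub>R z) = t\<^sup>2 * a z"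
    and d3: "\<And>z w. findiff 3 (\<lambda>j. a (z + real j *\<^sub>R w)) = 0"
    and cont: "\<And>z w. ((\<lambda>s. a (z + s *\<^sub>R w)) \<longlongrightarrow> a z) (at 0)"
  shows "\<exists>B. bilinear B \<and> (\<forall>z. a z = B z z)"
proof -
  have d3': "a (z + 3 *\<^sub>R w) = 3 * a (z + 2 *\<^sub>R w) - 3 * a (z + w) + a z" for z w
    using d3[of z w] by (simp add: findiff_3)
  have para: "a (z + w) + a (z - w) = 2 * a z + 2 * a w" for z w
  proof -
    \<comment> \<open>On the integers \<open>a (z + n w)\<close> satisfies the recursion of a quadratic polynomial. By homogeneity its
      leading coefficient is the limit of \<open>a (w + z / n)\<close>, that is, \<open>a w\<close>.\<close>
    define p where "p n = a (z + real n *\<^sub>R w)" for n :: nat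
    define c2 where "c2 = p 2 - 2 * p 1 + p 0"
    define c1 where "c1 = p 1 - p 0 - c2 / 2"
    define e where "e n = p n - (p 0 + c1 * real n + c2 / 2 * (real n)\<^sup>2)" for n
    have "p (n + 3) = 3 * p (n + 2) - 3 * p (n + 1) + p n" for n
      using d3'[of "z + real n *\<^sub>R w" w] by (simp add: p_def algebra_simps)
    then have rec: "e (n + 3) = 3 * e (n + 2) - 3 * e (n + 1) + e n" for n
      by (simp add: e_def power2_eq_square algebra_simps)
    have e012: "e 0 = 0" "e 1 = 0" "e 2 = 0" by (simp_all add: e_def c1_def c2_def power2_eq_square field_simps)
    have "e n = 0 \<and> e (n + 1) = 0 \<and> e (n + 2) = 0" for n
    proof (induction n)
      case 0
      then show ?case using e012 by (simp add: numeral_2_eq_2)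
    next
      case (Suc n)
      then show ?case using rec[of n] by (simp add: numeral_3_eq_3)
    qed
    then have "e n = 0" for n by blast
    then have form: "p n = p 0 + c1 * real n + c2 / 2 * (real n)\<^sup>2" for n
      unfolding e_def by (rule right_minus_eq[THEN iffD1])
    define x where "x n = inverse (real (Suc n))" for n
    have x0: "x \<longlonglongrightarrow> 0" unfolding x_def by (rule LIMSEQ_inverse_real_of_nat)
    have xn: "x n \<noteq> 0" "x n * real (Suc n) = 1" for n by (simp_all add: x_def del: of_nat_Suc)
    have "(\<lambda>n. a (w + x n *\<^sub>R z)) \<longlonglongrightarrow> a w"
      by (rule filterlim_compose[OF cont]) (use x0 xn in \<open>simp add: filterlim_at\<close>)
    moreover have "a (w + x n *\<^sub>R z) = p 0 * (x n)\<^sup>2 + c1 * x n + c2 / 2" for n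
    proof -
      have "w + x n *\<^sub>R z = x n *\<^sub>R (z + real (Suc n) *\<^sub>R w)"
        by (simp only: scaleR_add_right scaleR_scaleR xn) (simp add: add.commute)
      then have "a (w + x n *\<^sub>R z) = (x n)\<^sup>2 * p (Suc n)"
        using hom[OF xn(1), of n "z + real (Suc n) *\<^sub>R w"] by (simp add: p_def)
      also have "\<dots> = p 0 * (x n)\<^sup>2 + c1 * x n * (x n * real (Suc n)) + c2 / 2 * (x n * real (Suc n))\<^sup>2"
        unfolding form[of "Suc n"] by (simp only: power2_eq_square ring_distribs mult_ac)
      finally show ?thesis unfolding xn by simp
    qed
    moreover have "(\<lambda>n. p 0 * (x n)\<^sup>2 + c1 * x n + c2 / 2) \<longlonglongrightarrow> p 0 * 0\<^sup>2 + c1 * 0 + c2 / 2"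
      by (intro tendsto_add tendsto_mult tendsto_power tendsto_const x0)
    ultimately have "a w = p 0 * 0\<^sup>2 + c1 * 0 + c2 / 2" using LIMSEQ_unique by (simp only:)
    then have "a w = c2 / 2" by simp
    moreover have "a (z - w) = p 2 - 3 * p 1 + 3 * p 0"
    proof -
      have e: "z - w + 3 *\<^sub>R w = z + 2 *\<^sub>R w" "z - w + 2 *\<^sub>R w = z + w" "z - w + w = z"
        using scaleR_left_distrib[of 2 1 w] by (simp_all add: scaleR_2)
      show ?thesis using d3'[of "z - w" w] unfolding e by (simp add: p_def)
    qed
    ultimately show ?thesis by (simp add: c2_def p_def)
  qed
  have a0: "a 0 = 0" using hom[of 2 0] by simp
  define b where "b z w = a (z + w) - a z - a w" for z w
  have sym: "b z w = b w z" for z w by (simp add: b_def add.commute)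
  have add: "b (x + y) w = b x w + b y w" for x y w
  proof -
    have 1: "a (x + y + w) + a (x + y - w) = 2 * a (x + y) + 2 * a w" by (rule para)
    have 2: "a (x + w + y) + a (x + w - y) = 2 * a (x + w) + 2 * a y" by (rule para)
    have 3: "a (y + w + x) + a (y + w - x) = 2 * a (y + w) + 2 * a x" by (rule para)
    have 4: "a (w + (x - y)) + a (w - (x - y)) = 2 * a w + 2 * a (x - y)" by (rule para)
    have 5: "a (x + y) + a (x - y) = 2 * a x + 2 * a y" by (rule para)
    show ?thesis using 2 3 4 5 unfolding b_def by (simp add: algebra_simps)
  qed
  have scale: "b (t *\<^sub>R z) w = t * b z w" for t z w
  proof -
    have "b (t *\<^sub>R z) w = t * b (1 *\<^sub>R z) w"
    proof (rule real_additive_linear)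
      show "b ((x + y) *\<^sub>R z) w = b (x *\<^sub>R z) w + b (y *\<^sub>R z) w" for x y
        using add by (simp add: scaleR_left_distrib)
      have "((\<lambda>s. a (w + s *\<^sub>R z) - a (0 + s *\<^sub>R z) - a w) \<longlongrightarrow> a w - a 0 - a w) (at 0)"
        by (intro tendsto_diff cont tendsto_const)
      then show "((\<lambda>s. b (s *\<^sub>R z) w) \<longlongrightarrow> 0) (at 0)" by (simp add: b_def a0 add.commute)
    qed
    then show ?thesis by simp
  qed
  have "bilinear (\<lambda>z w. b z w / 2)"
  proof -
    have "b w (x + y) = b w x + b w y" "b w (t *\<^sub>R x) = t * b w x" for w x y t
      unfolding sym[of w] by (rule add, rule scale)
    then show ?thesis unfolding bilinear_def by (intro conjI allI linearI) (simp_all add: add scale add_divide_distrib)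
  qed
  moreover have "a z = b z z / 2" for z using hom[of 2 z] by (simp add: b_def scaleR_2)
  ultimately show ?thesis by blast
qed

text \<open>Monomials are indexed by lists, like the iterated partial derivatives \<open>pds\<close>.\<close>

definition mon :: "'m list \<Rightarrow> real^'m::finite \<Rightarrow> real" where
  "mon is y = prod_list (map (\<lambda>i. y $ i) is)"

lemma smooth_on_mon: "open S \<Longrightarrow> smooth_on (mon is) S"
proof (induction "is")
  case Nil
  then show ?case by (simp add: mon_def smooth_on_const)
next
  case (Cons i "is")
  then have "smooth_on (\<lambda>y. y $ i * mon is y) S" by (intro smooth_on_mult smooth_on_vec_nth smooth_on_id)
  then show ?case by (simp add: mon_def)
qed

lemma mon_scale: "mon is (t *\<^sub>R y) = t ^ length is * mon is y"
  by (induction "is") (simp_all add: mon_def)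

text \<open>Separating the powers of one variable; \<open>mon_shift\<close> says that the other factor is constant in its direction.\<close>

lemma mon_split: "mon is y = (y $ i) ^ length (filter ((=) i) is) * mon (filter ((\<noteq>) i) is) y"
  by (induction "is") (simp_all add: mon_def)

lemma mon_shift: "mon (filter ((\<noteq>) i) is) (y + s *\<^sub>R axis i 1) = mon (filter ((\<noteq>) i) is) y"
  by (induction "is") (auto simp: mon_def axis_def)

text \<open>The sum runs over all lists and not over multisets; the symmetric arrays to which it is applied make
  the Taylor formula hold with the factor \<open>1 / fact n\<close>.\<close>

definition sym_poly :: "nat \<Rightarrow> ('m list \<Rightarrow> real) \<Rightarrow> real^'m::finite \<Rightarrow> real" where
  "sym_poly n a y = (\<Sum>is\<in>{is. length is = n}. a is * mon is y)"

lemma finite_lists: "finite {is :: 'm::finite list. length is = n}"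
  using finite_lists_length_eq[of "UNIV :: 'm set" n] by simp

lemma smooth_on_sym_poly: "open S \<Longrightarrow> smooth_on (sym_poly n a) S"
  unfolding sym_poly_def[abs_def] by (intro smooth_on_sum smooth_on_mult smooth_on_const smooth_on_mon)

lemma sym_poly_Suc: "sym_poly (Suc n) a y = (\<Sum>i\<in>UNIV. y $ i * sym_poly n (\<lambda>is. a (i # is)) y)"
proof -
  have S: "{is :: 'a list. length is = Suc n} = (\<lambda>(i, is). i # is) ` (UNIV \<times> {is. length is = n})"
    by (auto simp: length_Suc_conv image_iff)
  have inj: "inj_on (\<lambda>(i :: 'a, is). i # is) (UNIV \<times> {is. length is = n})" by (auto intro!: inj_onI)
  have "sym_poly (Suc n) a y = (\<Sum>(i, is)\<in>UNIV \<times> {is. length is = n}. a (i # is) * mon (i # is) y)"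
    unfolding sym_poly_def S sum.reindex[OF inj] by (simp add: comp_def split_beta)
  also have "\<dots> = (\<Sum>i\<in>UNIV. \<Sum>is\<in>{is. length is = n}. a (i # is) * mon (i # is) y)"
    by (rule sum.cartesian_product[symmetric])
  also have "\<dots> = (\<Sum>i\<in>UNIV. y $ i * sym_poly n (\<lambda>is. a (i # is)) y)"
    by (simp add: sym_poly_def sum_distrib_left mon_def mult_ac)
  finally show ?thesis .
qed

lemma pd_sym_poly:
  assumes "\<And>xs i j ys. a (xs @ i # j # ys) = a (xs @ j # i # ys)"
  shows "pd j (sym_poly (Suc n) a) y = real (Suc n) * sym_poly n (\<lambda>is. a (j # is)) y"
  using assms
proof (induction n arbitrary: a)
  case 0
  have "sym_poly (Suc 0) a = (\<lambda>y. \<Sum>i\<in>UNIV. a [i] * y $ i)"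
    by (simp add: fun_eq_iff sym_poly_Suc) (simp add: sym_poly_def mon_def mult.commute)
  moreover have "pd j (\<lambda>y. \<Sum>i\<in>UNIV. a [i] * y $ i) y = (\<Sum>i\<in>UNIV. a [i] * (if j = i then 1 else 0))"
  proof -
    have d: "(\<lambda>y :: real^'a. y $ i) differentiable (at y)" for i
      by (rule smooth_on_differentiable[OF smooth_on_vec_nth[OF open_UNIV smooth_on_id[OF open_UNIV]]]) simp
    show ?thesis by (subst pd_sum) (auto intro!: differentiable_mult d simp: pd_cmult[OF d] pd_nth)
  qed
  ultimately show ?case by (simp add: sym_poly_def mon_def if_distrib cong: if_cong)
next
  case (Suc n)
  have d: "sym_poly k b differentiable (at y)" "(\<lambda>y :: real^'a. y $ i) differentiable (at y)" for k b i
    by (rule smooth_on_differentiable[OF smooth_on_sym_poly[OF open_UNIV]], simp,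
        rule smooth_on_differentiable[OF smooth_on_vec_nth[OF open_UNIV smooth_on_id[OF open_UNIV]]], simp)
  have IH: "pd j (sym_poly (Suc n) (\<lambda>is. a (i # is))) y = real (Suc n) * sym_poly n (\<lambda>is. a (j # i # is)) y" for i
  proof -
    have "pd j (sym_poly (Suc n) (\<lambda>is. a (i # is))) y = real (Suc n) * sym_poly n (\<lambda>is. a (i # j # is)) y"
      by (rule Suc.IH) (use Suc.prems[of "i # xs" for xs] in simp)
    moreover have "a (i # j # is) = a (j # i # is)" for "is" using Suc.prems[of "[]"] by simp
    ultimately show ?thesis by simp
  qed
  have "pd j (sym_poly (Suc (Suc n)) a) y = pd j (\<lambda>y. \<Sum>i\<in>UNIV. y $ i * sym_poly (Suc n) (\<lambda>is. a (i # is)) y) y"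
    by (simp add: sym_poly_Suc[of "Suc n", abs_def])
  also have "\<dots> = (\<Sum>i\<in>UNIV. y $ i * pd j (sym_poly (Suc n) (\<lambda>is. a (i # is))) y
      + (if j = i then 1 else 0) * sym_poly (Suc n) (\<lambda>is. a (i # is)) y)"
    by (subst pd_sum) (auto intro!: differentiable_mult d simp: pd_mult[OF d(2) d(1)] pd_nth)
  also have "\<dots> = real (Suc n) * (\<Sum>i\<in>UNIV. y $ i * sym_poly n (\<lambda>is. a (j # i # is)) y)
      + (\<Sum>i\<in>UNIV. if j = i then sym_poly (Suc n) (\<lambda>is. a (i # is)) y else 0)"
    unfolding IH sum.distrib sum_distrib_left by (intro arg_cong2[where f = "(+)"] sum.cong) auto
  also have "\<dots> = real (Suc n) * sym_poly (Suc n) (\<lambda>is. a (j # is)) y + sym_poly (Suc n) (\<lambda>is. a (j # is)) y"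
    by (simp add: sym_poly_Suc[of n "\<lambda>is. a (j # is)"])
  finally show ?case by (simp add: algebra_simps)
qed

lemma pds_sym_poly:
  assumes "\<And>xs i j ys. a (xs @ i # j # ys) = a (xs @ j # i # ys)"
  shows "length js \<le> n \<Longrightarrow> pds js (sym_poly n a) = (\<lambda>y. fact n / fact (n - length js) * sym_poly (n - length js) (\<lambda>is. a (rev js @ is)) y)"
proof (induction js)
  case Nil
  then show ?case by simp
next
  case (Cons j js)
  then obtain k where k: "n - length js = Suc k" "n - length (j # js) = k" by (metis Suc_diff_le diff_Suc_Suc length_Cons)
  let ?b = "\<lambda>is. a (rev js @ is)"
  have d: "sym_poly (Suc k) ?b differentiable (at y)" for y
    by (rule smooth_on_differentiable[OF smooth_on_sym_poly[OF open_UNIV]]) simp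
  have "pd j (sym_poly (Suc k) ?b) y = real (Suc k) * sym_poly k (\<lambda>is. ?b (j # is)) y" for y
    by (rule pd_sym_poly) (use assms[of "rev js @ xs" for xs] in simp)
  moreover have "pds js (sym_poly n a) = (\<lambda>y. fact n / fact (Suc k) * sym_poly (Suc k) ?b y)"
    using Cons.IH Cons.prems unfolding k(1) by simp
  ultimately have "pds (j # js) (sym_poly n a) y = fact n / fact (Suc k) * (real (Suc k) * sym_poly k (\<lambda>is. ?b (j # is)) y)" for y
    by (simp only: pds_Cons pd_cmult[OF d])
  moreover have "fact n / fact (Suc k) * (real (Suc k) * X) = fact n / fact k * X" for X :: real
    by (simp only: fact_Suc of_nat_mult) (simp add: field_simps del: of_nat_Suc)
  ultimately show ?case using k by (simp add: fun_eq_iff del: fact_Suc pds_Cons)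
qed

lemma pds_append: "pds (xs @ ys) f = pds xs (pds ys f)"
  by (induction xs) simp_all

text \<open>A function with vanishing derivatives of order less than \<open>n\<close> has the same \<open>n\<close>-jet as the homogeneous
  polynomial of its derivatives of order \<open>n\<close>.\<close>

lemma taylor_leading_term:
  fixes D :: "real^'m::finite \<Rightarrow> real"
  assumes D: "smooth_on D UNIV" and z: "\<And>is. length is < n \<Longrightarrow> pds is D 0 = 0" and js: "length js \<le> n"
  shows "pds js (sym_poly n (\<lambda>is. pds (rev is) D 0 / fact n)) 0 = pds js D 0"
proof -
  let ?a = "\<lambda>is. pds (rev is) D 0 / fact n"
  have sw: "?a (xs @ i # j # ys) = ?a (xs @ j # i # ys)" for xs i j ys
  proof -
    have "pd j (pd i (pds (rev xs) D)) = pd i (pd j (pds (rev xs) D))"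
      using pd_commute[OF open_UNIV UNIV_I smooth_on_pds[OF D]] by (intro ext)
    then show ?thesis by (simp add: pds_append)
  qed
  show ?thesis
  proof (cases "length js = n")
    case True
    have "{is :: 'm list. length is = 0} = {[]}" by auto
    then show ?thesis using pds_sym_poly[of ?a, OF sw, of js n] True by (simp add: sym_poly_def mon_def)
  next
    case False
    then have l: "length js < n" using js by simp
    have "sym_poly n ?a (t *\<^sub>R y) = t ^ n * sym_poly n ?a y" for t y
      unfolding sym_poly_def sum_distrib_left by (intro sum.cong) (auto simp: mon_scale)
    from pds_homogeneous[OF smooth_on_sym_poly[OF open_UNIV] this l] show ?thesis using z[OF l] by simp
  qed
qed

text \<open>The fields that are linear in the coordinates, given by their first derivatives.\<close>

definition lin :: "'m cf^'m::finite \<Rightarrow> real^'m \<Rightarrow> 'm cf" where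
  "lin Z y = (\<Sum>d\<in>UNIV. y $ d *\<^sub>R Z $ d)"

lemma lin_simps:
  "lin (Z + Z') y = lin Z y + lin Z' y" "lin (t *\<^sub>R Z) y = t *\<^sub>R lin Z y"
  "lin Z (y + y') = lin Z y + lin Z y'" "lin Z (t *\<^sub>R y) = t *\<^sub>R lin Z y" "lin 0 y = 0" "lin Z 0 = 0"
  by (simp_all add: lin_def scaleR_add_right scaleR_add_left sum.distrib scaleR_sum_right mult.commute)

lemma smooth_on_lin: "open S \<Longrightarrow> smooth_on (lin Z) S"
  unfolding lin_def[abs_def] by (intro smooth_intros)

context nat_op
begin

text \<open>The horizontal part of the tensor at the origin, which carries the dependence on the connection.\<close>

definition hor :: "(real^'m \<Rightarrow> 'm cf) \<Rightarrow> real^'m \<Rightarrow> real^'m \<Rightarrow> real^'m \<Rightarrow> real" where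
  "hor P u a b = ph P (0, u) (a, 0) (b, 0)"

lemma ph_scaled_hor:
  assumes P: "smooth_on P UNIV" and t: "t \<noteq> 0"
  shows "ph (\<lambda>y. t *\<^sub>R P (t *\<^sub>R y)) (x, u) (a, 0) (b, 0) = t\<^sup>2 * ph P (t *\<^sub>R x, u /\<^sub>R t) (a, 0) (b, 0)"
proof -
  note bl = ph_tensor(1)[OF P]
  have "ph P z (t *\<^sub>R a, 0) (t *\<^sub>R b, 0) = ph P z (t *\<^sub>R (a, 0)) (t *\<^sub>R (b, 0))" for z by simp
  also have "ph P z (t *\<^sub>R (a, 0)) (t *\<^sub>R (b, 0)) = t\<^sup>2 * ph P z (a, 0) (b, 0)" for z
    by (simp only: bilinear_lmul[OF bl] bilinear_rmul[OF bl] real_scaleR_def power2_eq_square mult.assoc)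
  finally show ?thesis using ph_homothety[OF P t, of x u a 0 b 0] by simp
qed

lemma hor_scaled: "smooth_on P UNIV \<Longrightarrow> t \<noteq> 0 \<Longrightarrow> hor (\<lambda>y. t *\<^sub>R P (t *\<^sub>R y)) (t *\<^sub>R u) a b = t\<^sup>2 * hor P u a b"
  using ph_scaled_hor[of P t 0 "t *\<^sub>R u" a b] by (simp add: hor_def)

text \<open>The heart of the argument. Let \<open>q\<close> be homogeneous of degree \<open>r + 1\<close> and such that adding a large multiple
  \<open>N q\<close> to a field changes \<open>hor\<close> by a constant. Moving the field \<open>P + N q\<close> by \<open>j s v0\<close> yields, up to
  the multiple of \<open>q\<close>, the field \<open>P + j W\<close> when \<open>N s = 1\<close>, in the limit \<open>s \<rightarrow> 0\<close>. So the \<open>k\<close>-th difference in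
  \<open>j\<close> is the \<open>k\<close>-th difference along a step \<open>s v0\<close> of the tensor field of one connection. After a
  homothety by \<open>t\<close> this connection stays in a fixed bounded family while the step has length of the
  order \<open>t ^ (r + 1)\<close>. With the factor \<open>t\<^sup>2\<close> of the homothety, the difference is of the order
  \<open>t ^ (k * (r + 1) - 2)\<close> and tends to \<open>0\<close>. For \<open>r = 0\<close> the covector may move at the same time.\<close>

lemma vanishing_difference:
  fixes q :: "real^'m \<Rightarrow> 'm cf" and W :: "real \<times> (real^'m) \<Rightarrow> 'm cf"
  assumes q: "smooth_on q UNIV" and hom: "\<And>t y. q (t *\<^sub>R y) = t ^ (r + 1) *\<^sub>R q y"
    and W: "smooth_on W UNIV" and qW: "\<And>s y. q (y + s *\<^sub>R v0) = q y + s *\<^sub>R W (s, y)"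
    and inv: "\<And>P u N. smooth_on P UNIV \<Longrightarrow> hor (\<lambda>y. P y + N *\<^sub>R q y) u a b = hor P u a b + l N"
    and \<beta>: "r = 0 \<or> \<beta> = 0" and k: "3 \<le> k * (r + 1)" and P: "smooth_on P UNIV"
  shows "findiff k (\<lambda>j. hor (\<lambda>y. P y + real j *\<^sub>R W (0, y)) (u + real j *\<^sub>R \<beta>) a b) = 0"
proof -
  have kpos: "k > 0" using k by (cases k) auto
  have G: "smooth_on (\<lambda>p :: real \<times> (real^'m). P (snd p)) UNIV"
    by (rule smooth_on_compose_UNIV[OF open_UNIV P]) (intro smooth_intros open_UNIV)
  obtain K \<rho> where \<rho>: "\<rho> > 0" "K \<ge> 0" and bd: "\<And>s t c u d. \<bar>s\<bar> \<le> \<rho> \<Longrightarrow> \<bar>t\<bar> \<le> \<rho> \<Longrightarrow> \<bar>c\<bar> \<le> \<rho> \<Longrightarrow> norm u \<le> 1 \<Longrightarrow> norm d \<le> \<rho> \<Longrightarrow>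
     \<bar>line_diff k (\<lambda>z. ph (\<lambda>y. t *\<^sub>R P (snd (s :: real, t *\<^sub>R y)) + q (c *\<^sub>R y)) z (a, 0) (b, 0)) (0, u) d\<bar> \<le> K * norm d ^ k"
    using difference_bound[OF G q, of k "(a, 0)" "(b, 0)"] by blast
  \<comment> \<open>\<open>hh t\<close> is the step length after the homothety, \<open>step t\<close> before it. The powers of \<open>\<rho>\<close> make \<open>N q\<close>
    become \<open>q (\<rho> y)\<close>, a member of the bounded family.\<close>
  define bb where "bb = (if r = 0 then \<rho> *\<^sub>R \<beta> else 0)"
  define hh where "hh t = t ^ (r + 1) / \<rho> ^ (r + 1)" for t
  define step where "step t = t * hh t" for t
  define d where "d t = hh t *\<^sub>R (v0, bb)" for t
  define \<psi> where "\<psi> s j = hor (\<lambda>y. P (y + (real j * s) *\<^sub>R v0) + real j *\<^sub>R W (real j * s, y)) (u + real j *\<^sub>R \<beta>) a b" for s j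
  have fam: "smooth_on (\<lambda>p. P (snd p + (real j * fst p) *\<^sub>R v0) + real j *\<^sub>R W (real j * fst p, snd p)) UNIV" for j
    by (intro smooth_on_add smooth_on_scaleR smooth_on_const smooth_on_compose_UNIV[OF _ P] smooth_on_compose_UNIV[OF _ W]
        smooth_on_Pair smooth_on_mult smooth_on_fst smooth_on_snd smooth_on_id open_UNIV)
  have fam1: "smooth_on (\<lambda>y. P (y + (real j * s) *\<^sub>R v0) + real j *\<^sub>R W (real j * s, y)) UNIV" for j s
    by (intro smooth_on_add smooth_on_scaleR smooth_on_const smooth_on_compose_UNIV[OF _ P] smooth_on_compose_UNIV[OF _ W]
        smooth_on_Pair smooth_on_id open_UNIV)
  have main: "line_diff k (\<lambda>z. ph (\<lambda>y. t *\<^sub>R P (t *\<^sub>R y) + q (\<rho> *\<^sub>R y)) z (a, 0) (b, 0)) (0, t *\<^sub>R u) (d t) = t\<^sup>2 * findiff k (\<psi> (step t))"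
    if t: "t > 0" for t
  proof -
    define N where "N = \<rho> ^ (r + 1) / t ^ (r + 2)"
    let ?Q = "\<lambda>y. P y + N *\<^sub>R q y"
    have Q: "smooth_on ?Q UNIV" by (intro smooth_on_add smooth_on_scaleR smooth_on_const P q open_UNIV)
    have Ns: "N * step t = 1" using t \<rho> by (simp add: N_def step_def hh_def)
    have "t *\<^sub>R (N *\<^sub>R q (t *\<^sub>R y)) = q (\<rho> *\<^sub>R y)" for y
      using t by (simp add: hom N_def)
    then have field: "(\<lambda>y. t *\<^sub>R P (t *\<^sub>R y) + q (\<rho> *\<^sub>R y)) = (\<lambda>y. t *\<^sub>R ?Q (t *\<^sub>R y))"
      by (simp add: scaleR_add_right)
    have "ph (\<lambda>y. t *\<^sub>R ?Q (t *\<^sub>R y)) ((0, t *\<^sub>R u) + real j *\<^sub>R d t) (a, 0) (b, 0) = t\<^sup>2 * (\<psi> (step t) j + l N)" for j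
    proof -
      have e1: "(0, t *\<^sub>R u) + real j *\<^sub>R d t = ((real j * hh t) *\<^sub>R v0, t *\<^sub>R u + (real j * hh t) *\<^sub>R bb)"
        by (simp add: d_def)
      have e2: "t *\<^sub>R ((real j * hh t) *\<^sub>R v0) = 0 + (real j * step t) *\<^sub>R v0"
        by (simp add: step_def mult_ac)
      have e3: "(t *\<^sub>R u + (real j * hh t) *\<^sub>R bb) /\<^sub>R t = u + real j *\<^sub>R \<beta>"
        using t \<beta> \<rho> by (auto simp: bb_def hh_def scaleR_add_right)
      have t0: "t \<noteq> 0" using t by simp
      have "ph (\<lambda>y. t *\<^sub>R ?Q (t *\<^sub>R y)) ((0, t *\<^sub>R u) + real j *\<^sub>R d t) (a, 0) (b, 0) =
          t\<^sup>2 * ph ?Q (0 + (real j * step t) *\<^sub>R v0, u + real j *\<^sub>R \<beta>) (a, 0) (b, 0)"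
        unfolding e1 ph_scaled_hor[OF Q t0] e2 e3 ..
      also have "ph ?Q (0 + (real j * step t) *\<^sub>R v0, u + real j *\<^sub>R \<beta>) (a, 0) (b, 0) =
          hor (\<lambda>y. ?Q (y + (real j * step t) *\<^sub>R v0)) (u + real j *\<^sub>R \<beta>) a b"
        unfolding hor_def by (rule ph_translate[OF Q, symmetric])
      also have "(\<lambda>y. ?Q (y + (real j * step t) *\<^sub>R v0)) =
          (\<lambda>y. P (y + (real j * step t) *\<^sub>R v0) + real j *\<^sub>R W (real j * step t, y) + N *\<^sub>R q y)"
      proof
        fix y
        have "N *\<^sub>R q (y + (real j * step t) *\<^sub>R v0) = N *\<^sub>R q y + (real j * (N * step t)) *\<^sub>R W (real j * step t, y)"
          by (simp add: qW scaleR_add_right mult_ac)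
        then show "?Q (y + (real j * step t) *\<^sub>R v0) = P (y + (real j * step t) *\<^sub>R v0) + real j *\<^sub>R W (real j * step t, y) + N *\<^sub>R q y"
          by (simp add: Ns)
      qed
      also have "hor \<dots> (u + real j *\<^sub>R \<beta>) a b = \<psi> (step t) j + l N"
        unfolding \<psi>_def by (rule inv[OF fam1])
      finally show ?thesis .
    qed
    then show ?thesis
      unfolding field line_diff_def by (simp add: findiff_cmult findiff_add_const[OF kpos])
  qed
  define D where "D = norm (v0, bb)"
  define e where "e = k * (r + 1) - 2"
  define C where "C = K * (D / \<rho> ^ (r + 1)) ^ k"
  have e: "k * (r + 1) = e + 2" "e > 0" using k by (simp_all add: e_def)
  have findiff_d: "norm (d t) = t ^ (r + 1) * (D / \<rho> ^ (r + 1))" if "t > 0" for t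
  proof -
    have "hh t \<ge> 0" using that \<rho> by (simp add: hh_def)
    then have "norm (d t) = hh t * D" by (simp only: d_def D_def norm_scaleR abs_of_nonneg)
    then show ?thesis by (simp add: hh_def)
  qed
  have est: "\<bar>findiff k (\<psi> (step t))\<bar> \<le> C * t ^ e" if t: "t > 0" "t \<le> \<rho>" "norm (t *\<^sub>R u) \<le> 1" "norm (d t) \<le> \<rho>" for t
  proof -
    have "t\<^sup>2 * \<bar>findiff k (\<psi> (step t))\<bar> \<le> K * norm (d t) ^ k"
      using bd[of 0 t \<rho> "t *\<^sub>R u" "d t"] t \<rho> main[OF t(1)] by (simp add: abs_mult)
    also have "\<dots> = C * t ^ (k * (r + 1))" unfolding findiff_d[OF t(1)] C_def
    proof -
      have "(t ^ (r + 1)) ^ k = t ^ (k * (r + 1))" by (metis power_mult mult.commute)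
      then show "K * (t ^ (r + 1) * (D / \<rho> ^ (r + 1))) ^ k = K * (D / \<rho> ^ (r + 1)) ^ k * t ^ (k * (r + 1))"
        by (simp only: power_mult_distrib mult_ac)
    qed
    also have "\<dots> = t\<^sup>2 * (C * t ^ e)" unfolding e(1) by (simp add: power_add power2_eq_square)
    finally show ?thesis using t(1) by simp
  qed
  have ev: "\<forall>\<^sub>F t in at_right (0::real). \<bar>findiff k (\<psi> (step t))\<bar> \<le> C * t ^ e"
  proof -
    have "((\<lambda>t. norm (t *\<^sub>R u)) \<longlongrightarrow> norm (0 *\<^sub>R u)) (at_right 0)" by (intro tendsto_intros)
    then have "\<forall>\<^sub>F t in at_right 0. norm (t *\<^sub>R u) < 1" by (rule order_tendstoD) simp
    moreover have "((\<lambda>t. norm (d t)) \<longlongrightarrow> norm ((0 ^ (r + 1) / \<rho> ^ (r + 1)) *\<^sub>R (v0, bb))) (at_right 0)"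
      unfolding d_def hh_def using \<rho> by (intro tendsto_intros) auto
    then have "\<forall>\<^sub>F t in at_right 0. norm (d t) < \<rho>" by (rule order_tendstoD) (use \<rho> in simp)
    moreover have "\<forall>\<^sub>F t in at_right 0. t \<le> \<rho>"
      using eventually_at_right_real[OF \<rho>(1)] by eventually_elim simp
    moreover have "\<forall>\<^sub>F t in at_right (0::real). t > 0" by (rule eventually_at_right_less)
    ultimately show ?thesis by eventually_elim (rule est; simp)
  qed
  have "((\<lambda>t::real. C * t ^ e) \<longlongrightarrow> C * 0 ^ e) (at_right 0)" by (intro tendsto_intros)
  moreover have "C * 0 ^ e = 0" using e(2) by simp
  ultimately have "((\<lambda>t. C * t ^ e) \<longlongrightarrow> 0) (at_right (0::real))" by (simp only:)
  then have "((\<lambda>t. \<bar>findiff k (\<psi> (step t))\<bar>) \<longlongrightarrow> 0) (at_right 0)"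
    by (rule tendsto_sandwich[OF _ ev tendsto_const, rotated]) simp
  then have z: "((\<lambda>t. findiff k (\<psi> (step t))) \<longlongrightarrow> 0) (at_right 0)" by (rule tendsto_rabs_zero_cancel)
  have st: "filterlim step (at 0) (at_right 0)"
  proof -
    have "(step \<longlongrightarrow> 0 * (0 ^ (r + 1) / \<rho> ^ (r + 1))) (at_right 0)"
      unfolding step_def[abs_def] hh_def using \<rho> by (intro tendsto_intros) auto
    moreover have "\<forall>\<^sub>F t in at_right 0. step t \<noteq> 0"
      using eventually_at_right_less[of "0::real"] by eventually_elim (use \<rho> in \<open>simp add: step_def hh_def\<close>)
    ultimately show ?thesis by (simp add: filterlim_at)
  qed
  have "((\<lambda>s. \<psi> s j) \<longlongrightarrow> hor (\<lambda>y. P y + real j *\<^sub>R W (0, y)) (u + real j *\<^sub>R \<beta>) a b) (at 0)" for j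
    using ph_continuous[OF fam[of j] tendsto_const[of "u + real j *\<^sub>R \<beta>"], of "(a, 0)" "(b, 0)"]
    by (simp add: \<psi>_def hor_def)
  then have "((\<lambda>t. findiff k (\<psi> (step t))) \<longlongrightarrow> findiff k (\<lambda>j. hor (\<lambda>y. P y + real j *\<^sub>R W (0, y)) (u + real j *\<^sub>R \<beta>) a b)) (at_right 0)"
    by (intro tendsto_findiff) (rule filterlim_compose[OF _ st])
  with z show ?thesis using tendsto_unique[of "at_right (0::real)"] trivial_limit_at_right_real by blast
qed

definition hor_order :: "nat \<Rightarrow> bool" where
  "hor_order r \<longleftrightarrow> (\<forall>P P' u a b. smooth_on P UNIV \<longrightarrow> smooth_on P' UNIV \<longrightarrow>
     same_jet r 0 (\<lambda>y. co (P y)) (\<lambda>y. co (P' y)) \<longrightarrow> hor P u a b = hor P' u a b)"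

lemma homogeneous_jet:
  fixes P q :: "real^'m \<Rightarrow> 'm cf"
  assumes P: "smooth_on P UNIV" and q: "smooth_on q UNIV" and hom: "\<And>t y. q (t *\<^sub>R y) = t ^ (r + 1) *\<^sub>R q y"
  shows "same_jet r 0 (\<lambda>y. co (P y + N *\<^sub>R q y)) (\<lambda>y. co (P y))"
  unfolding same_jet_def
proof (intro allI impI)
  fix "is" :: "'m list" and l k n assume len: "length is \<le> r"
  have sP: "smooth_on (\<lambda>y. co (P y) l k n) UNIV" and sq: "smooth_on (\<lambda>y. co (q y) l k n) UNIV"
    using P q by (auto intro: smooth_on_co)
  have "pds is (\<lambda>y. co (P y) l k n + N * co (q y) l k n) 0 = pds is (\<lambda>y. co (P y) l k n) 0 + N * pds is (\<lambda>y. co (q y) l k n) 0"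
    using pds_add[OF open_UNIV UNIV_I sP smooth_on_mult[OF open_UNIV smooth_on_const[OF open_UNIV] sq]]
      pds_cmult[OF open_UNIV UNIV_I sq] by simp
  moreover have "pds is (\<lambda>y. co (q y) l k n) 0 = 0"
    by (rule pds_homogeneous[OF sq, of "r + 1"]) (use len in \<open>auto simp: co_def hom\<close>)
  ultimately show "pds is (\<lambda>y. co (P y + N *\<^sub>R q y) l k n) 0 = pds is (\<lambda>y. co (P y) l k n) 0"
    by (simp add: co_def)
qed

text \<open>For \<open>r \<ge> 2\<close> already the first differences vanish. Here \<open>q\<close> is the monomial times a variable \<open>y $ i\<close>
  that occurs in it, divided so that the derivative of \<open>q\<close> in the direction of \<open>i\<close> is the given monomial;
  adding \<open>N q\<close> does not change the \<open>r\<close>-jet.\<close>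

lemma add_monomial:
  assumes r: "hor_order r" "r \<ge> 2" and P: "smooth_on P UNIV" and len: "length is = r"
  shows "hor (\<lambda>y. P y + mon is y *\<^sub>R E) u a b = hor P u a b"
proof -
  obtain i where "i \<in> set is" using len r(2) by (cases "is") auto
  define c where "c = length (filter ((=) i) is)"
  define rest where "rest = mon (filter ((\<noteq>) i) is)"
  define q where "q y = (y $ i * mon is y / real (Suc c)) *\<^sub>R E" for y
  define W where "W p = ((\<Sum>k<Suc c. (snd p $ i + fst p) ^ k * (snd p $ i) ^ (c - k)) / real (Suc c) * rest (snd p)) *\<^sub>R E" for p
  have mon: "mon is y = (y $ i) ^ c * rest y" for y unfolding c_def rest_def by (rule mon_split)
  have q: "smooth_on q UNIV" unfolding q_def divide_inverse
    by (intro smooth_on_scaleR smooth_on_mult smooth_on_const smooth_on_vec_nth smooth_on_id smooth_on_mon open_UNIV)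
  have sr: "smooth_on rest UNIV" unfolding rest_def by (rule smooth_on_mon[OF open_UNIV])
  have W: "smooth_on W UNIV" unfolding W_def divide_inverse
    by (intro smooth_on_scaleR smooth_on_mult smooth_on_sum smooth_on_power smooth_on_add smooth_on_const smooth_on_vec_nth
        smooth_on_fst smooth_on_snd smooth_on_id smooth_on_compose_UNIV[OF _ sr] open_UNIV)
  have hom: "q (t *\<^sub>R y) = t ^ (r + 1) *\<^sub>R q y" for t y by (simp add: q_def mon_scale len)
  have qW: "q (y + s *\<^sub>R axis i 1) = q y + s *\<^sub>R W (s, y)" for s y
  proof -
    have "(y $ i + s) ^ Suc c - (y $ i) ^ Suc c = s * (\<Sum>k<Suc c. (y $ i + s) ^ k * (y $ i) ^ (c - k))"
      using diff_power_eq_sum[of "y $ i + s" c "y $ i"] by simp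
    then have pw: "(y $ i + s) ^ Suc c = (y $ i) ^ Suc c + s * (\<Sum>k<Suc c. (y $ i + s) ^ k * (y $ i) ^ (c - k))" by linarith
    have yi: "(y + s *\<^sub>R axis i 1) $ i = y $ i + s" by (simp add: axis_def)
    have "mon is (y + s *\<^sub>R axis i 1) = (y $ i + s) ^ c * rest y"
      unfolding mon rest_def mon_shift yi ..
    then have "(y + s *\<^sub>R axis i 1) $ i * mon is (y + s *\<^sub>R axis i 1) = (y $ i + s) ^ Suc c * rest y"
      unfolding yi by simp
    also have "\<dots> = y $ i * mon is y + s * (\<Sum>k<Suc c. (y $ i + s) ^ k * (y $ i) ^ (c - k)) * rest y"
      unfolding pw mon by (simp only: distrib_right power_Suc mult.assoc)
    finally have "(y + s *\<^sub>R axis i 1) $ i * mon is (y + s *\<^sub>R axis i 1) = y $ i * mon is y + s * (\<Sum>k<Suc c. (y $ i + s) ^ k * (y $ i) ^ (c - k)) * rest y" .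
    then show ?thesis unfolding q_def W_def
      by (simp add: add_divide_distrib scaleR_add_left mult_ac del: sum.lessThan_Suc)
  qed
  have inv: "hor (\<lambda>y. P y + N *\<^sub>R q y) u a b = hor P u a b + 0" if "smooth_on P UNIV" for P u N
  proof -
    have "smooth_on (\<lambda>y. P y + N *\<^sub>R q y) UNIV" by (intro smooth_on_add smooth_on_scaleR smooth_on_const that q open_UNIV)
    then show ?thesis using r(1) that homogeneous_jet[OF that q hom, of N] unfolding hor_order_def by simp
  qed
  have W0: "W (0, y) = mon is y *\<^sub>R E" for y
  proof -
    have "(\<Sum>k<Suc c. (y $ i) ^ k * (y $ i) ^ (c - k)) = (\<Sum>k<Suc c. (y $ i) ^ c)"
      by (intro sum.cong refl) (auto simp flip: power_add)
    then show ?thesis by (simp add: W_def mon del: sum.lessThan_Suc)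
  qed
  have "findiff 1 (\<lambda>j. hor (\<lambda>y. P y + real j *\<^sub>R W (0, y)) (u + real j *\<^sub>R 0) a b) = 0"
    by (rule vanishing_difference[OF q hom W qW inv _ _ P]) (use r in auto)
  then show ?thesis by (simp add: W0)
qed

text \<open>Two fields with the same \<open>r\<close>-jet differ, up to the jet of order \<open>r + 1\<close>, by a sum of monomials of degree
  \<open>r + 1\<close>, which may be added one by one.\<close>

lemma order_reduction:
  assumes r: "hor_order (Suc r)" "r \<ge> 1"
  shows "hor_order r"
  unfolding hor_order_def
proof (intro allI impI)
  fix P P' :: "real^'m \<Rightarrow> 'm cf" and u a b assume P: "smooth_on P UNIV" and P': "smooth_on P' UNIV"
    and jet: "same_jet r 0 (\<lambda>y. co (P y)) (\<lambda>y. co (P' y))"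
  define D where "D l k n y = co (P' y) l k n - co (P y) l k n" for l k n y
  define E where "E is = (\<chi> l k n. pds (rev is) (D l k n) 0 / fact (Suc r))" for "is" :: "'m list"
  let ?S = "{is :: 'm list. length is = Suc r}"
  have sP: "smooth_on (\<lambda>y. co (P y) l k n) UNIV" "smooth_on (\<lambda>y. co (P' y) l k n) UNIV" for l k n
    using P P' by (auto intro: smooth_on_co)
  have sD: "smooth_on (D l k n) UNIV" for l k n unfolding D_def by (intro smooth_on_diff sP open_UNIV)
  have pD: "pds is (D l k n) 0 = pds is (\<lambda>y. co (P' y) l k n) 0 - pds is (\<lambda>y. co (P y) l k n) 0" for "is" l k n
    using pds_add[OF open_UNIV UNIV_I sP(1) sD, of "is" l k n l k n] by (simp add: D_def)
  have sum: "hor (\<lambda>y. P y + (\<Sum>is\<in>A. mon is y *\<^sub>R E is)) u a b = hor P u a b" if "finite A" "A \<subseteq> ?S" for A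
    using that
  proof (induction A rule: finite_induct)
    case (insert x A)
    have "smooth_on (\<lambda>y. P y + (\<Sum>is\<in>A. mon is y *\<^sub>R E is)) UNIV"
      by (intro smooth_on_add smooth_on_sum smooth_on_scaleR smooth_on_const smooth_on_mon P open_UNIV)
    from add_monomial[OF r(1) _ this, of x "E x" u a b] insert r(2)
    show ?case by (simp add: add.assoc add.commute[of "mon x _ *\<^sub>R _"])
  qed simp
  let ?R = "\<lambda>y. P y + (\<Sum>is\<in>?S. mon is y *\<^sub>R E is)"
  have R: "smooth_on ?R UNIV"
    by (intro smooth_on_add smooth_on_sum smooth_on_scaleR smooth_on_const smooth_on_mon P open_UNIV)
  have "same_jet (Suc r) 0 (\<lambda>y. co (?R y)) (\<lambda>y. co (P' y))"
    unfolding same_jet_def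
  proof (intro allI impI)
    fix js :: "'m list" and l k n assume js: "length js \<le> Suc r"
    have "co (?R y) l k n = co (P y) l k n + sym_poly (Suc r) (\<lambda>is. pds (rev is) (D l k n) 0 / fact (Suc r)) y" for y
      by (simp add: co_def sym_poly_def E_def mult.commute)
    then have "pds js (\<lambda>y. co (?R y) l k n) 0 = pds js (\<lambda>y. co (P y) l k n) 0
        + pds js (sym_poly (Suc r) (\<lambda>is. pds (rev is) (D l k n) 0 / fact (Suc r))) 0"
      using pds_add[OF open_UNIV UNIV_I sP(1) smooth_on_sym_poly[OF open_UNIV]] by simp
    also have "pds js (sym_poly (Suc r) (\<lambda>is. pds (rev is) (D l k n) 0 / fact (Suc r))) 0 = pds js (D l k n) 0"
    proof (rule taylor_leading_term[OF sD _ js])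
      fix "is" :: "'m list" assume "length is < Suc r"
      then show "pds is (D l k n) 0 = 0" using jet unfolding pD same_jet_def by simp
    qed
    finally show "pds js (\<lambda>y. co (?R y) l k n) 0 = pds js (\<lambda>y. co (P' y) l k n) 0" by (simp add: pD)
  qed
  then have "hor ?R u a b = hor P' u a b" using r(1) R P' unfolding hor_order_def by blast
  then show "hor P u a b = hor P' u a b" using sum[OF finite_lists] by simp
qed

lemma same_jet_mono: "same_jet r x L L' \<Longrightarrow> r' \<le> r \<Longrightarrow> same_jet r' x L L'"
  unfolding same_jet_def by auto

theorem horizontal_order_one: "hor_order 1"
proof -
  have up: "hor_order r \<Longrightarrow> r \<le> r' \<Longrightarrow> hor_order r'" for r r'
    unfolding hor_order_def using same_jet_mono by blast
  have "hor_order ord" unfolding hor_order_def hor_def using ph_jet by metis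
  then have "hor_order (Suc ord)" using up by auto
  then show ?thesis
  proof (induction ord)
    case (Suc n)
    then show ?case using order_reduction[of "Suc n"] by simp
  qed simp
qed

end

context nat_op
begin

definition jac :: "(real^'m \<Rightarrow> 'm cf) \<Rightarrow> 'm cf^'m" where
  "jac P = (\<chi> d. frechet_derivative P (at 0) (axis d 1))"

lemma co_bounded_linear: "bounded_linear (\<lambda>X :: 'm cf. co X l r n)"
  unfolding co_def
  by (rule bounded_linear_compose[OF bounded_linear_vec_nth
        bounded_linear_compose[OF bounded_linear_vec_nth bounded_linear_vec_nth]])

lemma pd_co: 
  assumes "smooth_on P UNIV"
  shows "pd d (\<lambda>y. co (P y) l r n) 0 = co (jac P $ d) l r n"
  using pd_eqI[OF bounded_linear.has_derivative[OF co_bounded_linear smooth_on_has_derivative[OF assms UNIV_I]]]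
  by (simp add: jac_def)

lemma jac_lin: "jac (\<lambda>y. X + lin Z y) = Z"
proof -
  have "bounded_linear (lin Z)"
    unfolding linear_conv_bounded_linear[symmetric] by (rule linearI) (simp_all add: lin_simps)
  then have "((\<lambda>y. X + lin Z y) has_derivative lin Z) (at 0)"
    using has_derivative_add[OF has_derivative_const bounded_linear_imp_has_derivative] by fastforce
  from frechet_derivative_at[OF this, symmetric] have "frechet_derivative (\<lambda>y. X + lin Z y) (at 0) = lin Z" .
  moreover have "lin Z (axis d 1) = Z $ d" for d
    by (simp add: lin_def axis_def if_distrib[of "\<lambda>c. c *\<^sub>R _"] cong: if_cong)
  ultimately show ?thesis by (simp add: jac_def vec_eq_iff)
qed

lemma lin_zero: "lin 0 = (\<lambda>y :: real^'m. 0)"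
  by (simp add: fun_eq_iff lin_simps)

lemma smooth_on_affine_field: "smooth_on (\<lambda>y. X + lin Z y) UNIV"
  by (intro smooth_on_add smooth_on_const smooth_on_lin open_UNIV)

text \<open>By the reduction of the order, \<open>P\<close> may be replaced by its Taylor polynomial.\<close>

lemma hor_jet:
  assumes P: "smooth_on P UNIV"
  shows "hor P u a b = hor (\<lambda>y. P 0 + lin (jac P) y) u a b"
proof -
  have "same_jet 1 0 (\<lambda>y. co (P y)) (\<lambda>y. co (P 0 + lin (jac P) y))"
    unfolding same_jet_def
  proof (intro allI impI)
    fix "is" :: "'m list" and l k n assume "length is \<le> 1"
    then consider "is = []" | d where "is = [d]" by (cases "is") auto
    then show "pds is (\<lambda>y. co (P y) l k n) 0 = pds is (\<lambda>y. co (P 0 + lin (jac P) y) l k n) 0"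
    proof cases
      case 1
      then show ?thesis by (simp add: lin_simps)
    next
      case 2
      then show ?thesis using pd_co[OF P] pd_co[OF smooth_on_affine_field] by (simp add: jac_lin)
    qed
  qed
  then show ?thesis using horizontal_order_one P smooth_on_affine_field unfolding hor_order_def by blast
qed

text \<open>The case \<open>r = 1\<close>, where only second differences are covered by \<open>vanishing_difference\<close>. The field \<open>q\<close> is
  a quadratic field with derivative \<open>lin Z\<close> in a coordinate direction; order one is used to
  ignore \<open>N q\<close>.\<close>

lemma second_difference:
  assumes P: "smooth_on P UNIV"
  shows "hor (\<lambda>y. P y + 2 *\<^sub>R lin Z y) u a b - 2 * hor (\<lambda>y. P y + lin Z y) u a b + hor P u a b = 0"
proof -
  define i :: 'm where "i = undefined"
  define q where "q y = (y $ i) *\<^sub>R lin Z y - ((y $ i)\<^sup>2 / 2) *\<^sub>R lin Z (axis i 1)" for y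
  define W where "W p = lin Z (snd p) + (fst p / 2) *\<^sub>R lin Z (axis i 1)" for p :: "real \<times> (real^'m)"
  have q: "smooth_on q UNIV" unfolding q_def divide_inverse
    by (intro smooth_on_diff smooth_on_scaleR smooth_on_vec_nth smooth_on_id smooth_on_mult smooth_on_power
        smooth_on_const smooth_on_lin open_UNIV)
  have W: "smooth_on W UNIV" unfolding W_def divide_inverse
    by (intro smooth_on_add smooth_on_scaleR smooth_on_mult smooth_on_fst smooth_on_id smooth_on_const open_UNIV
       smooth_on_compose_UNIV[OF open_UNIV smooth_on_lin[OF open_UNIV]] smooth_on_snd)
  have hom: "q (t *\<^sub>R y) = t ^ (1 + 1) *\<^sub>R q y" for t y
    by (simp add: q_def lin_simps power_mult_distrib power2_eq_square scaleR_diff_right mult_ac)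
  have qW: "q (y + s *\<^sub>R axis i 1) = q y + s *\<^sub>R W (s, y)" for s y
  proof -
    have "(y + s *\<^sub>R axis i 1) $ i = y $ i + s" by (simp add: axis_def)
    then have "q (y + s *\<^sub>R axis i 1) = (y $ i + s) *\<^sub>R (lin Z y + s *\<^sub>R lin Z (axis i 1))
        - ((y $ i + s)\<^sup>2 / 2) *\<^sub>R lin Z (axis i 1)" by (simp add: q_def lin_simps)
    also have "\<dots> = q y + s *\<^sub>R W (s, y)"
    proof -
      have "(y $ i + s) * s - (y $ i + s)\<^sup>2 / 2 = s * (s / 2) - (y $ i)\<^sup>2 / 2" by (simp add: power2_eq_square field_simps)
      then have "((y $ i + s) * s) *\<^sub>R V - ((y $ i + s)\<^sup>2 / 2) *\<^sub>R V = (s * (s / 2)) *\<^sub>R V - ((y $ i)\<^sup>2 / 2) *\<^sub>R V" for V :: "'m cf"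
        by (metis scaleR_diff_left)
      then show ?thesis unfolding q_def W_def
        by (simp add: scaleR_add_left scaleR_add_right algebra_simps)
    qed
    finally show ?thesis .
  qed
  have inv: "hor (\<lambda>y. P y + N *\<^sub>R q y) u a b = hor P u a b + 0" if "smooth_on P UNIV" for P u N
  proof -
    have "smooth_on (\<lambda>y. P y + N *\<^sub>R q y) UNIV" by (intro smooth_on_add smooth_on_scaleR smooth_on_const that q open_UNIV)
    then show ?thesis using horizontal_order_one that homogeneous_jet[OF that q hom, of N] unfolding hor_order_def by simp
  qed
  have "findiff 2 (\<lambda>j. hor (\<lambda>y. P y + real j *\<^sub>R W (0, y)) (u + real j *\<^sub>R 0) a b) = 0"
    by (rule vanishing_difference[OF q hom W qW inv _ _ P]) auto
  then show ?thesis by (simp add: W_def numeral_2_eq_2)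
qed

text \<open>Vanishing second differences make the dependence on first derivatives additive; scaling then
  removes the dependence of the increment on the remaining arguments and makes it linear.\<close>

lemma hor_affine: "\<exists>L. linear L \<and> (\<forall>P u Z. smooth_on P UNIV \<longrightarrow> hor (\<lambda>y. P y + lin Z y) u a b = hor P u a b + L Z)"
proof -
  define D where "D P u Z = hor (\<lambda>y. P y + lin Z y) u a b - hor P u a b" for P u Z
  have sP: "smooth_on (\<lambda>y. P y + lin Z y) UNIV" if "smooth_on P UNIV" for P Z
    by (intro smooth_on_add that smooth_on_lin open_UNIV)
  have mid: "hor (\<lambda>y. P y + lin A y) u a b + hor (\<lambda>y. P y + lin B y) u a b = 2 * hor (\<lambda>y. P y + lin ((1/2) *\<^sub>R (A + B)) y) u a b"
    if P: "smooth_on P UNIV" for P u A B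
  proof -
    have e1: "P y + lin A y + 2 *\<^sub>R lin ((1/2) *\<^sub>R (B - A)) y = P y + lin B y" for y
      using lin_simps(1)[of A "B - A" y] by (simp add: lin_simps)
    have "lin A y + lin ((1/2) *\<^sub>R (B - A)) y = lin ((1/2) *\<^sub>R (A + B)) y" for y
    proof -
      have "A + (1/2) *\<^sub>R (B - A) = (1/2) *\<^sub>R (A + B)"
        by (simp add: vec_eq_iff field_simps)
      then show ?thesis by (metis lin_simps(1))
    qed
    then have e2: "P y + lin A y + lin ((1/2) *\<^sub>R (B - A)) y = P y + lin ((1/2) *\<^sub>R (A + B)) y" for y
      by (simp add: add.assoc)
    show ?thesis using second_difference[OF sP[OF P, of A], of "(1/2) *\<^sub>R (B - A)" u a b] unfolding e1 e2 by simp
  qed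
  have add: "D P u (A + B) = D P u A + D P u B" if P: "smooth_on P UNIV" for P u A B
    using mid[OF P, of A u B] mid[OF P, of "A + B" u 0] by (simp add: D_def lin_simps)
  have nat: "D P u (real n *\<^sub>R Z) = real n * D P u Z" if P: "smooth_on P UNIV" for P u n Z
  proof (induction n)
    case 0
    then show ?case using add[OF P, of u 0 0] by simp
  next
    case (Suc n)
    then show ?case using add[OF P, of u "real n *\<^sub>R Z" Z] by (simp add: scaleR_add_left algebra_simps)
  qed
  have neg: "D P u (- Z) = - D P u Z" if P: "smooth_on P UNIV" for P u Z
    using add[OF P, of u Z "- Z"] nat[OF P, of u 0 Z] by simp
  have sc: "D (\<lambda>y. t *\<^sub>R P (t *\<^sub>R y)) (t *\<^sub>R u) (t\<^sup>2 *\<^sub>R Z) = t\<^sup>2 * D P u Z" if P: "smooth_on P UNIV" and t: "t \<noteq> 0" for P u Z t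
  proof -
    have "t *\<^sub>R (P (t *\<^sub>R y) + lin Z (t *\<^sub>R y)) = t *\<^sub>R P (t *\<^sub>R y) + lin (t\<^sup>2 *\<^sub>R Z) y" for y
      by (simp add: lin_simps scaleR_add_right power2_eq_square)
    then show ?thesis using hor_scaled[OF sP[OF P] t, of Z u a b] hor_scaled[OF P t, of u a b] by (simp add: D_def right_diff_distrib)
  qed
  have sd: "smooth_on (\<lambda>y. t *\<^sub>R P (t *\<^sub>R y)) UNIV" if P: "smooth_on P UNIV" for P :: "real^'m \<Rightarrow> 'm cf" and t
    using smooth_affine[OF P, of t 0] by (intro smooth_on_scaleR smooth_on_const open_UNIV) auto
  define L where "L = D (\<lambda>y. 0) 0"
  have const: "D P u Z = L Z" if P: "smooth_on P UNIV" for P u Z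
  proof -
    \<comment> \<open>The homothety that multiplies first derivatives by \<open>1 / (n + 1)\<close>; additivity restores the factor, and the
      other arguments tend to \<open>0\<close>.\<close>
    define t where "t n = 1 / sqrt (real (Suc n))" for n
    have t: "t n \<noteq> 0" "(t n)\<^sup>2 = 1 / real (Suc n)" for n
      by (simp_all add: t_def power_divide)
    have t0: "t \<longlonglongrightarrow> 0"
    proof -
      have "(\<lambda>n. sqrt (1 / real (Suc n))) \<longlonglongrightarrow> sqrt 0"
        using LIMSEQ_inverse_real_of_nat by (intro tendsto_real_sqrt) (simp add: inverse_eq_divide)
      then show ?thesis by (simp add: t_def[abs_def] real_sqrt_divide)
    qed
    have step: "D P u Z = D (\<lambda>y. t n *\<^sub>R P (t n *\<^sub>R y)) (t n *\<^sub>R u) Z" for n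
    proof -
      have "real (Suc n) *\<^sub>R ((t n)\<^sup>2 *\<^sub>R Z) = Z" unfolding t(2) by simp
      then have "D (\<lambda>y. t n *\<^sub>R P (t n *\<^sub>R y)) (t n *\<^sub>R u) Z = real (Suc n) * D (\<lambda>y. t n *\<^sub>R P (t n *\<^sub>R y)) (t n *\<^sub>R u) ((t n)\<^sup>2 *\<^sub>R Z)"
        using nat[OF sd[OF P, of "t n"], of "t n *\<^sub>R u" "Suc n" "(t n)\<^sup>2 *\<^sub>R Z"] by simp
      also have "\<dots> = D P u Z" by (subst sc[OF P t(1)]) (simp add: t(2) del: of_nat_Suc)
      finally show ?thesis by simp
    qed
    have G: "smooth_on (\<lambda>p. fst p *\<^sub>R P (fst p *\<^sub>R snd p) + lin Z (snd p)) UNIV" for Z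
      by (intro smooth_on_add smooth_on_scaleR smooth_on_fst smooth_on_id open_UNIV smooth_on_compose_UNIV[OF open_UNIV P]
          smooth_on_compose_UNIV[OF open_UNIV smooth_on_lin[OF open_UNIV]] smooth_on_snd)
    have u0: "((\<lambda>s. s *\<^sub>R u) \<longlongrightarrow> 0) (at 0)"
    proof -
      have "((\<lambda>s. s *\<^sub>R u) \<longlongrightarrow> 0 *\<^sub>R u) (at 0)" by (intro tendsto_intros)
      then show ?thesis by simp
    qed
    have F0: "((\<lambda>s. hor (\<lambda>y. s *\<^sub>R P (s *\<^sub>R y) + lin Z y) (s *\<^sub>R u) a b) \<longlongrightarrow> hor (lin Z) 0 a b) (at 0)" for Z
      using ph_continuous[OF G[of Z] u0, of "(a, 0)" "(b, 0)"] by (simp add: hor_def)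
    have "((\<lambda>s. D (\<lambda>y. s *\<^sub>R P (s *\<^sub>R y)) (s *\<^sub>R u) Z) \<longlongrightarrow> L Z) (at 0)"
      unfolding D_def L_def using tendsto_diff[OF F0[of Z] F0[of 0]] by (simp add: lin_zero)
    then have "(\<lambda>n. D (\<lambda>y. t n *\<^sub>R P (t n *\<^sub>R y)) (t n *\<^sub>R u) Z) \<longlonglongrightarrow> L Z"
      by (rule filterlim_compose) (use t0 t(1) in \<open>simp add: filterlim_at\<close>)
    then show ?thesis using step LIMSEQ_unique[OF tendsto_const] by simp
  qed
  have z: "smooth_on (\<lambda>y :: real^'m. 0 :: 'm cf) UNIV" by (rule smooth_on_const[OF open_UNIV])
  have pos: "L (c *\<^sub>R Z) = c * L Z" if "c > 0" for c Z
    using sc[OF z, of "sqrt c" 0 Z] that by (simp add: L_def)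
  have "linear L"
  proof (rule linearI)
    show "L (A + B) = L A + L B" for A B unfolding L_def by (rule add[OF z])
    show "L (c *\<^sub>R Z) = c *\<^sub>R L Z" for c Z
    proof (cases c "0 :: real" rule: linorder_cases)
      case less
      then have "L (c *\<^sub>R Z) = - L ((- c) *\<^sub>R Z)" using neg[OF z, of 0 "(- c) *\<^sub>R Z"] by (simp add: L_def)
      then show ?thesis using pos[of "- c" Z] less by simp
    next
      case equal
      then show ?thesis using nat[OF z, of 0 0 Z] by (simp add: L_def)
    next
      case greater
      then show ?thesis using pos by simp
    qed
  qed
  moreover have "hor (\<lambda>y. P y + lin Z y) u a b = hor P u a b + L Z" if "smooth_on P UNIV" for P u Z
    using const[OF that, of u Z] by (simp add: D_def)
  ultimately show ?thesis by blast
qed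

text \<open>The case \<open>r = 0\<close> of \<open>vanishing_difference\<close> gives vanishing third differences in \<open>(u, X)\<close>: the linear field
  \<open>q\<close>, whose slope is the increment of \<open>X\<close>, changes \<open>hor\<close> by a constant according to \<open>hor_affine\<close>, and
  shifting it adds that increment.\<close>

lemma hor_quadratic: "\<exists>B. bilinear B \<and> (\<forall>u X. hor (\<lambda>y. X) u a b = B (u, X) (u, X))"
proof -
  obtain L where L: "linear L" "\<And>P u Z. smooth_on P UNIV \<Longrightarrow> hor (\<lambda>y. P y + lin Z y) u a b = hor P u a b + L Z"
    using hor_affine by blast
  define f where "f z = hor (\<lambda>y. snd z) (fst z) a b" for z
  have c: "smooth_on (\<lambda>y :: real^'m. X :: 'm cf) UNIV" for X by (rule smooth_on_const[OF open_UNIV])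
  have "\<exists>B. bilinear B \<and> (\<forall>z. f z = B z z)"
  proof (rule quadratic_form)
    show "f (t *\<^sub>R z) = t\<^sup>2 * f z" if "t \<noteq> 0" for t z
      using hor_scaled[OF c that, of "snd z" "fst z" a b] by (simp add: f_def)
    show "((\<lambda>s. f (z + s *\<^sub>R w)) \<longlongrightarrow> f z) (at 0)" for z w
    proof -
      have G: "smooth_on (\<lambda>p :: real \<times> (real^'m). snd z + fst p *\<^sub>R snd w) UNIV"
        by (intro smooth_on_add smooth_on_scaleR smooth_on_fst smooth_on_id smooth_on_const open_UNIV)
      have "((\<lambda>s. fst z + s *\<^sub>R fst w) \<longlongrightarrow> fst z + 0 *\<^sub>R fst w) (at 0)" by (intro tendsto_intros)
      then have "((\<lambda>s. fst z + s *\<^sub>R fst w) \<longlongrightarrow> fst z) (at 0)" by simp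
      from ph_continuous[OF G this, of "(a, 0)" "(b, 0)"] show ?thesis by (simp add: f_def hor_def)
    qed
    show "findiff 3 (\<lambda>j. f (z + real j *\<^sub>R w)) = 0" for z w
    proof -
      define i :: 'm where "i = undefined"
      define Z :: "'m cf^'m" where "Z = axis i (snd w)"
      have lZ: "lin Z y = (y $ i) *\<^sub>R snd w" for y
        by (simp add: lin_def Z_def axis_def if_distrib[of "\<lambda>c. _ *\<^sub>R c"] cong: if_cong)
      have "findiff 3 (\<lambda>j. hor (\<lambda>y. snd z + real j *\<^sub>R (\<lambda>p. snd w) (0 :: real, y)) (fst z + real j *\<^sub>R fst w) a b) = 0"
      proof (rule vanishing_difference[where q = "lin Z" and r = 0 and ?v0.0 = "axis i 1" and l = "\<lambda>N. L (N *\<^sub>R Z)"])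
        show "hor (\<lambda>y. P y + N *\<^sub>R lin Z y) u a b = hor P u a b + L (N *\<^sub>R Z)" if "smooth_on P UNIV" for P u N
          using L(2)[OF that, of "N *\<^sub>R Z" u] by (simp add: lin_simps)
        show "lin Z (y + s *\<^sub>R axis i 1) = lin Z y + s *\<^sub>R (\<lambda>p. snd w) (s, y)" for s y
          by (simp add: lZ axis_def scaleR_add_left)
      qed (auto simp: lin_simps intro: smooth_on_lin smooth_on_const)
      then show ?thesis by (simp add: f_def)
    qed
  qed
  then show ?thesis by (auto simp: f_def)
qed

theorem hor_polynomial:
  "\<exists>B L. bilinear B \<and> linear L \<and> (\<forall>P u. smooth_on P UNIV \<longrightarrow> hor P u a b = B (u, P 0) (u, P 0) + L (jac P))"
proof -
  obtain L where L: "linear L" "\<And>P u Z. smooth_on P UNIV \<Longrightarrow> hor (\<lambda>y. P y + lin Z y) u a b = hor P u a b + L Z"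
    using hor_affine by blast
  obtain B where B: "bilinear B" "\<And>u X. hor (\<lambda>y. X) u a b = B (u, X) (u, X)" using hor_quadratic by blast
  have "hor P u a b = B (u, P 0) (u, P 0) + L (jac P)" if P: "smooth_on P UNIV" for P u
    using hor_jet[OF P, of u a b] L(2)[OF smooth_on_const[OF open_UNIV], of "P 0" "jac P" u] B(2) by simp
  then show ?thesis using L(1) B(1) by blast
qed

text \<open>The homothety contracts any field and covector to zero.\<close>

lemma scaled_limit:
  assumes P: "smooth_on P UNIV"
  shows "((\<lambda>t. ph (\<lambda>y. t *\<^sub>R P (t *\<^sub>R y)) (0, t *\<^sub>R u) v w) \<longlongrightarrow> ph (\<lambda>y. 0) (0, 0) v w) (at 0)"
proof -
  have G: "smooth_on (\<lambda>p. fst p *\<^sub>R P (fst p *\<^sub>R snd p)) UNIV"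
    by (intro smooth_on_scaleR smooth_on_fst smooth_on_id open_UNIV smooth_on_compose_UNIV[OF open_UNIV P] smooth_on_snd)
  have u0: "((\<lambda>s. s *\<^sub>R u) \<longlongrightarrow> 0) (at 0)"
  proof -
    have "((\<lambda>s. s *\<^sub>R u) \<longlongrightarrow> 0 *\<^sub>R u) (at 0)" by (intro tendsto_intros)
    then show ?thesis by simp
  qed
  show ?thesis using ph_continuous[OF G u0, of v w] by simp
qed

text \<open>The mixed parts have weight \<open>0\<close> under homotheties, the vertical part has weight \<open>-2\<close>; compare with the
  limit for \<open>t \<rightarrow> 0\<close>.\<close>

lemma ph_mixed_const:
  assumes P: "smooth_on P UNIV"
  shows "ph P (0, u) (a, 0) (0, b) = ph (\<lambda>y. 0) (0, 0) (a, 0) (0, b)"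
    and "ph P (0, u) (0, a) (b, 0) = ph (\<lambda>y. 0) (0, 0) (0, a) (b, 0)"
    and "ph P (0, u) (0, a) (0, b) = 0"
proof -
  have sd: "smooth_on (\<lambda>y. t *\<^sub>R P (t *\<^sub>R y)) UNIV" for t
    using smooth_affine[OF P, of t 0] by (intro smooth_on_scaleR smooth_on_const P open_UNIV) auto
  have s1: "(t *\<^sub>R c, 0 :: real^'m) = t *\<^sub>R (c, 0)" and s2: "(0 :: real^'m, c /\<^sub>R t) = inverse t *\<^sub>R (0, c)" for t and c :: "real^'m"
    by (simp_all add: scaleR_Pair)
  note bl = ph_tensor(1)[OF P]
  have e: "ph (\<lambda>y. t *\<^sub>R P (t *\<^sub>R y)) (0, t *\<^sub>R u) (a, 0) (0, b) = ph P (0, u) (a, 0) (0, b)"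
    "ph (\<lambda>y. t *\<^sub>R P (t *\<^sub>R y)) (0, t *\<^sub>R u) (0, a) (b, 0) = ph P (0, u) (0, a) (b, 0)"
    "t\<^sup>2 * ph (\<lambda>y. t *\<^sub>R P (t *\<^sub>R y)) (0, t *\<^sub>R u) (0, a) (0, b) = ph P (0, u) (0, a) (0, b)"
    if t: "t \<noteq> 0" for t
  proof -
    have "ph P z (t *\<^sub>R (a, 0)) (inverse t *\<^sub>R (0, b)) = ph P z (a, 0) (0, b)"
      "ph P z (inverse t *\<^sub>R (0, a)) (t *\<^sub>R (b, 0)) = ph P z (0, a) (b, 0)"
      "t\<^sup>2 * ph P z (inverse t *\<^sub>R (0, a)) (inverse t *\<^sub>R (0, b)) = ph P z (0, a) (0, b)" for z
      using t by (simp_all only: bilinear_lmul[OF bl] bilinear_rmul[OF bl]) (simp_all add: power2_eq_square field_simps)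
    note this[folded s1 s2]
    then show "ph (\<lambda>y. t *\<^sub>R P (t *\<^sub>R y)) (0, t *\<^sub>R u) (a, 0) (0, b) = ph P (0, u) (a, 0) (0, b)"
      "ph (\<lambda>y. t *\<^sub>R P (t *\<^sub>R y)) (0, t *\<^sub>R u) (0, a) (b, 0) = ph P (0, u) (0, a) (b, 0)"
      "t\<^sup>2 * ph (\<lambda>y. t *\<^sub>R P (t *\<^sub>R y)) (0, t *\<^sub>R u) (0, a) (0, b) = ph P (0, u) (0, a) (0, b)"
      using ph_homothety[OF P t, of 0 "t *\<^sub>R u" a 0 0 b] ph_homothety[OF P t, of 0 "t *\<^sub>R u" 0 a b 0]
        ph_homothety[OF P t, of 0 "t *\<^sub>R u" 0 a 0 b] t by simp_all
  qed
  have ev: "\<forall>\<^sub>F t in at (0::real). t \<noteq> 0" by (simp add: eventually_at_filter)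
  have "((\<lambda>t::real. ph P (0, u) (a, 0) (0, b)) \<longlongrightarrow> ph (\<lambda>y. 0) (0, 0) (a, 0) (0, b)) (at 0)"
    by (rule Lim_transform_eventually[OF scaled_limit[OF P, of u]]) (use ev e(1) in \<open>auto elim!: eventually_mono\<close>)
  then show "ph P (0, u) (a, 0) (0, b) = ph (\<lambda>y. 0) (0, 0) (a, 0) (0, b)"
    using tendsto_unique[OF _ tendsto_const] by (metis at_neq_bot)
  have "((\<lambda>t::real. ph P (0, u) (0, a) (b, 0)) \<longlongrightarrow> ph (\<lambda>y. 0) (0, 0) (0, a) (b, 0)) (at 0)"
    by (rule Lim_transform_eventually[OF scaled_limit[OF P, of u]]) (use ev e(2) in \<open>auto elim!: eventually_mono\<close>)
  then show "ph P (0, u) (0, a) (b, 0) = ph (\<lambda>y. 0) (0, 0) (0, a) (b, 0)"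
    using tendsto_unique[OF _ tendsto_const] by (metis at_neq_bot)
  have "((\<lambda>t::real. t\<^sup>2 * ph (\<lambda>y. t *\<^sub>R P (t *\<^sub>R y)) (0, t *\<^sub>R u) (0, a) (0, b)) \<longlongrightarrow> 0\<^sup>2 * ph (\<lambda>y. 0) (0, 0) (0, a) (0, b)) (at 0)"
    by (intro tendsto_intros scaled_limit[OF P])
  then have "((\<lambda>t::real. ph P (0, u) (0, a) (0, b)) \<longlongrightarrow> 0\<^sup>2 * ph (\<lambda>y. 0) (0, 0) (0, a) (0, b)) (at 0)"
    by (rule Lim_transform_eventually) (use ev e(3) in \<open>auto elim!: eventually_mono\<close>)
  then show "ph P (0, u) (0, a) (0, b) = 0"
    using tendsto_unique[OF _ tendsto_const] by (metis at_neq_bot mult_zero_left zero_power2)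
qed

end

section \<open>Classification of the invariant pieces\<close>

text \<open>Expand one argument after the other.\<close>

lemma multilinear_expand:
  fixes f :: "('k::finite \<Rightarrow> 'v::real_vector) \<Rightarrow> real" and e :: "'j::finite \<Rightarrow> 'v"
  assumes lin: "\<And>g q. linear (\<lambda>x. f (g(q := x)))"
  shows "f (\<lambda>q. \<Sum>j\<in>UNIV. a q j *\<^sub>R e j) = (\<Sum>j\<in>UNIV. (\<Prod>q\<in>UNIV. a q (j q)) * f (\<lambda>q. e (j q)))"
proof -
  define w where "w q = (\<Sum>j\<in>UNIV. a q j *\<^sub>R e j)" for q
  have "f (\<lambda>q. if q \<in> S then w q else g q) =
      (\<Sum>j\<in>PiE S (\<lambda>_. UNIV). (\<Prod>q\<in>S. a q (j q)) * f (\<lambda>q. if q \<in> S then e (j q) else g q))" if "finite S" for S g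
    using that
  proof (induction S arbitrary: g rule: finite_induct)
    case empty
    then show ?case by simp
  next
    case (insert s S)
    let ?h = "\<lambda>j x q. if q \<in> insert s S then e ((j(s := x)) q) else g q"
    have "f (\<lambda>q. if q \<in> insert s S then w q else g q) = f (\<lambda>q. if q \<in> S then w q else (g(s := w s)) q)"
      using insert by (intro arg_cong[where f = f]) auto
    also have "\<dots> = (\<Sum>j\<in>PiE S (\<lambda>_. UNIV). (\<Prod>q\<in>S. a q (j q)) * f (\<lambda>q. if q \<in> S then e (j q) else (g(s := w s)) q))"
      by (rule insert.IH)
    also have "\<dots> = (\<Sum>j\<in>PiE S (\<lambda>_. UNIV). (\<Prod>q\<in>S. a q (j q)) * (\<Sum>x\<in>UNIV. a s x * f (?h j x)))"
    proof (intro sum.cong refl arg_cong2[where f = "(*)"])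
      fix j :: "'k \<Rightarrow> 'j"
      let ?k = "\<lambda>q. if q \<in> S then e (j q) else g q"
      have "(\<lambda>q. if q \<in> S then e (j q) else (g(s := w s)) q) = ?k(s := w s)" using insert by auto
      then have "f (\<lambda>q. if q \<in> S then e (j q) else (g(s := w s)) q) = (\<Sum>x\<in>UNIV. a s x * f (?k(s := e x)))"
        by (simp only: w_def linear_sum[OF lin] linear_scale[OF lin] real_scaleR_def)
      moreover have "?k(s := e x) = ?h j x" for x using insert by auto
      ultimately show "f (\<lambda>q. if q \<in> S then e (j q) else (g(s := w s)) q) = (\<Sum>x\<in>UNIV. a s x * f (?h j x))" by simp
    qed
    also have "\<dots> = (\<Sum>x\<in>UNIV. \<Sum>j\<in>PiE S (\<lambda>_. UNIV). (\<Prod>q\<in>insert s S. a q ((j(s := x)) q)) * f (?h j x))"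
    proof -
      have "(\<Prod>q\<in>insert s S. a q ((j(s := x)) q)) = a s x * (\<Prod>q\<in>S. a q (j q))" for j x
        using insert by (simp, intro disjI2 prod.cong) auto
      then show ?thesis by (subst sum.swap) (simp add: sum_distrib_left mult_ac)
    qed
    also have "\<dots> = (\<Sum>(x, j)\<in>UNIV \<times> PiE S (\<lambda>_. UNIV). (\<Prod>q\<in>insert s S. a q ((j(s := x)) q)) * f (?h j x))"
      by (rule sum.cartesian_product)
    also have "\<dots> = (\<Sum>j\<in>PiE (insert s S) (\<lambda>_. UNIV). (\<Prod>q\<in>insert s S. a q (j q)) * f (\<lambda>q. if q \<in> insert s S then e (j q) else g q))"
    proof -
      have inj: "inj_on (\<lambda>(x, j). j(s := x)) (UNIV \<times> PiE S (\<lambda>_. UNIV :: 'j set))"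
        using insert(2) by (rule inj_combinator)
      have im: "PiE (insert s S) (\<lambda>_. UNIV :: 'j set) = (\<lambda>(x, j). j(s := x)) ` (UNIV \<times> PiE S (\<lambda>_. UNIV))"
        by (rule PiE_insert_eq)
      show ?thesis unfolding im sum.reindex[OF inj] comp_def by (intro sum.cong refl) (simp only: split_beta)
    qed
    finally show ?case .
  qed
  from this[of UNIV] show ?thesis by (simp add: w_def)
qed

text \<open>Invariance under \<open>A\<close> on vectors and the inverse transpose on covectors says that the coefficient
  array commutes with the tensor powers of \<open>A\<close>. Each permutation \<open>s\<close> stands for a complete
  contraction of the covectors with the vectors.\<close>

theorem invariant_forms:
  fixes f :: "('k::finite \<Rightarrow> real^'m::finite) \<Rightarrow> ('k \<Rightarrow> real^'m) \<Rightarrow> real"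
  assumes l1: "\<And>\<alpha> v q. linear (\<lambda>x. f (\<alpha>(q := x)) v)" and l2: "\<And>\<alpha> v q. linear (\<lambda>x. f \<alpha> (v(q := x)))"
    and inv: "\<And>A B \<alpha> \<alpha>' v. linear A \<Longrightarrow> linear B \<Longrightarrow> (\<And>x. B (A x) = x) \<Longrightarrow> (\<And>x. A (B x) = x) \<Longrightarrow>
       (\<And>q x. \<alpha>' q \<bullet> A x = \<alpha> q \<bullet> x) \<Longrightarrow> f \<alpha> v = f \<alpha>' (\<lambda>q. A (v q))"
  shows "\<exists>a. \<forall>i j. f (\<lambda>q. axis (j q) 1) (\<lambda>q. axis (i q) 1) = (\<Sum>s | bij s. a s * (if j = i \<circ> s then 1 else 0))"
proof -
  let ?c = "\<lambda>i j. f (\<lambda>q. axis (j q) 1) (\<lambda>q. axis (i q) 1)"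
  have "\<exists>a. \<forall>i j. ?c i j = (\<Sum>s | bij s. a s * (if j = i \<circ> s then 1 else 0))"
  proof (rule invariant_tensors)
    fix A :: "real^'m^'m" and i l :: "'k \<Rightarrow> 'm" assume "invertible A"
    then obtain A' where A': "A ** A' = mat 1" "A' ** A = mat 1" by (auto simp: invertible_def)
    let ?A = "\<lambda>x. transpose A *v x" and ?B = "\<lambda>x. transpose A' *v x"
    have AB: "?B (?A x) = x" "?A (?B x) = x" for x
      using A' by (simp_all add: vector_matrix_mul_assoc)
    have "(\<Sum>j\<in>UNIV. ?c i j * (\<Prod>q\<in>UNIV. A $ (j q) $ (l q))) = f (\<lambda>q. \<Sum>j\<in>UNIV. A $ j $ (l q) *\<^sub>R axis j 1) (\<lambda>q. axis (i q) 1)"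
      using multilinear_expand[of "\<lambda>\<alpha>. f \<alpha> (\<lambda>q. axis (i q) 1)" "\<lambda>q j. A $ j $ (l q)" "\<lambda>j. axis j 1", OF l1] by (simp add: mult.commute)
    also have "\<dots> = f (\<lambda>q. axis (l q) 1) (\<lambda>q. ?A (axis (i q) 1))"
    proof (rule inv[OF matrix_vector_mul_linear matrix_vector_mul_linear AB])
      fix q x
      have "(\<Sum>j\<in>UNIV. A $ j $ (l q) *\<^sub>R axis j (1::real)) = A *v axis (l q) 1"
        by (simp add: vec_eq_iff matrix_vector_mult_def axis_def if_distrib cong: if_cong)
      then show "axis (l q) 1 \<bullet> ?A x = (\<Sum>j\<in>UNIV. A $ j $ (l q) *\<^sub>R axis j 1) \<bullet> x"
        by (simp add: dot_lmul_matrix inner_commute vector_transpose_matrix)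
    qed
    also have "(\<lambda>q. ?A (axis (i q) 1)) = (\<lambda>q. \<Sum>j\<in>UNIV. A $ (i q) $ j *\<^sub>R axis j 1)"
      by (simp add: fun_eq_iff vec_eq_iff matrix_vector_mult_def transpose_def axis_def if_distrib cong: if_cong)
    also have "f (\<lambda>q. axis (l q) 1) (\<lambda>q. \<Sum>j\<in>UNIV. A $ (i q) $ j *\<^sub>R axis j 1) = (\<Sum>j\<in>UNIV. (\<Prod>q\<in>UNIV. A $ (i q) $ (j q)) * ?c j l)"
      by (rule multilinear_expand[OF l2])
    finally show "(\<Sum>j\<in>UNIV. ?c i j * (\<Prod>q\<in>UNIV. A $ (j q) $ (l q))) = (\<Sum>j\<in>UNIV. (\<Prod>q\<in>UNIV. A $ (i q) $ (j q)) * ?c j l)" .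
  qed
  then show ?thesis .
qed

text \<open>Decomposable coefficient arrays, with the upper index in the middle, and decomposable derivatives of fields.\<close>

definition ten3 :: "real^'m \<Rightarrow> real^'m \<Rightarrow> real^'m \<Rightarrow> 'm::finite cf" where
  "ten3 \<alpha> v \<beta> = (\<chi> l r n. \<alpha> $ l * v $ r * \<beta> $ n)"

definition ten4 :: "real^'m \<Rightarrow> real^'m \<Rightarrow> real^'m \<Rightarrow> real^'m \<Rightarrow> 'm::finite cf^'m" where
  "ten4 \<gamma> \<alpha> v \<beta> = (\<chi> d. \<gamma> $ d *\<^sub>R ten3 \<alpha> v \<beta>)"

lemma ten3_simps:
  "ten3 (\<alpha> + \<alpha>') v \<beta> = ten3 \<alpha> v \<beta> + ten3 \<alpha>' v \<beta>" "ten3 (t *\<^sub>R \<alpha>) v \<beta> = t *\<^sub>R ten3 \<alpha> v \<beta>"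
  "ten3 \<alpha> (v + v') \<beta> = ten3 \<alpha> v \<beta> + ten3 \<alpha> v' \<beta>" "ten3 \<alpha> (t *\<^sub>R v) \<beta> = t *\<^sub>R ten3 \<alpha> v \<beta>"
  "ten3 \<alpha> v (\<beta> + \<beta>') = ten3 \<alpha> v \<beta> + ten3 \<alpha> v \<beta>'" "ten3 \<alpha> v (t *\<^sub>R \<beta>) = t *\<^sub>R ten3 \<alpha> v \<beta>"
  by (simp_all add: ten3_def vec_eq_iff algebra_simps)

lemma ten4_simps:
  "ten4 (\<gamma> + \<gamma>') \<alpha> v \<beta> = ten4 \<gamma> \<alpha> v \<beta> + ten4 \<gamma>' \<alpha> v \<beta>" "ten4 (t *\<^sub>R \<gamma>) \<alpha> v \<beta> = t *\<^sub>R ten4 \<gamma> \<alpha> v \<beta>"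
  "ten4 \<gamma> (\<alpha> + \<alpha>') v \<beta> = ten4 \<gamma> \<alpha> v \<beta> + ten4 \<gamma> \<alpha>' v \<beta>" "ten4 \<gamma> (t *\<^sub>R \<alpha>) v \<beta> = t *\<^sub>R ten4 \<gamma> \<alpha> v \<beta>"
  "ten4 \<gamma> \<alpha> (v + v') \<beta> = ten4 \<gamma> \<alpha> v \<beta> + ten4 \<gamma> \<alpha> v' \<beta>" "ten4 \<gamma> \<alpha> (t *\<^sub>R v) \<beta> = t *\<^sub>R ten4 \<gamma> \<alpha> v \<beta>"
  "ten4 \<gamma> \<alpha> v (\<beta> + \<beta>') = ten4 \<gamma> \<alpha> v \<beta> + ten4 \<gamma> \<alpha> v \<beta>'" "ten4 \<gamma> \<alpha> v (t *\<^sub>R \<beta>) = t *\<^sub>R ten4 \<gamma> \<alpha> v \<beta>"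
  by (simp_all add: ten4_def ten3_def vec_eq_iff algebra_simps)

lemma gam_ten3: "gam (co (ten3 \<alpha> v \<beta>)) p q = ((\<alpha> \<bullet> p) * (\<beta> \<bullet> q)) *\<^sub>R v"
  by (simp add: gam_def co_def ten3_def vec_eq_iff inner_vec_def sum_product sum_distrib_left sum_distrib_right mult_ac)
    (intro allI sum.swap)

lemma lin_ten4: "lin (ten4 \<gamma> \<alpha> v \<beta>) y = (\<gamma> \<bullet> y) *\<^sub>R ten3 \<alpha> v \<beta>"
  by (simp add: lin_def ten4_def inner_vec_def scaleR_sum_left mult.commute)

lemma ten3_expand: "X = (\<Sum>l\<in>UNIV. \<Sum>r\<in>UNIV. \<Sum>n\<in>UNIV. co X l r n *\<^sub>R ten3 (axis l 1) (axis r 1) (axis n 1))"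
proof -
  have "(\<Sum>l\<in>UNIV. \<Sum>r\<in>UNIV. \<Sum>n\<in>UNIV. co X l r n *\<^sub>R ten3 (axis l 1) (axis r 1) (axis n 1)) $ a $ b $ c
     = (\<Sum>l\<in>UNIV. \<Sum>r\<in>UNIV. \<Sum>n\<in>UNIV. if n = c then if r = b then if l = a then co X l r n else 0 else 0 else 0)" for a b c
    unfolding sum_component by (intro sum.cong refl) (auto simp: ten3_def axis_def)
  then show ?thesis by (simp add: vec_eq_iff co_def)
qed

lemma ten4_expand: "Z = (\<Sum>d\<in>UNIV. \<Sum>l\<in>UNIV. \<Sum>r\<in>UNIV. \<Sum>n\<in>UNIV. co (Z $ d) l r n *\<^sub>R ten4 (axis d 1) (axis l 1) (axis r 1) (axis n 1))"
proof -
  have "(\<Sum>d\<in>UNIV. \<Sum>l\<in>UNIV. \<Sum>r\<in>UNIV. \<Sum>n\<in>UNIV. co (Z $ d) l r n *\<^sub>R ten4 (axis d 1) (axis l 1) (axis r 1) (axis n 1)) $ e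
    = (\<Sum>d\<in>UNIV. if d = e then \<Sum>l\<in>UNIV. \<Sum>r\<in>UNIV. \<Sum>n\<in>UNIV. co (Z $ d) l r n *\<^sub>R ten3 (axis l 1) (axis r 1) (axis n 1) else 0)" for e
    unfolding sum_component by (intro sum.cong refl) (auto simp: ten4_def axis_def)
  then show ?thesis by (simp add: vec_eq_iff[where y = "sum _ _"] flip: ten3_expand)
qed

context nat_op
begin

lemma hor_bilinear: assumes "smooth_on P UNIV" shows "bilinear (hor P u)"
proof -
  note b = ph_tensor(1)[OF assms, of "(0, u)"]
  have "(a + a', 0 :: real^'m) = (a, 0) + (a', 0)" "(t *\<^sub>R a, 0 :: real^'m) = t *\<^sub>R (a, 0)" for a a' :: "real^'m" and t by simp_all
  then show ?thesis unfolding bilinear_def hor_def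
    by (intro conjI allI linearI) (simp_all only: bilinear_ladd[OF b] bilinear_radd[OF b] bilinear_lmul[OF b] bilinear_rmul[OF b])
qed

lemma hor_invariant:
  assumes A: "linear A" "linear B" "\<And>v. B (A v) = v" "\<And>v. A (B v) = v"
    and P: "smooth_on P UNIV" "smooth_on P' UNIV"
    and law: "\<And>x v w. A (gam (co (P x)) v w) = gam (co (P' (A x))) (A v) (A w)" and u: "\<And>v. u' \<bullet> A v = u \<bullet> v"
  shows "hor P u a b = hor P' u' (A a) (A b)"
proof -
  have l: "A (gam (co (P x)) v w) = gam (co (P' (A x + 0))) (A v) (A w)" for x v w by (simp add: law)
  have "ph P (0, u) (a, 0) (b, 0) = ph P' (A 0 + 0, u') (A a, 0) (A b, 0)"
    by (rule ph_affine[OF A P l u]) simp_all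
  then show ?thesis unfolding hor_def using linear_0[OF A(1)] by simp
qed

text \<open>The polar form of the quadratic form of \<open>hor_polynomial\<close>, on pairs of a covector and the value of a field.\<close>

definition pol :: "(real^'m) \<times> 'm cf \<Rightarrow> (real^'m) \<times> 'm cf \<Rightarrow> real^'m \<Rightarrow> real^'m \<Rightarrow> real" where
  "pol z w a b = hor (\<lambda>y. snd (z + w)) (fst (z + w)) a b - hor (\<lambda>y. snd z) (fst z) a b - hor (\<lambda>y. snd w) (fst w) a b"

text \<open>The linear part of \<open>hor_polynomial\<close>, on first derivatives of fields.\<close>

definition lin_part :: "'m cf^'m \<Rightarrow> real^'m \<Rightarrow> real^'m \<Rightarrow> real" where
  "lin_part Z a b = hor (lin Z) 0 a b"

lemma smooth_const_field: "smooth_on (\<lambda>y :: real^'m. X :: 'm cf) UNIV"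
  by (rule smooth_on_const[OF open_UNIV])

lemma hor_split:
  assumes P: "smooth_on P UNIV"
  shows "hor P u a b = pol (u, P 0) (u, P 0) a b / 2 + lin_part (jac P) a b"
    and "bilinear (\<lambda>z w. pol z w a b)" and "linear (\<lambda>Z. lin_part Z a b)"
proof -
  obtain B L where B: "bilinear B" and L: "linear L"
    and hor: "\<And>P u. smooth_on P UNIV \<Longrightarrow> hor P u a b = B (u, P 0) (u, P 0) + L (jac P)" using hor_polynomial by metis
  have j0: "jac (\<lambda>y. X) = 0" for X using jac_lin[of X 0] by (simp add: lin_simps)
  have Fc: "hor (\<lambda>y. snd z) (fst z) a b = B z z" for z
    using hor[OF smooth_const_field, of "snd z" "fst z"] linear_0[OF L] by (simp add: j0)
  have p: "pol z w a b = B z w + B w z" for z w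
    unfolding pol_def Fc by (simp add: bilinear_ladd[OF B] bilinear_radd[OF B])
  have lin_part: "lin_part Z a b = L Z" for Z
    using hor[OF smooth_on_lin[OF open_UNIV], of Z 0] jac_lin[of 0 Z] bilinear_lzero[OF B, of 0]
    by (simp add: lin_part_def lin_simps zero_prod_def)
  show "hor P u a b = pol (u, P 0) (u, P 0) a b / 2 + lin_part (jac P) a b" by (simp add: p lin_part hor[OF P])
  show "bilinear (\<lambda>z w. pol z w a b)" unfolding p bilinear_def
    by (intro conjI allI linearI) (simp_all add: bilinear_ladd[OF B] bilinear_radd[OF B] bilinear_lmul[OF B] bilinear_rmul[OF B] algebra_simps)
  show "linear (\<lambda>Z. lin_part Z a b)" unfolding lin_part by (rule L)
qed

lemma pol_bilinear_ab: "bilinear (pol z w)"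
  unfolding pol_def bilinear_def
  by (intro conjI allI linearI)
    (simp_all add: bilinear_ladd[OF hor_bilinear[OF smooth_const_field]] bilinear_radd[OF hor_bilinear[OF smooth_const_field]]
      bilinear_lmul[OF hor_bilinear[OF smooth_const_field]] bilinear_rmul[OF hor_bilinear[OF smooth_const_field]] algebra_simps)

lemma lin_part_bilinear_ab: "bilinear (lin_part Z)"
  unfolding lin_part_def[abs_def] by (rule hor_bilinear[OF smooth_on_lin[OF open_UNIV]])

lemma pol_sym: "pol z w a b = pol w z a b"
  by (simp add: pol_def add.commute)

lemma pol_slots:
  "pol (x + y, 0) w a b = pol (x, 0) w a b + pol (y, 0) w a b" "pol (t *\<^sub>R x, 0) w a b = t * pol (x, 0) w a b"
  "pol w (x + y, 0) a b = pol w (x, 0) a b + pol w (y, 0) a b" "pol w (t *\<^sub>R x, 0) a b = t * pol w (x, 0) a b"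
  "pol (0, X + Y) w a b = pol (0, X) w a b + pol (0, Y) w a b" "pol (0, t *\<^sub>R X) w a b = t * pol (0, X) w a b"
  "pol w (0, X + Y) a b = pol w (0, X) a b + pol w (0, Y) a b" "pol w (0, t *\<^sub>R X) a b = t * pol w (0, X) a b"
proof -
  note b = hor_split(2)[OF smooth_const_field, of a b]
  have e: "(x + y, 0 :: 'm cf) = (x, 0) + (y, 0)" "(t *\<^sub>R x, 0 :: 'm cf) = t *\<^sub>R (x, 0)"
    "(0 :: real^'m, X + Y) = (0, X) + (0, Y)" "(0 :: real^'m, t *\<^sub>R X) = t *\<^sub>R (0, X)" by simp_all
  show "pol (x + y, 0) w a b = pol (x, 0) w a b + pol (y, 0) w a b" "pol (t *\<^sub>R x, 0) w a b = t * pol (x, 0) w a b"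
    "pol w (x + y, 0) a b = pol w (x, 0) a b + pol w (y, 0) a b" "pol w (t *\<^sub>R x, 0) a b = t * pol w (x, 0) a b"
    "pol (0, X + Y) w a b = pol (0, X) w a b + pol (0, Y) w a b" "pol (0, t *\<^sub>R X) w a b = t * pol (0, X) w a b"
    "pol w (0, X + Y) a b = pol w (0, X) a b + pol w (0, Y) a b" "pol w (0, t *\<^sub>R X) a b = t * pol w (0, X) a b"
    unfolding e by (simp_all only: bilinear_ladd[OF b] bilinear_radd[OF b] bilinear_lmul[OF b] bilinear_rmul[OF b] real_scaleR_def)
qed

lemmas slot_simps = pol_slots ten3_simps ten4_simps linear_add[OF hor_split(3)[OF smooth_const_field]]
  linear_scale[OF hor_split(3)[OF smooth_const_field]]
  bilinear_ladd[OF pol_bilinear_ab] bilinear_radd[OF pol_bilinear_ab] bilinear_lmul[OF pol_bilinear_ab] bilinear_rmul[OF pol_bilinear_ab]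
  bilinear_ladd[OF lin_part_bilinear_ab] bilinear_radd[OF lin_part_bilinear_ab] bilinear_lmul[OF lin_part_bilinear_ab] bilinear_rmul[OF lin_part_bilinear_ab]

lemma hor_const_invariant:
  assumes A: "linear A" "linear B" "\<And>v. B (A v) = v" "\<And>v. A (B v) = v"
    and X: "\<And>v w. A (gam (co X) v w) = gam (co X') (A v) (A w)" and u: "\<And>v. u' \<bullet> A v = u \<bullet> v"
  shows "hor (\<lambda>y. X) u a b = hor (\<lambda>y. X') u' (A a) (A b)"
  by (rule hor_invariant[OF A smooth_const_field smooth_const_field X u])

lemma pol_invariant:
  assumes A: "linear A" "linear B" "\<And>v. B (A v) = v" "\<And>v. A (B v) = v"
    and X: "\<And>v w. A (gam (co X) v w) = gam (co X') (A v) (A w)" and u: "\<And>v. u' \<bullet> A v = u \<bullet> v"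
    and Y: "\<And>v w. A (gam (co Y) v w) = gam (co Y') (A v) (A w)" and t: "\<And>v. t' \<bullet> A v = t \<bullet> v"
  shows "pol (u, X) (t, Y) a b = pol (u', X') (t', Y') (A a) (A b)"
proof -
  have XY: "A (gam (co (X + Y)) v w) = gam (co (X' + Y')) (A v) (A w)" for v w
    by (simp add: gam_co linear_add[OF A(1)] X Y)
  have ut: "(u' + t') \<bullet> A v = (u + t) \<bullet> v" for v by (simp add: inner_add_left u t)
  show ?thesis unfolding pol_def
    using hor_const_invariant[OF A X u, of a b] hor_const_invariant[OF A Y t, of a b] hor_const_invariant[OF A XY ut, of a b] by simp
qed

lemma ten3_invariant:
  assumes "linear A" "\<And>v. \<alpha>' \<bullet> A v = \<alpha> \<bullet> v" "\<And>v. \<beta>' \<bullet> A v = \<beta> \<bullet> v"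
  shows "A (gam (co (ten3 \<alpha> x \<beta>)) v w) = gam (co (ten3 \<alpha>' (A x) \<beta>')) (A v) (A w)"
  by (simp add: gam_ten3 assms linear_scale)

lemma zero_invariant: "linear A \<Longrightarrow> A (gam (co 0) v w) = gam (co 0) (A v) (A w)"
  by (simp add: gam_def co_def linear_0 zero_vec_def[symmetric])

text \<open>The polynomial parts are invariant forms in covectors and vectors, once fields are written as sums of
  decomposable ones: here two covectors \<open>u\<close> and two vectors, below the slots \<open>\<alpha>\<close> and \<open>\<beta>\<close> of
  \<open>ten3 \<alpha> v \<beta>\<close> count as covectors and \<open>v\<close> as a vector.\<close>

lemma uu_array:
  "\<exists>a. \<forall>i j. pol (axis (j 1) 1, 0) (axis (j 2) 1, 0) (axis (i 1) 1) (axis (i 2) 1) = (\<Sum>s | bij (s :: 2 \<Rightarrow> 2). a s * (if j = i \<circ> s then 1 else 0))"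
proof (rule invariant_forms[where f = "\<lambda>\<alpha> v. pol (\<alpha> (1::2), 0) (\<alpha> 2, 0) (v (1::2)) (v 2)"])
  show "linear (\<lambda>x. pol ((\<alpha>(q := x)) 1, 0) ((\<alpha>(q := x)) 2, 0) (v 1) (v 2))" for \<alpha> v and q :: 2
    using exhaust_2[of q] by (auto intro!: linearI simp: slot_simps)
  show "linear (\<lambda>x. pol (\<alpha> (1::2), 0) (\<alpha> 2, 0) ((v(q := x)) 1) ((v(q := x)) 2))" for \<alpha> v and q :: 2
    using exhaust_2[of q] by (auto intro!: linearI simp: slot_simps)
  fix A B :: "real^'m \<Rightarrow> real^'m" and \<alpha> \<alpha>' v :: "2 \<Rightarrow> real^'m"
  assume A: "linear A" "linear B" "\<And>x. B (A x) = x" "\<And>x. A (B x) = x" and \<alpha>: "\<And>q x. \<alpha>' q \<bullet> A x = \<alpha> q \<bullet> x"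
  show "pol (\<alpha> 1, 0) (\<alpha> 2, 0) (v 1) (v 2) = pol (\<alpha>' 1, 0) (\<alpha>' 2, 0) (A (v 1)) (A (v 2))"
    by (rule pol_invariant[OF A zero_invariant[OF A(1)] \<alpha> zero_invariant[OF A(1)] \<alpha>])
qed

lemma uX_array:
  "\<exists>a. \<forall>i j. pol (axis (j 1) 1, 0) (0, ten3 (axis (j 2) 1) (axis (i 1) 1) (axis (j 3) 1)) (axis (i 2) 1) (axis (i 3) 1)
     = (\<Sum>s | bij (s :: 3 \<Rightarrow> 3). a s * (if j = i \<circ> s then 1 else 0))"
proof (rule invariant_forms[where f = "\<lambda>\<alpha> v. pol (\<alpha> (1::3), 0) (0, ten3 (\<alpha> 2) (v (1::3)) (\<alpha> 3)) (v 2) (v 3)"])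
  show "linear (\<lambda>x. pol ((\<alpha>(q := x)) 1, 0) (0, ten3 ((\<alpha>(q := x)) 2) (v 1) ((\<alpha>(q := x)) 3)) (v 2) (v 3))" for \<alpha> v and q :: 3
    using exhaust_3[of q] by (auto intro!: linearI simp: slot_simps)
  show "linear (\<lambda>x. pol (\<alpha> (1::3), 0) (0, ten3 (\<alpha> 2) ((v(q := x)) 1) (\<alpha> 3)) ((v(q := x)) 2) ((v(q := x)) 3))" for \<alpha> v and q :: 3
    using exhaust_3[of q] by (auto intro!: linearI simp: slot_simps)
  fix A B :: "real^'m \<Rightarrow> real^'m" and \<alpha> \<alpha>' v :: "3 \<Rightarrow> real^'m"
  assume A: "linear A" "linear B" "\<And>x. B (A x) = x" "\<And>x. A (B x) = x" and \<alpha>: "\<And>q x. \<alpha>' q \<bullet> A x = \<alpha> q \<bullet> x"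
  show "pol (\<alpha> 1, 0) (0, ten3 (\<alpha> 2) (v 1) (\<alpha> 3)) (v 2) (v 3) = pol (\<alpha>' 1, 0) (0, ten3 (\<alpha>' 2) (A (v 1)) (\<alpha>' 3)) (A (v 2)) (A (v 3))"
    by (rule pol_invariant[OF A zero_invariant[OF A(1)] \<alpha> ten3_invariant[OF A(1) \<alpha> \<alpha>]]) simp
qed

lemma L_array:
  "\<exists>a. \<forall>i j. lin_part (ten4 (axis (j 1) 1) (axis (j 2) 1) (axis (i 1) 1) (axis (j 3) 1)) (axis (i 2) 1) (axis (i 3) 1)
     = (\<Sum>s | bij (s :: 3 \<Rightarrow> 3). a s * (if j = i \<circ> s then 1 else 0))"
proof (rule invariant_forms[where f = "\<lambda>\<alpha> v. lin_part (ten4 (\<alpha> (1::3)) (\<alpha> 2) (v (1::3)) (\<alpha> 3)) (v 2) (v 3)"])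
  show "linear (\<lambda>x. lin_part (ten4 ((\<alpha>(q := x)) 1) ((\<alpha>(q := x)) 2) (v 1) ((\<alpha>(q := x)) 3)) (v 2) (v 3))" for \<alpha> v and q :: 3
    using exhaust_3[of q] by (auto intro!: linearI simp: slot_simps)
  show "linear (\<lambda>x. lin_part (ten4 (\<alpha> (1::3)) (\<alpha> 2) ((v(q := x)) 1) (\<alpha> 3)) ((v(q := x)) 2) ((v(q := x)) 3))" for \<alpha> v and q :: 3
    using exhaust_3[of q] by (auto intro!: linearI simp: slot_simps)
  fix A B :: "real^'m \<Rightarrow> real^'m" and \<alpha> \<alpha>' v :: "3 \<Rightarrow> real^'m"
  assume A: "linear A" "linear B" "\<And>x. B (A x) = x" "\<And>x. A (B x) = x" and \<alpha>: "\<And>q x. \<alpha>' q \<bullet> A x = \<alpha> q \<bullet> x"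
  show "lin_part (ten4 (\<alpha> 1) (\<alpha> 2) (v 1) (\<alpha> 3)) (v 2) (v 3) = lin_part (ten4 (\<alpha>' 1) (\<alpha>' 2) (A (v 1)) (\<alpha>' 3)) (A (v 2)) (A (v 3))"
    unfolding lin_part_def
    by (rule hor_invariant[OF A smooth_on_lin[OF open_UNIV] smooth_on_lin[OF open_UNIV]])
      (simp_all add: lin_ten4 gam_co gam_ten3 \<alpha> linear_scale[OF A(1)])
qed

lemma XX_array:
  "\<exists>a. \<forall>i j. pol (0, ten3 (axis (j 1) 1) (axis (i 1) 1) (axis (j 2) 1)) (0, ten3 (axis (j 3) 1) (axis (i 2) 1) (axis (j 4) 1)) (axis (i 3) 1) (axis (i 4) 1)
     = (\<Sum>s | bij (s :: 4 \<Rightarrow> 4). a s * (if j = i \<circ> s then 1 else 0))"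
proof (rule invariant_forms[where f = "\<lambda>\<alpha> v. pol (0, ten3 (\<alpha> (1::4)) (v (1::4)) (\<alpha> 2)) (0, ten3 (\<alpha> 3) (v 2) (\<alpha> 4)) (v 3) (v 4)"])
  show "linear (\<lambda>x. pol (0, ten3 ((\<alpha>(q := x)) 1) (v 1) ((\<alpha>(q := x)) 2)) (0, ten3 ((\<alpha>(q := x)) 3) (v 2) ((\<alpha>(q := x)) 4)) (v 3) (v 4))" for \<alpha> v and q :: 4
    using exhaust_4[of q] by (auto intro!: linearI simp: slot_simps)
  show "linear (\<lambda>x. pol (0, ten3 (\<alpha> (1::4)) ((v(q := x)) 1) (\<alpha> 2)) (0, ten3 (\<alpha> 3) ((v(q := x)) 2) (\<alpha> 4)) ((v(q := x)) 3) ((v(q := x)) 4))" for \<alpha> v and q :: 4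
    using exhaust_4[of q] by (auto intro!: linearI simp: slot_simps)
  fix A B :: "real^'m \<Rightarrow> real^'m" and \<alpha> \<alpha>' v :: "4 \<Rightarrow> real^'m"
  assume A: "linear A" "linear B" "\<And>x. B (A x) = x" "\<And>x. A (B x) = x" and \<alpha>: "\<And>q x. \<alpha>' q \<bullet> A x = \<alpha> q \<bullet> x"
  show "pol (0, ten3 (\<alpha> 1) (v 1) (\<alpha> 2)) (0, ten3 (\<alpha> 3) (v 2) (\<alpha> 4)) (v 3) (v 4) =
     pol (0, ten3 (\<alpha>' 1) (A (v 1)) (\<alpha>' 2)) (0, ten3 (\<alpha>' 3) (A (v 2)) (\<alpha>' 4)) (A (v 3)) (A (v 4))"
    by (rule pol_invariant[OF A ten3_invariant[OF A(1) \<alpha> \<alpha>] _ ten3_invariant[OF A(1) \<alpha> \<alpha>]]) simp_all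
qed

text \<open>The only invariant pairing of a vector and a covector is the evaluation.\<close>

lemma mixed_array:
  "\<exists>c. \<forall>a b. ph (\<lambda>y. 0) (0, 0) (a, 0) (0, b) = c * (a \<bullet> b)" "\<exists>c. \<forall>a b. ph (\<lambda>y. 0) (0, 0) (0, b) (a, 0) = c * (a \<bullet> b)"
proof -
  have bl: "bilinear (ph (\<lambda>y. 0) (0, 0))" by (rule ph_tensor(1)[OF smooth_const_field])
  have e: "(a + a', 0 :: real^'m) = (a, 0) + (a', 0)" "(t *\<^sub>R a, 0 :: real^'m) = t *\<^sub>R (a, 0)"
    "(0 :: real^'m, a + a') = (0, a) + (0, a')" "(0 :: real^'m, t *\<^sub>R a) = t *\<^sub>R (0, a)" for a a' :: "real^'m" and t by simp_all
  have gen: "\<exists>c. \<forall>a b. f b a = c * (a \<bullet> b)"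
    if l: "\<And>a. linear (\<lambda>b. f b a)" "\<And>b. linear (f b)"
      and inv: "\<And>A B \<alpha> \<alpha>' v. linear A \<Longrightarrow> linear B \<Longrightarrow> (\<And>x. B (A x) = x) \<Longrightarrow> (\<And>x. A (B x) = x) \<Longrightarrow> (\<And>x. \<alpha>' \<bullet> A x = \<alpha> \<bullet> x) \<Longrightarrow> f \<alpha> v = f \<alpha>' (A v)"
    for f :: "real^'m \<Rightarrow> real^'m \<Rightarrow> real"
  proof -
    have "\<exists>a. \<forall>i j. f (axis (j ()) 1) (axis (i ()) 1) = (\<Sum>s | bij (s :: unit \<Rightarrow> unit). a s * (if j = i \<circ> s then 1 else 0))"
      by (rule invariant_forms[where f = "\<lambda>\<alpha> v. f (\<alpha> ()) (v ())"]) (auto simp: l intro: inv)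
    then obtain a where a: "\<And>i j. f (axis (j ()) 1) (axis (i ()) 1) = (\<Sum>s | bij (s :: unit \<Rightarrow> unit). a s * (if j = i \<circ> s then 1 else 0))" by blast
    have b: "bij (s :: unit \<Rightarrow> unit)" "(s :: unit \<Rightarrow> unit) = id" for s
      by (auto simp: fun_eq_iff bij_def inj_on_def surj_def)
    have "{s :: unit \<Rightarrow> unit. bij s} = {id}" using b by auto
    then have c: "f (axis q 1) (axis p 1) = a id * (if q = p then 1 else 0)" for p q
      using a[of "\<lambda>_. q" "\<lambda>_. p"] by (simp add: fun_eq_iff)
    have "bilinear f" unfolding bilinear_def using l by auto
    note f_bilinear = this
    have "f b v = (\<Sum>l\<in>UNIV. \<Sum>n\<in>UNIV. if l = n then a id * b $ l * v $ n else 0)" for b v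
      unfolding bilinear_expand[OF f_bilinear, of b v] by (intro sum.cong refl) (simp add: c)
    then have "f b v = a id * (v \<bullet> b)" for b v
      by (simp add: inner_vec_def sum_distrib_left mult_ac)
    then show ?thesis by blast
  qed
  have inv: "ph (\<lambda>y. 0) (0, 0) (v, 0) (0, \<alpha>) = ph (\<lambda>y. 0) (0, 0) (A v, 0) (0, \<alpha>')"
    "ph (\<lambda>y. 0) (0, 0) (0, \<alpha>) (v, 0) = ph (\<lambda>y. 0) (0, 0) (0, \<alpha>') (A v, 0)"
    if A: "linear A" "linear B" "\<And>x. B (A x) = x" "\<And>x. A (B x) = x" "\<And>x. \<alpha>' \<bullet> A x = \<alpha> \<bullet> x" for A B \<alpha> \<alpha>' v
    using ph_affine[OF A(1-4) smooth_const_field smooth_const_field zero_invariant[OF A(1)], of 0 0 0 0 \<alpha>' \<alpha> 0 v 0]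
      ph_affine[OF A(1-4) smooth_const_field smooth_const_field zero_invariant[OF A(1)], of 0 0 \<alpha>' \<alpha> 0 0 0 0 v] A(5) linear_0[OF A(1)]
    by simp_all
  show "\<exists>c. \<forall>a b. ph (\<lambda>y. 0) (0, 0) (a, 0) (0, b) = c * (a \<bullet> b)"
  proof (rule gen[of "\<lambda>b a. ph (\<lambda>y. 0) (0, 0) (a, 0) (0, b)"])
    show "linear (\<lambda>b. ph (\<lambda>y. 0) (0, 0) (a, 0) (0, b))" "linear (\<lambda>a. ph (\<lambda>y. 0) (0, 0) (a, 0) (0, b))" for a b
      by (auto intro!: linearI simp: e bilinear_ladd[OF bl] bilinear_radd[OF bl] bilinear_lmul[OF bl] bilinear_rmul[OF bl] simp del: add_Pair scaleR_Pair)
  qed (rule inv(1))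
  show "\<exists>c. \<forall>a b. ph (\<lambda>y. 0) (0, 0) (0, b) (a, 0) = c * (a \<bullet> b)"
  proof (rule gen[of "\<lambda>b a. ph (\<lambda>y. 0) (0, 0) (0, b) (a, 0)"])
    show "linear (\<lambda>b. ph (\<lambda>y. 0) (0, 0) (0, b) (a, 0))" "linear (\<lambda>a. ph (\<lambda>y. 0) (0, 0) (0, b) (a, 0))" for a b
      by (auto intro!: linearI simp: e bilinear_ladd[OF bl] bilinear_radd[OF bl] bilinear_lmul[OF bl] bilinear_rmul[OF bl] simp del: add_Pair scaleR_Pair)
  qed (rule inv(2))
qed

end

section \<open>Explicit form of the horizontal part\<close>

text \<open>For the permutation expansions: up to symmetries every summand is a multiple of one of a few
  basic expressions.\<close>

lemma sum_of_multiples: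
  fixes g :: "'s \<Rightarrow> 'x \<Rightarrow> real" and bs :: "('x \<Rightarrow> real) list"
  assumes "finite S" and g: "\<And>s. s \<in> S \<Longrightarrow> \<exists>i<length bs. \<exists>e. \<forall>x. D x \<longrightarrow> g s x = e * (bs ! i) x"
  shows "\<exists>c. \<forall>x. D x \<longrightarrow> (\<Sum>s\<in>S. a s * g s x) = (\<Sum>i<length bs. c i * (bs ! i) x)"
proof -
  obtain i e where ie: "\<And>s. s \<in> S \<Longrightarrow> i s < length bs" "\<And>s x. s \<in> S \<Longrightarrow> D x \<Longrightarrow> g s x = e s * (bs ! i s) x"
    using g by metis
  define c where "c j = (\<Sum>s\<in>S. if i s = j then a s * e s else 0)" for j
  have "(\<Sum>s\<in>S. a s * g s x) = (\<Sum>j<length bs. c j * (bs ! j) x)" if "D x" for x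
  proof -
    have "(\<Sum>j<length bs. c j * (bs ! j) x) = (\<Sum>s\<in>S. \<Sum>j<length bs. if i s = j then a s * e s * (bs ! j) x else 0)"
      unfolding c_def sum_distrib_right by (subst sum.swap) (intro sum.cong refl, simp)
    also have "\<dots> = (\<Sum>s\<in>S. a s * g s x)" using ie that by (intro sum.cong refl) simp
    finally show ?thesis by simp
  qed
  then show ?thesis by blast
qed

text \<open>The index carried by slot \<open>k\<close> when the vectors in an invariant form are basis vectors: the summation index
  \<open>r\<close> (and \<open>t\<close>) comes from the upper indices of fields, and \<open>p\<close>, \<open>s\<close> are the
  arguments of the form.\<close>

definition idx3 :: "'m \<Rightarrow> 'm \<Rightarrow> 'm \<Rightarrow> 3 \<Rightarrow> 'm" where
  "idx3 r p s k = (if k = 1 then r else if k = 2 then p else s)"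

definition idx4 :: "'m \<Rightarrow> 'm \<Rightarrow> 'm \<Rightarrow> 'm \<Rightarrow> 4 \<Rightarrow> 'm" where
  "idx4 r t p s k = (if k = 1 then r else if k = 2 then t else if k = 3 then p else s)"

lemma idx_simps:
  "idx3 r p s 1 = r" "idx3 r p s 2 = p" "idx3 r p s 3 = s"
  "idx4 r t p s 1 = r" "idx4 r t p s 2 = t" "idx4 r t p s 3 = p" "idx4 r t p s 4 = s"
  by (simp_all add: idx3_def idx4_def)

lemma idx3_eq: "idx3 x y z = i \<circ> s \<longleftrightarrow> x = i (s 1) \<and> y = i (s 2) \<and> z = i (s 3)"
  by (simp add: fun_eq_iff forall_3 idx_simps)

lemma idx4_eq: "idx4 x y z w = i \<circ> s \<longleftrightarrow> x = i (s 1) \<and> y = i (s 2) \<and> z = i (s 3) \<and> w = i (s 4)"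
  by (simp add: fun_eq_iff forall_4 idx_simps)

lemma contract_perm:
  assumes "finite S"
  shows "(\<Sum>t\<in>UNIV. w t * (\<Sum>b\<in>S. a b * (if t = i b then 1 else 0))) = (\<Sum>b\<in>S. a b * (w (i b :: 'x::finite) :: real))"
proof -
  have "(\<Sum>t\<in>UNIV. w t * (\<Sum>b\<in>S. a b * (if t = i b then 1 else 0))) = (\<Sum>b\<in>S. \<Sum>t\<in>UNIV. if t = i b then a b * w t else 0)"
    unfolding sum_distrib_left by (subst sum.swap) (intro sum.cong refl, simp)
  then show ?thesis by simp
qed

lemma sum_triple: "(\<Sum>x\<in>UNIV. \<Sum>y\<in>UNIV. \<Sum>z\<in>UNIV. f x y z) = (\<Sum>t\<in>UNIV. case t of (x, y, z) \<Rightarrow> f x y z)"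
  for f :: "'a::finite \<Rightarrow> 'b::finite \<Rightarrow> 'c::finite \<Rightarrow> real"
  by (simp add: sum.cartesian_product split_beta)

lemma contract3:
  fixes w :: "'m::finite \<Rightarrow> 'm \<Rightarrow> 'm \<Rightarrow> real"
  assumes "finite S" "\<And>x y z. c x y z = (\<Sum>b\<in>S. a b * (if x = i b \<and> y = j b \<and> z = k b then 1 else 0))"
  shows "(\<Sum>x\<in>UNIV. \<Sum>y\<in>UNIV. \<Sum>z\<in>UNIV. w x y z * c x y z) = (\<Sum>b\<in>S. a b * w (i b) (j b) (k b))"
  unfolding sum_triple using contract_perm[OF assms(1), where w = "\<lambda>(x, y, z). w x y z" and a = a and i = "\<lambda>b. (i b, j b, k b)"]
  by (simp add: split_beta prod_eq_iff assms(2))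

lemma contract4:
  fixes w :: "'m::finite \<Rightarrow> 'm \<Rightarrow> 'm \<Rightarrow> 'm \<Rightarrow> real"
  assumes "finite S" "\<And>x y z t. c x y z t = (\<Sum>b\<in>S. a b * (if x = i b \<and> y = j b \<and> z = k b \<and> t = l b then 1 else 0))"
  shows "(\<Sum>x\<in>UNIV. \<Sum>y\<in>UNIV. \<Sum>z\<in>UNIV. \<Sum>t\<in>UNIV. w x y z t * c x y z t) = (\<Sum>b\<in>S. a b * w (i b) (j b) (k b) (l b))"
proof -
  have "(\<Sum>x\<in>UNIV. \<Sum>y\<in>UNIV. \<Sum>z\<in>UNIV. \<Sum>t\<in>UNIV. w x y z t * c x y z t)
      = (\<Sum>q\<in>UNIV. case q of (x, y, z, t) \<Rightarrow> w x y z t * c x y z t)"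
    by (simp add: sum.cartesian_product split_beta)
  also have "\<dots> = (\<Sum>b\<in>S. a b * w (i b) (j b) (k b) (l b))"
    using contract_perm[OF assms(1), where w = "\<lambda>(x, y, z, t). w x y z t" and a = a and i = "\<lambda>b. (i b, j b, k b, l b)"]
    by (simp add: split_beta prod_eq_iff assms(2))
  finally show ?thesis .
qed

lemma linear_ten3_expand:
  assumes "linear (f :: 'm::finite cf \<Rightarrow> real)"
  shows "f X = (\<Sum>r\<in>UNIV. \<Sum>l\<in>UNIV. \<Sum>n\<in>UNIV. co X l r n * f (ten3 (axis l 1) (axis r 1) (axis n 1)))"
proof -
  have "f X = f (\<Sum>l\<in>UNIV. \<Sum>r\<in>UNIV. \<Sum>n\<in>UNIV. co X l r n *\<^sub>R ten3 (axis l 1) (axis r 1) (axis n 1))"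
    by (subst ten3_expand) (rule refl)
  also have "\<dots> = (\<Sum>l\<in>UNIV. \<Sum>r\<in>UNIV. \<Sum>n\<in>UNIV. co X l r n * f (ten3 (axis l 1) (axis r 1) (axis n 1)))"
    by (simp add: linear_sum[OF assms] linear_scale[OF assms])
  also have "\<dots> = (\<Sum>r\<in>UNIV. \<Sum>l\<in>UNIV. \<Sum>n\<in>UNIV. co X l r n * f (ten3 (axis l 1) (axis r 1) (axis n 1)))"
    by (rule sum.swap)
  finally show ?thesis .
qed

lemma linear_ten4_expand:
  assumes "linear (f :: 'm::finite cf^'m \<Rightarrow> real)"
  shows "f Z = (\<Sum>r\<in>UNIV. \<Sum>d\<in>UNIV. \<Sum>l\<in>UNIV. \<Sum>n\<in>UNIV. co (Z $ d) l r n * f (ten4 (axis d 1) (axis l 1) (axis r 1) (axis n 1)))"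
proof -
  let ?s = "\<lambda>d r. \<Sum>l\<in>UNIV. \<Sum>n\<in>UNIV. co (Z $ d) l r n * f (ten4 (axis d 1) (axis l 1) (axis r 1) (axis n 1))"
  have "f Z = f (\<Sum>d\<in>UNIV. \<Sum>l\<in>UNIV. \<Sum>r\<in>UNIV. \<Sum>n\<in>UNIV. co (Z $ d) l r n *\<^sub>R ten4 (axis d 1) (axis l 1) (axis r 1) (axis n 1))"
    by (subst ten4_expand) (rule refl)
  also have "\<dots> = (\<Sum>d\<in>UNIV. \<Sum>l\<in>UNIV. \<Sum>r\<in>UNIV. \<Sum>n\<in>UNIV. co (Z $ d) l r n * f (ten4 (axis d 1) (axis l 1) (axis r 1) (axis n 1)))"
    by (simp add: linear_sum[OF assms] linear_scale[OF assms])
  also have "\<dots> = (\<Sum>d\<in>UNIV. \<Sum>r\<in>UNIV. ?s d r)"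
    by (intro sum.cong refl sum.swap)
  also have "\<dots> = (\<Sum>r\<in>UNIV. \<Sum>d\<in>UNIV. ?s d r)" by (rule sum.swap)
  finally show ?thesis .
qed

definition antis :: "'m::finite cf \<Rightarrow> bool" where "antis X \<longleftrightarrow> (\<forall>l r n. co X l r n = - co X n r l)"

lemma bij_distinct3: "bij (s :: 3 \<Rightarrow> 3) \<Longrightarrow> distinct [s 1, s 2, s 3]"
  by (auto simp: bij_def inj_eq)

lemma bij_distinct4: "bij (s :: 4 \<Rightarrow> 4) \<Longrightarrow> distinct [s 1, s 2, s 3, s 4]"
  by (auto simp: bij_def inj_eq)

context nat_op
begin

lemma pol_expand_u: "pol (u, 0) w a b = (\<Sum>l\<in>UNIV. u $ l * pol (axis l 1, 0) w a b)"
proof -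
  have l: "linear (\<lambda>u. pol (u, 0) w a b)" by (rule linearI) (simp_all add: pol_slots)
  have "pol (\<Sum>l\<in>UNIV. u $ l *\<^sub>R axis l 1, 0) w a b = (\<Sum>l\<in>UNIV. u $ l * pol (axis l 1, 0) w a b)"
    by (simp only: linear_sum[OF l] linear_scale[OF l] real_scaleR_def)
  then show ?thesis by (simp add: basis_expansion flip: scalar_mult_eq_scaleR)
qed

lemma pol_expand_X: "pol z (0, X) a b = (\<Sum>r\<in>UNIV. \<Sum>l\<in>UNIV. \<Sum>n\<in>UNIV. co X l r n * pol z (0, ten3 (axis l 1) (axis r 1) (axis n 1)) a b)"
  by (rule linear_ten3_expand) (auto intro!: linearI simp: pol_slots)

lemma uu_form: "\<exists>c. \<forall>u p s. pol (u, 0) (u, 0) (axis p 1) (axis s 1) = c * u $ p * u $ s"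
proof -
  obtain a where a: "\<And>i j. pol (axis (j 1) 1, 0) (axis (j 2) 1, 0) (axis (i 1) 1) (axis (i 2) 1) = (\<Sum>s | bij (s :: 2 \<Rightarrow> 2). a s * (if j = i \<circ> s then 1 else 0))"
    using uu_array by blast
  have "pol (u, 0) (u, 0) (axis p 1) (axis s 1) = (\<Sum>b | bij (b :: 2 \<Rightarrow> 2). a b) * u $ p * u $ s" for u p s
  proof -
    let ?i = "\<lambda>k :: 2. if k = 1 then p else s"
    have c: "pol (axis (fst t) 1, 0) (axis (snd t) 1, 0) (axis p 1) (axis s 1) = (\<Sum>b | bij (b :: 2 \<Rightarrow> 2). a b * (if t = (?i (b 1), ?i (b 2)) then 1 else 0))" for t
    proof -
      have eq: "(\<lambda>k :: 2. if k = 1 then fst t else snd t) = ?i \<circ> b \<longleftrightarrow> t = (?i (b 1), ?i (b 2))" for b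
        by (simp add: fun_eq_iff forall_2 prod_eq_iff)
      show ?thesis using a[of "\<lambda>k. if k = 1 then fst t else snd t" ?i] unfolding eq by simp
    qed
    have "pol (u, 0) (u, 0) (axis p 1) (axis s 1) = (\<Sum>l\<in>UNIV. u $ l * (\<Sum>n\<in>UNIV. u $ n * pol (axis n 1, 0) (axis l 1, 0) (axis p 1) (axis s 1)))"
      by (subst pol_expand_u, subst pol_sym, subst pol_expand_u) (rule refl)
    also have "\<dots> = (\<Sum>t\<in>UNIV. u $ fst t * u $ snd t * pol (axis (snd t) 1, 0) (axis (fst t) 1, 0) (axis p 1) (axis s 1))"
      by (simp add: sum_distrib_left sum.cartesian_product split_beta mult_ac)
    also have "\<dots> = (\<Sum>b | bij (b :: 2 \<Rightarrow> 2). a b * (u $ ?i (b 1) * u $ ?i (b 2)))"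
      using contract_perm[of "{b. bij b}" "\<lambda>t. u $ fst t * u $ snd t" a "\<lambda>b. (?i (b 1), ?i (b 2))"]
      unfolding c[symmetric] by (simp add: pol_sym)
    also have "\<dots> = (\<Sum>b | bij (b :: 2 \<Rightarrow> 2). a b * (u $ p * u $ s))"
    proof (intro sum.cong refl)
      fix b :: "2 \<Rightarrow> 2" assume "b \<in> {b. bij b}"
      then have "b 1 \<noteq> b 2" by (auto simp: bij_def inj_eq)
      then show "a b * (u $ ?i (b 1) * u $ ?i (b 2)) = a b * (u $ p * u $ s)"
        using exhaust_2[of "b 1"] exhaust_2[of "b 2"] by auto
    qed
    finally show ?thesis by (simp add: sum_distrib_right mult.assoc)
  qed
  then show ?thesis by blast
qed

text \<open>Six permutations give six contractions of \<open>u\<close> with \<open>X\<close>; exchanging the lower indices of \<open>X\<close> changes only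
  the sign, so three remain.\<close>

lemma uX_form:
  "\<exists>c1 c2 c3. \<forall>u X p s. antis X \<longrightarrow> pol (u, 0) (0, X) (axis p 1) (axis s 1) =
     c1 * (u $ p * (\<Sum>r\<in>UNIV. co X r r s)) + c2 * (u $ s * (\<Sum>r\<in>UNIV. co X r r p)) + c3 * (\<Sum>r\<in>UNIV. u $ r * co X p r s)"
proof -
  obtain a where a: "\<And>i j. pol (axis (j 1) 1, 0) (0, ten3 (axis (j 2) 1) (axis (i 1) 1) (axis (j 3) 1)) (axis (i 2) 1) (axis (i 3) 1)
     = (\<Sum>s | bij (s :: 3 \<Rightarrow> 3). a s * (if j = i \<circ> s then 1 else 0))"
    using uX_array by blast
  define t where "t i j k = (\<lambda>(u :: real^'m, X :: 'm cf, p, s). \<Sum>r\<in>UNIV. u $ idx3 r p s i * co X (idx3 r p s j) r (idx3 r p s k))" for i j k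
  have ex: "pol (u, 0) (0, X) (axis p 1) (axis s 1) = (\<Sum>b | bij b. a b * t (b 1) (b 2) (b 3) (u, X, p, s))" for u X p s
  proof -
    have c: "pol (axis n 1, 0) (0, ten3 (axis l 1) (axis r 1) (axis m 1)) (axis p 1) (axis s 1) =
       (\<Sum>b | bij b. a b * (if l = idx3 r p s (b 2) \<and> m = idx3 r p s (b 3) \<and> n = idx3 r p s (b 1) then 1 else 0))" for l m n r
      using a[of "idx3 n l m" "idx3 r p s"] unfolding idx_simps idx3_eq by (simp add: conj_ac)
    have "pol (u, 0) (0, X) (axis p 1) (axis s 1) =
       (\<Sum>r\<in>UNIV. \<Sum>l\<in>UNIV. \<Sum>m\<in>UNIV. \<Sum>n\<in>UNIV. u $ n * co X l r m * pol (axis n 1, 0) (0, ten3 (axis l 1) (axis r 1) (axis m 1)) (axis p 1) (axis s 1))"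
      by (subst pol_expand_X, subst pol_expand_u) (simp add: sum_distrib_left mult_ac)
    also have "\<dots> = (\<Sum>r\<in>UNIV. \<Sum>b | bij b. a b * (u $ idx3 r p s (b 1) * co X (idx3 r p s (b 2)) r (idx3 r p s (b 3))))"
      by (intro sum.cong refl contract3 c) simp
    also have "\<dots> = (\<Sum>b | bij b. a b * t (b 1) (b 2) (b 3) (u, X, p, s))"
      unfolding t_def by (subst sum.swap) (simp add: sum_distrib_left)
    finally show ?thesis .
  qed
  define D where "D = (\<lambda>(u :: real^'m, X :: 'm cf, p :: 'm, s :: 'm). antis X)"
  define bs where "bs = [\<lambda>(u :: real^'m, X :: 'm cf, p, s). u $ p * (\<Sum>r\<in>UNIV. co X r r s), \<lambda>(u, X, p, s). u $ s * (\<Sum>r\<in>UNIV. co X r r p),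
     \<lambda>(u, X, p, s). \<Sum>r\<in>UNIV. u $ r * co X p r s]"
  have lbs: "length bs = 3" by (simp add: bs_def)
  define good where "good i j k \<longleftrightarrow> (\<exists>q<length bs. \<exists>e. \<forall>x. D x \<longrightarrow> t i j k x = e * (bs ! q) x)" for i j k
  have flip: "good i k j" if gd: "good i j k" for i j k
  proof -
    have "t i k j x = - t i j k x" if "D x" for x
    proof -
      obtain u X p s where x: "x = (u, X, p, s)" by (rule prod_cases4)
      have "antis X" using that by (simp add: x D_def)
      then have X: "co X l r n = - co X n r l" for l r n unfolding antis_def by blast
      show ?thesis unfolding x t_def prod.case sum_negf[symmetric]
        by (intro sum.cong refl) (subst X, simp)
    qed
    moreover obtain q e where "q < length bs" "\<And>x. D x \<Longrightarrow> t i j k x = e * (bs ! q) x" using gd unfolding good_def by blast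
    ultimately show ?thesis unfolding good_def by (intro exI[of _ q] conjI exI[of _ "- e"]) simp_all
  qed
  have goodI: "good i j k" if "q < 3" "\<And>x. t i j k x = (bs ! q) x" for q i j k
    unfolding good_def using that by (intro exI[of _ q] conjI exI[of _ 1]) (simp_all add: lbs)
  have r: "good 1 2 3" "good 2 1 3" "good 3 1 2"
    by (rule goodI[of 2], simp, simp add: t_def bs_def idx_simps split_beta)
       (rule goodI[of 0], simp, simp add: t_def bs_def idx_simps split_beta sum_distrib_left,
        rule goodI[of 1], simp, simp add: t_def bs_def idx_simps split_beta sum_distrib_left)
  have "good i j k" if "distinct [i, j, k]" for i j k
    using exhaust_3[of i] exhaust_3[of j] exhaust_3[of k] that r flip[OF r(1)] flip[OF r(2)] flip[OF r(3)] by auto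
  then have g: "good (b 1) (b 2) (b 3)" if "bij b" for b :: "3 \<Rightarrow> 3" using bij_distinct3[OF that] by blast
  have "\<exists>c. \<forall>x. D x \<longrightarrow> (\<Sum>b | bij b. a b * t (b 1) (b 2) (b 3) x) = (\<Sum>i<length bs. c i * (bs ! i) x)"
    by (rule sum_of_multiples) (use g in \<open>auto simp: good_def\<close>)
  then obtain c where c: "\<And>x. D x \<Longrightarrow> (\<Sum>b | bij b. a b * t (b 1) (b 2) (b 3) x) = (\<Sum>i<length bs. c i * (bs ! i) x)" by blast
  show ?thesis
  proof (intro exI allI impI)
    fix u :: "real^'m" and X :: "'m cf" and p s :: 'm assume "antis X"
    then show "pol (u, 0) (0, X) (axis p 1) (axis s 1) =
       c 0 * (u $ p * (\<Sum>r\<in>UNIV. co X r r s)) + c 1 * (u $ s * (\<Sum>r\<in>UNIV. co X r r p)) + c 2 * (\<Sum>r\<in>UNIV. u $ r * co X p r s)"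
      unfolding ex using c[of "(u, X, p, s)"] by (simp add: D_def bs_def numeral_3_eq_3 numeral_2_eq_2)
  qed
qed

text \<open>Of the \<open>24\<close> contractions of \<open>X\<close> with itself, the antisymmetry in two pairs of indices leaves six classes.
  Two of them are products of traces, two are traces of a composition, and two are a trace
  applied to a value of \<open>X\<close>, each pair being equal up to sign and the order of summation.\<close>

lemma XX_form:
  "\<exists>c1 c2 c3. \<forall>X p s. antis X \<longrightarrow> pol (0, X) (0, X) (axis p 1) (axis s 1) =
     c1 * ((\<Sum>r\<in>UNIV. co X r r p) * (\<Sum>r\<in>UNIV. co X r r s)) + c2 * (\<Sum>r\<in>UNIV. \<Sum>t\<in>UNIV. co X t r p * co X r t s)
     + c3 * (\<Sum>r\<in>UNIV. \<Sum>t\<in>UNIV. co X r r t * co X p t s)"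
proof -
  obtain a where a: "\<And>i j. pol (0, ten3 (axis (j 1) 1) (axis (i 1) 1) (axis (j 2) 1)) (0, ten3 (axis (j 3) 1) (axis (i 2) 1) (axis (j 4) 1)) (axis (i 3) 1) (axis (i 4) 1)
     = (\<Sum>s | bij (s :: 4 \<Rightarrow> 4). a s * (if j = i \<circ> s then 1 else 0))"
    using XX_array by blast
  define t where "t i j k l = (\<lambda>(X :: 'm cf, p, s). \<Sum>r\<in>UNIV. \<Sum>t\<in>UNIV. co X (idx4 r t p s i) r (idx4 r t p s j) * co X (idx4 r t p s k) t (idx4 r t p s l))" for i j k l
  have ex: "pol (0, X) (0, X) (axis p 1) (axis s 1) = (\<Sum>b | bij b. a b * t (b 1) (b 2) (b 3) (b 4) (X, p, s))" for X p s
  proof -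
    have c: "pol (0, ten3 (axis l 1) (axis r 1) (axis m 1)) (0, ten3 (axis l' 1) (axis r' 1) (axis m' 1)) (axis p 1) (axis s 1) =
       (\<Sum>b | bij b. a b * (if l' = idx4 r r' p s (b 3) \<and> m' = idx4 r r' p s (b 4) \<and> l = idx4 r r' p s (b 1) \<and> m = idx4 r r' p s (b 2) then 1 else 0))" for l m l' m' r r'
      using a[of "idx4 l m l' m'" "idx4 r r' p s"] unfolding idx_simps idx4_eq by (simp add: conj_ac)
    let ?f = "\<lambda>r r' l' m' l m. co X l r m * co X l' r' m' * pol (0, ten3 (axis l 1) (axis r 1) (axis m 1)) (0, ten3 (axis l' 1) (axis r' 1) (axis m' 1)) (axis p 1) (axis s 1)"
    have "pol (0, X) (0, X) (axis p 1) (axis s 1) = (\<Sum>r'\<in>UNIV. \<Sum>l'\<in>UNIV. \<Sum>m'\<in>UNIV. \<Sum>r\<in>UNIV. \<Sum>l\<in>UNIV. \<Sum>m\<in>UNIV. ?f r r' l' m' l m)"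
      by (subst pol_expand_X, subst pol_sym, subst pol_expand_X, subst pol_sym) (simp add: sum_distrib_left mult_ac)
    also have "\<dots> = (\<Sum>r'\<in>UNIV. \<Sum>l'\<in>UNIV. \<Sum>r\<in>UNIV. \<Sum>m'\<in>UNIV. \<Sum>l\<in>UNIV. \<Sum>m\<in>UNIV. ?f r r' l' m' l m)"
      by (intro sum.cong refl sum.swap)
    also have "\<dots> = (\<Sum>r'\<in>UNIV. \<Sum>r\<in>UNIV. \<Sum>l'\<in>UNIV. \<Sum>m'\<in>UNIV. \<Sum>l\<in>UNIV. \<Sum>m\<in>UNIV. ?f r r' l' m' l m)"
      by (intro sum.cong refl sum.swap)
    also have "\<dots> = (\<Sum>r\<in>UNIV. \<Sum>r'\<in>UNIV. \<Sum>l'\<in>UNIV. \<Sum>m'\<in>UNIV. \<Sum>l\<in>UNIV. \<Sum>m\<in>UNIV. ?f r r' l' m' l m)"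
      by (rule sum.swap)
    also have "\<dots> = (\<Sum>r\<in>UNIV. \<Sum>r'\<in>UNIV. \<Sum>b | bij b. a b * (co X (idx4 r r' p s (b 1)) r (idx4 r r' p s (b 2)) * co X (idx4 r r' p s (b 3)) r' (idx4 r r' p s (b 4))))"
      by (intro sum.cong refl contract4 c) simp
    also have "\<dots> = (\<Sum>r\<in>UNIV. \<Sum>b | bij b. \<Sum>r'\<in>UNIV. a b * (co X (idx4 r r' p s (b 1)) r (idx4 r r' p s (b 2)) * co X (idx4 r r' p s (b 3)) r' (idx4 r r' p s (b 4))))"
      by (intro sum.cong refl sum.swap)
    also have "\<dots> = (\<Sum>b | bij b. a b * t (b 1) (b 2) (b 3) (b 4) (X, p, s))"
      unfolding t_def by (subst sum.swap) (simp add: sum_distrib_left)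
    finally show ?thesis .
  qed
  define D where "D = (\<lambda>(X :: 'm cf, p :: 'm, s :: 'm). antis X)"
  define bs where "bs = [\<lambda>(X :: 'm cf, p, s). (\<Sum>r\<in>UNIV. co X r r p) * (\<Sum>r\<in>UNIV. co X r r s), \<lambda>(X, p, s). \<Sum>r\<in>UNIV. \<Sum>t\<in>UNIV. co X t r p * co X r t s,
     \<lambda>(X, p, s). \<Sum>r\<in>UNIV. \<Sum>t\<in>UNIV. co X r r t * co X p t s]"
  have lbs: "length bs = 3" by (simp add: bs_def)
  define good where "good i j k l \<longleftrightarrow> (\<exists>q<length bs. \<exists>e. \<forall>x. D x \<longrightarrow> t i j k l x = e * (bs ! q) x)" for i j k l
  have neg: "good i' j' k' l'" if gd: "good i j k l" "\<And>x. D x \<Longrightarrow> t i' j' k' l' x = - t i j k l x" for i j k l i' j' k' l'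
  proof -
    obtain q e where "q < length bs" "\<And>x. D x \<Longrightarrow> t i j k l x = e * (bs ! q) x" using gd(1) unfolding good_def by blast
    then show ?thesis using gd(2) unfolding good_def by (intro exI[of _ q] conjI exI[of _ "- e"]) simp_all
  qed
  have flip1: "good j i k l" if "good i j k l" for i j k l
  proof (rule neg[OF that])
    fix x assume "D x"
    then obtain X p s where x: "x = (X, p, s)" and "antis X" by (cases x) (auto simp: D_def)
    then have X: "\<And>l r n. co X l r n = - co X n r l" unfolding antis_def by blast
    show "t j i k l x = - t i j k l x" unfolding x t_def prod.case sum_negf[symmetric]
      by (intro sum.cong refl) (subst (1) X, simp)
  qed
  have flip2: "good i j l k" if "good i j k l" for i j k l
  proof (rule neg[OF that])
    fix x assume "D x"
    then obtain X p s where x: "x = (X, p, s)" and "antis X" by (cases x) (auto simp: D_def)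
    then have X: "\<And>l r n. co X l r n = - co X n r l" unfolding antis_def by blast
    show "t i j l k x = - t i j k l x" unfolding x t_def prod.case sum_negf[symmetric]
      by (intro sum.cong refl) (subst (2) X, simp)
  qed
  have goodI: "good i j k l" if "q < 3" "\<And>x. t i j k l x = (bs ! q) x" for q i j k l
    unfolding good_def using that by (intro exI[of _ q] conjI exI[of _ 1]) (simp_all add: lbs)
  have "good 1 2 3 4" by (rule goodI[of 2]) (simp_all add: t_def bs_def idx_simps split_beta)
  moreover have "good 1 3 2 4"
    by (rule goodI[of 0]) (simp_all add: t_def bs_def idx_simps split_beta sum_product)
  moreover have "good 1 4 2 3"
  proof (rule goodI[of 0])
    show "t 1 4 2 3 x = (bs ! 0) x" for x
      by (simp add: t_def bs_def idx_simps split_beta sum_product) (subst sum.swap, simp add: mult.commute)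
  qed simp
  moreover have "good 2 3 1 4" by (rule goodI[of 1]) (simp_all add: t_def bs_def idx_simps split_beta)
  moreover have "good 2 4 1 3"
  proof (rule goodI[of 1])
    show "t 2 4 1 3 x = (bs ! 1) x" for x
      by (simp add: t_def bs_def idx_simps split_beta) (subst sum.swap, simp add: mult.commute)
  qed simp
  moreover have "good 3 4 2 1"
  proof (rule goodI[of 2])
    show "t 3 4 2 1 x = (bs ! 2) x" for x
      by (simp add: t_def bs_def idx_simps split_beta) (subst sum.swap, simp add: mult.commute)
  qed simp
  ultimately have r: "good 1 2 3 4" "good 1 3 2 4" "good 1 4 2 3" "good 2 3 1 4" "good 2 4 1 3" "good 3 4 2 1" by blast+
  note g1 = r(1) flip1[OF r(1)] flip2[OF r(1)] flip1[OF flip2[OF r(1)]] and g2 = r(2) flip1[OF r(2)] flip2[OF r(2)] flip1[OF flip2[OF r(2)]]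
    and g3 = r(3) flip1[OF r(3)] flip2[OF r(3)] flip1[OF flip2[OF r(3)]] and g4 = r(4) flip1[OF r(4)] flip2[OF r(4)] flip1[OF flip2[OF r(4)]]
    and g5 = r(5) flip1[OF r(5)] flip2[OF r(5)] flip1[OF flip2[OF r(5)]] and g6 = r(6) flip1[OF r(6)] flip2[OF r(6)] flip1[OF flip2[OF r(6)]]
  have "good i j k l" if "distinct [i, j, k, l]" for i j k l
    using exhaust_4[of i] exhaust_4[of j] exhaust_4[of k] exhaust_4[of l] that
    by (elim disjE; simp add: g1 g2 g3 g4 g5 g6)
  then have g: "good (b 1) (b 2) (b 3) (b 4)" if "bij b" for b :: "4 \<Rightarrow> 4" using bij_distinct4[OF that] by blast
  have "\<exists>c. \<forall>x. D x \<longrightarrow> (\<Sum>b | bij b. a b * t (b 1) (b 2) (b 3) (b 4) x) = (\<Sum>i<length bs. c i * (bs ! i) x)"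
    by (rule sum_of_multiples) (use g in \<open>auto simp: good_def\<close>)
  then obtain c where c: "\<And>x. D x \<Longrightarrow> (\<Sum>b | bij b. a b * t (b 1) (b 2) (b 3) (b 4) x) = (\<Sum>i<length bs. c i * (bs ! i) x)" by blast
  show ?thesis
  proof (intro exI allI impI)
    fix X :: "'m cf" and p s :: 'm assume "antis X"
    then show "pol (0, X) (0, X) (axis p 1) (axis s 1) =
     c 0 * ((\<Sum>r\<in>UNIV. co X r r p) * (\<Sum>r\<in>UNIV. co X r r s)) + c 1 * (\<Sum>r\<in>UNIV. \<Sum>t\<in>UNIV. co X t r p * co X r t s)
     + c 2 * (\<Sum>r\<in>UNIV. \<Sum>t\<in>UNIV. co X r r t * co X p t s)"
      unfolding ex using c[of "(X, p, s)"] by (simp add: D_def bs_def numeral_3_eq_3 numeral_2_eq_2)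
  qed
qed

text \<open>No symmetry is available for the derivatives of a field, so all six contractions occur.\<close>

lemma L_form:
  "\<exists>s1 s2 s3 s4 s5 s6. \<forall>Z p q. lin_part Z (axis p 1) (axis q 1) =
     s1 * (\<Sum>r\<in>UNIV. co (Z $ r) p r q) + s2 * (\<Sum>r\<in>UNIV. co (Z $ r) q r p) + s3 * (\<Sum>r\<in>UNIV. co (Z $ p) r r q)
     + s4 * (\<Sum>r\<in>UNIV. co (Z $ p) q r r) + s5 * (\<Sum>r\<in>UNIV. co (Z $ q) r r p) + s6 * (\<Sum>r\<in>UNIV. co (Z $ q) p r r)"
proof -
  obtain a where a: "\<And>i j. lin_part (ten4 (axis (j 1) 1) (axis (j 2) 1) (axis (i 1) 1) (axis (j 3) 1)) (axis (i 2) 1) (axis (i 3) 1)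
     = (\<Sum>s | bij (s :: 3 \<Rightarrow> 3). a s * (if j = i \<circ> s then 1 else 0))"
    using L_array by blast
  define t where "t i j k = (\<lambda>(Z :: 'm cf^'m, p, s). \<Sum>r\<in>UNIV. co (Z $ idx3 r p s i) (idx3 r p s j) r (idx3 r p s k))" for i j k
  have ex: "lin_part Z (axis p 1) (axis s 1) = (\<Sum>b | bij b. a b * t (b 1) (b 2) (b 3) (Z, p, s))" for Z p s
  proof -
    have c: "lin_part (ten4 (axis d 1) (axis l 1) (axis r 1) (axis n 1)) (axis p 1) (axis s 1) =
       (\<Sum>b | bij b. a b * (if d = idx3 r p s (b 1) \<and> l = idx3 r p s (b 2) \<and> n = idx3 r p s (b 3) then 1 else 0))" for d l n r
      using a[of "idx3 d l n" "idx3 r p s"] unfolding idx_simps idx3_eq by simp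
    have "lin_part Z (axis p 1) (axis s 1) =
       (\<Sum>r\<in>UNIV. \<Sum>d\<in>UNIV. \<Sum>l\<in>UNIV. \<Sum>n\<in>UNIV. co (Z $ d) l r n * lin_part (ten4 (axis d 1) (axis l 1) (axis r 1) (axis n 1)) (axis p 1) (axis s 1))"
      by (rule linear_ten4_expand) (rule hor_split(3)[OF smooth_const_field])
    also have "\<dots> = (\<Sum>r\<in>UNIV. \<Sum>b | bij b. a b * co (Z $ idx3 r p s (b 1)) (idx3 r p s (b 2)) r (idx3 r p s (b 3)))"
      by (intro sum.cong refl contract3 c) simp
    also have "\<dots> = (\<Sum>b | bij b. a b * t (b 1) (b 2) (b 3) (Z, p, s))"
      unfolding t_def by (subst sum.swap) (simp add: sum_distrib_left)
    finally show ?thesis .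
  qed
  let ?bs = "[t 1 2 3, t 1 3 2, t 2 1 3, t 2 3 1, t 3 1 2, t 3 2 1]"
  have goodI: "\<exists>i<length ?bs. \<exists>e. \<forall>x. True \<longrightarrow> (?bs ! q) x = e * (?bs ! i) x" if "q < 6" for q
    using that by (intro exI[of _ q] conjI exI[of _ 1]) simp_all
  have "\<exists>q<length ?bs. \<exists>e. \<forall>x. True \<longrightarrow> t i j k x = e * (?bs ! q) x" if "distinct [i, j, k]" for i j k
    using exhaust_3[of i] exhaust_3[of j] exhaust_3[of k] that goodI[of 0] goodI[of 1] goodI[of 2] goodI[of 3] goodI[of 4] goodI[of 5] by auto
  then have g: "\<exists>q<length ?bs. \<exists>e. \<forall>x. True \<longrightarrow> t (b 1) (b 2) (b 3) x = e * (?bs ! q) x" if "bij b" for b :: "3 \<Rightarrow> 3"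
    using bij_distinct3[OF that] by blast
  have "\<exists>c. \<forall>x. True \<longrightarrow> (\<Sum>b | bij b. a b * t (b 1) (b 2) (b 3) x) = (\<Sum>i<length ?bs. c i * (?bs ! i) x)"
    by (rule sum_of_multiples) (simp, use g in blast)
  then obtain c where c: "\<And>x. (\<Sum>b | bij b. a b * t (b 1) (b 2) (b 3) x) = (\<Sum>i<length ?bs. c i * (?bs ! i) x)" by blast
  have "lin_part Z (axis p 1) (axis q 1) =
     c 0 * (\<Sum>r\<in>UNIV. co (Z $ r) p r q) + c 1 * (\<Sum>r\<in>UNIV. co (Z $ r) q r p) + c 2 * (\<Sum>r\<in>UNIV. co (Z $ p) r r q)
     + c 3 * (\<Sum>r\<in>UNIV. co (Z $ p) q r r) + c 4 * (\<Sum>r\<in>UNIV. co (Z $ q) r r p) + c 5 * (\<Sum>r\<in>UNIV. co (Z $ q) p r r)" for Z p q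
  proof -
    have "(\<Sum>i<length ?bs. c i * (?bs ! i) x) = c 0 * t 1 2 3 x + c 1 * t 1 3 2 x + c 2 * t 2 1 3 x + c 3 * t 2 3 1 x + c 4 * t 3 1 2 x + c 5 * t 3 2 1 x" for x
      by (simp add: eval_nat_numeral)
    note s = this
    show ?thesis unfolding ex c s by (simp add: t_def idx_simps)
  qed
  then show ?thesis by blast
qed

end

section \<open>Changes of coordinates that remove the symmetric part\<close>

lemma (in coord_change) smooth_J: "smooth_on w X \<Longrightarrow> smooth_on (\<lambda>x. J x (w x) $ r) X"
  by (rule smooth_on_cong[OF X, THEN iffD1, rotated, of "\<lambda>x. \<Sum>i\<in>UNIV. pd i (\<lambda>y. g y $ r) x * w x $ i"])
    (auto simp: J_pd intro!: smooth_intros X smooth_on_pd sgi)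

lemma (in coord_change) smooth_H: "smooth_on v X \<Longrightarrow> smooth_on w X \<Longrightarrow> smooth_on (\<lambda>x. H x (v x) (w x) $ r) X"
  by (rule smooth_on_cong[OF X, THEN iffD1, rotated, of "\<lambda>x. \<Sum>l\<in>UNIV. \<Sum>n\<in>UNIV. pd l (pd n (\<lambda>y. g y $ r)) x * v x $ l * w x $ n"])
    (auto simp: H_expand intro!: smooth_intros X smooth_on_pd sgi)

lemma smooth_on_gam:
  assumes X: "open X" "\<And>l r n. smooth_on (\<lambda>x. c x l r n) X" "smooth_on v X" "smooth_on w X"
  shows "smooth_on (\<lambda>x. gam (c x) (v x) (w x)) X"
  unfolding gam_def by (rule smooth_on_vec) (auto intro!: smooth_intros assms)

text \<open>Solve the transformation law for the coefficients over the target.\<close>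

definition (in coord_change) image_conn :: "(real^'m \<Rightarrow> 'm cf) \<Rightarrow> real^'m \<Rightarrow> 'm cf" where
  "image_conn P y = (let x = h y in \<chi> l r n.
     (J x (gam (co (P x)) (K x (axis l 1)) (K x (axis n 1))) + H x (K x (axis l 1)) (K x (axis n 1))) $ r)"

lemma (in coord_change) gam_image_conn:
  assumes x: "x \<in> X"
  shows "gam (co (image_conn P (g x))) v w = J x (gam (co (P x)) (K x v) (K x w)) + H x (K x v) (K x w)"
proof -
  have b: "bilinear (\<lambda>v w. (J x (gam (co (P x)) (K x v) (K x w)) + H x (K x v) (K x w)) $ r)" for r
    unfolding bilinear_def
    by (auto intro!: linearI simp: lin_simps[OF x] linear_add[OF linK[OF x]] linear_scale[OF linK[OF x]] gam_linear algebra_simps)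
  show ?thesis unfolding vec_eq_iff bilinear_expand[OF b, of v w] gam_def[of "co (image_conn P (g x))"] co_def[of "image_conn P (g x)"]
    unfolding image_conn_def Let_def hg[OF x] by simp
qed

lemma (in coord_change) image_conn_law:
  assumes x: "x \<in> X"
  shows "conn_law g x (co (P x)) (co (image_conn P (g x)))"
  unfolding conn_law_iff[OF x] gam_image_conn[OF x] KJ[OF x] by simp

lemma (in coord_change) smooth_image_conn:
  assumes P: "smooth_on P X"
  shows "smooth_on (image_conn P) Y"
proof -
  have K': "smooth_on (\<lambda>x. K x v) X" for v
  proof -
    have "smooth_on (\<lambda>x. frechet_derivative h (at (g x)) v) X"
      by (rule smooth_on_compose[OF X Y _ sg smooth_on_frechet[OF sh]]) (use gX in auto)
    then show ?thesis by (simp add: K_def)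
  qed
  define Q where "Q x = (\<chi> l r n. (J x (gam (co (P x)) (K x (axis l 1)) (K x (axis n 1))) + H x (K x (axis l 1)) (K x (axis n 1))) $ r)" for x
  have "smooth_on Q X" unfolding Q_def
    by (intro smooth_on_vec[OF X])
      (simp add: smooth_on_add[OF X] smooth_J smooth_H smooth_on_gam[OF X smooth_on_co[OF X P]] K')
  then have "smooth_on (\<lambda>y. Q (h y)) Y"
    by (rule smooth_on_compose[OF Y X _ sh, rotated]) (use hY in auto)
  then show ?thesis by (simp add: Q_def image_conn_def[abs_def] Let_def)
qed

text \<open>Global diffeomorphisms with prescribed higher derivatives at the origin, built from a diffeomorphism of
  the line in the coordinate \<open>x \<bullet> \<alpha>\<close>. For \<open>\<alpha> \<bullet> v = 1\<close> the first derivative is the identity and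
  the second one is \<open>tanh c\<close> times the square of \<open>\<alpha>\<close>, with values along \<open>v\<close>. For
  \<open>c = 0\<close> the second derivative vanishes and the third one is the cube of \<open>\<alpha>\<close>. Being global, they
  map global connections to global connections.\<close>

definition bend :: "real \<Rightarrow> real^'m \<Rightarrow> real^'m \<Rightarrow> real^'m \<Rightarrow> real^'m::finite" where
  "bend c \<alpha> v x = x + ((sinh (x \<bullet> \<alpha> + c) - sinh c) / cosh c - x \<bullet> \<alpha>) *\<^sub>R v"

definition unbend :: "real \<Rightarrow> real^'m \<Rightarrow> real^'m \<Rightarrow> real^'m \<Rightarrow> real^'m::finite" where
  "unbend c \<alpha> v y = y + ((arsinh (cosh c * (y \<bullet> \<alpha>) + sinh c) - c) - y \<bullet> \<alpha>) *\<^sub>R v"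

lemma coord_change_bend:
  assumes "\<alpha> \<bullet> v = 1"
  shows "coord_change (bend c \<alpha> v) (unbend c \<alpha> v) UNIV UNIV"
proof unfold_locales
  have v: "v \<bullet> \<alpha> = 1" using assms by (simp add: inner_commute)
  show "smooth_on (bend c \<alpha> v) UNIV" unfolding bend_def[abs_def] divide_inverse
    by (intro smooth_intros open_UNIV smooth_on_compose_UNIV[OF open_UNIV smooth_on_sinh])
  show "smooth_on (unbend c \<alpha> v) UNIV" unfolding unbend_def[abs_def]
    by (intro smooth_intros open_UNIV smooth_on_compose_UNIV[OF open_UNIV smooth_on_arsinh])
  show "unbend c \<alpha> v (bend c \<alpha> v x) = x" for x
    by (simp add: bend_def unbend_def inner_add_left v arsinh_sinh_real flip: scaleR_left_distrib)
  show "bend c \<alpha> v (unbend c \<alpha> v y) = y" for y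
    by (simp add: bend_def unbend_def inner_add_left v flip: scaleR_left_distrib)
qed auto

lemma sinh_cosh_inner:
  fixes \<alpha> :: "'a::real_inner"
  shows "((\<lambda>x. sinh (x \<bullet> \<alpha> + c)) has_derivative (\<lambda>d. (d \<bullet> \<alpha>) * cosh (x \<bullet> \<alpha> + c))) (at x)"
    and "((\<lambda>x. cosh (x \<bullet> \<alpha> + c)) has_derivative (\<lambda>d. (d \<bullet> \<alpha>) * sinh (x \<bullet> \<alpha> + c))) (at x)"
proof -
  have d: "((\<lambda>x. x \<bullet> \<alpha> + c) has_derivative (\<lambda>d. d \<bullet> \<alpha>)) (at x)"
    by (auto intro!: derivative_eq_intros)
  have "DERIV sinh y :> cosh y" "DERIV cosh y :> sinh y" for y :: real
    by (auto intro!: derivative_eq_intros)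
  from DERIV_compose_FDERIV[OF this(1) d] DERIV_compose_FDERIV[OF this(2) d]
  show "((\<lambda>x. sinh (x \<bullet> \<alpha> + c)) has_derivative (\<lambda>d. (d \<bullet> \<alpha>) * cosh (x \<bullet> \<alpha> + c))) (at x)"
    and "((\<lambda>x. cosh (x \<bullet> \<alpha> + c)) has_derivative (\<lambda>d. (d \<bullet> \<alpha>) * sinh (x \<bullet> \<alpha> + c))) (at x)" .
qed

lemmas sinh_cosh_intros = sinh_cosh_inner[THEN has_derivative_eq_rhs]
  sinh_cosh_inner[THEN has_derivative_eq_rhs, unfolded add.commute[of "_ \<bullet> _"]]
  sinh_cosh_inner[where c = 0, simplified, THEN has_derivative_eq_rhs]

context
  fixes c :: real and \<alpha> v :: "real^'m::finite"
  assumes \<alpha>v: "\<alpha> \<bullet> v = 1"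
begin

interpretation bend: coord_change "bend c \<alpha> v" "unbend c \<alpha> v" UNIV UNIV
  by (rule coord_change_bend[OF \<alpha>v])

lemma bend_J: "bend.J x d = d + ((cosh (x \<bullet> \<alpha> + c) / cosh c - 1) * (d \<bullet> \<alpha>)) *\<^sub>R v"
proof -
  have "(bend c \<alpha> v has_derivative (\<lambda>d. d + ((cosh (x \<bullet> \<alpha> + c) / cosh c - 1) * (d \<bullet> \<alpha>)) *\<^sub>R v)) (at x)"
    unfolding bend_def[abs_def] divide_inverse
    by (auto intro!: sinh_cosh_intros derivative_eq_intros simp: fun_eq_iff algebra_simps)
  from fun_cong[OF frechet_derivative_at[OF this, symmetric], of d] show ?thesis unfolding bend.J_def .
qed

lemma bend_H: "bend.H x d w = (sinh (x \<bullet> \<alpha> + c) / cosh c * (d \<bullet> \<alpha>) * (w \<bullet> \<alpha>)) *\<^sub>R v"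
proof -
  have "((\<lambda>x. bend.J x w) has_derivative (\<lambda>d. (sinh (x \<bullet> \<alpha> + c) / cosh c * (d \<bullet> \<alpha>) * (w \<bullet> \<alpha>)) *\<^sub>R v)) (at x)"
    unfolding bend_J divide_inverse
    by (auto intro!: sinh_cosh_intros derivative_eq_intros simp: fun_eq_iff algebra_simps)
  from fun_cong[OF frechet_derivative_at[OF this, symmetric], of d] show ?thesis unfolding bend.H_def .
qed

lemma bend_zero: "bend c \<alpha> v 0 = 0" "bend.J 0 d = d" "bend.K 0 d = d" "bend.H 0 d w = (tanh c * (d \<bullet> \<alpha>) * (w \<bullet> \<alpha>)) *\<^sub>R v"
proof -
  show J: "bend.J 0 d = d" for d by (simp add: bend_J)
  show "bend c \<alpha> v 0 = 0" by (simp add: bend_def)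
  show "bend.K 0 d = d" using bend.KJ[of 0 d] J by simp
  show "bend.H 0 d w = (tanh c * (d \<bullet> \<alpha>) * (w \<bullet> \<alpha>)) *\<^sub>R v" by (simp add: bend_H tanh_def)
qed

lemma bend_image_zero: "bend.image_conn P 0 = P 0 + tanh c *\<^sub>R ten3 \<alpha> v \<alpha>"
proof -
  have "gam (co (bend.image_conn P 0)) a b = gam (co (P 0 + tanh c *\<^sub>R ten3 \<alpha> v \<alpha>)) a b" for a b
    using bend.gam_image_conn[of 0 P a b] by (simp add: bend_zero gam_co gam_ten3 inner_commute)
  then show ?thesis using gam_axis[of "co (bend.image_conn P 0)"] gam_axis[of "co (P 0 + tanh c *\<^sub>R ten3 \<alpha> v \<alpha>)"]
    by (simp add: vec_eq_iff co_def)
qed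

text \<open>For \<open>c = 0\<close> the image of the flat connection vanishes at the origin; differentiating the
  transformation law shows that its first derivative there is the third derivative of the diffeomorphism.\<close>

lemma bend_image_flat: 
  assumes "c = 0"
  shows "frechet_derivative (bend.image_conn (\<lambda>x. 0)) (at 0) d = (d \<bullet> \<alpha>) *\<^sub>R ten3 \<alpha> v \<alpha>"
proof -
  let ?P = "bend.image_conn (\<lambda>x. 0)"
  have s: "smooth_on ?P UNIV" by (rule bend.smooth_image_conn[OF smooth_on_const[OF open_UNIV]])
  have z: "gam (co (0 :: 'm cf)) a b = 0" for a b by (simp add: gam_def co_def zero_vec_def[symmetric] vec_eq_iff)
  have P0: "?P 0 = 0" using bend_image_zero[of "\<lambda>x. 0"] by (simp add: assms)
  have dco: "(\<lambda>y. co (?P y) l r n) differentiable (at x)" "(\<lambda>y :: real^'m. co (0 :: 'm cf) l r n) differentiable (at x)" for l r n x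
    by (auto intro: smooth_on_differentiable[OF smooth_on_co[OF open_UNIV s] UNIV_I])
  have law: "bend.J y (gam (co (0 :: 'm cf)) a b) = gam (co (?P (bend c \<alpha> v y))) (bend.J y a) (bend.J y b) - bend.H y a b" for y a b
    using bend.image_conn_law[of y "\<lambda>x. 0"] bend.conn_law_iff[of y] by simp
  have Hd: "((\<lambda>y. bend.H y a b) has_derivative (\<lambda>d. ((d \<bullet> \<alpha>) * (a \<bullet> \<alpha>) * (b \<bullet> \<alpha>)) *\<^sub>R v)) (at 0)" for a b
    unfolding bend_H divide_inverse
    by (auto intro!: sinh_cosh_intros derivative_eq_intros simp: fun_eq_iff assms)
  have dz: "gam (dcf (\<lambda>y :: real^'m. co (0 :: 'm cf)) 0 d) a b = 0" for a b
    by (simp add: dcf_def[abs_def] gam_def zero_vec_def[symmetric])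
  have t0: "tanh c = 0" by (simp add: assms)
  have g: "gam (dcf (\<lambda>y. co (?P y)) 0 d) a b = ((d \<bullet> \<alpha>) * (a \<bullet> \<alpha>) * (b \<bullet> \<alpha>)) *\<^sub>R v" for a b
    using bend.law_deriv[of 0 "\<lambda>y. co 0" "\<lambda>y. co (?P y)" "bend.H" "\<lambda>d a b. ((d \<bullet> \<alpha>) * (a \<bullet> \<alpha>) * (b \<bullet> \<alpha>)) *\<^sub>R v", OF UNIV_I _ _ law Hd, of d a b]
    by (simp add: dco z P0 bend_zero t0 dz)
  have "frechet_derivative ?P (at 0) d $ l $ r $ n = dcf (\<lambda>y. co (?P y)) 0 d l r n" for l r n
  proof -
    have "((\<lambda>y. co (?P y) l r n) has_derivative (\<lambda>d. co (frechet_derivative ?P (at 0) d) l r n)) (at 0)"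
      unfolding co_def by (intro bounded_linear.has_derivative[OF bounded_linear_vec_nth] smooth_on_has_derivative[OF s UNIV_I])
    from fun_cong[OF frechet_derivative_at[OF this], of d] show ?thesis by (simp add: dcf_def co_def)
  qed
  moreover have "dcf (\<lambda>y. co (?P y)) 0 d l r n = ((d \<bullet> \<alpha>) *\<^sub>R ten3 \<alpha> v \<alpha>) $ l $ r $ n" for l r n
    unfolding gam_axis[of "dcf (\<lambda>y. co (?P y)) 0 d", symmetric] g by (simp add: ten3_def inner_axis inner_commute[of "axis _ _"])
  ultimately show ?thesis by (simp add: vec_eq_iff)
qed

end

subsection \<open>Symmetric coefficients are combinations of bends\<close>

text \<open>Scaling gives all \<open>ten3 \<alpha> v \<alpha>\<close> with \<open>\<alpha> \<bullet> v \<noteq> 0\<close>; the case \<open>\<alpha> \<bullet> v = 0\<close> is a difference of two of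
  these, and polarisation in \<open>\<alpha>\<close> gives the symmetrised products.\<close>

lemma symmetric_in_span:
  assumes S: "\<And>l r n. co S l r n = co S n r l"
  shows "S \<in> span {ten3 \<alpha> v \<alpha> | \<alpha> v :: real^'m::finite. \<alpha> \<bullet> v = 1}" (is "_ \<in> span ?G")
proof -
  have nz: "ten3 \<alpha> v \<alpha> \<in> span ?G" if "\<alpha> \<bullet> v \<noteq> 0" for \<alpha> v
  proof -
    have "ten3 \<alpha> ((1 / (\<alpha> \<bullet> v)) *\<^sub>R v) \<alpha> \<in> ?G"
      by (intro CollectI exI[of _ \<alpha>] exI[of _ "(1 / (\<alpha> \<bullet> v)) *\<^sub>R v"]) (use that in simp)
    then have "(\<alpha> \<bullet> v) *\<^sub>R ten3 \<alpha> ((1 / (\<alpha> \<bullet> v)) *\<^sub>R v) \<alpha> \<in> span ?G" by (intro span_mul span_base)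
    then show ?thesis using that by (simp add: ten3_simps)
  qed
  have sq: "ten3 \<alpha> v \<alpha> \<in> span ?G" for \<alpha> v
  proof (cases "\<alpha> \<bullet> v = 0")
    case True
    show ?thesis
    proof (cases "\<alpha> = 0")
      case True
      then show ?thesis using ten3_simps(2)[of 0 \<alpha> v \<alpha>] by (simp add: span_zero)
    next
      case False
      then have "ten3 \<alpha> (v + \<alpha>) \<alpha> - ten3 \<alpha> \<alpha> \<alpha> \<in> span ?G"
        using \<open>\<alpha> \<bullet> v = 0\<close> by (intro span_diff nz) (simp_all add: inner_add_right)
      then show ?thesis by (simp add: ten3_simps)
    qed
  qed (rule nz)
  have pol: "ten3 \<alpha> v \<beta> + ten3 \<beta> v \<alpha> \<in> span ?G" for \<alpha> \<beta> v
  proof -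
    have "ten3 (\<alpha> + \<beta>) v (\<alpha> + \<beta>) - ten3 \<alpha> v \<alpha> - ten3 \<beta> v \<beta> \<in> span ?G" by (intro span_diff sq)
    then show ?thesis by (simp add: ten3_simps add.commute)
  qed
  let ?e = "\<lambda>l r n. ten3 (axis l 1) (axis r 1) (axis n 1) :: 'm cf"
  have "S = (\<Sum>l\<in>UNIV. \<Sum>r\<in>UNIV. \<Sum>n\<in>UNIV. co S l r n *\<^sub>R ?e l r n)" by (rule ten3_expand)
  moreover have "(\<Sum>l\<in>UNIV. \<Sum>r\<in>UNIV. \<Sum>n\<in>UNIV. co S l r n *\<^sub>R ?e n r l) = (\<Sum>l\<in>UNIV. \<Sum>r\<in>UNIV. \<Sum>n\<in>UNIV. co S l r n *\<^sub>R ?e l r n)"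
  proof -
    have "(\<Sum>l\<in>UNIV. \<Sum>r\<in>UNIV. \<Sum>n\<in>UNIV. co S l r n *\<^sub>R ?e n r l) = (\<Sum>r\<in>UNIV. \<Sum>l\<in>UNIV. \<Sum>n\<in>UNIV. co S l r n *\<^sub>R ?e n r l)"
      by (rule sum.swap)
    also have "\<dots> = (\<Sum>r\<in>UNIV. \<Sum>n\<in>UNIV. \<Sum>l\<in>UNIV. co S l r n *\<^sub>R ?e n r l)" by (intro sum.cong refl sum.swap)
    also have "\<dots> = (\<Sum>r\<in>UNIV. \<Sum>n\<in>UNIV. \<Sum>l\<in>UNIV. co S n r l *\<^sub>R ?e n r l)"
      by (intro sum.cong refl) (subst S, rule refl)
    also have "\<dots> = (\<Sum>l\<in>UNIV. \<Sum>r\<in>UNIV. \<Sum>n\<in>UNIV. co S l r n *\<^sub>R ?e l r n)" by (rule sum.swap)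
    finally show ?thesis .
  qed
  ultimately have "S + S = (\<Sum>l\<in>UNIV. \<Sum>r\<in>UNIV. \<Sum>n\<in>UNIV. co S l r n *\<^sub>R (?e l r n + ?e n r l))"
    by (simp add: scaleR_add_right sum.distrib)
  moreover have "\<dots> \<in> span ?G" by (intro span_sum span_mul pol)
  ultimately have "(1/2) *\<^sub>R (S + S) \<in> span ?G" by (intro span_mul) simp
  then show ?thesis by (simp add: scaleR_2[symmetric])
qed

section \<open>The value of the operator over the standard manifold\<close>

definition agrees :: "((real^'m \<Rightarrow> 'm cf) \<Rightarrow> 'm cot \<Rightarrow> 'm cot \<Rightarrow> 'm cot \<Rightarrow> real) \<Rightarrow> params \<Rightarrow> (real^'m \<Rightarrow> 'm::finite cf) \<Rightarrow> bool" where
  "agrees \<phi> \<kappa> P \<longleftrightarrow> (\<forall>u v w. \<phi> P (0, u) v w = family \<kappa> (\<lambda>y. co (P y)) (0, u) v w)"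

context nat_op
begin

text \<open>Operator and family satisfy the same transformation law.\<close>

lemma agrees_transfer:
  assumes g: "coord_change g k UNIV UNIV" and g0: "g 0 = 0"
    and P: "smooth_on P UNIV" "smooth_on P' UNIV" and law: "\<And>x. conn_law g x (co (P x)) (co (P' (g x)))"
    and a: "agrees ph \<kappa> P'"
  shows "agrees ph \<kappa> P"
  unfolding agrees_def
proof (intro allI)
  fix u v w
  interpret coord_change g k UNIV UNIV by (rule g)
  have "fst (cot_lift g (0, u)) = 0" by (simp add: cot_lift_inner g0)
  then obtain u' where l: "cot_lift g (0, u) = (0, u')" by (metis prod.collapse)
  have "ph P (0, u) v w = ph P' (cot_lift g (0, u)) (frechet_derivative (cot_lift g) (at (0, u)) v) (frechet_derivative (cot_lift g) (at (0, u)) w)"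
    by (rule ph_natural[OF g P law UNIV_I])
  also have "\<dots> = family \<kappa> (\<lambda>y. co (P' y)) (cot_lift g (0, u)) (frechet_derivative (cot_lift g) (at (0, u)) v) (frechet_derivative (cot_lift g) (at (0, u)) w)"
    using a unfolding agrees_def l by blast
  also have "\<dots> = family \<kappa> (\<lambda>y. co (P y)) (0, u) v w"
    by (rule family_invariant[symmetric, OF smooth_on_co[OF open_UNIV P(1)] smooth_on_co[OF open_UNIV P(2)] law UNIV_I])
  finally show "ph P (0, u) v w = family \<kappa> (\<lambda>y. co (P y)) (0, u) v w" .
qed

text \<open>As \<open>tanh\<close> is bounded, the factor \<open>t\<close> is put into \<open>\<alpha>\<close>, with \<open>v\<close> scaled inversely.\<close>

lemma gauge_step:
  assumes \<alpha>v: "\<alpha> \<bullet> v = 1" and P: "smooth_on P UNIV"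
  shows "\<exists>P'. smooth_on P' UNIV \<and> P' 0 = P 0 + t *\<^sub>R ten3 \<alpha> v \<alpha> \<and> (\<forall>\<kappa>. agrees ph \<kappa> P' \<longrightarrow> agrees ph \<kappa> P)"
proof (cases "t = 0")
  case True
  then show ?thesis using P by auto
next
  case False
  define s where "s = t / tanh 1"
  have th: "tanh 1 \<noteq> (0 :: real)" by simp
  then have s: "s \<noteq> 0" using False by (simp add: s_def)
  let ?\<alpha> = "s *\<^sub>R \<alpha>" and ?v = "(1 / s) *\<^sub>R v"
  have av: "?\<alpha> \<bullet> ?v = 1" using s \<alpha>v by simp
  interpret b: coord_change "bend 1 ?\<alpha> ?v" "unbend 1 ?\<alpha> ?v" UNIV UNIV by (rule coord_change_bend[OF av])
  have sm: "smooth_on (b.image_conn P) UNIV" by (rule b.smooth_image_conn[OF P])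
  have "b.image_conn P 0 = P 0 + t *\<^sub>R ten3 \<alpha> v \<alpha>"
    using bend_image_zero[OF av, of 1 P] th s by (simp add: ten3_simps s_def)
  moreover have "agrees ph \<kappa> (b.image_conn P) \<longrightarrow> agrees ph \<kappa> P" for \<kappa>
    using agrees_transfer[OF b.coord_change_axioms bend_zero(1)[OF av] P sm b.image_conn_law[OF UNIV_I]] by blast
  ultimately show ?thesis using sm by blast
qed

text \<open>A symmetric array is a sum of finitely many bends, which are applied one after the other. Each one changes
  the derivatives of the field, too, so the statement is about all fields.\<close>

lemma gauge_symmetric:
  assumes S: "\<And>l r n. co S l r n = co S n r l" and P: "smooth_on P UNIV"
  shows "\<exists>P'. smooth_on P' UNIV \<and> P' 0 = P 0 + S \<and> (\<forall>\<kappa>. agrees ph \<kappa> P' \<longrightarrow> agrees ph \<kappa> P)"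
proof -
  from symmetric_in_span[OF S] have "\<forall>P. smooth_on P UNIV \<longrightarrow> (\<exists>P'. smooth_on P' UNIV \<and> P' 0 = P 0 + S \<and> (\<forall>\<kappa>. agrees ph \<kappa> P' \<longrightarrow> agrees ph \<kappa> P))"
  proof (induction rule: span_induct_alt)
    case base
    show ?case by auto
  next
    case (step t x S)
    show ?case
    proof (intro allI impI)
      fix P :: "real^'m \<Rightarrow> 'm cf" assume P: "smooth_on P UNIV"
      obtain \<alpha> v where x: "x = ten3 \<alpha> v \<alpha>" and av: "\<alpha> \<bullet> v = 1" using step(1) by blast
      obtain P1 where P1: "smooth_on P1 UNIV" "P1 0 = P 0 + t *\<^sub>R x" "\<And>\<kappa>. agrees ph \<kappa> P1 \<Longrightarrow> agrees ph \<kappa> P"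
        using gauge_step[OF av P, of t] unfolding x by blast
      obtain P2 where P2: "smooth_on P2 UNIV" "P2 0 = P1 0 + S" "\<And>\<kappa>. agrees ph \<kappa> P2 \<Longrightarrow> agrees ph \<kappa> P1"
        using step(2) P1(1) by blast
      show "\<exists>P'. smooth_on P' UNIV \<and> P' 0 = P 0 + (t *\<^sub>R x + S) \<and> (\<forall>\<kappa>. agrees ph \<kappa> P' \<longrightarrow> agrees ph \<kappa> P)"
        using P1 P2 by (intro exI[of _ P2]) (simp add: add.assoc)
    qed
  qed
  then show ?thesis using P by blast
qed

text \<open>By naturality the image of the flat connection under a map with vanishing second derivative and third
  derivative \<open>\<alpha> \<otimes> \<alpha> \<otimes> \<alpha> \<otimes> v\<close> gives the same value as the flat connection, and the value differs from it
  by this linear term only.\<close>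

lemma lin_part_cubic: "\<alpha> \<bullet> v = 1 \<Longrightarrow> lin_part (ten4 \<alpha> \<alpha> v \<alpha>) a b = 0"
proof -
  assume av: "\<alpha> \<bullet> v = 1"
  interpret b: coord_change "bend 0 \<alpha> v" "unbend 0 \<alpha> v" UNIV UNIV by (rule coord_change_bend[OF av])
  define P where "P = b.image_conn (\<lambda>x. 0)"
  note z = bend_zero[OF av, of 0]
  have P: "smooth_on P UNIV" unfolding P_def by (rule b.smooth_image_conn[OF smooth_on_const[OF open_UNIV]])
  have P0: "P 0 = 0" unfolding P_def using bend_image_zero[OF av, of 0 "\<lambda>x. 0"] by simp
  have "frechet_derivative P (at 0) d = (d \<bullet> \<alpha>) *\<^sub>R ten3 \<alpha> v \<alpha>" for d
    unfolding P_def by (rule bend_image_flat[OF av refl])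
  then have j: "jac P = ten4 \<alpha> \<alpha> v \<alpha>"
    by (simp add: jac_def ten4_def vec_eq_iff inner_axis inner_commute[of "axis _ _"])
  have u: "cot_lift (bend 0 \<alpha> v) (0, 0) = (0, 0)"
  proof -
    have "snd (cot_lift (bend 0 \<alpha> v) (0, 0)) \<bullet> d = 0" for d
      using b.cot_lift_inner(3)[of 0 0 d] by (simp add: z)
    then have "snd (cot_lift (bend 0 \<alpha> v) (0, 0)) = 0" using inner_eq_zero_iff by blast
    moreover have "fst (cot_lift (bend 0 \<alpha> v) (0, 0)) = 0" using b.cot_lift_inner(1)[of 0 0] by (simp add: z)
    ultimately show ?thesis by (simp add: prod_eq_iff)
  qed
  have d: "frechet_derivative (cot_lift (bend 0 \<alpha> v)) (at (0, 0)) (a, 0) = (a, 0)" for a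
  proof -
    obtain q where q: "frechet_derivative (cot_lift (bend 0 \<alpha> v)) (at (0, 0)) (a, 0) = (b.J 0 a, q)"
      "\<And>v'. q \<bullet> b.J 0 v' + snd (cot_lift (bend 0 \<alpha> v) (0, 0)) \<bullet> b.H 0 a v' = 0 \<bullet> v'"
      using b.cot_lift_deriv[of 0 0 a 0] by blast
    have "q \<bullet> v' = 0" for v' using q(2)[of v'] by (simp add: z u)
    then have "q = 0" using inner_eq_zero_iff by blast
    then show ?thesis using q(1) by (simp add: z)
  qed
  have "hor (\<lambda>x. 0) 0 a b = hor P 0 a b"
    using ph_natural[OF b.coord_change_axioms smooth_const_field P, of 0 0 0 "(a, 0)" "(b, 0)"] b.image_conn_law[of _ "\<lambda>x. 0"]
    unfolding hor_def u d by (simp add: P_def)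
  moreover have "hor P 0 a b = pol 0 0 a b / 2 + lin_part (ten4 \<alpha> \<alpha> v \<alpha>) a b"
    using hor_split(1)[OF P, of 0 a b] by (simp add: P0 j zero_prod_def)
  moreover have "pol 0 0 a b = 0" using bilinear_lzero[OF hor_split(2)[OF smooth_const_field]] by blast
  moreover have "hor (\<lambda>x. 0) 0 a b = 0"
  proof -
    have "lin (0 :: 'm cf^'m) = (\<lambda>y. 0)" by (rule lin_zero)
    then have "hor (\<lambda>x. 0) 0 a b = lin_part 0 a b" by (simp add: lin_part_def)
    then show ?thesis using linear_0[OF hor_split(3)[OF smooth_const_field]] by simp
  qed
  ultimately show "lin_part (ten4 \<alpha> \<alpha> v \<alpha>) a b = 0" by simp
qed

lemma co_ten4: "co (ten4 \<gamma> \<alpha> v \<beta> $ d) l r n = \<gamma> $ d * (\<alpha> $ l * v $ r * \<beta> $ n)"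
  by (simp add: co_def ten4_def ten3_def)

lemma axis_sum: "(\<Sum>r\<in>UNIV. axis e 1 $ r * f r) = f (e :: 'm)" for f :: "'m \<Rightarrow> real"
  by (simp add: axis_def if_distribR if_distrib cong: if_cong)

text \<open>At a point where the coefficients are antisymmetric the torsion is given by them, and the
  covariant derivatives and the curvature reduce to the derivatives of the coefficients.\<close>

lemma base_part_antis:
  assumes P: "smooth_on P UNIV" and A: "antis (P 0)"
  shows "base_part \<kappa> (\<lambda>y. co (P y)) 0 u p q = cA \<kappa> * u $ p * u $ q
     + cC1 \<kappa> * u $ p * (\<Sum>r\<in>UNIV. co (P 0) r r q) + cC2 \<kappa> * u $ q * (\<Sum>r\<in>UNIV. co (P 0) r r p) + cC3 \<kappa> * (\<Sum>r\<in>UNIV. u $ r * co (P 0) p r q)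
     + cF1 \<kappa> * (\<Sum>r\<in>UNIV. co (P 0) r r p) * (\<Sum>r\<in>UNIV. co (P 0) r r q)
     + cF2 \<kappa> * (\<Sum>r\<in>UNIV. \<Sum>t\<in>UNIV. co (P 0) t r p * co (P 0) r t q)
     + cF3 \<kappa> * (\<Sum>r\<in>UNIV. \<Sum>t\<in>UNIV. co (P 0) r r t * co (P 0) p t q)
     + cG1 \<kappa> * (((\<Sum>r\<in>UNIV. co (jac P $ q) r r p) - (\<Sum>r\<in>UNIV. co (jac P $ q) p r r)) / 2)
     + cG2 \<kappa> * (((\<Sum>r\<in>UNIV. co (jac P $ p) r r q) - (\<Sum>r\<in>UNIV. co (jac P $ p) q r r)) / 2)
     + cG3 \<kappa> * (((\<Sum>r\<in>UNIV. co (jac P $ r) p r q) - (\<Sum>r\<in>UNIV. co (jac P $ r) q r p)) / 2)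
     + cH1 \<kappa> * (((\<Sum>r\<in>UNIV. co (jac P $ q) p r r) + (\<Sum>r\<in>UNIV. co (jac P $ q) r r p)) / 2
         - ((\<Sum>r\<in>UNIV. co (jac P $ p) q r r) + (\<Sum>r\<in>UNIV. co (jac P $ p) r r q)) / 2)
     + cH2 \<kappa> * (((\<Sum>r\<in>UNIV. co (jac P $ q) r r p) + (\<Sum>r\<in>UNIV. co (jac P $ q) p r r)) / 2
         - ((\<Sum>r\<in>UNIV. co (jac P $ r) q r p) + (\<Sum>r\<in>UNIV. co (jac P $ r) p r q)) / 2)"
proof -
  let ?L = "\<lambda>y. co (P y)"
  have an: "?L 0 l r n = - ?L 0 n r l" for l r n using A unfolding antis_def by blast
  have sy: "symm ?L 0 = (\<lambda>l r n. 0)"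
  proof (intro ext)
    fix l r n show "symm ?L 0 l r n = 0" using an[of n r l] by (simp add: symm_def)
  qed
  have to: "tors ?L 0 = ?L 0"
  proof (intro ext)
    fix l r n show "tors ?L 0 l r n = ?L 0 l r n" using an[of n r l] by (simp add: tors_def)
  qed
  have dL: "(\<lambda>y. ?L y l r n) differentiable (at x)" for l r n x
    by (rule smooth_on_differentiable[OF smooth_on_co[OF open_UNIV P] UNIV_I])
  let ?Z = "\<lambda>k l r n. co (jac P $ k) l r n"
  have pt: "pd k (\<lambda>y. tors ?L y l r n) 0 = (?Z k l r n - ?Z k n r l) / 2"
    and ps: "pd k (\<lambda>y. symm ?L y l r n) 0 = (?Z k l r n + ?Z k n r l) / 2" for k l r n
  proof -
    have "(\<lambda>y. tors ?L y l r n) = (\<lambda>y. (1/2) * (?L y l r n + (- 1) * ?L y n r l))"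
      "(\<lambda>y. symm ?L y l r n) = (\<lambda>y. (1/2) * (?L y l r n + ?L y n r l))"
      by (simp_all add: fun_eq_iff tors_def symm_def)
    then show "pd k (\<lambda>y. tors ?L y l r n) 0 = (?Z k l r n - ?Z k n r l) / 2"
      "pd k (\<lambda>y. symm ?L y l r n) 0 = (?Z k l r n + ?Z k n r l) / 2"
      using dL by (simp_all only: pd_cmult pd_add pd_co[OF P] differentiable_add differentiable_mult differentiable_const) simp_all
  qed
  have tc: "tors_cov ?L 0 l r n k = (?Z k l r n - ?Z k n r l) / 2" for l r n k
    by (simp add: tors_cov_def pt sy)
  have cu: "curv ?L 0 n r l k = (?Z k l r n + ?Z k n r l) / 2 - (?Z l k r n + ?Z l n r k) / 2" for n r l k
    by (simp add: curv_def ps sy)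
  define g1 g2 g3 g4 g5 g6 where "g1 = (\<Sum>r\<in>UNIV. ?Z r p r q)" and "g2 = (\<Sum>r\<in>UNIV. ?Z r q r p)" and "g3 = (\<Sum>r\<in>UNIV. ?Z p r r q)"
    and "g4 = (\<Sum>r\<in>UNIV. ?Z p q r r)" and "g5 = (\<Sum>r\<in>UNIV. ?Z q r r p)" and "g6 = (\<Sum>r\<in>UNIV. ?Z q p r r)"
  note gd = this
  have G: "(\<Sum>r\<in>UNIV. tors_cov ?L 0 r r p q) = (g5 - g6) / 2" "(\<Sum>r\<in>UNIV. tors_cov ?L 0 r r q p) = (g3 - g4) / 2"
    "(\<Sum>r\<in>UNIV. tors_cov ?L 0 p r q r) = (g1 - g2) / 2"
    "(\<Sum>r\<in>UNIV. curv ?L 0 r r p q) = (g6 + g5) / 2 - (g4 + g3) / 2"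
    "(\<Sum>r\<in>UNIV. curv ?L 0 p r r q) = (g5 + g6) / 2 - (g2 + g1) / 2"
    unfolding tc cu gd by (simp_all add: sum_subtractf sum.distrib flip: sum_divide_distrib)
  show ?thesis unfolding gd[symmetric] base_part_def G to ..
qed

lemma gam_antis: assumes "antis X" shows "gam (co X) b a = - gam (co X) a b"
proof -
  have an: "co X l r n = - co X n r l" for l r n using assms unfolding antis_def by blast
  have "gam (co X) b a $ r = - gam (co X) a b $ r" for r
  proof -
    have "gam (co X) b a $ r = (\<Sum>n\<in>UNIV. \<Sum>l\<in>UNIV. co X l r n * b $ l * a $ n)"
      unfolding gam_def vec_lambda_beta by (rule sum.swap)
    also have "\<dots> = - (\<Sum>n\<in>UNIV. \<Sum>l\<in>UNIV. co X n r l * a $ n * b $ l)"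
      unfolding sum_negf[symmetric] by (intro sum.cong refl) (subst an, simp)
    finally show ?thesis by (simp add: gam_def)
  qed
  then show ?thesis by (simp add: vec_eq_iff)
qed

text \<open>After removal of the symmetric part it remains to match coefficients. In the antisymmetric gauge the
  two terms of the family with \<open>cB\<close> and \<open>cC\<close> contribute \<open>cB - cC\<close> times \<open>u \<bullet> T v w\<close>, which is
  absorbed in \<open>cC3\<close>.\<close>

theorem ph_agrees: "\<exists>\<kappa>. \<forall>P. smooth_on P UNIV \<longrightarrow> agrees ph \<kappa> P"
proof -
  obtain a0 where uu: "\<And>u p s. pol (u, 0) (u, 0) (axis p 1) (axis s 1) = a0 * u $ p * u $ s" using uu_form by blast
  obtain c1 c2 c3 where uX: "\<And>u X p s. antis X \<Longrightarrow> pol (u, 0) (0, X) (axis p 1) (axis s 1) =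
     c1 * (u $ p * (\<Sum>r\<in>UNIV. co X r r s)) + c2 * (u $ s * (\<Sum>r\<in>UNIV. co X r r p)) + c3 * (\<Sum>r\<in>UNIV. u $ r * co X p r s)"
    using uX_form by blast
  obtain f1 f2 f3 where XX: "\<And>X p s. antis X \<Longrightarrow> pol (0, X) (0, X) (axis p 1) (axis s 1) =
     f1 * ((\<Sum>r\<in>UNIV. co X r r p) * (\<Sum>r\<in>UNIV. co X r r s)) + f2 * (\<Sum>r\<in>UNIV. \<Sum>t\<in>UNIV. co X t r p * co X r t s)
     + f3 * (\<Sum>r\<in>UNIV. \<Sum>t\<in>UNIV. co X r r t * co X p t s)"
    using XX_form by blast
  obtain s1 s2 s3 s4 s5 s6 where L: "\<And>Z p q. lin_part Z (axis p 1) (axis q 1) =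
     s1 * (\<Sum>r\<in>UNIV. co (Z $ r) p r q) + s2 * (\<Sum>r\<in>UNIV. co (Z $ r) q r p) + s3 * (\<Sum>r\<in>UNIV. co (Z $ p) r r q)
     + s4 * (\<Sum>r\<in>UNIV. co (Z $ p) q r r) + s5 * (\<Sum>r\<in>UNIV. co (Z $ q) r r p) + s6 * (\<Sum>r\<in>UNIV. co (Z $ q) p r r)"
    using L_form by blast
  obtain cB' cC' where mB: "\<And>a b. ph (\<lambda>y. 0) (0, 0) (a, 0) (0, b) = cB' * (a \<bullet> b)"
    and mC: "\<And>a b. ph (\<lambda>y. 0) (0, 0) (0, b) (a, 0) = cC' * (a \<bullet> b)"
    using mixed_array by blast
  \<comment> \<open>In a single direction all six contractions of the cubic field are equal to one.\<close>
  have sum0: "s1 + s2 + s3 + s4 + s5 + s6 = 0"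
  proof -
    obtain e :: 'm where True by blast
    have "lin_part (ten4 (axis e 1) (axis e 1) (axis e 1) (axis e 1)) (axis e 1) (axis e 1) = 0"
      by (rule lin_part_cubic) (simp add: inner_axis1)
    then show ?thesis unfolding L co_ten4 by (simp add: axis_sum)
  qed
  \<comment> \<open>The antisymmetric parts of the three kinds of derivatives are the covariant derivatives of the torsion. The
    symmetric parts have coefficients with sum zero, and the two contractions of the curvature span these.
    Halves come from polar forms.\<close>
  define \<kappa> where "\<kappa> = \<lparr>cA = a0 / 2, cB = cB', cC = cC', cC1 = c1, cC2 = c2, cC3 = c3 - cB' + cC',
    cF1 = f1 / 2, cF2 = f2 / 2, cF3 = f3 / 2, cG1 = s5 - s6, cG2 = s3 - s4, cG3 = s1 - s2, cH1 = - (s3 + s4), cH2 = - (s1 + s2)\<rparr>"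
  have normal: "agrees ph \<kappa> P" if P: "smooth_on P UNIV" and A: "antis (P 0)" for P
  proof -
    let ?L = "\<lambda>y. co (P y)"
    have dL: "(\<lambda>y. ?L y l r n) differentiable (at x)" for l r n x
      by (rule smooth_on_differentiable[OF smooth_on_co[OF open_UNIV P] UNIV_I])
    have hor: "hor P u (axis p 1) (axis q 1) = base_part \<kappa> ?L 0 u p q + (cB' - cC') * (\<Sum>r\<in>UNIV. u $ r * ?L 0 p r q)" for u p q
    proof -
      note b = hor_split(2)[OF smooth_const_field, of "axis p 1" "axis q 1"]
      have "pol (u, P 0) (u, P 0) (axis p 1) (axis q 1) = pol ((u, 0) + (0, P 0)) ((u, 0) + (0, P 0)) (axis p 1) (axis q 1)" by simp
      also have "\<dots> = pol (u, 0) (u, 0) (axis p 1) (axis q 1) + 2 * pol (u, 0) (0, P 0) (axis p 1) (axis q 1) + pol (0, P 0) (0, P 0) (axis p 1) (axis q 1)"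
        unfolding bilinear_ladd[OF b] bilinear_radd[OF b] pol_sym[of "(0, P 0)" "(u, 0)"] by simp
      finally have po: "pol (u, P 0) (u, P 0) (axis p 1) (axis q 1) = \<dots>" .
      have s6: "s6 = - s1 - s2 - s3 - s4 - s5" using sum0 by simp
      show ?thesis
        unfolding hor_split(1)[OF P] po uu uX[OF A] XX[OF A] L base_part_antis[OF P A] \<kappa>_def params.simps s6
        by (simp add: algebra_simps add_divide_distrib diff_divide_distrib)
    qed
    have base: "hor P u a b = base_form \<kappa> ?L 0 u a b + (cB' - cC') * (u \<bullet> gam (?L 0) a b)" for u a b
    proof -
      let ?R = "\<lambda>a b. base_form \<kappa> ?L 0 u a b + (cB' - cC') * (u \<bullet> gam (?L 0) a b)"
      note bb = base_form_bilinear[of ?L 0 \<kappa> u, OF dL]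
      have R: "bilinear ?R"
        unfolding bilinear_def
        by (auto intro!: linearI simp: bilinear_ladd[OF bb] bilinear_radd[OF bb] bilinear_lmul[OF bb] bilinear_rmul[OF bb]
            gam_linear inner_add_right algebra_simps)
      have "?R (axis p 1) (axis q 1) = hor P u (axis p 1) (axis q 1)" for p q
        unfolding hor base_form_axis by (simp add: inner_vec_def gam_axis)
      then show ?thesis
        unfolding bilinear_expand[OF hor_bilinear[OF P], of u a b] bilinear_expand[OF R, of a b] by simp
    qed
    show ?thesis unfolding agrees_def
    proof (intro allI)
      fix u and v w :: "'m cot"
      obtain a a' b b' where v: "v = (a, a')" and w: "w = (b, b')" by (metis surj_pair)
      note bl = ph_tensor(1)[OF P, of "(0, u)"]
      note ga = gam_antis[OF A, of b a]
      have vw: "v = (a, 0) + (0, a')" "w = (b, 0) + (0, b')" by (simp_all add: v w)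
      have "ph P (0, u) v w = hor P u a b + cB' * (a \<bullet> b') + cC' * (b \<bullet> a')"
        unfolding vw bilinear_ladd[OF bl] bilinear_radd[OF bl] ph_mixed_const[OF P] mB mC hor_def by simp
      then show "ph P (0, u) v w = family \<kappa> ?L (0, u) v w"
        unfolding family_eq[of ?L 0 \<kappa> u, OF dL] base by (simp add: v w ga \<kappa>_def inner_commute algebra_simps)
    qed
  qed
  have "agrees ph \<kappa> P" if P: "smooth_on P UNIV" for P
  proof -
    define S :: "'m cf" where "S = (\<chi> l r n. - (co (P 0) l r n + co (P 0) n r l) / 2)"
    have "co S l r n = co S n r l" for l r n by (simp add: S_def co_def add.commute)
    from gauge_symmetric[OF this P] obtain P' where P': "smooth_on P' UNIV" "P' 0 = P 0 + S" "agrees ph \<kappa> P' \<Longrightarrow> agrees ph \<kappa> P" by blast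
    have "antis (P' 0)" unfolding antis_def P' by (simp add: S_def co_def field_simps)
    with normal P' show ?thesis by blast
  qed
  then show ?thesis by blast
qed

end

section \<open>Passage to arbitrary manifolds\<close>

lemma family_translate: "family k (\<lambda>y. L (y + a)) (x, u) v w = family k L (x + a, u) v w"
proof -
  let ?L = "\<lambda>y. L (y + a)"
  have s: "symm ?L y = symm L (y + a)" "tors ?L y = tors L (y + a)" for y
    by (simp_all add: symm_def tors_def fun_eq_iff)
  have ps: "pd i (\<lambda>y. symm L (y + a) l r n) x = pd i (\<lambda>y. symm L y l r n) (x + a)"
    and pt: "pd i (\<lambda>y. tors L (y + a) l r n) x = pd i (\<lambda>y. tors L y l r n) (x + a)" for i l r n
    by (rule pd_translate)+
  show ?thesis
    by (simp only: family_def base_part_def tors_cov_def curv_def vert_form_def s ps pt fst_conv snd_conv prod.case)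
qed

text \<open>A chart representation is meaningful on the chart domain only, so the lift of \<open>crep c id c\<close> is the
  identity merely near the point; a derivative sees no more.\<close>

lemma cot_lift_local_identity:
  assumes X: "open X" and f: "\<And>x. x \<in> X \<Longrightarrow> f x = x" and x: "x \<in> X"
  shows "cot_lift f (x, u) = (x, u)" "frechet_derivative (cot_lift f) (at (x, u)) v = v"
proof -
  interpret coord_change f f X X
    by unfold_locales (use X f in \<open>auto simp: smooth_on_cong[OF X f] intro: smooth_on_id\<close>)
  have J: "J y v = v" if "y \<in> X" for y v
  proof -
    have "(f has_derivative (\<lambda>v. v)) (at y)"
      by (rule has_derivative_transform_within_open[OF has_derivative_ident X that]) (simp add: f)
    from fun_cong[OF frechet_derivative_at[OF this, symmetric], of v] show ?thesis by (simp add: J_def)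
  qed
  have id: "cot_lift f (y, u) = (y, u)" if y: "y \<in> X" for y u
  proof -
    have "(snd (cot_lift f (y, u)) - u) \<bullet> v = 0" for v
      using cot_lift_inner(3)[OF y, of u v] by (simp add: J[OF y] inner_diff_left)
    then have "snd (cot_lift f (y, u)) - u = 0" using inner_eq_zero_iff by blast
    then show ?thesis using cot_lift_inner(1)[OF y, of u] by (simp add: prod_eq_iff f[OF y])
  qed
  show "cot_lift f (x, u) = (x, u)" by (rule id[OF x])
  have "(cot_lift f has_derivative (\<lambda>v. v)) (at (x, u))"
  proof (rule has_derivative_transform_within_open[OF has_derivative_ident])
    show "open (X \<times> (UNIV :: (real^'a) set))" "(x, u) \<in> X \<times> UNIV" using X x by (auto simp: open_Times)
  qed (auto simp: id)
  from fun_cong[OF frechet_derivative_at[OF this, symmetric], of v]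
  show "frechet_derivative (cot_lift f) (at (x, u)) v = v" .
qed

context nat_op
begin

lemma smooth_cutoff:
  fixes L :: "real^'m \<Rightarrow> 'm coeffs"
  assumes X: "open X" "x0 \<in> X" and L: "\<And>l r n. smooth_on (\<lambda>x. L x l r n) X"
  shows "\<exists>e>0. ball x0 e \<subseteq> X \<and> (\<exists>P. smooth_on P UNIV \<and> (\<forall>x\<in>ball x0 e. co (P x) = L x))"
proof -
  obtain d where d: "d > 0" "ball x0 d \<subseteq> X" using X open_contains_ball by blast
  obtain \<psi> :: "real^'m \<Rightarrow> real" where \<psi>: "smooth_on \<psi> UNIV" "\<And>x. x \<in> ball x0 (d/3) \<Longrightarrow> \<psi> x = 1" "\<And>x. x \<notin> ball x0 (d/2) \<Longrightarrow> \<psi> x = 0"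
    using exists_bump_ball[of "d/3" "d/2" x0] d by auto
  define P where "P x = (\<chi> l r n. \<psi> x * L x l r n)" for x
  have "smooth_on P UNIV"
  proof (rule smooth_on_local)
    fix x
    show "\<exists>T. open T \<and> x \<in> T \<and> smooth_on P T"
    proof (cases "x \<in> ball x0 d")
      case True
      have "smooth_on P (ball x0 d)" unfolding P_def
        by (intro smooth_on_vec open_ball) (auto intro!: smooth_on_mult smooth_on_subset[OF \<psi>(1)] smooth_on_subset[OF L d(2)])
      then show ?thesis using True by blast
    next
      case False
      have "smooth_on P (- cball x0 (d/2))"
      proof (rule smooth_on_cong[THEN iffD1])
        show "smooth_on (\<lambda>x. 0 :: 'm cf) (- cball x0 (d/2))" by (rule smooth_on_const) auto
        show "0 = P x" if "x \<in> - cball x0 (d/2)" for x using that \<psi>(3)[of x] by (simp add: P_def vec_eq_iff)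
      qed auto
      moreover have "x \<in> - cball x0 (d/2)" using False d(1) by auto
      ultimately show ?thesis by (meson open_Compl closed_cball)
    qed
  qed
  moreover have "co (P x) = L x" if "x \<in> ball x0 (d/3)" for x
    using \<psi>(2)[OF that] by (simp add: P_def co_def fun_eq_iff)
  moreover have "ball x0 (d/3) \<subseteq> X" using d subset_ball[of "d/3" d x0] by simp
  ultimately show ?thesis using d(1) by (intro exI[of _ "d/3"]) auto
qed

text \<open>Near a point a chart identifies the connection with a global one over the coordinate space. Naturality
  carries the value of the operator over, a translation moves the point to the origin, and the
  family depends only on the germ.\<close>

theorem coord_expr_exists: "\<exists>\<kappa>. has_coord_expr \<Phi> \<kappa>"
proof -
  obtain \<kappa> where \<kappa>: "\<And>P. smooth_on P UNIV \<Longrightarrow> agrees ph \<kappa> P" using ph_agrees by blast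
  have "\<Phi> M \<Lambda> c (x0, u) v w = family \<kappa> (\<Lambda> c) (x0, u) v w"
    if M: "smooth_manifold M" and \<Lambda>: "linear_connection M \<Lambda>" and c: "c \<in> atlas M" and x0: "x0 \<in> cimg c" for M \<Lambda> c x0 u v w
  proof -
    note C = chart_facts[OF M c]
    have hh: "inv h (h x) = x" for x using inj by simp
    have L: "smooth_on (\<lambda>x. \<Lambda> c x l r n) (cimg c)" for l r n using \<Lambda> c unfolding linear_connection_def by blast
    obtain e P where e: "e > 0" "ball x0 e \<subseteq> cimg c" and P: "smooth_on P UNIV" "\<And>x. x \<in> ball x0 e \<Longrightarrow> co (P x) = \<Lambda> c x"
      using smooth_cutoff[where L = "\<Lambda> c", OF C(3) x0 L] by blast
    define W where "W = {p \<in> cdom c. cmap c p \<in> ball x0 e}"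
    have W: "openin (mtop M) W"
    proof -
      have "continuous_map (subtopology (mtop M) (cdom c)) (top_of_set (cimg c)) (cmap c)"
        using M c unfolding smooth_manifold_def by (blast intro: homeomorphic_imp_continuous_map)
      then have "continuous_map (subtopology (mtop M) (cdom c)) euclidean (cmap c)"
        using continuous_map_into_fulltopology by blast
      then have "openin (subtopology (mtop M) (cdom c)) {p \<in> topspace (subtopology (mtop M) (cdom c)). cmap c p \<in> ball x0 e}"
        by (rule openin_continuous_map_preimage) simp
      moreover have "{p \<in> topspace (subtopology (mtop M) (cdom c)). cmap c p \<in> ball x0 e} = W"
        unfolding W_def using C(2) by auto
      ultimately have "openin (subtopology (mtop M) (cdom c)) W" by (simp only:)
      then show ?thesis by (rule openin_trans_full[OF _ C(1)])
    qed
    have Wc: "W \<subseteq> cdom c" by (auto simp: W_def)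
    have cr: "crep d (h \<circ> cmap c) (stdc h) = crep d id c" for d by (simp add: crep_def fun_eq_iff hh)
    have "conn_related W (h \<circ> cmap c) M \<Lambda> (stdM h) (\<lambda>d y. co (P y))"
      unfolding conn_related_def
    proof (intro ballI impI)
      fix d d' p assume d: "d \<in> atlas M" "d' \<in> atlas (stdM h)" and p: "p \<in> cdom d \<inter> W"
      then have d': "d' = stdc h" by (simp add: stdM_def)
      have "p \<in> cdom d \<inter> topspace (mtop M)" "id p \<in> cdom c" "cmap c p \<in> ball x0 e" using p C(2) by (auto simp: W_def)
      moreover from this have "conn_law (crep d id c) (cmap d p) (\<Lambda> d (cmap d p)) (\<Lambda> c (cmap c (id p)))"
        using \<Lambda> d(1) c unfolding linear_connection_def conn_related_def by blast
      ultimately show "conn_law (crep d (h \<circ> cmap c) d') (cmap d p) (\<Lambda> d (cmap d p)) (co (P (cmap d' ((h \<circ> cmap c) p))))"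
        unfolding d' cr by (simp add: hh P(2))
    qed
    then have "tensor_related W (h \<circ> cmap c) M (\<Phi> M \<Lambda>) (stdM h) (\<Phi> (stdM h) (\<lambda>d y. co (P y)))"
      using nat M std_smooth_manifold[OF inj] chart_local_diffeo[OF inj M c W Wc] \<Lambda> std_conn[OF P(1)]
      unfolding natural_cot_tensor_def by blast
    moreover obtain p where p: "p \<in> cdom c" "cmap c p = x0" using x0 by auto
    moreover have "p \<in> cdom c \<inter> W" "(h \<circ> cmap c) p \<in> cdom (stdc h)" "stdc h \<in> atlas (stdM h)" using p e(1) by (auto simp: W_def stdM_def)
    ultimately have "\<Phi> M \<Lambda> c (x0, u) v w = \<Phi> (stdM h) (\<lambda>d y. co (P y)) (stdc h) (cot_lift (crep c id c) (x0, u))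
        (frechet_derivative (cot_lift (crep c id c)) (at (x0, u)) v) (frechet_derivative (cot_lift (crep c id c)) (at (x0, u)) w)"
      using c unfolding tensor_related_def Let_def cr[symmetric] by blast
    moreover have "crep c id c x = x" if "x \<in> cimg c" for x using that C(5) by (auto simp: crep_def)
    ultimately have "\<Phi> M \<Lambda> c (x0, u) v w = ph P (x0, u) v w"
      using cot_lift_local_identity[OF C(3) _ x0, of "crep c id c"] by (simp add: ph_def)
    also have "\<dots> = ph (\<lambda>y. P (y + x0)) (0, u) v w" using ph_translate[OF P(1), of x0 0 u v w] by simp
    also have "\<dots> = family \<kappa> (\<lambda>y. co (P (y + x0))) (0, u) v w"
    proof -
      have "smooth_on (\<lambda>y. P (y + x0)) UNIV" using smooth_affine[OF P(1), of 1 x0] by simp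
      from \<kappa>[OF this] show ?thesis unfolding agrees_def by blast
    qed
    also have "\<dots> = family \<kappa> (\<lambda>y. co (P y)) (x0, u) v w"
      using family_translate[of \<kappa> "\<lambda>y. co (P y)" x0 0 u v w] by simp
    also have "family \<kappa> (\<lambda>y. co (P y)) (x0, u) = family \<kappa> (\<Lambda> c) (x0, u)"
    proof (rule family_jet)
      show "(\<lambda>y. co (P y) l r n) differentiable (at x0)" for l r n
        by (rule smooth_on_differentiable[OF smooth_on_co[OF open_UNIV P(1)] UNIV_I])
      show "(\<lambda>y. \<Lambda> c y l r n) differentiable (at x0)" for l r n
        by (rule smooth_on_differentiable[OF L x0])
      show "same_jet 1 x0 (\<lambda>y. co (P y)) (\<Lambda> c)" unfolding same_jet_def
        using e(1) P(2) by (auto intro!: pds_cong[of "ball x0 e"])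
    qed
    finally show ?thesis .
  qed
  then have "has_coord_expr \<Phi> \<kappa>" unfolding has_coord_expr_def by (auto simp: fun_eq_iff)
  then show ?thesis by blast
qed

section \<open>Uniqueness of the parameters\<close>

lemma coord_expr_agrees:
  assumes k: "has_coord_expr \<Phi> k" and P: "smooth_on P UNIV"
  shows "agrees ph k P"
proof -
  have "stdc h \<in> atlas (stdM h)" "cimg (stdc h) = UNIV" using crep_std(4)[OF inj] by (simp_all add: stdM_def)
  then have "\<Phi> (stdM h) (\<lambda>c y. co (P y)) (stdc h) (0, u) = family k (\<lambda>y. co (P y)) (0, u)" for u
    using k[unfolded has_coord_expr_def, rule_format, of "stdM h" "\<lambda>c y. co (P y)" "stdc h" "(0, u)"]
      std_smooth_manifold[OF inj] std_conn[OF P] by simp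
  then show ?thesis by (simp add: agrees_def ph_def)
qed

definition elem :: "'m \<Rightarrow> 'm \<Rightarrow> 'm \<Rightarrow> 'm cf" where
  "elem a b c = (\<chi> l r n. if l = a \<and> r = b \<and> n = c then 1 else 0)"

definition wedge :: "'m \<Rightarrow> 'm \<Rightarrow> 'm \<Rightarrow> 'm cf" where
  "wedge a b c = elem a b c - elem c b a"

lemma co_elem: "co (elem a b c) l r n = (if l = a \<and> r = b \<and> n = c then 1 else 0)"
  by (simp add: elem_def co_def)

lemma co_lin_simps: "co (X + Y) l r n = co X l r n + co Y l r n" "co (X - Y) l r n = co X l r n - co Y l r n" "co 0 l r n = 0"
  by (simp_all add: co_def)

text \<open>The two parameter lists give equal forms for every field, covector and pair of vectors. Testing with
  arrays that live on three basis vectors \<open>i\<close>, \<open>j\<close>, \<open>l\<close> gives linear equations with a unique solution.\<close>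

lemma params_unique:
  assumes k: "\<And>P. smooth_on P UNIV \<Longrightarrow> agrees ph k P" and k': "\<And>P. smooth_on P UNIV \<Longrightarrow> agrees ph k' P"
    and card: "CARD('m) \<ge> 3"
  shows "k = k'"
proof -
  have fam: "family k (\<lambda>y. co (P y)) (0, u) v w = family k' (\<lambda>y. co (P y)) (0, u) v w" if "smooth_on P UNIV" for P :: "real^'m \<Rightarrow> 'm cf" and u v w
    using k[OF that] k'[OF that] unfolding agrees_def by metis
  have dL: "(\<lambda>y. co (P y) l r n) differentiable (at x)" if "smooth_on P UNIV" for P :: "real^'m \<Rightarrow> 'm cf" and l r n x
    by (rule smooth_on_differentiable[OF smooth_on_co[OF open_UNIV that] UNIV_I])
  obtain S :: "'m set" where "card S = 3" using obtain_subset_with_card_n[OF card] by blast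
  then obtain i j l :: 'm where ne: "i \<noteq> j" "i \<noteq> l" "j \<noteq> l" by (auto simp: card_3_iff)
  have base0: "bilinear (base_form q (\<lambda>y. co (P y)) 0 u)" if "smooth_on P UNIV" for P :: "real^'m \<Rightarrow> 'm cf" and u q
    by (rule base_form_bilinear[of "\<lambda>y. co (P y)"]) (rule dL[OF that])
  have fe: "family q (\<lambda>y. co (P y)) (0, u) v w = base_form q (\<lambda>y. co (P y)) 0 u (fst v) (fst w)
    + cB q * (snd w \<bullet> fst v + u \<bullet> gam (co (P 0)) (fst v) (fst w)) + cC q * (snd v \<bullet> fst w + u \<bullet> gam (co (P 0)) (fst w) (fst v))"
    if "smooth_on P UNIV" for P :: "real^'m \<Rightarrow> 'm cf" and u v w q
    by (rule family_eq[of "\<lambda>y. co (P y)"]) (rule dL[OF that])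
  let ?z = "\<lambda>y :: real^'m. 0 :: 'm cf"
  note z = smooth_const_field[of 0]
  have B: "cB k = cB k'"
    using fam[OF z, of 0 "(axis i 1, 0)" "(0, axis i 1)"] by (simp add: fe[OF z] bilinear_rzero[OF base0[OF z]] inner_axis1)
  have C: "cC k = cC k'"
    using fam[OF z, of 0 "(0, axis i 1)" "(axis i 1, 0)"] by (simp add: fe[OF z] bilinear_lzero[OF base0[OF z]] inner_axis1)
  have bp: "base_part k (\<lambda>y. co (X + lin Z y)) 0 u p q = base_part k' (\<lambda>y. co (X + lin Z y)) 0 u p q" for X :: "'m cf" and Z u p q
    using fam[OF smooth_on_affine_field, of X Z u "(axis p 1, 0)" "(axis q 1, 0)"]
    by (simp add: fe[OF smooth_on_affine_field] B C base_form_axis)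
  have sum3: "(\<Sum>r\<in>UNIV. f r) = f i + f j + f l" if "\<And>r. r \<noteq> i \<Longrightarrow> r \<noteq> j \<Longrightarrow> r \<noteq> l \<Longrightarrow> f r = 0" for f :: "'m \<Rightarrow> real"
  proof -
    have "(\<Sum>r\<in>UNIV. f r) = (\<Sum>r\<in>{i, j, l}. f r)" by (rule sum.mono_neutral_right) (use that in auto)
    then show ?thesis using ne by simp
  qed
  note ne' = ne ne[symmetric]
  have const: "let T = co X in cA k * u $ p * u $ q
     + cC1 k * u $ p * (T i i q + T j j q + T l l q) + cC2 k * u $ q * (T i i p + T j j p + T l l p)
     + cC3 k * (u $ i * T p i q + u $ j * T p j q + u $ l * T p l q)
     + cF1 k * (T i i p + T j j p + T l l p) * (T i i q + T j j q + T l l q)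
     + cF2 k * (\<Sum>r\<in>{i, j, l}. \<Sum>t\<in>{i, j, l}. T t r p * T r t q)
     + cF3 k * (\<Sum>r\<in>{i, j, l}. \<Sum>t\<in>{i, j, l}. T r r t * T p t q)
    = cA k' * u $ p * u $ q
     + cC1 k' * u $ p * (T i i q + T j j q + T l l q) + cC2 k' * u $ q * (T i i p + T j j p + T l l p)
     + cC3 k' * (u $ i * T p i q + u $ j * T p j q + u $ l * T p l q)
     + cF1 k' * (T i i p + T j j p + T l l p) * (T i i q + T j j q + T l l q)
     + cF2 k' * (\<Sum>r\<in>{i, j, l}. \<Sum>t\<in>{i, j, l}. T t r p * T r t q)
     + cF3 k' * (\<Sum>r\<in>{i, j, l}. \<Sum>t\<in>{i, j, l}. T r r t * T p t q)"
    if A: "antis X" and s: "\<And>a b c. co X a b c \<noteq> 0 \<Longrightarrow> b \<in> {i, j, l} \<and> a \<in> {i, j, l}" for X :: "'m cf" and u p q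
  proof -
    have A': "antis (X + lin 0 0)" using A by (simp add: lin_simps)
    have s': "co X a b c = 0" if "b \<noteq> i \<and> b \<noteq> j \<and> b \<noteq> l \<or> a \<noteq> i \<and> a \<noteq> j \<and> a \<noteq> l" for a b c using s that by blast
    have e: "(\<Sum>r\<in>UNIV. \<Sum>t\<in>UNIV. f r t) = (\<Sum>r\<in>{i, j, l}. \<Sum>t\<in>{i, j, l}. f r t)"
      if "\<And>r t. r \<notin> {i, j, l} \<or> t \<notin> {i, j, l} \<Longrightarrow> f r t = 0" for f :: "'m \<Rightarrow> 'm \<Rightarrow> real"
    proof -
      have "(\<Sum>r\<in>UNIV. \<Sum>t\<in>UNIV. f r t) = (\<Sum>r\<in>UNIV. \<Sum>t\<in>{i, j, l}. f r t)"
        by (intro sum.cong refl sum.mono_neutral_right) (use that in auto)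
      also have "\<dots> = (\<Sum>r\<in>{i, j, l}. \<Sum>t\<in>{i, j, l}. f r t)"
        by (rule sum.mono_neutral_right) (use that in auto)
      finally show ?thesis .
    qed
    have sums: "(\<Sum>r\<in>UNIV. co X r r c) = co X i i c + co X j j c + co X l l c"
      "(\<Sum>r\<in>UNIV. u $ r * co X p r q) = u $ i * co X p i q + u $ j * co X p j q + u $ l * co X p l q"
      "(\<Sum>r\<in>UNIV. \<Sum>t\<in>UNIV. co X t r p * co X r t q) = (\<Sum>r\<in>{i, j, l}. \<Sum>t\<in>{i, j, l}. co X t r p * co X r t q)"
      "(\<Sum>r\<in>UNIV. \<Sum>t\<in>UNIV. co X r r t * co X p t q) = (\<Sum>r\<in>{i, j, l}. \<Sum>t\<in>{i, j, l}. co X r r t * co X p t q)" for c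
      by (rule sum3, simp add: s') (rule sum3, simp add: s', (rule e, use s in fastforce)+)
    show ?thesis
      using bp[of X 0 u p q] unfolding base_part_antis[of "\<lambda>y. X + lin 0 y", OF smooth_on_affine_field A'] jac_lin
      by (simp add: lin_simps co_lin_simps sums)
  qed
  have linear: "let Z = \<lambda>d a b c. co (Z $ d) a b c; s = \<lambda>f. f i + f j + f l in
      cG1 k * ((s (\<lambda>r. Z q r r p) - s (\<lambda>r. Z q p r r)) / 2) + cG2 k * ((s (\<lambda>r. Z p r r q) - s (\<lambda>r. Z p q r r)) / 2)
      + cG3 k * ((s (\<lambda>r. Z r p r q) - s (\<lambda>r. Z r q r p)) / 2)
      + cH1 k * ((s (\<lambda>r. Z q p r r) + s (\<lambda>r. Z q r r p)) / 2 - (s (\<lambda>r. Z p q r r) + s (\<lambda>r. Z p r r q)) / 2)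
      + cH2 k * ((s (\<lambda>r. Z q r r p) + s (\<lambda>r. Z q p r r)) / 2 - (s (\<lambda>r. Z r q r p) + s (\<lambda>r. Z r p r q)) / 2)
    = cG1 k' * ((s (\<lambda>r. Z q r r p) - s (\<lambda>r. Z q p r r)) / 2) + cG2 k' * ((s (\<lambda>r. Z p r r q) - s (\<lambda>r. Z p q r r)) / 2)
      + cG3 k' * ((s (\<lambda>r. Z r p r q) - s (\<lambda>r. Z r q r p)) / 2)
      + cH1 k' * ((s (\<lambda>r. Z q p r r) + s (\<lambda>r. Z q r r p)) / 2 - (s (\<lambda>r. Z p q r r) + s (\<lambda>r. Z p r r q)) / 2)
      + cH2 k' * ((s (\<lambda>r. Z q r r p) + s (\<lambda>r. Z q p r r)) / 2 - (s (\<lambda>r. Z r q r p) + s (\<lambda>r. Z r p r q)) / 2)"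
    if s: "\<forall>d a b c. co (Z $ d) a b c \<noteq> 0 \<longrightarrow> b \<in> {i, j, l}" for Z :: "'m cf^'m" and p q
  proof -
    have A': "antis (0 + lin Z 0)" by (simp add: lin_simps antis_def co_lin_simps)
    have s': "co (Z $ d) a b c = 0" if "b \<noteq> i \<and> b \<noteq> j \<and> b \<noteq> l" for d a b c using s that by blast
    have sums: "(\<Sum>r\<in>UNIV. co (Z $ d) r r a) = co (Z $ d) i i a + co (Z $ d) j j a + co (Z $ d) l l a"
      "(\<Sum>r\<in>UNIV. co (Z $ d) a r r) = co (Z $ d) a i i + co (Z $ d) a j j + co (Z $ d) a l l"
      "(\<Sum>r\<in>UNIV. co (Z $ r) a r b) = co (Z $ i) a i b + co (Z $ j) a j b + co (Z $ l) a l b" for d a b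
      by (rule sum3, simp add: s')+
    show ?thesis
      using bp[of 0 Z 0 p q] unfolding base_part_antis[of "\<lambda>y. 0 + lin Z y", OF smooth_on_affine_field A'] jac_lin
      by (simp add: lin_simps co_lin_simps sums)
  qed
  let ?S = "{i, j, l}"
  have cw: "co (wedge a b c) x y z = (if x = a \<and> y = b \<and> z = c then 1 else 0) - (if x = c \<and> y = b \<and> z = a then 1 else 0)" for a b c x y z :: 'm
    by (simp only: wedge_def co_lin_simps co_elem)
  have wa: "antis (wedge a b c)" for a b c :: 'm unfolding antis_def cw by (simp add: conj_ac)
  have wa2: "antis (X + Y)" if "antis X" "antis Y" for X Y :: "'m cf"
    unfolding antis_def
  proof (intro allI)
    fix l r n
    have "co X l r n = - co X n r l" "co Y l r n = - co Y n r l" using that unfolding antis_def by blast+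
    then show "co (X + Y) l r n = - co (X + Y) n r l" by (simp only: co_lin_simps)
  qed
  have ws: "y \<in> Q \<and> x \<in> Q" if "co (wedge a b c) x y z \<noteq> 0" "a \<in> Q" "b \<in> Q" "c \<in> Q" for a b c x y z :: 'm and Q
  proof -
    have "x = a \<and> y = b \<or> x = c \<and> y = b" using that(1) unfolding cw by (simp split: if_splits)
    then show ?thesis using that(2-4) by (elim disjE conjE) simp_all
  qed
  have ws2: "y \<in> Q \<and> x \<in> Q" if "co (wedge a b c + wedge a' b' c') x y z \<noteq> 0" "a \<in> Q" "b \<in> Q" "c \<in> Q" "a' \<in> Q" "b' \<in> Q" "c' \<in> Q"
    for a b c a' b' c' x y z :: 'm and Q
  proof (cases "co (wedge a b c) x y z = 0")
    case True
    then have "co (wedge a' b' c') x y z \<noteq> 0" using that(1) by (simp add: co_lin_simps)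
    then show ?thesis by (rule ws) (rule that)+
  next
    case False
    then show ?thesis by (rule ws) (rule that)+
  qed
  have W1: "y \<in> ?S \<and> x \<in> ?S" if "co (wedge i l j) x y z \<noteq> 0" for x y z by (rule ws[OF that]) simp_all
  have W2: "y \<in> ?S \<and> x \<in> ?S" if "co (wedge i i j) x y z \<noteq> 0" for x y z by (rule ws[OF that]) simp_all
  have W3: "y \<in> ?S \<and> x \<in> ?S" if "co (wedge i j l + wedge j i l) x y z \<noteq> 0" for x y z by (rule ws2[OF that]) simp_all
  have W4: "y \<in> ?S \<and> x \<in> ?S" if "co (wedge i i j + wedge i j l) x y z \<noteq> 0" for x y z by (rule ws2[OF that]) simp_all
  note cs = cw co_lin_simps Let_def axis_def
  \<comment> \<open>Constant antisymmetric fields separate the parameters of the terms without derivatives. The array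
    \<open>wedge i i j\<close> has a nonzero trace, the other elementary ones used have none.\<close>
  have A: "cA k = cA k'" using const[where X = 0, where u = "axis i 1" and p = i and q = i] by (simp add: antis_def cs)
  have C3: "cC3 k = cC3 k'" using const[where X = "wedge i l j", OF wa W1, where u = "axis l 1" and p = i and q = j] by (simp add: cs ne')
  have C1: "cC1 k = cC1 k'" using const[where X = "wedge i i j", OF wa W2, where u = "axis l 1" and p = l and q = j] by (simp add: cs ne')
  have C2: "cC2 k = cC2 k'" using const[where X = "wedge i i j", OF wa W2, where u = "axis l 1" and p = j and q = l] by (simp add: cs ne')
  have F12: "cF1 k + cF2 k = cF1 k' + cF2 k'" using const[where X = "wedge i i j", OF wa W2, where u = 0 and p = j and q = j] by (simp add: cs ne')
  have F2: "cF2 k = cF2 k'" using const[where X = "wedge i j l + wedge j i l", OF wa2[OF wa wa] W3, where u = 0 and p = l and q = l] by (simp add: cs ne')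
  have F3: "cF3 k - cF2 k = cF3 k' - cF2 k'" using const[where X = "wedge i i j + wedge i j l", OF wa2[OF wa wa] W4, where u = 0 and p = i and q = l] by (simp add: cs ne')
  let ?Z = "\<lambda>d a b c. axis d (elem a b c) :: 'm cf^'m"
  have cZ: "co (?Z d a b c $ d') a' b' c' = (if d' = d \<and> a' = a \<and> b' = b \<and> c' = c then 1 else 0)" for d a b c d' a' b' c' :: 'm
    by (simp add: axis_def co_elem co_lin_simps)
  have zs: "b' \<in> Q" if "co (?Z d a b c $ d') a' b' c' \<noteq> 0" "b \<in> Q" for d a b c d' a' b' c' :: 'm and Q
    using that unfolding cZ by (simp split: if_splits)
  have Z1: "\<forall>d x y z. co (?Z i j i l $ d) x y z \<noteq> 0 \<longrightarrow> y \<in> ?S"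
    by (intro allI impI, erule zs) simp
  have Z2: "\<forall>d x y z. co (?Z l i i j $ d) x y z \<noteq> 0 \<longrightarrow> y \<in> ?S"
    by (intro allI impI, erule zs) simp
  have Z3: "\<forall>d x y z. co (?Z l j i i $ d) x y z \<noteq> 0 \<longrightarrow> y \<in> ?S"
    by (intro allI impI, erule zs) simp
  note ls = cZ Let_def
  \<comment> \<open>Elementary linear fields separate the parameters of the terms with derivatives.\<close>
  have T1: "cG3 k - cH2 k = cG3 k' - cH2 k'" using linear[where Z = "?Z i j i l", OF Z1, where p = j and q = l] by (simp add: ls ne')
  have T2: "- cG3 k - cH2 k = - cG3 k' - cH2 k'" using linear[where Z = "?Z i j i l", OF Z1, where p = l and q = j] by (simp add: ls ne')
  have T3: "cG1 k + cH1 k + cH2 k = cG1 k' + cH1 k' + cH2 k'" using linear[where Z = "?Z l i i j", OF Z2, where p = j and q = l] by (simp add: ls ne')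
  have T4: "cG2 k - cH1 k = cG2 k' - cH1 k'" using linear[where Z = "?Z l i i j", OF Z2, where p = l and q = j] by (simp add: ls ne')
  have T5: "- cG1 k + cH1 k + cH2 k = - cG1 k' + cH1 k' + cH2 k'" using linear[where Z = "?Z l j i i", OF Z3, where p = j and q = l] by (simp add: ls ne')
  have T6: "- cG2 k - cH1 k = - cG2 k' - cH1 k'" using linear[where Z = "?Z l j i i", OF Z3, where p = l and q = j] by (simp add: ls ne')
  have "cF1 k = cF1 k'" "cF3 k = cF3 k'" "cG1 k = cG1 k'" "cG2 k = cG2 k'" "cG3 k = cG3 k'" "cH1 k = cH1 k'" "cH2 k = cH2 k'"
    using F12 F2 F3 T1 T2 T3 T4 T5 T6 by linarith+
  then show ?thesis using A B C C1 C2 C3 F2 by (intro params.equality) simp_all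
qed

end

section \<open>The classification\<close>

theorem theorem5p3:
  assumes universe: "\<exists>h :: real^'m::finite \<Rightarrow> 'p. inj h"
  shows "(\<forall>\<Phi> :: ('p, 'm) operator.
            natural_cot_tensor \<Phi> \<and> (\<exists>r. of_order r \<Phi>) \<longrightarrow>
            of_order 1 \<Phi> \<and> (\<exists>k. has_coord_expr \<Phi> k)) \<and>
         (\<forall>(\<Phi> :: ('p, 'm) operator) k.
            has_coord_expr \<Phi> k \<longrightarrow> natural_cot_tensor \<Phi> \<and> of_order 1 \<Phi>) \<and>
         (CARD('m) \<ge> 3 \<longrightarrow>
            (\<forall>(\<Phi> :: ('p, 'm) operator) k k'.
               has_coord_expr \<Phi> k \<and> has_coord_expr \<Phi> k' \<longrightarrow> k = k'))"
proof -
  obtain h :: "real^'m \<Rightarrow> 'p" where h: "inj h" using universe by blast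
  have classify: "of_order 1 \<Phi> \<and> (\<exists>k. has_coord_expr \<Phi> k)"
    if "natural_cot_tensor \<Phi>" "of_order r \<Phi>" for \<Phi> :: "('p, 'm) operator" and r
  proof -
    interpret nat_op \<Phi> h r by unfold_locales (rule that h)+
    obtain k where "has_coord_expr \<Phi> k" using coord_expr_exists by blast
    then show ?thesis using family_natural(2) by blast
  qed
  have unique: "k = k'" if "CARD('m) \<ge> 3" "has_coord_expr \<Phi> k" "has_coord_expr \<Phi> k'" for \<Phi> :: "('p, 'm) operator" and k k'
  proof -
    interpret nat_op \<Phi> h 1 by unfold_locales (rule family_natural[OF that(2)] h)+
    show ?thesis by (rule params_unique[OF coord_expr_agrees[OF that(2)] coord_expr_agrees[OF that(3)] that(1)])
  qed
  show ?thesis using classify family_natural unique by blast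
qed

end
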